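(* Let $\varrho$ be a primitive inflation rule in one dimension with $n_a$ prototiles and hull $\mathbb Y$, and let $\mathcal I(k)=(I_{ij}(k))_{1\leqslant i,j\leqslant n_a}$ be the matrix of relative intensities of the pure point part of the Fourier-transformed pair correlation measures. Then, for all $k\in\mathbb R$, there are numbers $a_i(k)$, with $1\leqslant i\leqslant n_a$, such that the identity $$I_{ij}(k)=\overline{a_i(k)}\,a_j(k)$$ holds for $1\leqslant i,j\leqslant n_a$. These numbers are the dimensionless Fourier–Bohr coefficients, defined (for $\Lambda=\bigcup_i\Lambda_i\in\mathbb Y$) as $$a_j(k)\,=\,\alpha\lim_{r\to\infty}\frac{1}{2r}\sum_{x\in\Lambda_j\cap[-r+c,\,r+c]}\mathrm e^{-2\pi\mathrm i kx},$$ with $\alpha=\operatorname{dens}(\Lambda)^{-1}$. Here, the convergence is uniform in $c\in\mathbb R$. This coefficient is independent of the choice of $\Lambda\in\mathbb Y$. As a consequence, for all $k\in\mathbb R$, the matrix $\mathcal I(k)$ is Hermitian, positive semi-definite, and has rank at most $1$. Moreover, the set of $k$ with $a_j(k)\neq0$ for some $j$ is at most a countable set.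
   Context: Let $\mathcal A=\{a_1,\dots,a_{n_a}\}$ be a finite alphabet and $\varrho$ a primitive substitution on $\mathcal A$: each letter is mapped to a non-empty finite word, and the substitution matrix $M_\varrho=(M_{ij})$, with $M_{ij}$ the number of letters $a_i$ in $\varrho(a_j)$, is primitive. (The letters $a_i$ are not to be confused with the numbers $a_i(k)$.) Let $\lambda>1$ be its Perron–Frobenius (PF) eigenvalue, called the inflation multiplier. The associated (geometric) inflation rule, also denoted $\varrho$, uses intervals (prototiles) of natural lengths $\ell_1,\dots,\ell_{n_a}>0$, where $(\ell_1,\dots,\ell_{n_a})$ is a fixed left PF eigenvector of $M_\varrho$; a tile of type $a_i$ is expanded by $\lambda$ and then dissected into tiles of the original sizes in the order specified by $\varrho(a_i)$. Tiles of different type but equal length are distinguished by colour. Hull: Starting from a tiling of $\mathbb R$ that is a fixed point of $\varrho$ (or of a suitable power), the hull $\mathbb Y$ is the closure of its translation orbit in the local topology. Each tiling is identified with the coloured point set $\Lambda=\bigcup_{i}\Lambda_i$, where $\Lambda_i$ is the set of left endpoints of tiles of type $a_i$ (disjoint union). The system $(\mathbb Y,\mathbb R)$ is strictly ergodic; $\operatorname{dens}$ denotes the (uniformly existing) density of a point set. Pair correlations: $\nu_{ij}(z)=\operatorname{dens}\bigl(\Lambda_i\cap(\Lambda_j-z)\bigr)/\operatorname{dens}(\Lambda)$, which does not depend on $\Lambda\in\mathbb Y$, and $\Upsilon_{ij}=\sum_{z\in\Lambda-\Lambda}\nu_{ij}(z)\,\delta_z$. Each $\Upsilon_{ij}$ is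 a translation-bounded, Fourier-transformable measure (convention $\widehat f(k)=\int \mathrm e^{-2\pi\mathrm i kx}f(x)\,\mathrm dx$). The intensities $I_{ij}(k)$ are defined by writing the pure point part as $\bigl(\widehat{\Upsilon_{ij}}\bigr)_{\mathsf{pp}}=\operatorname{dens}(\Lambda)\sum_{k}I_{ij}(k)\,\delta_k$, the sum running over an at most countable set, with $I_{ij}(k)=0$ for $k$ outside this set.
   Formalization: Literal independence of a_j(k) from Λ fails (translating Λ by t multiplies it by e^{-2πikt}; e.g. a→aa, k=1), so it is stated as: for Λ, Λ' in the hull the coefficients agree up to one unimodular factor u(k) common to all j. *)

theory Defs
  imports "HOL-Probability.Probability" "HOL-Library.Sublist"
begin

section \<open>Primitive substitutions\<close>

definition subst_word :: "('a \<Rightarrow> 'a list) \<Rightarrow> 'a list \<Rightarrow> 'a list" where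
  "subst_word \<rho> w = concat (map \<rho> w)"

definition subst_matrix :: "('a::finite \<Rightarrow> 'a list) \<Rightarrow> real^'a^'a" where
  "subst_matrix \<rho> = (\<chi> i j. real (count_list (\<rho> j) i))"

definition matrix_pow :: "real^'n^'n \<Rightarrow> nat \<Rightarrow> real^'n^'n" where
  "matrix_pow A n = (((**) A) ^^ n) (mat 1)"

definition primitive_matrix :: "real^'n^'n \<Rightarrow> bool" where
  "primitive_matrix A \<longleftrightarrow>
     (\<forall>i j. 0 \<le> A $ i $ j) \<and> (\<exists>n\<ge>1. \<forall>i j. 0 < matrix_pow A n $ i $ j)"

definition primitive_substitution :: "('a::finite \<Rightarrow> 'a list) \<Rightarrow> bool" where
  "primitive_substitution \<rho> \<longleftrightarrow> (\<forall>i. \<rho> i \<noteq> []) \<and> primitive_matrix (subst_matrix \<rho>)"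

definition eigenvalue_of :: "complex^'n^'n \<Rightarrow> complex \<Rightarrow> bool" where
  "eigenvalue_of A \<mu> \<longleftrightarrow> (\<exists>v. v \<noteq> 0 \<and> A *v v = \<mu> *s v)"

text \<open>The Perron--Frobenius eigenvalue: the spectral radius, itself an eigenvalue.\<close>

definition pf_eigenvalue :: "real^'n^'n \<Rightarrow> real \<Rightarrow> bool" where
  "pf_eigenvalue A lam \<longleftrightarrow>
     (let A' = (\<chi> i j. complex_of_real (A $ i $ j))
      in eigenvalue_of A' (complex_of_real lam) \<and> (\<forall>\<mu>. eigenvalue_of A' \<mu> \<longrightarrow> norm \<mu> \<le> lam))"

section \<open>Inflation tilings as coloured point sets\<close>

text \<open>A coloured point set assigns to each type \<open>i\<close> the set of left endpoints of the tiles
  of type \<open>i\<close>.\<close>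

type_synonym 'a cps = "'a \<Rightarrow> real set"

definition support :: "'a cps \<Rightarrow> real set" where
  "support \<Lambda> = (\<Union>i. \<Lambda> i)"

definition translate :: "real \<Rightarrow> 'a cps \<Rightarrow> 'a cps" where
  "translate t \<Lambda> = (\<lambda>i. (\<lambda>x. x + t) ` \<Lambda> i)"

text \<open>The half-open tiles \<open>[x, x + len i)\<close> partition the line.\<close>

definition is_tiling :: "real^'a \<Rightarrow> 'a cps \<Rightarrow> bool" where
  "is_tiling len \<Lambda> \<longleftrightarrow> (\<forall>y. \<exists>!p. case p of (i, x) \<Rightarrow> x \<in> \<Lambda> i \<and> x \<le> y \<and> y < x + len $ i)"

text \<open>The tile of type \<open>i\<close> at \<open>x\<close> is expanded to \<open>[lam x, lam x + lam len i]\<close> and dissected, from left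
  to right, according to the word \<open>\<rho> i\<close>.\<close>

definition inflate :: "('a \<Rightarrow> 'a list) \<Rightarrow> real \<Rightarrow> real^'a \<Rightarrow> 'a cps \<Rightarrow> 'a cps" where
  "inflate \<rho> lam len \<Lambda> = (\<lambda>j. {lam * x + (\<Sum>q<p. len $ (\<rho> i ! q)) | i x p.
      x \<in> \<Lambda> i \<and> p < length (\<rho> i) \<and> \<rho> i ! p = j})"

text \<open>Adjacent tiles form two-letter factors of iterates of \<open>\<rho>\<close> on letters. For a fixed
  point of a power of the inflation this is legality of the seed at the origin, and every finite
  word of consecutive tiles is then legal. An illegal seed yields a tiling with a defect, whose
  orbit closure is not minimal and is not the hull of \<open>\<rho>\<close>.\<close>

definition legal :: "('a \<Rightarrow> 'a list) \<Rightarrow> real^'a \<Rightarrow> 'a cps \<Rightarrow> bool" where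
  "legal \<rho> len \<Lambda> \<longleftrightarrow> (\<forall>i j x. x \<in> \<Lambda> i \<and> x + len $ i \<in> \<Lambda> j \<longrightarrow>
      (\<exists>n a. sublist [i, j] ((subst_word \<rho> ^^ n) [a])))"

definition inflation_fixed_point ::
    "('a \<Rightarrow> 'a list) \<Rightarrow> real \<Rightarrow> real^'a \<Rightarrow> 'a cps \<Rightarrow> bool" where
  "inflation_fixed_point \<rho> lam len T \<longleftrightarrow>
     is_tiling len T \<and> legal \<rho> len T \<and> (\<exists>N\<ge>1. (inflate \<rho> lam len ^^ N) T = T)"

text \<open>Local topology: \<open>\<epsilon>\<close>-close means agreement on \<open>[-1/\<epsilon>, 1/\<epsilon>]\<close> after a translation by at
  most \<open>\<epsilon>\<close>.\<close>

definition locally_close :: "real \<Rightarrow> 'a cps \<Rightarrow> 'a cps \<Rightarrow> bool" where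
  "locally_close \<epsilon> \<Lambda> \<Lambda>' \<longleftrightarrow> (\<exists>s. \<bar>s\<bar> \<le> \<epsilon> \<and>
     (\<forall>i. \<Lambda> i \<inter> {-1/\<epsilon>..1/\<epsilon>} = translate s \<Lambda>' i \<inter> {-1/\<epsilon>..1/\<epsilon>}))"

definition local_closure :: "'a cps set \<Rightarrow> 'a cps set" where
  "local_closure X = {\<Lambda>. \<forall>\<epsilon>>0. \<exists>\<Lambda>'\<in>X. locally_close \<epsilon> \<Lambda> \<Lambda>'}"

definition tiling_hull :: "'a cps \<Rightarrow> 'a cps set" where
  "tiling_hull T = local_closure (range (\<lambda>t. translate t T))"

section \<open>Density and Fourier--Bohr coefficients\<close>

definition dens :: "real set \<Rightarrow> real" where
  "dens S = (THE d. uniform_limit UNIV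
      (\<lambda>r c. real (card (S \<inter> {- r + c..r + c})) / (2 * r)) (\<lambda>c. d) at_top)"

definition fb_average :: "'a cps \<Rightarrow> 'a \<Rightarrow> real \<Rightarrow> real \<Rightarrow> real \<Rightarrow> complex" where
  "fb_average \<Lambda> j k r c =
     1 / complex_of_real (2 * r) *
       (\<Sum>x \<in> \<Lambda> j \<inter> {- r + c..r + c}. exp (- 2 * of_real pi * \<i> * of_real k * of_real x))"

definition fb_coeff :: "'a cps \<Rightarrow> 'a \<Rightarrow> real \<Rightarrow> complex" where
  "fb_coeff \<Lambda> j k =
     inverse (complex_of_real (dens (support \<Lambda>))) * Lim at_top (\<lambda>r. fb_average \<Lambda> j k r 0)"

section \<open>Complex Radon measures and their Fourier transforms\<close>

text \<open>A (possibly unbounded) complex Radon measure on the line is given by a polar decomposition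
  \<open>h \<cdot> N\<close> with \<open>N\<close> a locally finite positive Borel measure and \<open>h\<close> measurable of modulus one.
  It is determined by the pair, which in turn is unique up to changing \<open>h\<close> on \<open>N\<close>-null sets.\<close>

type_synonym cmeasure = "real measure \<times> (real \<Rightarrow> complex)"

definition complex_radon :: "cmeasure \<Rightarrow> bool" where
  "complex_radon = (\<lambda>(N, h). sets N = sets borel \<and>
     (\<forall>B \<in> sets borel. bounded B \<longrightarrow> emeasure N B < \<infinity>) \<and>
     h \<in> borel_measurable borel \<and> (\<forall>x. norm (h x) = 1))"

definition cm_value :: "cmeasure \<Rightarrow> real set \<Rightarrow> complex" where
  "cm_value = (\<lambda>(N, h) B. LINT x:B|N. h x)"

definition pp_part :: "cmeasure \<Rightarrow> real set \<Rightarrow> complex" where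
  "pp_part \<mu> B = cm_value \<mu> (B \<inter> {x. cm_value \<mu> {x} \<noteq> 0})"

definition schwartz :: "(real \<Rightarrow> complex) \<Rightarrow> bool" where
  "schwartz \<phi> \<longleftrightarrow> (\<exists>D. D 0 = \<phi> \<and>
     (\<forall>n x. (D n has_vector_derivative D (Suc n) x) (at x)) \<and>
     (\<forall>m n. bounded (range (\<lambda>x. x ^ m *\<^sub>R D n x))))"

definition fourier :: "(real \<Rightarrow> complex) \<Rightarrow> real \<Rightarrow> complex" where
  "fourier \<phi> k = (LINT x|lborel. exp (- 2 * of_real pi * \<i> * of_real k * of_real x) * \<phi> x)"

text \<open>The transform is taken in the sense of tempered distributions; \<open>M\<close> is positive because
  the pair correlation measures are.\<close>

definition is_fourier_transform :: "real measure \<Rightarrow> cmeasure \<Rightarrow> bool" where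
  "is_fourier_transform M = (\<lambda>(N, h). complex_radon (N, h) \<and>
     (\<forall>\<phi>. schwartz \<phi> \<longrightarrow> integrable M (fourier \<phi>) \<and> integrable N \<phi> \<and>
        (LINT k|N. \<phi> k * h k) = (LINT x|M. fourier \<phi> x)))"

definition measure_fourier :: "real measure \<Rightarrow> cmeasure" where
  "measure_fourier M = (SOME \<mu>. is_fourier_transform M \<mu>)"

section \<open>Pair correlations and intensities\<close>

definition pair_corr :: "'a cps \<Rightarrow> 'a \<Rightarrow> 'a \<Rightarrow> real \<Rightarrow> real" where
  "pair_corr \<Lambda> i j z = dens (\<Lambda> i \<inter> (\<lambda>x. x - z) ` \<Lambda> j) / dens (support \<Lambda>)"

text \<open>The Borel measure \<open>\<Sum>z. \<nu>\<^sub>i\<^sub>j(z) \<delta>\<^sub>z\<close>, with \<open>z\<close> running over the difference set.\<close>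

definition pair_corr_measure :: "'a cps \<Rightarrow> 'a \<Rightarrow> 'a \<Rightarrow> real measure" where
  "pair_corr_measure \<Lambda> i j =
     distr (point_measure {y - x | x y. x \<in> support \<Lambda> \<and> y \<in> support \<Lambda>}
              (\<lambda>z. ennreal (pair_corr \<Lambda> i j z)))
           borel (\<lambda>z. z)"

definition intensity :: "'a cps \<Rightarrow> 'a \<Rightarrow> 'a \<Rightarrow> real \<Rightarrow> complex" where
  "intensity \<Lambda> i j = (THE I. countable {k. I k \<noteq> 0} \<and>
     (\<forall>B \<in> sets borel. bounded B \<longrightarrow>
        ((\<lambda>k. complex_of_real (dens (support \<Lambda>)) * I k)
           has_sum pp_part (measure_fourier (pair_corr_measure \<Lambda> i j)) B) B))"

definition intensity_matrix :: "('a::finite) cps \<Rightarrow> real \<Rightarrow> complex^'a^'a" where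
  "intensity_matrix \<Lambda> k = (\<chi> i j. intensity \<Lambda> i j k)"

section \<open>Complex matrices\<close>

definition hermitian :: "complex^'n^'n \<Rightarrow> bool" where
  "hermitian A \<longleftrightarrow> (\<forall>i j. A $ i $ j = cnj (A $ j $ i))"

definition pos_semidef :: "complex^'n^'n \<Rightarrow> bool" where
  "pos_semidef A \<longleftrightarrow> (\<forall>v :: complex^'n.
     (\<Sum>i\<in>UNIV. \<Sum>j\<in>UNIV. cnj (v $ i) * A $ i $ j * v $ j) \<in> \<real> \<and>
     0 \<le> Re (\<Sum>i\<in>UNIV. \<Sum>j\<in>UNIV. cnj (v $ i) * A $ i $ j * v $ j))"

end

theory Submission imports Defs begin

text \<open>
  Every exponential sum over a supertile is governed by the vector of exponential sums over the
  \<open>n\<close>-th inflated letters. Its norm, weighted by the letter frequencies and scaled by the inflation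
  factor, is nonincreasing in \<open>n\<close>. If it tends to \<open>0\<close>, all Fourier--Bohr averages vanish uniformly.
  Otherwise almost no cancellation takes place at high levels, so that \<open>k \<lambda>\<^sup>n \<tau>\<close> tends to
  \<open>0\<close> modulo \<open>1\<close> for every return vector \<open>\<tau>\<close>. As \<open>\<lambda>\<close> is algebraic, the
  distances to the integers eventually obey a linear recursion and are therefore summable, which
  makes the phases of all supertiles of one type and level nearly equal on the whole line; uniform
  convergence follows. Elements of the hull agree with translates of the fixed point on large
  windows, and a limit of the corresponding phases gives the common factor.

  The Fourier transform of a pair correlation measure is obtained from the diffraction measures of
  finite patches by polarization, Helly selection and a Radon--Nikodym derivative. Testing any such
  transform with shrinking Gaussians identifies its atoms as means of the pair correlations, and
  these factorize because the Fourier--Bohr averages converge uniformly in the centre.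
\<close>

section \<open>Words and tiles\<close>

text \<open>Convergence of the phases to 1 along return vectors would be too weak by itself: a
  position inside a supertile of level q is reached through q nested choices, and exchanging the
  choice on each level costs one phase error, so the errors of all levels from n on must add up to
  something small. This is what the algebraicity of the inflation factor buys. Legality enters when
  two equal tiles of the fixed point sit in neighbouring supertiles: a pair of letters that occurs
  in an iterated letter lets their distance be read off inside one supertile. A translation by t
  multiplies all coefficients at k by exp(-2 pi i k t), so those of two hull elements can agree only
  up to one unimodular factor, while the products of a conjugated and a plain coefficient agree
  exactly. For distinct letters the pair correlation measure need not be positive definite, hence
  the polarization and the polar form of the transform. The transform is introduced by a choice
  operator, so its existence has to be proved, and its atoms are computed for every measure that
  qualifies.\<close>

lemma subst_word_Nil [simp]: "subst_word \<rho> [] = []"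
  by (simp add: subst_word_def)

lemma subst_word_append: "subst_word \<rho> (u @ v) = subst_word \<rho> u @ subst_word \<rho> v"
  by (simp add: subst_word_def)

lemma subst_word_single [simp]: "subst_word \<rho> [a] = \<rho> a"
  by (simp add: subst_word_def)

lemma subst_word_pow_append:
  "(subst_word \<rho> ^^ n) (u @ v) = (subst_word \<rho> ^^ n) u @ (subst_word \<rho> ^^ n) v"
  by (induction n) (simp_all add: subst_word_append)

lemma subst_word_pow_Nil [simp]: "(subst_word \<rho> ^^ n) [] = []"
  by (induction n) simp_all

lemma subst_word_pow_Cons:
  "(subst_word \<rho> ^^ n) (a # w) = (subst_word \<rho> ^^ n) [a] @ (subst_word \<rho> ^^ n) w"
  using subst_word_pow_append[of n \<rho> "[a]" w] by simp

lemma subst_word_pow_conv_concat: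
  "(subst_word \<rho> ^^ n) w = concat (map (\<lambda>a. (subst_word \<rho> ^^ n) [a]) w)"
proof (induction w)
  case (Cons a w)
  then show ?case
    using subst_word_pow_Cons[of n \<rho> a w] by simp
qed simp

text \<open>Prepares the passage to a power of the substitution: the letterwise images under m steps
  form a substitution again, and \<open>subst_word_pow_conv_concat\<close> identifies one step of it
  with m steps of \<rho>.\<close>

lemma subst_word_pow_pow:
  "(subst_word (\<lambda>a. (subst_word \<rho> ^^ m) [a]) ^^ n) w = (subst_word \<rho> ^^ (m * n)) w"
proof (induction n)
  case (Suc n)
  let ?\<tau> = "\<lambda>a. (subst_word \<rho> ^^ m) [a]"
  have "(subst_word ?\<tau> ^^ Suc n) w = subst_word ?\<tau> ((subst_word \<rho> ^^ (m * n)) w)"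
    by (simp only: funpow.simps o_apply Suc)
  also have "\<dots> = (subst_word \<rho> ^^ m) ((subst_word \<rho> ^^ (m * n)) w)"
    unfolding subst_word_def[of ?\<tau>] by (rule subst_word_pow_conv_concat[symmetric])
  also have "\<dots> = (subst_word \<rho> ^^ (m * Suc n)) w"
    by (simp add: funpow_add)
  finally show ?case .
qed simp

lemma set_subst_word_pow: "set ((subst_word \<rho> ^^ n) w) = (\<Union>a\<in>set w. set ((subst_word \<rho> ^^ n) [a]))"
  by (subst subst_word_pow_conv_concat) auto

lemma count_subst_word_pow:
  fixes \<rho> :: "'a::finite \<Rightarrow> 'a list"
  shows "count_list ((subst_word \<rho> ^^ n) w) l
    = (\<Sum>j\<in>UNIV. count_list w j * count_list ((subst_word \<rho> ^^ n) [j]) l)"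
proof (induction w)
  case (Cons a w)
  have "(\<Sum>j\<in>UNIV. count_list (a # w) j * count_list ((subst_word \<rho> ^^ n) [j]) l)
      = (\<Sum>j\<in>UNIV. (if j = a then count_list ((subst_word \<rho> ^^ n) [j]) l else 0)
          + count_list w j * count_list ((subst_word \<rho> ^^ n) [j]) l)"
    by (intro sum.cong) auto
  also have "\<dots> = count_list ((subst_word \<rho> ^^ n) [a]) l + count_list ((subst_word \<rho> ^^ n) w) l"
    by (simp add: sum.distrib Cons)
  finally show ?case
    using subst_word_pow_Cons[of n \<rho> a w] by simp
qed simp

definition wlen :: "real^'a \<Rightarrow> 'a list \<Rightarrow> real" where
  "wlen len w = (\<Sum>a\<leftarrow>w. len $ a)"

lemma wlen_simps [simp]: "wlen len [] = 0" "wlen len (a # w) = len $ a + wlen len w"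
  "wlen len (u @ v) = wlen len u + wlen len v"
  by (simp_all add: wlen_def)

lemma wlen_conv_count:
  fixes len :: "real^'a::finite"
  shows "wlen len w = (\<Sum>l\<in>UNIV. real (count_list w l) * len $ l)"
proof (induction w)
  case (Cons a w)
  have "(\<Sum>l\<in>UNIV. real (count_list (a # w) l) * len $ l)
      = (\<Sum>l\<in>UNIV. (if l = a then len $ l else 0) + real (count_list w l) * len $ l)"
    by (intro sum.cong) (auto simp: algebra_simps)
  then show ?case by (simp add: sum.distrib Cons)
qed simp

text \<open>Carries the running left endpoint through the recursion, so that concatenation and
  iteration of words act on it directly; the partial sums in \<open>inflate\<close> are recovered in
  \<open>set_tiles\<close>.\<close>

primrec tiles :: "real^'a \<Rightarrow> real \<Rightarrow> 'a list \<Rightarrow> ('a \<times> real) list" where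
  "tiles len x [] = []"
| "tiles len x (a # w) = (a, x) # tiles len (x + len $ a) w"

lemma tiles_append: "tiles len x (u @ v) = tiles len x u @ tiles len (x + wlen len u) v"
  by (induction u arbitrary: x) (simp_all add: add.assoc)

lemma tiles_shift: "tiles len (x + y) w = map (\<lambda>(a, t). (a, t + y)) (tiles len x w)"
proof (induction w arbitrary: x)
  case (Cons a w)
  have "x + y + len $ a = x + len $ a + y" by simp
  then show ?case by (simp only: tiles.simps Cons list.map prod.case)
qed simp

lemma tiles_shift0: "tiles len y w = map (\<lambda>(a, t). (a, t + y)) (tiles len 0 w)"
  using tiles_shift[of len 0 y w] by simp

lemma map_fst_tiles [simp]: "map fst (tiles len x w) = w"
  by (induction w arbitrary: x) simp_all

lemma length_tiles [simp]: "length (tiles len x w) = length w"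
  by (induction w arbitrary: x) simp_all

lemma fst_set_tiles: "fst ` set (tiles len x w) = set w"
  by (metis list.set_map map_fst_tiles)

lemma nth_tiles:
  "p < length w \<Longrightarrow> tiles len x w ! p = (w ! p, x + (\<Sum>q<p. len $ (w ! q)))"
proof (induction w arbitrary: x p)
  case (Cons a w)
  show ?case
  proof (cases p)
    case (Suc p')
    have "(\<Sum>q<Suc p'. len $ ((a # w) ! q)) = len $ a + (\<Sum>q<p'. len $ (w ! q))"
      by (subst sum.lessThan_Suc_shift) simp
    then show ?thesis using Cons Suc by (simp del: sum.lessThan_Suc)
  qed simp
qed simp

lemma set_tiles:
  "set (tiles len x w) = {(w ! p, x + (\<Sum>q<p. len $ (w ! q))) | p. p < length w}"
  unfolding set_conv_nth length_tiles using nth_tiles[of _ w len x] by metis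

lemma sum_list_tiles_const:
  fixes g :: "'a::finite \<Rightarrow> 'b::comm_semiring_1"
  shows "(\<Sum>(a, t)\<leftarrow>tiles len x w. g a) = (\<Sum>l\<in>UNIV. of_nat (count_list w l) * g l)"
proof (induction w arbitrary: x)
  case (Cons a w)
  have "(\<Sum>l\<in>UNIV. of_nat (count_list (a # w) l) * g l)
      = (\<Sum>l\<in>UNIV. (if l = a then g l else 0) + of_nat (count_list w l) * g l)"
    by (intro sum.cong) (auto simp: algebra_simps)
  then show ?case by (simp add: sum.distrib Cons)
qed simp

text \<open>The eigenvector equation in combinatorial form. It is instantiated twice, for the given
  substitution and for the power of it that is chosen in
  \<open>inflation_fixed_point_tiling\<close>.\<close>

locale natural_lengths =
  fixes \<sigma> :: "'a::finite \<Rightarrow> 'a list" and mu :: real and len :: "real^'a"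
  assumes mu_gt_1: "mu > 1" and len_pos: "len $ i > 0"
    and wlen_subst_letter: "wlen len (\<sigma> i) = mu * len $ i"
begin

lemma mu_pos [simp]: "mu > 0" "mu \<noteq> 0" "mu \<ge> 0" using mu_gt_1 by auto

lemma mu_pow_pos [simp]: "mu ^ n > 0" by simp

lemma wlen_subst: "wlen len (subst_word \<sigma> w) = mu * wlen len w"
  by (induction w) (simp_all add: subst_word_def wlen_subst_letter algebra_simps)

lemma wlen_subst_pow: "wlen len ((subst_word \<sigma> ^^ n) w) = mu ^ n * wlen len w"
  by (induction n) (simp_all add: wlen_subst)

text \<open>The supertile over a tile at t starts at \<open>mu ^ n * t\<close>: the word to its left
  grows in length by the factor \<open>mu ^ n\<close>. All decompositions of sums into supertiles
  rest on this.\<close>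

lemma tiles_subst_pow:
  "tiles len (mu ^ n * x) ((subst_word \<sigma> ^^ n) w)
    = concat (map (\<lambda>(a, t). tiles len (mu ^ n * t) ((subst_word \<sigma> ^^ n) [a])) (tiles len x w))"
proof (induction w arbitrary: x)
  case (Cons a w)
  have "tiles len (mu ^ n * x) ((subst_word \<sigma> ^^ n) (a # w))
    = tiles len (mu ^ n * x) ((subst_word \<sigma> ^^ n) [a])
      @ tiles len (mu ^ n * x + wlen len ((subst_word \<sigma> ^^ n) [a])) ((subst_word \<sigma> ^^ n) w)"
    by (subst subst_word_pow_Cons) (simp add: tiles_append)
  also have "mu ^ n * x + wlen len ((subst_word \<sigma> ^^ n) [a]) = mu ^ n * (x + len $ a)"
    by (simp add: wlen_subst_pow algebra_simps)
  finally show ?case by (simp add: Cons)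
qed simp

lemma set_tiles_subst_pow:
  "set (tiles len (mu ^ n * x) ((subst_word \<sigma> ^^ n) w))
    = (\<Union>(a, t)\<in>set (tiles len x w). set (tiles len (mu ^ n * t) ((subst_word \<sigma> ^^ n) [a])))"
  by (subst tiles_subst_pow) (simp add: case_prod_unfold)

lemma set_tiles_subst_pow_add:
  "set (tiles len (mu ^ (m + n) * x) ((subst_word \<sigma> ^^ (m + n)) w))
    = (\<Union>(a, t)\<in>set (tiles len (mu ^ n * x) ((subst_word \<sigma> ^^ n) w)).
         set (tiles len (mu ^ m * t) ((subst_word \<sigma> ^^ m) [a])))"
  using set_tiles_subst_pow[of m "mu ^ n * x" "(subst_word \<sigma> ^^ n) w"]
  by (simp add: funpow_add power_add mult.assoc)

lemma sum_list_tiles_subst_pow_add: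
  fixes f :: "'a \<times> real \<Rightarrow> 'b::comm_monoid_add"
  shows "(\<Sum>p\<leftarrow>tiles len (mu ^ (m + n) * x) ((subst_word \<sigma> ^^ (m + n)) w). f p)
    = (\<Sum>(a, t)\<leftarrow>tiles len (mu ^ n * x) ((subst_word \<sigma> ^^ n) w).
         \<Sum>p\<leftarrow>tiles len (mu ^ m * t) ((subst_word \<sigma> ^^ m) [a]). f p)"
proof -
  have *: "sum_list (map f (concat (map g ps))) = (\<Sum>p\<leftarrow>ps. sum_list (map f (g p)))"
    for g :: "'a \<times> real \<Rightarrow> ('a \<times> real) list" and ps
    by (induction ps) simp_all
  have "tiles len (mu ^ (m + n) * x) ((subst_word \<sigma> ^^ (m + n)) w)
     = concat (map (\<lambda>(a, t). tiles len (mu ^ m * t) ((subst_word \<sigma> ^^ m) [a]))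
          (tiles len (mu ^ n * x) ((subst_word \<sigma> ^^ n) w)))"
    using tiles_subst_pow[of m "mu ^ n * x" "(subst_word \<sigma> ^^ n) w"]
    by (simp add: funpow_add power_add mult.assoc)
  then show ?thesis by (simp add: * case_prod_unfold)
qed

lemma inflate_conv_tiles:
  "inflate \<sigma> mu len \<Lambda> j = {y. \<exists>i x. x \<in> \<Lambda> i \<and> (j, y) \<in> set (tiles len (mu * x) (\<sigma> i))}"
  unfolding inflate_def set_tiles by blast

lemma inflate_pow_conv_tiles:
  "(inflate \<sigma> mu len ^^ n) \<Lambda> j
    = {y. \<exists>i x. x \<in> \<Lambda> i \<and> (j, y) \<in> set (tiles len (mu ^ n * x) ((subst_word \<sigma> ^^ n) [i]))}"
proof (induction n arbitrary: j)
  case (Suc n)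
  have "(inflate \<sigma> mu len ^^ Suc n) \<Lambda> j = inflate \<sigma> mu len ((inflate \<sigma> mu len ^^ n) \<Lambda>) j"
    by simp
  also have "\<dots> = {y. \<exists>i' x'. x' \<in> (inflate \<sigma> mu len ^^ n) \<Lambda> i'
      \<and> (j, y) \<in> set (tiles len (mu * x') (\<sigma> i'))}"
    by (rule inflate_conv_tiles)
  also have "\<dots> = {y. \<exists>i x. x \<in> \<Lambda> i \<and> (\<exists>i' x'.
      (i', x') \<in> set (tiles len (mu ^ n * x) ((subst_word \<sigma> ^^ n) [i]))
      \<and> (j, y) \<in> set (tiles len (mu * x') (\<sigma> i')))}"
    unfolding Suc by blast
  also have "\<dots> = {y. \<exists>i x. x \<in> \<Lambda> i
      \<and> (j, y) \<in> set (tiles len (mu ^ Suc n * x) ((subst_word \<sigma> ^^ Suc n) [i]))}"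
    (is "_ = ?R")
  proof -
    have *: "(j, y) \<in> set (tiles len (mu ^ Suc n * x) ((subst_word \<sigma> ^^ Suc n) [i])) \<longleftrightarrow>
       (\<exists>i' x'. (i', x') \<in> set (tiles len (mu ^ n * x) ((subst_word \<sigma> ^^ n) [i]))
         \<and> (j, y) \<in> set (tiles len (mu * x') (\<sigma> i')))" for i x y
      using arg_cong[OF set_tiles_subst_pow_add[of 1 n x "[i]"], of "\<lambda>S. (j, y) \<in> S"]
      by (simp only: plus_1_eq_Suc UN_iff Bex_def split_paired_Ex prod.case power_one_right
          funpow.simps funpow_0 o_id One_nat_def o_apply add_Suc add_0 power_Suc0_right subst_word_single id_apply)
    show ?thesis unfolding * ..
  qed
  finally show ?case .
qed simp

lemma tiles_bounds:
  assumes "(a, t) \<in> set (tiles len x w)"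
  shows "x \<le> t" "t + len $ a \<le> x + wlen len w"
proof -
  have nn: "wlen len w \<ge> 0" for w
    by (induction w) (use len_pos in \<open>auto simp: less_imp_le add_nonneg_nonneg\<close>)
  have "x \<le> t \<and> t + len $ a \<le> x + wlen len w"
    using assms
  proof (induction w arbitrary: x)
    case (Cons b w)
    from Cons.prems consider "a = b" "t = x" | "(a, t) \<in> set (tiles len (x + len $ b) w)"
      by auto
    then show ?case
    proof cases
      case 1 then show ?thesis using nn[of w] by simp
    next
      case 2
      from Cons.IH[OF this] show ?thesis using len_pos[of b] by simp
    qed
  qed simp
  then show "x \<le> t" "t + len $ a \<le> x + wlen len w" by auto
qed

text \<open>Positive lengths make the endpoints strictly increase. This allows sums along the list,
  which follow the substitution, to be exchanged with sums over the set, which follow the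
  tiling.\<close>

lemma distinct_tiles: "distinct (tiles len x w)"
proof (induction w arbitrary: x)
  case (Cons a w)
  have "(a, x) \<notin> set (tiles len (x + len $ a) w)"
    using tiles_bounds(1)[of a x "x + len $ a" w] len_pos[of a] by auto
  then show ?case using Cons by simp
qed simp

lemma supertile_bounds:
  assumes "(a, y) \<in> set (tiles len (mu ^ n * x) ((subst_word \<sigma> ^^ n) [i]))"
  shows "mu ^ n * x \<le> y" "y + len $ a \<le> mu ^ n * (x + len $ i)"
  using tiles_bounds(1)[OF assms] apply simp
  using tiles_bounds(2)[OF assms] unfolding wlen_subst_pow by (simp add: distrib_left)

end

section \<open>Positive stochastic iterations and linear recursions\<close>

text \<open>All weights are at least \<delta>, so every new value stays below the maximum by at
  least \<delta> times the current spread, and the spread contracts geometrically. The minimum never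
  drops; its bound on the limit later makes the letter frequencies positive.\<close>

lemma positive_stochastic_iteration_converges:
  fixes x :: "nat \<Rightarrow> 'a::finite \<Rightarrow> real" and q :: "'a \<Rightarrow> 'a \<Rightarrow> real"
  assumes step: "\<And>m i. x (Suc m) i = (\<Sum>j\<in>UNIV. q j i * x m j)"
    and stoch: "\<And>i. (\<Sum>j\<in>UNIV. q j i) = 1" and pos: "\<And>j i. q j i > 0"
  shows "\<exists>d. (\<forall>i. (\<lambda>m. x m i) \<longlonglongrightarrow> d) \<and> (\<forall>m. Min (range (x m)) \<le> d)"
proof -
  define A where "A m = Min (range (x m))" for m
  define B where "B m = Max (range (x m))" for m
  define \<delta> where "\<delta> = Min (range (\<lambda>(j, i). q j i))"
  have \<delta>: "0 < \<delta>" unfolding \<delta>_def using pos by auto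
  have \<delta>q: "\<delta> \<le> q j i" for j i
    unfolding \<delta>_def by (rule Min_le) (auto intro: rev_image_eqI[of "(j, i)"])
  have A_le: "A m \<le> x m i" and le_B: "x m i \<le> B m" for m i
    unfolding A_def B_def by auto
  have A_ex: "\<exists>i. x m i = A m" for m
  proof -
    have "A m \<in> range (x m)" unfolding A_def by (rule Min_in) simp_all
    then show ?thesis by (auto simp: image_iff)
  qed
  have B_ex: "\<exists>i. x m i = B m" for m
  proof -
    have "B m \<in> range (x m)" unfolding B_def by (rule Max_in) simp_all
    then show ?thesis by (auto simp: image_iff)
  qed
  have ge: "A m \<le> x (Suc m) i" for m i
  proof -
    have "A m = (\<Sum>j\<in>UNIV. q j i * A m)" by (simp add: sum_distrib_right[symmetric] stoch)
    also have "\<dots> \<le> x (Suc m) i" unfolding step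
      by (intro sum_mono mult_left_mono A_le less_imp_le pos)
    finally show ?thesis .
  qed
  have le: "x (Suc m) i \<le> B m - \<delta> * (B m - A m)" for m i
  proof -
    obtain i0 where i0: "x m i0 = A m" using A_ex by blast
    have "B m - x (Suc m) i = (\<Sum>j\<in>UNIV. q j i * (B m - x m j))"
      unfolding step by (simp add: right_diff_distrib sum_subtractf sum_distrib_right[symmetric] stoch)
    \<comment> \<open>Only the index at which the minimum is attained is kept; it alone contributes
      \<delta> times the spread.\<close>
    also have "\<dots> \<ge> (\<Sum>j\<in>{i0}. q j i * (B m - x m j))"
      by (rule sum_mono2) (auto intro!: mult_nonneg_nonneg less_imp_le[OF pos] simp: le_B)
    also have "(\<Sum>j\<in>{i0}. q j i * (B m - x m j)) \<ge> \<delta> * (B m - A m)"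
      using i0 A_le[of m i0] le_B[of m i0] by (auto intro!: mult_right_mono \<delta>q)
    finally show ?thesis by simp
  qed
  have AB: "A m \<le> B m" for m using A_le[of m undefined] le_B[of m undefined] by linarith
  have A_mono: "A m \<le> A (Suc m)" for m
    using ge[of m] A_ex[of "Suc m"] by metis
  have B_step: "B (Suc m) \<le> B m - \<delta> * (B m - A m)" for m
    using le[of m] B_ex[of "Suc m"] by metis
  have B_mono: "B (Suc m) \<le> B m" for m
  proof -
    have "0 \<le> \<delta> * (B m - A m)" using \<delta> AB[of m] by simp
    then show ?thesis using B_step[of m] by linarith
  qed
  have contr: "B (Suc m) - A (Suc m) \<le> (1 - \<delta>) * (B m - A m)" for m
    using A_mono[of m] B_step[of m] by (simp add: algebra_simps)
  \<comment> \<open>The maximum with 0 supplies a nonnegative ratio without a comparison of \<delta>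
    with 1.\<close>
  define \<kappa> where "\<kappa> = max 0 (1 - \<delta>)"
  have \<kappa>: "0 \<le> \<kappa>" "\<kappa> < 1" "1 - \<delta> \<le> \<kappa>" unfolding \<kappa>_def using \<delta> by simp_all
  have geom: "B m - A m \<le> \<kappa> ^ m * (B 0 - A 0)" for m
  proof (induction m)
    case (Suc m)
    have "B (Suc m) - A (Suc m) \<le> (1 - \<delta>) * (B m - A m)" by (rule contr)
    also have "\<dots> \<le> \<kappa> * (B m - A m)"
      using \<kappa>(3) by (rule mult_right_mono) (simp add: AB)
    also have "\<dots> \<le> \<kappa> * (\<kappa> ^ m * (B 0 - A 0))"
      using Suc.IH \<kappa>(1) by (rule mult_left_mono)
    finally show ?case by (simp only: power_Suc mult.assoc)
  qed simp
  have null: "(\<lambda>m. \<kappa> ^ m * (B 0 - A 0)) \<longlonglongrightarrow> 0"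
    by (rule tendsto_mult_left_zero, rule LIMSEQ_realpow_zero) (use \<kappa> in auto)
  have "(\<lambda>m. B m - A m) \<longlonglongrightarrow> 0"
    by (rule real_tendsto_sandwich[OF _ _ tendsto_const null]) (simp_all add: AB geom)
  then have "(\<lambda>m. A m - B m) \<longlonglongrightarrow> 0"
    using tendsto_minus[of "\<lambda>m. B m - A m" 0] by simp
  from nested_sequence_unique[of A B] this A_mono B_mono AB
  obtain d where d: "\<forall>n. A n \<le> d" "A \<longlonglongrightarrow> d" "B \<longlonglongrightarrow> d" by blast
  have "(\<lambda>m. x m i) \<longlonglongrightarrow> d" for i
    by (rule tendsto_sandwich[OF _ _ d(2,3)]) (auto simp: A_le le_B)
  then show ?thesis using d(1) unfolding A_def by blast
qed

text \<open>Dual functionals for a finite family of sequences, found by Gaussian elimination.\<close>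

lemma finite_family_reproducing:
  fixes e :: "'i \<Rightarrow> nat \<Rightarrow> real"
  assumes "finite I"
  shows "\<exists>(b :: 'i \<Rightarrow> nat \<Rightarrow> real) N. \<forall>i\<in>I. \<forall>m. e i m = (\<Sum>j\<in>I. (\<Sum>n<N. b j n * e i n) * e j m)"
  using assms
proof (induction I)
  case (insert s I)
  then obtain b :: "'i \<Rightarrow> nat \<Rightarrow> real" and N where
    b: "\<And>i m. i \<in> I \<Longrightarrow> e i m = (\<Sum>j\<in>I. (\<Sum>n<N. b j n * e i n) * e j m)" by blast
  define \<phi> where "\<phi> j x = (\<Sum>n<N. b j n * x n)" for j and x :: "nat \<Rightarrow> real"
  \<comment> \<open>What the functionals found so far fail to reproduce of the new sequence.\<close>
  define g where "g m = e s m - (\<Sum>j\<in>I. \<phi> j (e s) * e j m)" for m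
  have b': "e i m = (\<Sum>j\<in>I. \<phi> j (e i) * e j m)" if "i \<in> I" for i m
    using b[OF that] unfolding \<phi>_def .
  show ?case
  proof (cases "\<forall>m. g m = 0")
    case True
    define b1 where "b1 j = (if j = s then (\<lambda>_. 0) else b j)" for j
    have eq: "(\<Sum>j\<in>insert s I. (\<Sum>n<N. b1 j n * e i n) * e j m) = (\<Sum>j\<in>I. \<phi> j (e i) * e j m)" for i m
      using insert by (simp add: b1_def \<phi>_def) (intro sum.cong, auto)
    have rep: "e i m = (\<Sum>j\<in>I. \<phi> j (e i) * e j m)" if "i \<in> insert s I" for i m
    proof (cases "i = s")
      case True
      have "g m = 0" using \<open>\<forall>m. g m = 0\<close> by blast
      then show ?thesis unfolding g_def True right_minus_eq .
    next
      case False
      then have "i \<in> I" using that by simp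
      then show ?thesis by (rule b')
    qed
    have "e i m = (\<Sum>j\<in>insert s I. (\<Sum>n<N. b1 j n * e i n) * e j m)" if "i \<in> insert s I" for i m
      by (rule trans[OF rep[OF that] eq[symmetric]])
    then show ?thesis by (intro exI[of _ b1] exI[of _ N] ballI allI)
  next
    case False
    then obtain y where y: "g y \<noteq> 0" by blast
    define N' where "N' = max N (Suc y)"
    define bN where "bN j n = (if n < N then b j n else 0)" for j n
    \<comment> \<open>The pivot functional: evaluation at y of the unreproduced remainder, scaled by
      \<open>g y\<close>. It is 1 on the new sequence and 0 on the old ones.\<close>
    define bs where "bs n = ((if n = y then 1 else 0) - (\<Sum>j\<in>I. bN j n * e j y)) / g y" for n
    \<comment> \<open>The old functionals are corrected by a multiple of the pivot so that they
      vanish on the new sequence.\<close>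
    define b1 where "b1 j n = (if j = s then bs n else bN j n - \<phi> j (e s) * bs n)" for j n
    have \<phi>N: "(\<Sum>n<N'. bN j n * x n) = \<phi> j x" for j x
    proof -
      have "(\<Sum>n<N'. bN j n * x n) = (\<Sum>n<N. bN j n * x n)"
        by (intro sum.mono_neutral_right) (auto simp: N'_def bN_def)
      then show ?thesis by (simp add: \<phi>_def bN_def)
    qed
    have \<phi>s: "(\<Sum>n<N'. bs n * x n) = (x y - (\<Sum>j\<in>I. \<phi> j x * e j y)) / g y" for x
    proof -
      have "(\<Sum>n<N'. bs n * x n)
        = ((\<Sum>n<N'. (if n = y then x n else 0)) - (\<Sum>n<N'. \<Sum>j\<in>I. bN j n * e j y * x n)) / g y"
        unfolding sum_subtractf[symmetric] sum_divide_distrib bs_def sum_distrib_right[symmetric]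
        by (intro sum.cong) (auto simp: left_diff_distrib)
      also have "(\<Sum>n<N'. \<Sum>j\<in>I. bN j n * e j y * x n) = (\<Sum>j\<in>I. (\<Sum>n<N'. bN j n * x n) * e j y)"
        by (subst sum.swap) (simp add: sum_distrib_right sum_distrib_left mult_ac)
      finally have "(\<Sum>n<N'. bs n * x n)
          = ((\<Sum>n<N'. if n = y then x n else 0) - (\<Sum>j\<in>I. \<phi> j x * e j y)) / g y"
        unfolding \<phi>N .
      moreover have "y < N'" by (simp add: N'_def)
      ultimately show ?thesis by simp
    qed
    define \<psi> where "\<psi> j x = (\<Sum>n<N'. b1 j n * x n)" for j x
    have \<psi>s: "\<psi> s x = (x y - (\<Sum>j\<in>I. \<phi> j x * e j y)) / g y" for x
      unfolding \<psi>_def b1_def using \<phi>s by simp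
    have \<psi>j: "\<psi> j x = \<phi> j x - \<phi> j (e s) * \<psi> s x" if "j \<in> I" for j x
    proof -
      have "j \<noteq> s" using that insert by auto
      then show ?thesis
        unfolding \<psi>_def b1_def
        by (simp add: left_diff_distrib sum_subtractf \<phi>N sum_distrib_left mult.assoc)
    qed
    have "e i m = (\<Sum>j\<in>insert s I. \<psi> j (e i) * e j m)" if "i \<in> insert s I" for i m
    proof (cases "i = s")
      case True
      have "\<psi> s (e s) = 1" using y by (simp add: \<psi>s g_def)
      then show ?thesis using insert True by (simp add: \<psi>j)
    next
      case False
      then have "i \<in> I" using that by simp
      then have "\<psi> s (e i) = 0" using b'[of i y] by (simp add: \<psi>s)
      then show ?thesis using insert \<open>i \<in> I\<close> b'[of i m] by (simp add: \<psi>j)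
    qed
    then show ?thesis unfolding \<psi>_def by blast
  qed
qed simp

text \<open>The sequences and all their shifts lie in one finite-dimensional space. Dual functionals
  that look at only N terms express \<open>e i (p + m)\<close> through the N terms of
  \<open>e i\<close> starting at p, with factors \<open>e j m\<close> that tend to 0 in m. Hence
  passing from p to p + L at least halves a block of N terms, which gives geometric decay.\<close>

lemma shift_invariant_null_family_summable:
  fixes e :: "'i \<Rightarrow> nat \<Rightarrow> real"
  assumes fin: "finite I"
    and shift: "\<And>i. i \<in> I \<Longrightarrow> \<exists>A. \<forall>m. e i (Suc m) = (\<Sum>j\<in>I. A j * e j m)"
    and null: "\<And>i. i \<in> I \<Longrightarrow> e i \<longlonglongrightarrow> 0"
    and i: "i \<in> I"
  shows "summable (\<lambda>n. \<bar>e i n\<bar>)"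
proof -
  obtain b N where b: "\<And>i m. i \<in> I \<Longrightarrow> e i m = (\<Sum>j\<in>I. (\<Sum>n<N. b j n * e i n) * e j m)"
    using finite_family_reproducing[OF fin, of e] by blast
  have shifts: "\<exists>A. \<forall>m. e i (p + m) = (\<Sum>j\<in>I. A j * e j m)" if "i \<in> I" for i p
  proof (induction p)
    case 0
    show ?case using fin that
      by (intro exI[of _ "\<lambda>j. if j = i then 1 else 0"]) (simp add: if_distrib if_distribR cong: if_cong)
  next
    case (Suc p)
    then obtain A where A: "\<And>m. e i (p + m) = (\<Sum>j\<in>I. A j * e j m)" by blast
    obtain S where S: "\<And>j m. j \<in> I \<Longrightarrow> e j (Suc m) = (\<Sum>l\<in>I. S j l * e l m)"
      using shift by metis
    have "e i (Suc p + m) = (\<Sum>l\<in>I. (\<Sum>j\<in>I. A j * S j l) * e l m)" for m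
    proof -
      have "e i (Suc p + m) = (\<Sum>j\<in>I. A j * e j (Suc m))" using A[of "Suc m"] by simp
      also have "\<dots> = (\<Sum>j\<in>I. \<Sum>l\<in>I. A j * S j l * e l m)"
        by (intro sum.cong) (auto simp: S sum_distrib_left mult.assoc)
      also have "\<dots> = (\<Sum>l\<in>I. (\<Sum>j\<in>I. A j * S j l) * e l m)"
        by (subst sum.swap) (simp add: sum_distrib_right)
      finally show ?thesis .
    qed
    then show ?case by (intro exI[of _ "\<lambda>l. \<Sum>j\<in>I. A j * S j l"] allI)
  qed
  \<comment> \<open>The reproducing formula is linear, so it passes from the family to its shifts,
    which are linear combinations of it.\<close>
  have rep: "e i (p + m) = (\<Sum>j\<in>I. (\<Sum>n<N. b j n * e i (p + n)) * e j m)" if "i \<in> I" for i p m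
  proof -
    obtain A where A: "\<And>m. e i (p + m) = (\<Sum>j\<in>I. A j * e j m)" using shifts[OF \<open>i \<in> I\<close>] by metis
    have "e i (p + m) = (\<Sum>l\<in>I. A l * e l m)" by (rule A)
    also have "\<dots> = (\<Sum>l\<in>I. \<Sum>j\<in>I. A l * ((\<Sum>n<N. b j n * e l n) * e j m))"
      unfolding sum_distrib_left[symmetric]
      by (intro sum.cong refl arg_cong2[of _ _ _ _ "(*)"] b)
    also have "\<dots> = (\<Sum>j\<in>I. (\<Sum>l\<in>I. A l * (\<Sum>n<N. b j n * e l n)) * e j m)"
      by (subst sum.swap) (simp add: sum_distrib_right mult.assoc)
    also have "\<dots> = (\<Sum>j\<in>I. (\<Sum>n<N. b j n * e i (p + n)) * e j m)"
    proof (intro sum.cong refl arg_cong2[of _ _ _ _ "(*)"])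
      fix j
      have "(\<Sum>l\<in>I. A l * (\<Sum>n<N. b j n * e l n)) = (\<Sum>l\<in>I. \<Sum>n<N. b j n * (A l * e l n))"
        by (simp add: sum_distrib_left mult_ac)
      also have "\<dots> = (\<Sum>n<N. b j n * e i (p + n))"
        by (subst sum.swap) (simp add: sum_distrib_left A)
      finally show "(\<Sum>l\<in>I. A l * (\<Sum>n<N. b j n * e l n)) = (\<Sum>n<N. b j n * e i (p + n))" .
    qed
    finally show ?thesis .
  qed
  define a where "a p = (\<Sum>i\<in>I. \<Sum>n<N. \<bar>e i (p + n)\<bar>)" for p
  define B where "B = (\<Sum>j\<in>I. \<Sum>n<N. \<bar>b j n\<bar>)"
  define E where "E m = (\<Sum>j\<in>I. \<bar>e j m\<bar>)" for m
  have bound: "\<bar>e i (p + m)\<bar> \<le> B * a p * E m" if i: "i \<in> I" for i p m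
  proof -
    have 1: "\<bar>\<Sum>n<N. b j n * e i (p + n)\<bar> \<le> B * a p" if "j \<in> I" for j
    proof -
      have "\<bar>\<Sum>n<N. b j n * e i (p + n)\<bar> \<le> (\<Sum>n<N. \<bar>b j n\<bar> * \<bar>e i (p + n)\<bar>)"
        by (rule order.trans[OF sum_abs]) (simp add: abs_mult)
      also have "\<dots> \<le> (\<Sum>n<N. \<bar>b j n\<bar> * a p)"
      proof (intro sum_mono mult_left_mono)
        fix n assume "n \<in> {..<N}"
        then have "\<bar>e i (p + n)\<bar> \<le> (\<Sum>n<N. \<bar>e i (p + n)\<bar>)"
          by (intro member_le_sum) auto
        also have "\<dots> \<le> a p" unfolding a_def using i fin
          by (intro member_le_sum[of i I "\<lambda>i. \<Sum>n<N. \<bar>e i (p + n)\<bar>"]) (auto intro: sum_nonneg)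
        finally show "\<bar>e i (p + n)\<bar> \<le> a p" .
      qed auto
      also have "\<dots> = (\<Sum>n<N. \<bar>b j n\<bar>) * a p" by (simp add: sum_distrib_right)
      also have "\<dots> \<le> B * a p"
        unfolding B_def using that fin
        by (intro mult_right_mono member_le_sum[of j I "\<lambda>j. \<Sum>n<N. \<bar>b j n\<bar>"])
          (auto simp: a_def intro!: sum_nonneg)
      finally show ?thesis .
    qed
    have "\<bar>e i (p + m)\<bar> \<le> (\<Sum>j\<in>I. \<bar>\<Sum>n<N. b j n * e i (p + n)\<bar> * \<bar>e j m\<bar>)"
      by (subst rep[OF i]) (rule order.trans[OF sum_abs], simp add: abs_mult)
    also have "\<dots> \<le> (\<Sum>j\<in>I. B * a p * \<bar>e j m\<bar>)"
      by (intro sum_mono mult_right_mono 1) auto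
    finally show ?thesis by (simp add: E_def sum_distrib_left)
  qed
  have E0: "E \<longlonglongrightarrow> 0"
    unfolding E_def by (intro tendsto_null_sum) (auto intro: tendsto_rabs_zero null)
  define c where "c = B * (\<Sum>i\<in>I. real N)"
  have a_nonneg: "a p \<ge> 0" for p unfolding a_def by (intro sum_nonneg) auto
  have B_nonneg: "B \<ge> 0" unfolding B_def by (intro sum_nonneg) auto
  have c0: "c \<ge> 0" unfolding c_def using B_nonneg by (intro mult_nonneg_nonneg sum_nonneg) auto
  have "(\<lambda>m. c * E m) \<longlonglongrightarrow> 0" using E0 by (rule tendsto_mult_right_zero)
  then have "\<forall>\<^sub>F m in sequentially. c * E m < 1 / 2" by (rule order_tendstoD) simp
  then obtain m0 where m0: "\<And>m. m \<ge> m0 \<Longrightarrow> c * E m < 1 / 2"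
    unfolding eventually_sequentially by blast
  \<comment> \<open>The successor makes the block length positive, as the covering of {..n} by
    blocks at the end requires.\<close>
  define L where "L = Suc m0"
  have half: "a (p + L) \<le> a p / 2" for p
  proof -
    have "a (p + L) \<le> (\<Sum>i\<in>I. \<Sum>n<N. B * a p * Max ((\<lambda>n. E (L + n)) ` {..<N}))"
      unfolding a_def[of "p + L"]
    proof (intro sum_mono)
      fix i n assume "i \<in> I" "n \<in> {..<N}"
      have "\<bar>e i (p + L + n)\<bar> \<le> B * a p * E (L + n)"
        using bound[OF \<open>i \<in> I\<close>, of p "L + n"] by (simp add: add.assoc)
      also have "\<dots> \<le> B * a p * Max ((\<lambda>n. E (L + n)) ` {..<N})"
        using \<open>n \<in> _\<close> B_nonneg a_nonneg by (intro mult_left_mono Max_ge) auto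
      finally show "\<bar>e i (p + L + n)\<bar> \<le> B * a p * Max ((\<lambda>n. E (L + n)) ` {..<N})" .
    qed
    also have "\<dots> = a p * (c * Max ((\<lambda>n. E (L + n)) ` {..<N}))"
      by (simp add: c_def)
    also have "\<dots> \<le> a p * (1 / 2)"
    proof (cases "N = 0")
      case True
      then show ?thesis using a_nonneg by (auto simp: c_def)
    next
      case False
      then have "Max ((\<lambda>n. E (L + n)) ` {..<N}) \<in> (\<lambda>n. E (L + n)) ` {..<N}"
        by (intro Max_in) auto
      then obtain n where "Max ((\<lambda>n. E (L + n)) ` {..<N}) = E (L + n)" by auto
      then show ?thesis using m0[of "L + n"] a_nonneg[of p]
        by (intro mult_left_mono) (auto simp: L_def)
    qed
    finally show ?thesis by simp
  qed
  \<comment> \<open>With functionals that look at no term, the reproducing formula forces the family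
    to vanish.\<close>
  have "e i m = 0" if "N = 0" "i \<in> I" for i m
    using that by (subst b) auto
  then have "N > 0 \<or> (\<forall>i\<in>I. \<forall>m. e i m = 0)" by blast
  then have le_a: "\<bar>e i p\<bar> \<le> a p" for p
  proof
    assume "N > 0"
    then have "\<bar>e i p\<bar> \<le> (\<Sum>n<N. \<bar>e i (p + n)\<bar>)"
      using member_le_sum[of 0 "{..<N}" "\<lambda>n. \<bar>e i (p + n)\<bar>"] by auto
    also have "\<dots> \<le> a p" unfolding a_def using i fin
      by (intro member_le_sum[of i I "\<lambda>i. \<Sum>n<N. \<bar>e i (p + n)\<bar>"]) (auto intro: sum_nonneg)
    finally show ?thesis .
  qed (use i a_nonneg in auto)
  have block: "(\<Sum>p<k * L. a p) \<le> 2 * (1 - (1 / 2) ^ k) * (\<Sum>p<L. a p)" for k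
  proof (induction k)
    case (Suc k)
    have "(\<Sum>p<L + n. a p) = (\<Sum>p<L. a p) + (\<Sum>p<n. a (p + L))" for n
    proof (induction n)
      case (Suc n)
      then show ?case by (simp add: add.commute[of n L])
    qed simp
    from this[of "k * L"] have "(\<Sum>p<Suc k * L. a p) = (\<Sum>p<L. a p) + (\<Sum>p<k * L. a (p + L))"
      by (simp only: mult_Suc)
    also have "(\<Sum>p<k * L. a (p + L)) \<le> (\<Sum>p<k * L. a p / 2)"
      by (intro sum_mono half)
    also have "\<dots> \<le> 2 * (1 - (1 / 2) ^ k) * (\<Sum>p<L. a p) / 2"
      unfolding sum_divide_distrib[symmetric] using Suc.IH by (rule divide_right_mono) simp
    also have "(\<Sum>p<L. a p) + 2 * (1 - (1 / 2) ^ k) * (\<Sum>p<L. a p) / 2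
        = 2 * (1 - (1 / 2) ^ Suc k) * (\<Sum>p<L. a p)"
      by (simp add: field_simps)
    finally show ?case by linarith
  qed simp
  have "summable a"
  proof (rule bounded_imp_summable[OF a_nonneg])
    fix n
    have "Suc n * 1 \<le> Suc n * L" by (intro mult_le_mono) (simp_all add: L_def)
    then have "{..n} \<subseteq> {..<Suc n * L}"
      unfolding lessThan_Suc_atMost[symmetric] by (simp only: lessThan_subset_iff mult_1_right)
    then have "(\<Sum>k\<le>n. a k) \<le> (\<Sum>p<Suc n * L. a p)"
      by (rule sum_mono2[rotated]) (simp_all only: a_nonneg finite_lessThan)
    also have "\<dots> \<le> 2 * (1 - (1 / 2) ^ Suc n) * (\<Sum>p<L. a p)" by (rule block)
    also have "\<dots> \<le> 2 * 1 * (\<Sum>p<L. a p)"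
      using a_nonneg by (intro mult_right_mono sum_nonneg) simp_all
    finally show "(\<Sum>k\<le>n. a k) \<le> 2 * 1 * (\<Sum>p<L. a p)" .
  qed
  then show ?thesis
    by (rule summable_comparison_test'[of _ 0]) (simp only: real_norm_def abs_abs le_a)
qed

section \<open>Exponentials and uniform densities\<close>

definition ek :: "real \<Rightarrow> real \<Rightarrow> complex" where
  "ek k x = exp (- 2 * of_real pi * \<i> * of_real k * of_real x)"

lemma ek_add: "ek k (x + y) = ek k x * ek k y"
  by (simp add: ek_def exp_add[symmetric] algebra_simps)

lemma ek_0 [simp]: "ek k 0 = 1" by (simp add: ek_def)

lemma norm_ek [simp]: "norm (ek k x) = 1"
proof -
  have "ek k x = exp (\<i> * of_real (- 2 * pi * k * x))" by (simp add: ek_def mult_ac)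
  then show ?thesis by (simp only: norm_exp_i_times)
qed

lemma ek_minus: "ek k (- x) = cnj (ek k x)"
  by (simp add: ek_def exp_cnj)

lemma ek_diff: "ek k (x - y) = ek k x * cnj (ek k y)"
  using ek_add[of k x "- y"] by (simp add: ek_minus)

lemma norm_ek_diff: "norm (ek k x - ek k y) = norm (ek k (x - y) - 1)"
proof -
  have "ek k x - ek k y = ek k y * (ek k (x - y) - 1)"
    by (simp add: right_diff_distrib ek_add[symmetric])
  then show ?thesis by (simp only: norm_mult norm_ek mult_1_left)
qed

lemma fb_average_ek:
  "fb_average \<Lambda> j k r c = 1 / of_real (2 * r) * (\<Sum>x\<in>\<Lambda> j \<inter> {- r + c..r + c}. ek k x)"
  unfolding fb_average_def ek_def ..

lemma uniform_limit_const_unique: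
  assumes "uniform_limit UNIV g (\<lambda>_. d) (F :: 'r filter)" "uniform_limit UNIV g (\<lambda>_. d') F" "F \<noteq> bot"
  shows "(d :: 'b::metric_space) = d'"
  using tendsto_unique[OF assms(3) tendsto_uniform_limitI[OF assms(1)] tendsto_uniform_limitI[OF assms(2)]]
  by simp

lemma dens_eqI:
  assumes "uniform_limit UNIV (\<lambda>r c. real (card (S \<inter> {- r + c..r + c})) / (2 * r)) (\<lambda>_. d) at_top"
  shows "dens S = d"
  unfolding dens_def
proof (rule the_equality)
  show "uniform_limit UNIV (\<lambda>r c. real (card (S \<inter> {- r + c..r + c})) / (2 * r)) (\<lambda>_. d) at_top"
    by (rule assms)
  fix d' assume "uniform_limit UNIV (\<lambda>r c. real (card (S \<inter> {- r + c..r + c})) / (2 * r)) (\<lambda>_. d') at_top"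
  then show "d' = d" by (rule uniform_limit_const_unique[OF _ assms]) simp
qed

text \<open>Averages are computed for complex weights; this turns those with indicator weights into
  densities.\<close>

lemma uniform_limit_of_real_Re:
  assumes "uniform_limit S (\<lambda>r c. complex_of_real (g r c)) (\<lambda>_. D) F"
  shows "uniform_limit S g (\<lambda>_. Re D) F"
proof (rule uniform_limitI)
  fix e :: real assume "e > 0"
  show "\<forall>\<^sub>F r in F. \<forall>c\<in>S. dist (g r c) (Re D) < e"
    using uniform_limitD[OF assms \<open>e > 0\<close>]
  proof (eventually_elim, intro ballI)
    fix r c assume "\<forall>c\<in>S. dist (complex_of_real (g r c)) D < e" "c \<in> S"
    then have "norm (complex_of_real (g r c) - D) < e" by (simp add: dist_norm)
    then show "dist (g r c) (Re D) < e"
      using abs_Re_le_cmod[of "complex_of_real (g r c) - D"] by (simp add: dist_real_def)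
  qed
qed

text \<open>Counting in units of \<delta>: the integer part of (x - a) / \<delta> separates points
  that are at least \<delta> apart.\<close>

lemma uniformly_discrete_card:
  fixes S :: "real set"
  assumes "\<delta> > 0" and sep: "\<And>x y. x \<in> S \<Longrightarrow> y \<in> S \<Longrightarrow> x < y \<Longrightarrow> y - x \<ge> \<delta>"
  shows "finite (S \<inter> {a..b})" and "a \<le> b \<Longrightarrow> real (card (S \<inter> {a..b})) \<le> (b - a) / \<delta> + 1"
proof -
  let ?f = "\<lambda>x. nat \<lfloor>(x - a) / \<delta>\<rfloor>"
  have less: "?f x < ?f y" if "x \<in> S \<inter> {a..b}" "y \<in> S \<inter> {a..b}" "x < y" for x y
  proof -
    have "(x - a) / \<delta> + 1 \<le> (y - a) / \<delta>"
    proof -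
      have "(x - a) / \<delta> + 1 = (x - a + \<delta>) / \<delta>" using \<open>\<delta> > 0\<close> by (simp add: add_divide_distrib)
      also have "\<dots> \<le> (y - a) / \<delta>"
        using sep[of x y] that \<open>\<delta> > 0\<close> by (intro divide_right_mono) auto
      finally show ?thesis .
    qed
    then have "\<lfloor>(x - a) / \<delta>\<rfloor> + 1 \<le> \<lfloor>(y - a) / \<delta>\<rfloor>" by linarith
    moreover have "0 \<le> \<lfloor>(x - a) / \<delta>\<rfloor>" using that \<open>\<delta> > 0\<close> by simp
    ultimately show ?thesis by linarith
  qed
  have inj: "inj_on ?f (S \<inter> {a..b})"
    by (rule inj_onI) (metis less less_irrefl linorder_neqE)
  have im: "?f ` (S \<inter> {a..b}) \<subseteq> {..nat \<lfloor>(b - a) / \<delta>\<rfloor>}"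
    using \<open>\<delta> > 0\<close> by (auto intro!: nat_mono floor_mono divide_right_mono)
  then show "finite (S \<inter> {a..b})"
    using inj by (metis finite_atMost finite_imageD finite_subset)
  assume "a \<le> b"
  have "card (S \<inter> {a..b}) = card (?f ` (S \<inter> {a..b}))"
    by (rule card_image[OF inj, symmetric])
  also have "\<dots> \<le> card {..nat \<lfloor>(b - a) / \<delta>\<rfloor>}" by (rule card_mono[OF _ im]) simp
  finally have "real (card (S \<inter> {a..b})) \<le> real (nat \<lfloor>(b - a) / \<delta>\<rfloor>) + 1" by simp
  also have "real (nat \<lfloor>(b - a) / \<delta>\<rfloor>) \<le> (b - a) / \<delta>"
    using \<open>a \<le> b\<close> \<open>\<delta> > 0\<close> by (intro of_nat_floor) simp
  finally show "real (card (S \<inter> {a..b})) \<le> (b - a) / \<delta> + 1" by simp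
qed

text \<open>A Cauchy criterion: the approximate limits D for two tolerances are compared through a
  single common value of g, so they form a Cauchy sequence. The uniformity over c is carried along
  unchanged.\<close>

lemma uniform_limit_const_if_eventually_close:
  fixes g :: "'r \<Rightarrow> 'c \<Rightarrow> 'b::banach"
  assumes "F \<noteq> bot" and close: "\<And>\<epsilon>. \<epsilon> > 0 \<Longrightarrow> \<exists>D. \<forall>\<^sub>F r in F. \<forall>c. norm (g r c - D) \<le> \<epsilon>"
  shows "\<exists>D. uniform_limit UNIV g (\<lambda>_. D) F"
proof -
  define \<epsilon> where "\<epsilon> k = inverse (real (Suc k))" for k
  have \<epsilon>_pos: "\<epsilon> k > 0" for k by (simp add: \<epsilon>_def)
  have \<epsilon>_le: "\<epsilon> m \<le> \<epsilon> k" if "k \<le> m" for m k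
    using that by (simp add: \<epsilon>_def)
  have \<epsilon>_lim: "\<epsilon> \<longlonglongrightarrow> 0" unfolding \<epsilon>_def by (rule LIMSEQ_inverse_real_of_nat)
  obtain D where D: "\<And>k. \<forall>\<^sub>F r in F. \<forall>c. norm (g r c - D k) \<le> \<epsilon> k"
    using close[OF \<epsilon>_pos] by metis
  have dist: "norm (D k - D m) \<le> \<epsilon> k + \<epsilon> m" for k m
  proof -
    have "\<forall>\<^sub>F r in F. (\<forall>c. norm (g r c - D k) \<le> \<epsilon> k) \<and> (\<forall>c. norm (g r c - D m) \<le> \<epsilon> m)"
      by (rule eventually_conj[OF D D])
    then obtain r where "\<forall>c. norm (g r c - D k) \<le> \<epsilon> k" "\<forall>c. norm (g r c - D m) \<le> \<epsilon> m"
      using eventually_happens' \<open>F \<noteq> bot\<close> by blast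
    then show ?thesis
      using norm_triangle_ineq4[of "g r undefined - D m" "g r undefined - D k"]
      by (smt (verit) diff_diff_eq2 diff_add_cancel add_diff_cancel_left')
  qed
  have "Cauchy D"
  proof (rule CauchyI)
    fix e :: real assume "e > 0"
    then obtain k0 where k0: "\<And>k. k \<ge> k0 \<Longrightarrow> \<epsilon> k < e / 2"
      using order_tendstoD(2)[OF \<epsilon>_lim, of "e / 2"] unfolding eventually_sequentially by auto
    show "\<exists>M. \<forall>m\<ge>M. \<forall>n\<ge>M. norm (D m - D n) < e"
    proof (intro exI allI impI)
      fix m n assume "m \<ge> k0" "n \<ge> k0"
      then show "norm (D m - D n) < e" using dist[of m n] k0[of m] k0[of n] by linarith
    qed
  qed
  then obtain L where L: "D \<longlonglongrightarrow> L" using Cauchy_convergent convergentD by blast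
  have "uniform_limit UNIV g (\<lambda>_. L) F"
  proof (rule uniform_limitI)
    fix e :: real assume "e > 0"
    have "\<forall>\<^sub>F k in sequentially. \<epsilon> k < e / 2 \<and> norm (D k - L) < e / 2"
      using order_tendstoD(2)[OF \<epsilon>_lim, of "e / 2"] tendstoD[OF L, of "e / 2"] \<open>e > 0\<close>
      by (auto simp: dist_norm intro: eventually_conj)
    then obtain k where k: "\<epsilon> k < e / 2" "norm (D k - L) < e / 2"
      using eventually_happens' sequentially_bot by blast
    from D[of k] show "\<forall>\<^sub>F r in F. \<forall>c\<in>UNIV. dist (g r c) L < e"
    proof (rule eventually_mono, intro ballI)
      fix r c assume "\<forall>c. norm (g r c - D k) \<le> \<epsilon> k"
      then have "norm (g r c - D k) \<le> \<epsilon> k" by blast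
      then show "dist (g r c) L < e"
        using k norm_triangle_ineq[of "g r c - D k" "D k - L"] by (simp add: dist_norm)
    qed
  qed
  then show ?thesis by blast
qed

text \<open>The interface between the two halves of the development: what the harmonic analysis uses
  of a member of the hull. For that half the inflation structure enters only through
  \<open>hull_coloured_set\<close>, where these properties are verified.\<close>

locale coloured_set =
  fixes \<Lambda> :: "'a::finite cps" and \<delta> :: real
  assumes \<delta>_pos: "\<delta> > 0"
    and sep: "x \<in> support \<Lambda> \<Longrightarrow> y \<in> support \<Lambda> \<Longrightarrow> x < y \<Longrightarrow> y - x \<ge> \<delta>"
    and flc: "finite ({y - x | x y. x \<in> support \<Lambda> \<and> y \<in> support \<Lambda>} \<inter> {- R..R})"
    and fb_converges: "\<exists>A. uniform_limit UNIV (fb_average \<Lambda> j k) (\<lambda>_. A) at_top"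
    and pair_dens: "\<exists>d. uniform_limit UNIV
      (\<lambda>r c. real (card ((\<Lambda> i \<inter> (\<lambda>x. x - z) ` \<Lambda> j) \<inter> {- r + c..r + c})) / (2 * r)) (\<lambda>_. d) at_top"
    and support_dens: "\<exists>d>0. uniform_limit UNIV
      (\<lambda>r c. real (card (support \<Lambda> \<inter> {- r + c..r + c})) / (2 * r)) (\<lambda>_. d) at_top"

section \<open>Geometry of inflation tilings\<close>

locale tiling =
  fixes len :: "real^'a::finite" and T :: "'a cps"
  assumes len_pos: "len $ i > 0" and tiling: "is_tiling len T"
begin

definition lmin where "lmin = Min (range (($) len))"
definition lmax where "lmax = Max (range (($) len))"

lemma lmin_le: "lmin \<le> len $ i" unfolding lmin_def by (rule Min_le) auto
lemma le_lmax: "len $ i \<le> lmax" unfolding lmax_def by (rule Max_ge) auto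

lemma lmin_pos: "lmin > 0"
proof -
  have "lmin \<in> range (($) len)" unfolding lmin_def by (rule Min_in) simp_all
  then show ?thesis using len_pos by auto
qed

lemma lmax_pos: "lmax > 0"
  using le_lmax[of undefined] len_pos[of undefined] by linarith

lemma tile_unique:
  assumes "x \<in> T i" "x' \<in> T j" "x \<le> y" "y < x + len $ i" "x' \<le> y" "y < x' + len $ j"
  shows "i = j" "x = x'"
proof -
  have "\<exists>!p. case p of (i, x) \<Rightarrow> x \<in> T i \<and> x \<le> y \<and> y < x + len $ i"
    using tiling unfolding is_tiling_def by blast
  then have "(i, x) = (j, x')" using assms by (auto dest: ex1_implies_ex elim!: ex1E)
  then show "i = j" "x = x'" by auto
qed

lemma tile_cover: obtains i x where "x \<in> T i" "x \<le> y" "y < x + len $ i"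
  using tiling unfolding is_tiling_def by (metis (mono_tags, lifting) case_prodE)

lemma tile_spacing:
  assumes "x \<in> T i" "x' \<in> T j" "x < x'"
  shows "x + len $ i \<le> x'"
proof (rule ccontr)
  assume "\<not> ?thesis"
  then have "x = x'" using tile_unique(2)[OF assms(1,2), of x'] assms len_pos[of j] by auto
  then show False using assms by simp
qed

lemma tile_type_unique: "x \<in> T i \<Longrightarrow> x \<in> T j \<Longrightarrow> i = j"
  using tile_unique(1)[of x i x j x] len_pos by auto

lemma tile_right_neighbour:
  assumes "x \<in> T i"
  obtains j where "x + len $ i \<in> T j"
proof -
  obtain j y where y: "y \<in> T j" "y \<le> x + len $ i" "x + len $ i < y + len $ j"
    by (rule tile_cover)
  have "x < y"
  proof (rule ccontr)
    assume "\<not> x < y"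
    then have "y \<le> x" "x < y + len $ j" using y len_pos[of i] by auto
    then have "y = x" "j = i" using tile_unique[OF assms y(1), of x] len_pos[of i] by auto
    then show False using y by simp
  qed
  then have "y = x + len $ i" using tile_spacing[OF assms y(1)] y by simp
  then show thesis using that y by blast
qed

lemma support_sep: "x \<in> support T \<Longrightarrow> y \<in> support T \<Longrightarrow> x < y \<Longrightarrow> y - x \<ge> lmin"
  unfolding support_def
proof (elim UN_E)
  fix i j assume "x \<in> T i" "y \<in> T j" "x < y"
  then show "lmin \<le> y - x" using tile_spacing[of x i y j] lmin_le[of i] by linarith
qed

lemmas support_discrete = uniformly_discrete_card[of lmin "support T", OF lmin_pos support_sep]

definition window :: "real \<Rightarrow> real \<Rightarrow> ('a \<times> real) set" where
  "window a b = {(i, x). x \<in> T i \<and> a \<le> x \<and> x \<le> b}"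

lemma snd_window: "snd ` window a b = support T \<inter> {a..b}"
  by (force simp: window_def support_def)

lemma inj_on_snd_window: "inj_on snd (window a b)"
  by (auto simp: inj_on_def window_def intro: tile_type_unique)

lemma finite_window [simp]: "finite (window a b)"
  using support_discrete(1)[of a b] snd_window[of a b] inj_on_snd_window finite_imageD by metis

lemma card_window: "a \<le> b \<Longrightarrow> real (card (window a b)) \<le> (b - a) / lmin + 1"
  using support_discrete(2)[of a b] snd_window[of a b] card_image[OF inj_on_snd_window, of a b] by simp

text \<open>Compares Lebesgue measures: the disjoint union of the half-open tiles of the window lies
  in [a, b + \<open>lmax\<close>] and covers [a + \<open>lmax\<close>, b].\<close>

lemma window_length:
  assumes "a \<le> b"
  shows "\<bar>(\<Sum>(i, x)\<in>window a b. len $ i) - (b - a)\<bar> \<le> lmax"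
proof -
  let ?I = "\<lambda>(i, x). {x..<x + len $ i}"
  let ?U = "\<Union>p\<in>window a b. ?I p"
  have "emeasure lborel ?U = (\<Sum>p\<in>window a b. emeasure lborel (?I p))"
  proof (rule sum_emeasure[symmetric])
    show "disjoint_family_on ?I (window a b)"
      unfolding disjoint_family_on_def window_def using tile_unique by fastforce
  qed auto
  also have "\<dots> = (\<Sum>p\<in>window a b. ennreal (case p of (i, x) \<Rightarrow> len $ i))"
    by (intro sum.cong) (auto simp: len_pos less_imp_le)
  also have "\<dots> = ennreal (\<Sum>(i, x)\<in>window a b. len $ i)"
    by (intro sum_ennreal) (auto simp: len_pos less_imp_le)
  finally have U: "emeasure lborel ?U = ennreal (\<Sum>(i, x)\<in>window a b. len $ i)" .
  have nn: "(\<Sum>(i, x)\<in>window a b. len $ i) \<ge> 0"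
    by (intro sum_nonneg) (auto simp: len_pos less_imp_le)
  have "?U \<subseteq> {a..b + lmax}"
  proof
    fix y assume "y \<in> ?U"
    then obtain i x where "a \<le> x" "x \<le> b" "x \<le> y" "y < x + len $ i" by (auto simp: window_def)
    then show "y \<in> {a..b + lmax}" using le_lmax[of i] by auto
  qed
  then have "emeasure lborel ?U \<le> emeasure lborel {a..b + lmax}"
    by (rule emeasure_mono) simp
  then have 1: "(\<Sum>(i, x)\<in>window a b. len $ i) \<le> b + lmax - a"
    using assms lmax_pos by (simp add: U)
  have "{a + lmax..b} \<subseteq> ?U"
  proof
    fix y assume y: "y \<in> {a + lmax..b}"
    obtain i x where "x \<in> T i" "x \<le> y" "y < x + len $ i" by (rule tile_cover)
    moreover from this have "x \<ge> a" using y le_lmax[of i] by auto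
    ultimately have "(i, x) \<in> window a b" "y \<in> ?I (i, x)" using y by (auto simp: window_def)
    then show "y \<in> ?U" by blast
  qed
  then have "emeasure lborel {a + lmax..b} \<le> emeasure lborel ?U"
    by (rule emeasure_mono) (auto intro!: sets.finite_UN)
  then have 2: "b - (a + lmax) \<le> (\<Sum>(i, x)\<in>window a b. len $ i)"
    using nn by (cases "a + lmax \<le> b") (simp_all add: U)
  show ?thesis using 1 2 by linarith
qed

text \<open>Walks from x to y through right neighbours; N bounds the number of tiles still to be
  crossed, as each is at least \<open>lmin\<close> long.\<close>

lemma tile_differences:
  assumes "x \<in> T i" "y \<in> T j" "x \<le> y"
  shows "\<exists>n :: 'a \<Rightarrow> nat. y - x = (\<Sum>l\<in>UNIV. real (n l) * len $ l)"
proof -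
  have "\<forall>x i. x \<in> T i \<longrightarrow> x \<le> y \<longrightarrow> y - x \<le> real N * lmin \<longrightarrow>
      (\<exists>n :: 'a \<Rightarrow> nat. y - x = (\<Sum>l\<in>UNIV. real (n l) * len $ l))" for N
  proof (induction N)
    case 0
    then show ?case by (auto intro!: exI[of _ "\<lambda>_. 0"])
  next
    case (Suc N)
    show ?case
    proof (intro allI impI)
      fix x i assume x: "x \<in> T i" "x \<le> y" "y - x \<le> real (Suc N) * lmin"
      show "\<exists>n :: 'a \<Rightarrow> nat. y - x = (\<Sum>l\<in>UNIV. real (n l) * len $ l)"
      proof (cases "x = y")
        case True
        then show ?thesis by (auto intro!: exI[of _ "\<lambda>_. 0"])
      next
        case False
        then have le: "x + len $ i \<le> y" using tile_spacing[OF x(1) assms(2)] x by simp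
        obtain j' where "x + len $ i \<in> T j'" using tile_right_neighbour[OF x(1)] .
        moreover have "y - (x + len $ i) \<le> real N * lmin"
          using x(3) lmin_le[of i] by (simp add: algebra_simps)
        ultimately obtain n :: "'a \<Rightarrow> nat" where
          n: "y - (x + len $ i) = (\<Sum>l\<in>UNIV. real (n l) * len $ l)"
          using Suc le by blast
        have "(\<Sum>l\<in>UNIV. real ((n(i := n i + 1)) l) * len $ l)
          = (\<Sum>l\<in>UNIV. real (n l) * len $ l + (if l = i then len $ l else 0))"
          by (intro sum.cong) (auto simp: algebra_simps)
        also have "\<dots> = y - x" using n by (simp add: sum.distrib)
        finally show ?thesis by metis
      qed
    qed
  qed
  moreover obtain N where "(y - x) / lmin \<le> real N" using real_arch_simple by blast
  then have "y - x \<le> real N * lmin" using lmin_pos by (simp add: field_simps)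
  ultimately show ?thesis using assms by blast
qed

definition differences :: "real set" where
  "differences = {y - x | x y. x \<in> support T \<and> y \<in> support T}"

text \<open>By \<open>tile_differences\<close> a distance up to R is a combination of tile lengths
  with natural coefficients, each at most R / \<open>lmin\<close>, and there are finitely many of
  these.\<close>

lemma finite_differences: "finite (differences \<inter> {- R..R})"
proof -
  define K where "K = nat \<lceil>R / lmin\<rceil>"
  define P where "P = (\<lambda>n :: 'a \<Rightarrow> nat. \<Sum>l\<in>UNIV. real (n l) * len $ l) ` (UNIV \<rightarrow>\<^sub>E {..K})"
  have fin: "finite P" unfolding P_def by (intro finite_imageI finite_PiE) auto
  have in_P: "y - x \<in> P" if xy: "x \<in> T i" "y \<in> T j" "x \<le> y" "y - x \<le> R" for x y i j
  proof -
    obtain n :: "'a \<Rightarrow> nat" where n: "y - x = (\<Sum>l\<in>UNIV. real (n l) * len $ l)"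
      using tile_differences[OF xy(1-3)] by blast
    have "n l \<le> K" for l
    proof -
      have "real (n l) * lmin \<le> real (n l) * len $ l" by (intro mult_left_mono lmin_le) simp
      also have "\<dots> \<le> (\<Sum>l\<in>UNIV. real (n l) * len $ l)"
        by (rule member_le_sum) (auto intro!: mult_nonneg_nonneg less_imp_le[OF len_pos])
      finally have "real (n l) * lmin \<le> R" using n xy by linarith
      then have "real (n l) \<le> R / lmin" using lmin_pos by (simp add: field_simps)
      then show ?thesis unfolding K_def by linarith
    qed
    then show ?thesis unfolding P_def n by (intro imageI) auto
  qed
  have "differences \<inter> {- R..R} \<subseteq> P \<union> uminus ` P"
  proof
    fix z assume "z \<in> differences \<inter> {- R..R}"
    then obtain x y i j where z: "z = y - x" "x \<in> T i" "y \<in> T j" "- R \<le> z" "z \<le> R"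
      by (auto simp: differences_def support_def)
    show "z \<in> P \<union> uminus ` P"
    proof (cases "x \<le> y")
      case True
      then show ?thesis using in_P[of x i y j] z by auto
    next
      case False
      then have "x - y \<in> P" using in_P[of y j x i] z by auto
      moreover have "z = - (x - y)" using z by simp
      ultimately show ?thesis by (metis UnI2 image_eqI)
    qed
  qed
  then show ?thesis using fin by (meson finite_UnI finite_imageI finite_subset)
qed

end

text \<open>\<open>fixed\<close> and \<open>full\<close> are obtained by passing to a power of the
  substitution. Fullness makes the counting matrix positive, which yields frequencies, and puts each
  letter into each supertile of positive level, which yields return vectors.\<close>

locale inflation_tiling = natural_lengths \<sigma> mu len + tiling len T
  for \<sigma> :: "'a::finite \<Rightarrow> 'a list" and mu len T +
  assumes fixed: "inflate \<sigma> mu len T = T" and full: "i \<in> set (\<sigma> j)"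
begin

abbreviation "supertile n i x \<equiv> tiles len (mu ^ n * x) ((subst_word \<sigma> ^^ n) [i])"

lemma fixed_pow: "(inflate \<sigma> mu len ^^ n) T = T"
  by (induction n) (simp_all add: fixed)

lemma supertile_tiles: "x \<in> T i \<Longrightarrow> (j, y) \<in> set (supertile n i x) \<Longrightarrow> y \<in> T j"
  using inflate_pow_conv_tiles[of n T j] unfolding fixed_pow by blast

lemma ancestor:
  assumes "y \<in> T j"
  obtains i x where "x \<in> T i" "(j, y) \<in> set (supertile n i x)"
  using assms inflate_pow_conv_tiles[of n T j] unfolding fixed_pow by blast

text \<open>Division by \<open>mu ^ n\<close> puts both candidate ancestors of the tile over the
  same point of the line, where the tiling has only one tile.\<close>

lemma in_supertile:
  assumes "y \<in> T j" "x \<in> T i" "mu ^ n * x \<le> y" "y < mu ^ n * (x + len $ i)"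
  shows "(j, y) \<in> set (supertile n i x)"
proof -
  obtain i' x' where x': "x' \<in> T i'" "(j, y) \<in> set (supertile n i' x')" using ancestor[OF assms(1)] .
  have "x \<le> y / mu ^ n" "y / mu ^ n < x + len $ i" "x' \<le> y / mu ^ n" "y / mu ^ n < x' + len $ i'"
    using assms supertile_bounds[OF x'(2)] len_pos[of j] by (auto simp: field_simps)
  then have "i = i'" "x = x'" using tile_unique[OF assms(2) x'(1), of "y / mu ^ n"] by auto
  then show ?thesis using x' by simp
qed

text \<open>The two sums differ only near the ends: by tiles whose supertile starts to the left of
  a, and by tiles beyond b in a supertile that starts at or before b. Each of these sets lies in an
  interval of length \<open>mu ^ n * lmax\<close>.\<close>

lemma window_supertile_sum:
  fixes f :: "'a \<times> real \<Rightarrow> 'b::real_normed_vector"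
  assumes "a \<le> b" and C: "\<And>p. norm (f p) \<le> C"
  shows "norm (sum f (window a b)
      - (\<Sum>(l, t)\<in>window (a / mu ^ n) (b / mu ^ n). sum_list (map f (supertile n l t))))
    \<le> 2 * C * (mu ^ n * lmax / lmin + 1)"
proof -
  let ?W' = "window (a / mu ^ n) (b / mu ^ n)"
  let ?S = "\<lambda>(l, t). set (supertile n l t)"
  define U where "U = (\<Union>p\<in>?W'. ?S p)"
  have C0: "0 \<le> C" using C[of undefined] norm_ge_zero order_trans by blast
  have disj: "?S p \<inter> ?S q = {}" if pq: "p \<in> ?W'" "q \<in> ?W'" "p \<noteq> q" for p q
  proof (rule ccontr)
    assume ne: "?S p \<inter> ?S q \<noteq> {}"
    obtain l t l' t' where lt: "p = (l, t)" "q = (l', t')" by fastforce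
    with ne obtain j y where y: "(j, y) \<in> set (supertile n l t)" "(j, y) \<in> set (supertile n l' t')"
      by auto
    have "t \<le> y / mu ^ n" "y / mu ^ n < t + len $ l" "t' \<le> y / mu ^ n" "y / mu ^ n < t' + len $ l'"
      using supertile_bounds[OF y(1)] supertile_bounds[OF y(2)] len_pos[of j]
      by (auto simp: field_simps)
    then show False using tile_unique[of t l t' l' "y / mu ^ n"] pq lt by (auto simp: window_def)
  qed
  have "(\<Sum>(l, t)\<in>?W'. sum_list (map f (supertile n l t))) = (\<Sum>p\<in>?W'. sum f (?S p))"
    by (intro sum.cong) (auto simp: sum_list_distinct_conv_sum_set[OF distinct_tiles])
  also have "\<dots> = sum f U"
    unfolding U_def using disj by (intro sum.UNION_disjoint[symmetric]) auto
  finally have sumU: "(\<Sum>(l, t)\<in>?W'. sum_list (map f (supertile n l t))) = sum f U" .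
  have finU: "finite U" unfolding U_def by auto
  have sub1: "window a b - U \<subseteq> window a (a + mu ^ n * lmax)"
  proof
    fix p assume p: "p \<in> window a b - U"
    obtain j y where jy: "p = (j, y)" by fastforce
    have y: "y \<in> T j" "a \<le> y" "y \<le> b" using p by (auto simp: jy window_def)
    obtain l t where t: "t \<in> T l" "(j, y) \<in> set (supertile n l t)" using ancestor[OF y(1)] .
    note bd = supertile_bounds[OF t(2)]
    have "(l, t) \<notin> ?W'" using p t by (auto simp: U_def jy)
    moreover have "t \<le> b / mu ^ n" using bd y by (simp add: field_simps)
    ultimately have "t < a / mu ^ n" using t by (auto simp: window_def)
    then have "mu ^ n * t < a" by (simp add: field_simps)
    moreover have "mu ^ n * len $ l \<le> mu ^ n * lmax" by (intro mult_left_mono le_lmax) simp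
    ultimately have "y \<le> a + mu ^ n * lmax"
      using bd len_pos[of j] unfolding distrib_left by linarith
    then show "p \<in> window a (a + mu ^ n * lmax)" using y by (simp add: jy window_def)
  qed
  have sub2: "U - window a b \<subseteq> window b (b + mu ^ n * lmax)"
  proof
    fix p assume p: "p \<in> U - window a b"
    obtain j y where jy: "p = (j, y)" by fastforce
    obtain l t where t: "t \<in> T l" "a / mu ^ n \<le> t" "t \<le> b / mu ^ n" "(j, y) \<in> set (supertile n l t)"
      using p unfolding U_def jy window_def by auto
    note bd = supertile_bounds[OF t(4)]
    have y: "y \<in> T j" using supertile_tiles[OF t(1,4)] .
    have ta: "a \<le> mu ^ n * t" "mu ^ n * t \<le> b" using t by (simp_all add: field_simps)
    then have "y > b" using p y bd by (auto simp: jy window_def)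
    moreover have "mu ^ n * len $ l \<le> mu ^ n * lmax" by (intro mult_left_mono le_lmax) simp
    ultimately have "y > b" "y \<le> b + mu ^ n * lmax"
      using bd len_pos[of j] ta unfolding distrib_left by linarith+
    then show "p \<in> window b (b + mu ^ n * lmax)" using y by (simp add: jy window_def)
  qed
  have small: "norm (sum f V) \<le> C * (mu ^ n * lmax / lmin + 1)" if "V \<subseteq> window c (c + mu ^ n * lmax)" for V c
  proof -
    have "norm (sum f V) \<le> (\<Sum>p\<in>V. C)" by (rule sum_norm_le) (rule C)
    also have "\<dots> = C * real (card V)" by simp
    also have "\<dots> \<le> C * real (card (window c (c + mu ^ n * lmax)))"
      using C0 card_mono[OF _ that] by (intro mult_left_mono) auto
    also have "\<dots> \<le> C * (mu ^ n * lmax / lmin + 1)"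
      using C0 card_window[of c "c + mu ^ n * lmax"] lmax_pos by (intro mult_left_mono) auto
    finally show ?thesis .
  qed
  have "sum f (window a b) - sum f U = sum f (window a b - U) - sum f (U - window a b)"
    using finU sum.Int_Diff[of "window a b" f U] sum.Int_Diff[of U f "window a b"]
    by (simp add: Int_commute)
  then have "norm (sum f (window a b) - sum f U) \<le> norm (sum f (window a b - U)) + norm (sum f (U - window a b))"
    by (simp add: norm_triangle_ineq4)
  also have "\<dots> \<le> C * (mu ^ n * lmax / lmin + 1) + C * (mu ^ n * lmax / lmin + 1)"
    by (intro add_mono small[OF sub1] small[OF sub2])
  finally show ?thesis unfolding sumU by (simp add: algebra_simps)
qed

section \<open>Letter counts and letter frequencies of supertiles\<close>

definition letter_count :: "nat \<Rightarrow> 'a \<Rightarrow> 'a \<Rightarrow> real" where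
  "letter_count m l i = real (count_list ((subst_word \<sigma> ^^ m) [i]) l)"

lemma letter_count_add: "letter_count (m + n) l i = (\<Sum>j\<in>UNIV. letter_count m l j * letter_count n j i)"
  unfolding letter_count_def funpow_add o_apply
  by (subst count_subst_word_pow) (simp add: mult.commute)

lemma letter_count_nonneg [simp]: "letter_count m l i \<ge> 0" by (simp add: letter_count_def)

lemma letter_count_1_pos: "letter_count 1 l i > 0"
  using full[of l i] by (simp add: letter_count_def count_list_0_iff[symmetric] del: count_list_0_iff)
    (metis count_list_0_iff neq0_conv)

lemma letter_count_length: "(\<Sum>l\<in>UNIV. letter_count m l i) * lmin \<le> mu ^ m * len $ i"
proof -
  have "(\<Sum>l\<in>UNIV. letter_count m l i) * lmin \<le> (\<Sum>l\<in>UNIV. letter_count m l i * len $ l)"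
    unfolding sum_distrib_right by (intro sum_mono mult_left_mono lmin_le) simp
  also have "\<dots> = wlen len ((subst_word \<sigma> ^^ m) [i])"
    unfolding letter_count_def by (rule wlen_conv_count[symmetric])
  finally show ?thesis by (simp add: wlen_subst_pow)
qed

text \<open>Counts per unit length are averaged over the letters of \<sigma> i, each letter weighted
  by its share of the total length, so the stochastic iteration applies. Splitting off the last
  substitution step instead of the first turns the limit into a right eigenvector of the counting
  matrix.\<close>

lemma letter_frequencies:
  "\<exists>d. (\<forall>l. d l > 0) \<and> (\<forall>l i. (\<lambda>m. letter_count m l i / (mu ^ m * len $ i)) \<longlonglongrightarrow> d l)
     \<and> (\<forall>l. (\<Sum>j\<in>UNIV. letter_count 1 l j * d j) = mu * d l)"
proof -
  define x where "x l m i = letter_count m l i / (mu ^ m * len $ i)" for l m i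
  have "\<exists>d. (\<forall>i. (\<lambda>m. x l m i) \<longlonglongrightarrow> d) \<and> (\<forall>m. Min (range (x l m)) \<le> d)" for l
  proof (rule positive_stochastic_iteration_converges[where q = "\<lambda>j i. letter_count 1 j i * len $ j / (mu * len $ i)"])
    fix m i
    show "x l (Suc m) i = (\<Sum>j\<in>UNIV. letter_count 1 j i * len $ j / (mu * len $ i) * x l m j)"
      using letter_count_add[of m 1 l i] len_pos[THEN less_imp_neq, symmetric]
      by (simp add: x_def sum_divide_distrib mult_ac)
  next
    fix i
    have "(\<Sum>j\<in>UNIV. letter_count 1 j i * len $ j) = mu * len $ i"
      unfolding letter_count_def wlen_conv_count[symmetric] wlen_subst_pow by simp
    then show "(\<Sum>j\<in>UNIV. letter_count 1 j i * len $ j / (mu * len $ i)) = 1"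
      unfolding sum_divide_distrib[symmetric] using len_pos[of i] by simp
  next
    fix j i
    show "letter_count 1 j i * len $ j / (mu * len $ i) > 0" using letter_count_1_pos[of j i] len_pos by simp
  qed
  then obtain d where d: "\<And>l i. (\<lambda>m. x l m i) \<longlonglongrightarrow> d l" and ge: "\<And>l m. Min (range (x l m)) \<le> d l"
    by metis
  have "d l > 0" for l
  proof -
    have "Min (range (x l 1)) \<in> range (x l 1)" by (rule Min_in) simp_all
    then have "Min (range (x l 1)) > 0" using letter_count_1_pos len_pos by (auto simp: x_def)
    then show ?thesis using ge[of l 1] by linarith
  qed
  moreover have "(\<Sum>j\<in>UNIV. letter_count 1 l j * d j) = mu * d l" for l
  proof -
    have "(\<lambda>m. \<Sum>j\<in>UNIV. letter_count 1 l j * x j m undefined) \<longlonglongrightarrow> (\<Sum>j\<in>UNIV. letter_count 1 l j * d j)"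
      by (intro tendsto_sum tendsto_mult_left d)
    moreover have "(\<Sum>j\<in>UNIV. letter_count 1 l j * x j m undefined) = mu * x l (Suc m) undefined" for m
    proof -
      have "mu * x l (Suc m) undefined = letter_count (1 + m) l undefined / (mu ^ m * len $ undefined)"
        by (simp add: x_def)
      then show ?thesis unfolding letter_count_add by (simp add: x_def sum_divide_distrib)
    qed
    moreover have "(\<lambda>m. mu * x l (Suc m) undefined) \<longlonglongrightarrow> mu * d l"
      by (intro tendsto_mult_left LIMSEQ_Suc d)
    ultimately show ?thesis using LIMSEQ_unique by (simp only:) blast
  qed
  ultimately show ?thesis using d unfolding x_def by blast
qed

definition letter_freq :: "'a \<Rightarrow> real" where
  "letter_freq = (SOME d. (\<forall>l. d l > 0) \<and> (\<forall>l i. (\<lambda>m. letter_count m l i / (mu ^ m * len $ i)) \<longlonglongrightarrow> d l)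
     \<and> (\<forall>l. (\<Sum>j\<in>UNIV. letter_count 1 l j * d j) = mu * d l))"

lemma letter_freq: "letter_freq l > 0" "(\<lambda>m. letter_count m l i / (mu ^ m * len $ i)) \<longlonglongrightarrow> letter_freq l"
  "(\<Sum>j\<in>UNIV. letter_count 1 l j * letter_freq j) = mu * letter_freq l"
  using someI_ex[OF letter_frequencies] unfolding letter_freq_def[symmetric] by blast+

end

section \<open>Uniform averages\<close>

lemma norm_triangle_diff3:
  fixes x y u v :: "'b::real_normed_vector"
  shows "norm (x - v) \<le> norm (x - y) + norm (y - u) + norm (u - v)"
proof -
  have "x - v = (x - y) + (y - u) + (u - v)" by simp
  then show ?thesis by (metis norm_triangle_ineq norm_triangle_mono order_refl)
qed

context inflation_tiling begin

definition avg :: "('a \<times> real \<Rightarrow> complex) \<Rightarrow> real \<Rightarrow> real \<Rightarrow> complex" where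
  "avg f r c = 1 / complex_of_real (2 * r) * sum f (window (- r + c) (r + c))"

text \<open>At the fixed level n all boundary effects of a window are bounded together by a
  constant, which division by 2 r brings below \<eta> for large r, whatever the centre.\<close>

lemma avg_close_of_supertiles_close:
  assumes C: "\<And>p. norm (f p) \<le> C" and "\<eta> > 0"
    and D: "\<And>l t. t \<in> T l \<Longrightarrow>
      norm (sum_list (map f (supertile n l t)) - D * of_real (mu ^ n * len $ l)) \<le> \<eta> * (mu ^ n * len $ l)"
  shows "\<forall>\<^sub>F r in at_top. \<forall>c. norm (avg f r c - D) \<le> 2 * \<eta>"
proof -
  define K where "K = (\<eta> + norm D) * (mu ^ n * lmax) + 2 * C * (mu ^ n * lmax / lmin + 1)"
  have main: "norm (sum f (window a b) - D * of_real (b - a)) \<le> \<eta> * (b - a) + K" if "a \<le> b" for a b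
  proof -
    let ?W = "window (a / mu ^ n) (b / mu ^ n)"
    let ?S = "\<Sum>(l, t)\<in>?W. sum_list (map f (supertile n l t))"
    let ?L = "\<Sum>(l, t)\<in>?W. mu ^ n * len $ l"
    have "a / mu ^ n \<le> b / mu ^ n" using that by (simp add: divide_right_mono)
    from window_length[OF this] have "\<bar>mu ^ n * (\<Sum>(l, t)\<in>?W. len $ l) - (b - a)\<bar> \<le> mu ^ n * lmax"
      by (simp add: abs_le_iff field_simps)
    then have L: "\<bar>?L - (b - a)\<bar> \<le> mu ^ n * lmax"
      by (simp add: sum_distrib_left case_prod_unfold)
    have "norm (?S - D * of_real ?L)
        = norm (\<Sum>(l, t)\<in>?W. sum_list (map f (supertile n l t)) - D * of_real (mu ^ n * len $ l))"
      unfolding of_real_sum sum_distrib_left sum_subtractf[symmetric] by (simp add: case_prod_unfold)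
    also have "\<dots> \<le> (\<Sum>(l, t)\<in>?W. \<eta> * (mu ^ n * len $ l))"
      unfolding case_prod_unfold
      by (intro sum_norm_le D) (auto simp: window_def)
    also have "\<dots> = \<eta> * ?L" by (simp add: sum_distrib_left case_prod_unfold)
    also have "\<dots> \<le> \<eta> * ((b - a) + mu ^ n * lmax)"
      using L \<open>\<eta> > 0\<close> by (intro mult_left_mono) (auto simp: abs_le_iff)
    finally have 1: "norm (?S - D * of_real ?L) \<le> \<eta> * ((b - a) + mu ^ n * lmax)" .
    have "norm (D * of_real ?L - D * of_real (b - a)) = norm D * \<bar>?L - (b - a)\<bar>"
      unfolding right_diff_distrib[symmetric] of_real_diff[symmetric] norm_mult norm_of_real ..
    also have "\<dots> \<le> norm D * (mu ^ n * lmax)" by (intro mult_left_mono L) simp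
    finally have 2: "norm (D * of_real ?L - D * of_real (b - a)) \<le> norm D * (mu ^ n * lmax)" .
    have "norm (sum f (window a b) - D * of_real (b - a))
      \<le> norm (sum f (window a b) - ?S) + norm (?S - D * of_real ?L) + norm (D * of_real ?L - D * of_real (b - a))"
      by (rule norm_triangle_diff3)
    also have "\<dots> \<le> 2 * C * (mu ^ n * lmax / lmin + 1) + \<eta> * ((b - a) + mu ^ n * lmax)
        + norm D * (mu ^ n * lmax)"
      by (intro add_mono 1 2 window_supertile_sum that C)
    finally show ?thesis by (simp add: K_def algebra_simps)
  qed
  show ?thesis
  proof (rule eventually_mono[OF eventually_ge_at_top[of "max 1 (K / (2 * \<eta>))"]], intro allI)
    fix r c :: real assume r: "max 1 (K / (2 * \<eta>)) \<le> r"
    then have "r > 0" "K \<le> 2 * \<eta> * r" using \<open>\<eta> > 0\<close> by (auto simp: field_simps)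
    have "avg f r c - D = (sum f (window (- r + c) (r + c)) - D * of_real ((r + c) - (- r + c))) / of_real (2 * r)"
      using \<open>r > 0\<close> by (simp add: avg_def field_simps)
    then have "norm (avg f r c - D)
        = norm (sum f (window (- r + c) (r + c)) - D * of_real ((r + c) - (- r + c))) / (2 * r)"
      using \<open>r > 0\<close> by (simp only: norm_divide norm_of_real)
    also have "\<dots> \<le> (\<eta> * ((r + c) - (- r + c)) + K) / (2 * r)"
      using \<open>r > 0\<close> by (intro divide_right_mono main) auto
    also have "\<dots> \<le> 2 * \<eta>" using \<open>r > 0\<close> \<open>K \<le> 2 * \<eta> * r\<close> by (simp add: field_simps)
    finally show "norm (avg f r c - D) \<le> 2 * \<eta>" .
  qed
qed

text \<open>The working criterion for uniform averages. A supertile of level n + m consists of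
  supertiles of level n, whose types occur with nearly the limiting frequencies once m is large. If
  their sums depend only on the type, up to \<eta> \<open>mu ^ n\<close>, the sum over the large
  supertile is nearly proportional to its length.\<close>

lemma avg_converges:
  assumes C: "\<And>p. norm (f p) \<le> C"
    and H: "\<And>\<eta>. \<eta> > 0 \<Longrightarrow> \<exists>n b. \<forall>l t. t \<in> T l \<longrightarrow>
      norm (sum_list (map f (supertile n l t)) - b l) \<le> \<eta> * mu ^ n"
  shows "\<exists>D. uniform_limit UNIV (avg f) (\<lambda>_. D) at_top"
proof (rule uniform_limit_const_if_eventually_close)
  fix \<epsilon> :: real assume "\<epsilon> > 0"
  define \<eta> where "\<eta> = \<epsilon> / 2"
  have \<eta>: "\<eta> > 0" using \<open>\<epsilon> > 0\<close> by (simp add: \<eta>_def)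
  obtain n b where b: "\<And>l t. t \<in> T l \<Longrightarrow> norm (sum_list (map f (supertile n l t)) - b l) \<le> \<eta> / 2 * lmin * mu ^ n"
    using H[of "\<eta> / 2 * lmin"] \<eta> lmin_pos by auto
  \<comment> \<open>The summand 1 keeps the later divisor positive.\<close>
  define B where "B = (\<Sum>l\<in>UNIV. norm (b l)) + 1"
  have B: "B > 0" unfolding B_def by (intro add_nonneg_pos sum_nonneg) auto
  define \<eta>2 where "\<eta>2 = \<eta> / 2 * mu ^ n / B"
  have \<eta>2: "\<eta>2 > 0" using \<eta> B by (simp add: \<eta>2_def)
  have "\<forall>\<^sub>F m in sequentially. \<forall>l i. \<bar>letter_count m l i / (mu ^ m * len $ i) - letter_freq l\<bar> < \<eta>2"
    using tendstoD[OF letter_freq(2) \<eta>2] by (intro eventually_all_finite) (auto simp: dist_real_def)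
  then obtain m where m: "\<And>l i. \<bar>letter_count m l i / (mu ^ m * len $ i) - letter_freq l\<bar> < \<eta>2"
    using eventually_happens' sequentially_bot by blast
  have m': "\<bar>letter_count m l i - letter_freq l * (mu ^ m * len $ i)\<bar> \<le> \<eta>2 * (mu ^ m * len $ i)" for l i
  proof -
    define L where "L = mu ^ m * len $ i"
    have L: "L > 0" using len_pos by (simp add: L_def)
    have "\<bar>letter_count m l i - letter_freq l * L\<bar> = \<bar>letter_count m l i / L - letter_freq l\<bar> * L"
      using L abs_mult[of "letter_count m l i / L - letter_freq l" L] by (simp add: left_diff_distrib)
    also have "\<dots> \<le> \<eta>2 * L"
      using m[of l i] L unfolding L_def[symmetric] by (intro mult_right_mono less_imp_le)
    finally show ?thesis unfolding L_def .
  qed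
  \<comment> \<open>The sum per unit length that results when the types occur exactly with their
    frequencies.\<close>
  define D where "D = (\<Sum>l\<in>UNIV. of_real (letter_freq l) * b l) / of_real (mu ^ n)"
  have "norm (sum_list (map f (supertile (n + m) i t)) - D * of_real (mu ^ (n + m) * len $ i))
      \<le> \<eta> * (mu ^ (n + m) * len $ i)" if t: "t \<in> T i" for i t
  proof -
    let ?ps = "supertile m i t"
    let ?g = "\<lambda>(l, s). sum_list (map f (supertile n l s))"
    have S: "sum_list (map f (supertile (n + m) i t)) = sum_list (map ?g ?ps)"
      by (rule sum_list_tiles_subst_pow_add)
    have cb: "(\<Sum>(l, s)\<leftarrow>?ps. b l) = (\<Sum>l\<in>UNIV. of_real (letter_count m l i) * b l)"
      unfolding sum_list_tiles_const letter_count_def by simp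
    have "norm (sum_list (map ?g ?ps) - (\<Sum>(l, s)\<leftarrow>?ps. b l))
        = norm (\<Sum>(l, s)\<in>set ?ps. sum_list (map f (supertile n l s)) - b l)"
      by (simp add: sum_list_distinct_conv_sum_set[OF distinct_tiles] sum_subtractf[symmetric] case_prod_unfold)
    also have "\<dots> \<le> (\<Sum>p\<in>set ?ps. \<eta> / 2 * lmin * mu ^ n)"
      unfolding case_prod_unfold
    proof (intro sum_norm_le b)
      fix p assume "p \<in> set ?ps"
      then show "snd p \<in> T (fst p)" using supertile_tiles[OF t, of "fst p" "snd p" m] by simp
    qed
    also have "\<dots> = (\<Sum>(l, s)\<leftarrow>?ps. \<eta> / 2 * lmin * mu ^ n)"
      by (simp add: sum_list_distinct_conv_sum_set[OF distinct_tiles] case_prod_unfold)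
    also have "\<dots> = ((\<Sum>l\<in>UNIV. letter_count m l i) * lmin) * (\<eta> / 2 * mu ^ n)"
      unfolding sum_list_tiles_const letter_count_def sum_distrib_right[symmetric] by (simp only: mult_ac)
    also have "\<dots> \<le> (mu ^ m * len $ i) * (\<eta> / 2 * mu ^ n)"
      using \<eta> by (intro mult_right_mono letter_count_length) auto
    finally have 1: "norm (sum_list (map ?g ?ps) - (\<Sum>(l, s)\<leftarrow>?ps. b l)) \<le> \<eta> / 2 * (mu ^ (n + m) * len $ i)"
      by (simp add: power_add mult_ac)
    have "(\<Sum>(l, s)\<leftarrow>?ps. b l) - D * of_real (mu ^ (n + m) * len $ i)
        = (\<Sum>l\<in>UNIV. of_real (letter_count m l i - letter_freq l * (mu ^ m * len $ i)) * b l)"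
    proof -
      have "D * of_real (mu ^ (n + m) * len $ i) = (\<Sum>l\<in>UNIV. of_real (letter_freq l * (mu ^ m * len $ i)) * b l)"
      proof -
        have "D * of_real (mu ^ (n + m) * len $ i) = (\<Sum>l\<in>UNIV. of_real (letter_freq l) * b l) * of_real (mu ^ m * len $ i)"
          by (simp add: D_def power_add)
        also have "\<dots> = (\<Sum>l\<in>UNIV. of_real (letter_freq l * (mu ^ m * len $ i)) * b l)"
          unfolding sum_distrib_right by (intro sum.cong refl) (simp add: mult_ac)
        finally show ?thesis .
      qed
      then show ?thesis unfolding cb by (simp only: of_real_diff left_diff_distrib sum_subtractf)
    qed
    also have "norm \<dots> \<le> (\<Sum>l\<in>UNIV. \<eta>2 * (mu ^ m * len $ i) * norm (b l))"
      by (intro sum_norm_le) (simp only: norm_mult norm_of_real, intro mult_right_mono m' norm_ge_zero)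
    also have "\<dots> = \<eta>2 * (mu ^ m * len $ i) * (\<Sum>l\<in>UNIV. norm (b l))"
      by (simp add: sum_distrib_left)
    also have "\<dots> \<le> \<eta>2 * (mu ^ m * len $ i) * B"
      using \<eta>2 len_pos[of i] by (intro mult_left_mono) (auto simp: B_def less_imp_le)
    also have "\<dots> = \<eta> / 2 * (mu ^ (n + m) * len $ i)"
      using B by (simp add: \<eta>2_def power_add)
    finally have 2: "norm ((\<Sum>(l, s)\<leftarrow>?ps. b l) - D * of_real (mu ^ (n + m) * len $ i))
        \<le> \<eta> / 2 * (mu ^ (n + m) * len $ i)" .
    show ?thesis
      unfolding S using norm_triangle_le[OF add_mono[OF 1 2]] by (simp add: algebra_simps)
  qed
  from avg_close_of_supertiles_close[OF C \<eta> this]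
  show "\<exists>D. \<forall>\<^sub>F r in at_top. \<forall>c. norm (avg f r c - D) \<le> \<epsilon>"
    by (intro exI[of _ D]) (simp add: \<eta>_def)
qed simp

text \<open>Whether x + z is a point of type j is decided inside the supertile of x unless x is
  within distance |z| of its ends. The number of such exceptions is bounded independently of the
  level, hence negligible against \<open>mu ^ n\<close>.\<close>

lemma pair_avg_converges:
  "\<exists>D. uniform_limit UNIV (avg (\<lambda>(l, x). if l = i \<and> x + z \<in> T j then 1 else 0)) (\<lambda>_. D) at_top"
proof (rule avg_converges)
  let ?f = "\<lambda>(l, x). if l = i \<and> x + z \<in> T j then 1 else 0 :: complex"
  show "norm (?f p) \<le> 1" for p by (auto split: prod.split)
  fix \<eta> :: real assume \<eta>: "\<eta> > 0"
  define C where "C = 2 * (\<bar>z\<bar> / lmin + 1)"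
  have "(\<lambda>n. C / mu ^ n) \<longlonglongrightarrow> 0"
    using mu_gt_1 by (intro tendsto_divide_0[OF tendsto_const]
        filterlim_at_top_imp_at_infinity filterlim_realpow_sequentially_gt1) auto
  then have "\<forall>\<^sub>F n in sequentially. C / mu ^ n < \<eta>" using \<eta> by (rule order_tendstoD)
  then obtain n where n: "C / mu ^ n < \<eta>" using eventually_happens' sequentially_bot by blast
  \<comment> \<open>Only pairs with both members in the same supertile are counted, which depends on
    its type alone.\<close>
  define b where "b l = (\<Sum>(a, x)\<leftarrow>tiles len 0 ((subst_word \<sigma> ^^ n) [l]).
      if a = i \<and> (j, x + z) \<in> set (tiles len 0 ((subst_word \<sigma> ^^ n) [l])) then 1 else 0 :: complex)" for l
  have "norm (sum_list (map ?f (supertile n l t)) - b l) \<le> \<eta> * mu ^ n" if t: "t \<in> T l" for l t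
  proof -
    let ?g = "\<lambda>(a, x). if a = i \<and> (j, x + z) \<in> set (supertile n l t) then 1 else 0 :: complex"
    let ?S = "set (supertile n l t)"
    let ?lo = "mu ^ n * t" and ?hi = "mu ^ n * (t + len $ l)"
    have shift: "supertile n l t = map (\<lambda>(a, x). (a, x + mu ^ n * t)) (tiles len 0 ((subst_word \<sigma> ^^ n) [l]))"
      by (rule tiles_shift0)
    define B where "B = {p \<in> ?S. ?f p \<noteq> ?g p}"
    have sub: "B \<subseteq> window (?lo) (?lo + \<bar>z\<bar>) \<union> window (?hi - \<bar>z\<bar>) ?hi"
    proof
      fix p assume p: "p \<in> B"
      obtain a x where ax: "p = (a, x)" by fastforce
      have x: "(a, x) \<in> ?S" "x \<in> T a" using p supertile_tiles[OF t, of a x n] by (auto simp: ax B_def)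
      have ne: "(x + z \<in> T j) \<noteq> ((j, x + z) \<in> ?S)" using p by (auto simp: ax B_def split: if_splits)
      then have "x + z \<in> T j" "(j, x + z) \<notin> ?S"
        using supertile_tiles[OF t, of j "x + z" n] by auto
      then have "\<not> (?lo \<le> x + z \<and> x + z < ?hi)" using in_supertile[of "x + z" j t l n] t by auto
      then show "p \<in> window (?lo) (?lo + \<bar>z\<bar>) \<union> window (?hi - \<bar>z\<bar>) ?hi"
        using supertile_bounds[OF x(1)] len_pos[of a] x(2) by (auto simp: ax window_def)
    qed
    have "b l = sum_list (map ?g (supertile n l t))"
      unfolding b_def shift by (simp add: case_prod_unfold o_def image_iff add.assoc add.commute[of z])
        (intro arg_cong[of _ _ sum_list] map_cong; force)
    then have "sum_list (map ?f (supertile n l t)) - b l = sum (\<lambda>p. ?f p - ?g p) ?S"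
      by (simp only: sum_list_distinct_conv_sum_set[OF distinct_tiles] sum_subtractf)
    also have "\<dots> = sum (\<lambda>p. ?f p - ?g p) B"
      unfolding B_def by (intro sum.mono_neutral_right) auto
    finally have eq: "sum_list (map ?f (supertile n l t)) - b l = sum (\<lambda>p. ?f p - ?g p) B" .
    have "norm (?f p - ?g p) \<le> 1" for p by (cases p) simp
    then have "norm (sum (\<lambda>p. ?f p - ?g p) B) \<le> of_nat (card B) * 1"
      by (intro sum_norm_bound)
    then have "norm (sum_list (map ?f (supertile n l t)) - b l) \<le> real (card B)"
      unfolding eq by simp
    also have "real (card B) \<le> real (card (window (?lo) (?lo + \<bar>z\<bar>) \<union> window (?hi - \<bar>z\<bar>) ?hi))"
      using sub by (intro of_nat_mono card_mono) auto
    also have "\<dots> \<le> real (card (window (?lo) (?lo + \<bar>z\<bar>))) + real (card (window (?hi - \<bar>z\<bar>) ?hi))"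
      using card_Un_le[of "window (?lo) (?lo + \<bar>z\<bar>)" "window (?hi - \<bar>z\<bar>) ?hi"] by linarith
    also have "\<dots> \<le> (\<bar>z\<bar> / lmin + 1) + (\<bar>z\<bar> / lmin + 1)"
      using card_window[of ?lo "?lo + \<bar>z\<bar>"] card_window[of "?hi - \<bar>z\<bar>" ?hi] by (intro add_mono) auto
    also have "\<dots> = C" by (simp add: C_def)
    also have "\<dots> \<le> \<eta> * mu ^ n" using n by (simp add: field_simps)
    finally show ?thesis .
  qed
  then show "\<exists>n b. \<forall>l t. t \<in> T l \<longrightarrow> norm (sum_list (map ?f (supertile n l t)) - b l) \<le> \<eta> * mu ^ n"
    by blast
qed

end

section \<open>Phases along supertiles\<close>

text \<open>An integer polynomial annihilating mu, applied to the orbit, cancels the terms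
  \<open>x * mu ^ n\<close>, so the same combination of the deviations \<epsilon> from the nearest
  integers is an integer. It also tends to 0, hence is eventually 0: the deviations obey a linear
  recursion with constant coefficients and, being null, decay summably.\<close>

lemma algebraic_orbit_phase_summable:
  fixes x mu :: real
  assumes "algebraic mu" and lim: "(\<lambda>n. exp (- 2 * of_real pi * \<i> * of_real (x * mu ^ n))) \<longlonglongrightarrow> 1"
  shows "summable (\<lambda>n. norm (exp (- 2 * of_real pi * \<i> * of_real (x * mu ^ n)) - 1))"
proof -
  define \<epsilon> where "\<epsilon> n = x * mu ^ n - of_int (round (x * mu ^ n))" for n
  have exp_\<epsilon>: "exp (- 2 * of_real pi * \<i> * of_real (x * mu ^ n)) = exp (- 2 * of_real pi * \<i> * of_real (\<epsilon> n))" for n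
  proof -
    have "- 2 * of_real pi * \<i> * of_real (x * mu ^ n)
        = - 2 * of_real pi * \<i> * of_real (\<epsilon> n) + complex_of_real (of_int (2 * (- round (x * mu ^ n))) * pi) * \<i>"
      by (simp add: \<epsilon>_def algebra_simps)
    then show ?thesis
      unfolding exp_eq by blast
  qed
  have \<epsilon>_bounds: "- (1 / 2) \<le> \<epsilon> n" "\<epsilon> n < 1 / 2" for n
    unfolding \<epsilon>_def round_def by linarith+
  \<comment> \<open>The principal logarithm recovers \<epsilon> from the phase because 2 pi
    \<epsilon> stays within one period around 0; this is why the nearest integer is
    subtracted.\<close>
  have "(\<lambda>n. Ln (exp (- 2 * of_real pi * \<i> * of_real (\<epsilon> n)))) \<longlonglongrightarrow> Ln 1"
    using lim unfolding exp_\<epsilon> by (intro tendsto_Ln) auto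
  moreover have "Ln (exp (- 2 * of_real pi * \<i> * of_real (\<epsilon> n))) = - 2 * of_real pi * \<i> * of_real (\<epsilon> n)" for n
  proof (rule Ln_exp)
    have "pi * \<epsilon> n \<ge> pi * (- (1 / 2))" by (intro mult_left_mono \<epsilon>_bounds) simp
    moreover have "pi * \<epsilon> n < pi * (1 / 2)" by (intro mult_strict_left_mono \<epsilon>_bounds) simp
    ultimately show "- pi < Im (- 2 * of_real pi * \<i> * of_real (\<epsilon> n))"
      "Im (- 2 * of_real pi * \<i> * of_real (\<epsilon> n)) \<le> pi" by simp_all
  qed
  ultimately have "(\<lambda>n. - 2 * of_real pi * \<i> * of_real (\<epsilon> n)) \<longlonglongrightarrow> 0" by simp
  from tendsto_Im[OF this] have "(\<lambda>n. - 2 * pi * \<epsilon> n) \<longlonglongrightarrow> 0" by simp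
  then have "(\<lambda>n. (- 1 / (2 * pi)) * (- 2 * pi * \<epsilon> n)) \<longlonglongrightarrow> 0"
    by (rule tendsto_mult_right_zero)
  moreover have "(- 1 / (2 * pi)) * (- 2 * pi * \<epsilon> n) = \<epsilon> n" for n by simp
  ultimately have \<epsilon>_null: "\<epsilon> \<longlonglongrightarrow> 0" by (simp only:)
  obtain p where p: "\<And>i. coeff p i \<in> \<int>" "poly p mu = 0" "p \<noteq> 0"
    using \<open>algebraic mu\<close> unfolding algebraic_def by auto
  define d where "d = degree p"
  have lead: "coeff p d \<noteq> 0" using p(3) by (simp add: d_def)
  define s where "s n = (\<Sum>q\<le>d. coeff p q * \<epsilon> (n + q))" for n
  have "s n \<in> \<int>" for n
  proof -
    have "(\<Sum>q\<le>d. coeff p q * (x * mu ^ (n + q))) = x * mu ^ n * poly p mu"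
      by (simp add: poly_altdef d_def sum_distrib_left power_add mult_ac)
    then have "s n = - (\<Sum>q\<le>d. coeff p q * of_int (round (x * mu ^ (n + q))))"
      unfolding s_def \<epsilon>_def right_diff_distrib sum_subtractf using p(2) by simp
    moreover have "(\<Sum>q\<le>d. coeff p q * of_int (round (x * mu ^ (n + q)))) \<in> \<int>"
      by (intro Ints_sum Ints_mult p) simp
    ultimately show ?thesis by simp
  qed
  moreover have "s \<longlonglongrightarrow> 0"
    unfolding s_def by (intro tendsto_null_sum tendsto_mult_right_zero LIMSEQ_ignore_initial_segment \<epsilon>_null)
  then have "\<forall>\<^sub>F n in sequentially. \<bar>s n\<bar> < 1"
    using tendstoD[of s 0 sequentially 1] by (simp add: dist_real_def)
  ultimately have "\<forall>\<^sub>F n in sequentially. s n = 0"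
    by (auto elim!: eventually_mono Ints_cases) (metis Ints_nonzero_abs_less1)
  then obtain n0 where n0: "\<And>n. n \<ge> n0 \<Longrightarrow> s n = 0" unfolding eventually_sequentially by blast
  have "d > 0"
  proof (rule ccontr)
    assume "\<not> d > 0"
    then obtain c where "p = [:c:]" using degree_eq_zeroE unfolding d_def by blast
    then show False using p by simp
  qed
  \<comment> \<open>The d consecutive shifts of \<epsilon> form a shift-invariant family: each but
    the last is shifted into the next, and the recursion handles the last. Starting at n0 makes the
    recursion valid throughout.\<close>
  define e where "e i m = \<epsilon> (n0 + m + i)" for i m
  have "summable (\<lambda>n. \<bar>e 0 n\<bar>)"
  proof (rule shift_invariant_null_family_summable[of "{..<d}"])
    fix i assume i: "i \<in> {..<d}"
    show "e i \<longlonglongrightarrow> 0"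
      using LIMSEQ_ignore_initial_segment[OF \<epsilon>_null, of "n0 + i"] by (simp add: e_def[abs_def] add_ac)
    show "\<exists>A. \<forall>m. e i (Suc m) = (\<Sum>j\<in>{..<d}. A j * e j m)"
    proof (cases "Suc i < d")
      case True
      have "e i (Suc m) = (\<Sum>j\<in>{..<d}. (if j = Suc i then 1 else 0) * e j m)" for m
      proof -
        have "(\<Sum>j\<in>{..<d}. (if j = Suc i then 1 else 0) * e j m) = (\<Sum>j\<in>{..<d}. if j = Suc i then e j m else 0)"
          by (intro sum.cong) auto
        then show ?thesis using True by (simp add: e_def)
      qed
      then show ?thesis by (intro exI[of _ "\<lambda>j. if j = Suc i then 1 else 0"] allI)
    next
      case False
      then have di: "d = Suc i" using i by simp
      have "e i (Suc m) = (\<Sum>j\<in>{..<d}. - coeff p j / coeff p d * e j m)" for m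
      proof -
        have "0 = s (n0 + m)" using n0[of "n0 + m"] by simp
        also have "\<dots> = (\<Sum>j<d. coeff p j * e j m) + coeff p d * \<epsilon> (n0 + m + d)"
          unfolding s_def e_def by (simp add: lessThan_Suc_atMost[symmetric])
        finally have "\<epsilon> (n0 + m + d) = - (\<Sum>j<d. coeff p j * e j m) / coeff p d"
          using lead by (simp add: field_simps)
        moreover have "e i (Suc m) = \<epsilon> (n0 + m + d)" by (simp add: e_def di)
        ultimately show ?thesis by (simp add: sum_negf[symmetric] sum_divide_distrib)
      qed
      then show ?thesis by (intro exI[of _ "\<lambda>j. - coeff p j / coeff p d"] allI)
    qed
  qed (use \<open>d > 0\<close> in auto)
  then have "summable (\<lambda>n. \<bar>\<epsilon> (n + n0)\<bar>)" by (simp add: e_def add.commute)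
  then have sum_\<epsilon>: "summable (\<lambda>n. \<bar>\<epsilon> n\<bar>)" by (simp add: summable_iff_shift[of "\<lambda>n. \<bar>\<epsilon> n\<bar>"])
  show ?thesis
  proof (rule summable_comparison_test'[OF summable_mult[OF sum_\<epsilon>, of "2 * pi"], of 0])
    fix n
    have "norm (exp (- 2 * of_real pi * \<i> * of_real (x * mu ^ n)) - 1) = norm (iexp (- 2 * pi * \<epsilon> n) - 1)"
      unfolding exp_\<epsilon> by (simp add: mult_ac)
    also have "\<dots> \<le> \<bar>- 2 * pi * \<epsilon> n\<bar>" using iexp_approx1[of "- 2 * pi * \<epsilon> n" 0] by simp
    finally show "norm (norm (exp (- 2 * of_real pi * \<i> * of_real (x * mu ^ n)) - 1)) \<le> 2 * pi * \<bar>\<epsilon> n\<bar>"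
      by (simp add: abs_mult)
  qed
qed

context inflation_tiling begin

text \<open>The letter-count vectors of the iterates of one letter lie in a rational space whose
  dimension is the number of letters, so one vector more than that makes them dependent. Pairing the
  relation with the lengths turns it into a rational polynomial equation for mu.\<close>

lemma algebraic_mu: "algebraic mu"
proof -
  define i0 :: 'a where "i0 = undefined"
  define N where "N = CARD('a)"
  define v :: "nat \<Rightarrow> rat^'a" where
    "v q = (\<chi> l. of_nat (count_list ((subst_word \<sigma> ^^ q) [i0]) l))" for q
  have lin: "(\<Sum>l\<in>UNIV. of_rat (v q $ l) * len $ l) = mu ^ q * len $ i0" for q
    using wlen_conv_count[of len "(subst_word \<sigma> ^^ q) [i0]"] by (simp add: v_def wlen_subst_pow)
  have inj: "inj v"
  proof (rule injI)
    fix q q' assume "v q = v q'"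
    have "mu ^ q * len $ i0 = mu ^ q' * len $ i0" unfolding lin[symmetric] \<open>v q = v q'\<close> ..
    moreover have "len $ i0 \<noteq> 0" using len_pos[of i0] by simp
    ultimately have "mu ^ q = mu ^ q'" using mult_right_cancel[of "len $ i0" "mu ^ q" "mu ^ q'"] by blast
    then show "q = q'" using mu_gt_1 by (simp add: power_inject_exp)
  qed
  let ?S = "v ` {..N}"
  have "vec.dependent ?S"
  proof (rule ccontr)
    assume "\<not> vec.dependent ?S"
    then have "card ?S \<le> vec.dim (UNIV :: (rat^'a) set)"
      by (intro vec.independent_card_le_dim) auto
    also have "\<dots> = N" unfolding N_def by (rule vec_dim_card)
    finally show False using card_image[OF inj_on_subset[OF inj], of "{..N}"] by simp
  qed
  then obtain u where u: "\<exists>x\<in>?S. u x \<noteq> 0" "(\<Sum>x\<in>?S. u x *s x) = 0"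
    by (subst (asm) vec.dependent_finite) auto
  define c where "c q = u (v q)" for q
  have c0: "(\<Sum>q\<le>N. c q *s v q) = 0"
    using u(2) by (subst (asm) sum.reindex) (auto simp: c_def intro: inj_on_subset[OF inj])
  have "(\<Sum>q\<le>N. of_rat (c q) * mu ^ q) * len $ i0
      = (\<Sum>q\<le>N. of_rat (c q) * (\<Sum>l\<in>UNIV. of_rat (v q $ l) * len $ l))"
    unfolding lin by (simp add: sum_distrib_right mult.assoc)
  also have "\<dots> = (\<Sum>l\<in>UNIV. (\<Sum>q\<le>N. of_rat (c q) * of_rat (v q $ l)) * len $ l)"
    unfolding sum_distrib_left sum_distrib_right by (subst sum.swap) (simp only: mult.assoc)
  also have "\<dots> = (\<Sum>l\<in>UNIV. of_rat ((\<Sum>q\<le>N. c q *s v q) $ l) * len $ l)"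
    by (simp add: of_rat_sum of_rat_mult)
  also have "\<dots> = 0" by (simp add: c0)
  finally have root: "(\<Sum>q\<le>N. of_rat (c q) * mu ^ q) = 0" using len_pos[of i0] by simp
  define P :: "real poly" where "P = (\<Sum>q\<le>N. monom (of_rat (c q)) q)"
  have coeffP: "coeff P i = (if i \<le> N then of_rat (c i) else 0)" for i
    unfolding P_def coeff_sum coeff_monom by simp
  show ?thesis
  proof (rule algebraicI')
    show "coeff P i \<in> \<rat>" for i unfolding coeffP by simp
    obtain q where "q \<le> N" "c q \<noteq> 0" using u(1) by (auto simp: c_def)
    then have "coeff P q \<noteq> 0" by (simp add: coeffP)
    then show "P \<noteq> 0" by auto
    show "poly P mu = 0" unfolding P_def poly_sum poly_monom using root by simp
  qed
qed

lemma supertile_exponential_sum: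
  "(\<Sum>(a, x)\<leftarrow>tiles len y w. if a = j then ek k x else 0)
    = ek k y * (\<Sum>(a, x)\<leftarrow>tiles len 0 w. if a = j then ek k x else 0)"
  unfolding tiles_shift0[of len y w] sum_list_const_mult[symmetric]
  by (simp add: case_prod_unfold o_def ek_add if_distrib mult.commute cong: if_cong)

lemma letter_freq_eigen: "(\<Sum>i\<in>UNIV. letter_count n l i * letter_freq i) = mu ^ n * letter_freq l"
proof (induction n arbitrary: l)
  case 0
  have "(\<Sum>i\<in>UNIV. letter_count 0 l i * letter_freq i) = (\<Sum>i\<in>UNIV. if i = l then letter_freq i else 0)"
    by (intro sum.cong) (auto simp: letter_count_def)
  then show ?case by simp
next
  case (Suc n)
  have "(\<Sum>i\<in>UNIV. letter_count (Suc n) l i * letter_freq i) = (\<Sum>i\<in>UNIV. \<Sum>j\<in>UNIV. letter_count 1 l j * (letter_count n j i * letter_freq i))"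
    using letter_count_add[of 1 n l] by (simp add: sum_distrib_right mult.assoc)
  also have "\<dots> = (\<Sum>j\<in>UNIV. letter_count 1 l j * (\<Sum>i\<in>UNIV. letter_count n j i * letter_freq i))"
    by (subst sum.swap) (simp add: sum_distrib_left)
  also have "\<dots> = mu ^ n * (\<Sum>j\<in>UNIV. letter_count 1 l j * letter_freq j)"
    unfolding Suc by (simp add: sum_distrib_left mult_ac)
  also have "\<dots> = mu ^ Suc n * letter_freq l" unfolding letter_freq(3) by simp
  finally show ?case .
qed

section \<open>Exponential sums over supertiles, their mass and its loss by cancellation\<close>

definition expsum :: "real \<Rightarrow> 'a \<Rightarrow> nat \<Rightarrow> 'a \<Rightarrow> complex" where
  "expsum k j n l = (\<Sum>(a, x)\<leftarrow>tiles len 0 ((subst_word \<sigma> ^^ n) [l]). if a = j then ek k x else 0)"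

lemma expsum_add:
  "expsum k j (m + n) i
    = (\<Sum>(l, s)\<leftarrow>tiles len 0 ((subst_word \<sigma> ^^ n) [i]). ek k (mu ^ m * s) * expsum k j m l)"
  using sum_list_tiles_subst_pow_add[of "\<lambda>(a, x). if a = j then ek k x else 0" m n 0 "[i]"]
  by (simp add: expsum_def supertile_exponential_sum[of _ _ "mu ^ m * _"])

lemma sum_tiles_norm:
  "(\<Sum>(l, s)\<in>set (tiles len x ((subst_word \<sigma> ^^ n) [i])). norm (ek k (y s) * g l))
    = (\<Sum>l\<in>UNIV. letter_count n l i * norm (g l :: complex))"
proof -
  have "(\<Sum>(l, s)\<in>set (tiles len x ((subst_word \<sigma> ^^ n) [i])). norm (ek k (y s) * g l))
      = (\<Sum>(l, s)\<leftarrow>tiles len x ((subst_word \<sigma> ^^ n) [i]). norm (g l))"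
    by (simp add: sum_list_distinct_conv_sum_set[OF distinct_tiles] norm_mult)
  then show ?thesis unfolding sum_list_tiles_const letter_count_def .
qed

lemma norm_expsum_add: "norm (expsum k j (m + n) i) \<le> (\<Sum>l\<in>UNIV. letter_count n l i * norm (expsum k j m l))"
proof -
  have "norm (expsum k j (m + n) i)
    \<le> (\<Sum>(l, s)\<in>set (tiles len 0 ((subst_word \<sigma> ^^ n) [i])). norm (ek k (mu ^ m * s) * expsum k j m l))"
    unfolding expsum_add sum_list_distinct_conv_sum_set[OF distinct_tiles] case_prod_unfold
    by (rule norm_sum)
  then show ?thesis unfolding sum_tiles_norm .
qed

lemma norm_expsum_le: "norm (expsum k j n l) \<le> mu ^ n * lmax / lmin"
proof -
  have "norm (expsum k j n l) \<le> (\<Sum>i\<in>UNIV. letter_count n i l * norm (expsum k j 0 i))"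
    using norm_expsum_add[of k j 0 n l] by simp
  also have "\<dots> \<le> (\<Sum>i\<in>UNIV. letter_count n i l * 1)"
    by (intro sum_mono mult_left_mono) (auto simp: expsum_def)
  also have "\<dots> \<le> mu ^ n * lmax / lmin"
  proof -
    have "(\<Sum>i\<in>UNIV. letter_count n i l) * lmin \<le> mu ^ n * len $ l" by (rule letter_count_length)
    also have "\<dots> \<le> mu ^ n * lmax" by (intro mult_left_mono le_lmax) simp
    finally show ?thesis using lmin_pos by (simp add: pos_le_divide_eq)
  qed
  finally show ?thesis .
qed

lemma letter_freq_nonneg: "letter_freq l \<ge> 0"
  using letter_freq(1)[of l] by (rule less_imp_le)

definition mass :: "real \<Rightarrow> 'a \<Rightarrow> nat \<Rightarrow> real" where
  "mass k j n = (\<Sum>i\<in>UNIV. letter_freq i * norm (expsum k j n i)) / mu ^ n"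

text \<open>The loss in the triangle inequality over two inflation steps; two, because return
  vectors are differences of positions in supertiles of level two.\<close>

definition deficit :: "real \<Rightarrow> 'a \<Rightarrow> nat \<Rightarrow> 'a \<Rightarrow> real" where
  "deficit k j m i = (\<Sum>l\<in>UNIV. letter_count 2 l i * norm (expsum k j m l)) - norm (expsum k j (m + 2) i)"

lemma sum_letter_freq_count:
  "(\<Sum>i\<in>UNIV. letter_freq i * (\<Sum>l\<in>UNIV. letter_count n l i * g l)) = mu ^ n * (\<Sum>l\<in>UNIV. letter_freq l * g l)"
proof -
  have "(\<Sum>i\<in>UNIV. letter_freq i * (\<Sum>l\<in>UNIV. letter_count n l i * g l)) = (\<Sum>l\<in>UNIV. (\<Sum>i\<in>UNIV. letter_count n l i * letter_freq i) * g l)"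
    unfolding sum_distrib_left sum_distrib_right by (subst sum.swap) (simp add: mult_ac)
  then show ?thesis unfolding letter_freq_eigen by (simp add: sum_distrib_left mult_ac)
qed

lemma mass_nonneg: "mass k j n \<ge> 0"
  unfolding mass_def by (intro divide_nonneg_pos sum_nonneg mult_nonneg_nonneg) (auto simp: letter_freq_nonneg)

text \<open>The weights form a right eigenvector of the counting matrix, so the weighted sum of the
  triangle inequalities produces exactly the factor \<open>mu ^ n\<close> that the scaling
  removes.\<close>

lemma mass_add_le: "mass k j (m + n) \<le> mass k j m"
proof -
  have "(\<Sum>i\<in>UNIV. letter_freq i * norm (expsum k j (m + n) i))
      \<le> (\<Sum>i\<in>UNIV. letter_freq i * (\<Sum>l\<in>UNIV. letter_count n l i * norm (expsum k j m l)))"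
    by (intro sum_mono mult_left_mono norm_expsum_add letter_freq_nonneg)
  also have "\<dots> = mu ^ n * (\<Sum>l\<in>UNIV. letter_freq l * norm (expsum k j m l))" by (rule sum_letter_freq_count)
  finally show ?thesis unfolding mass_def
    by (simp add: power_add pos_divide_le_eq mult.commute mult.left_commute)
qed

lemma expsum_le_mass: "letter_freq l * norm (expsum k j n l) \<le> mass k j n * mu ^ n"
  unfolding mass_def
  by (simp, intro member_le_sum[of l UNIV "\<lambda>i. letter_freq i * norm (expsum k j n i)"])
    (auto intro!: mult_nonneg_nonneg letter_freq_nonneg)

lemma deficit_nonneg: "deficit k j m i \<ge> 0"
  unfolding deficit_def using norm_expsum_add[of k j m 2 i] by simp

text \<open>A single deficit is at most the weighted sum of all of them, and by the eigenvector
  property that sum is a difference of two masses.\<close>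

lemma deficit_le: "letter_freq i * deficit k j m i \<le> mu ^ (m + 2) * (mass k j m - mass k j (m + 2))"
proof -
  have "letter_freq i * deficit k j m i \<le> (\<Sum>i\<in>UNIV. letter_freq i * deficit k j m i)"
    by (intro member_le_sum[of i UNIV "\<lambda>i. letter_freq i * deficit k j m i"]) (auto intro!: mult_nonneg_nonneg letter_freq_nonneg deficit_nonneg)
  also have "\<dots> = mu ^ (m + 2) * (mass k j m - mass k j (m + 2))"
    unfolding deficit_def right_diff_distrib sum_subtractf sum_letter_freq_count
    by (simp add: mass_def power_add power2_eq_square)
  finally show ?thesis .
qed

end

text \<open>By the parallelogram law the squares of |w - 1| and |1 + w| add up to 4; the factor 4
  bounds 2 + |1 + w|.\<close>

lemma norm_one_minus_le:
  assumes "norm (w :: complex) = 1"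
  shows "norm (w - 1) ^ 2 \<le> 4 * (2 - norm (1 + w))"
proof -
  have "norm (w - 1) ^ 2 + norm (1 + w) ^ 2 = 2 * norm w ^ 2 + 2"
    unfolding cmod_power2 by (simp add: power2_eq_square algebra_simps)
  then have "norm (w - 1) ^ 2 + norm (1 + w) ^ 2 = 4" using assms by simp
  moreover have N: "norm (1 + w) \<le> 2" using norm_triangle_ineq[of 1 w] assms by simp
  moreover have "4 - norm (1 + w) ^ 2 = (2 - norm (1 + w)) * (2 + norm (1 + w))"
    by (simp add: power2_eq_square algebra_simps)
  moreover have "(2 - norm (1 + w)) * (2 + norm (1 + w)) \<le> (2 - norm (1 + w)) * 4"
    using N by (intro mult_left_mono) auto
  ultimately show ?thesis by linarith
qed

context inflation_tiling begin

lemma mass_convergent: "convergent (mass k j)"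
proof -
  have "decseq (mass k j)" using mass_add_le[of k j _ 1] by (intro decseq_SucI) simp
  then show ?thesis
    by (rule decseq_convergent[where B = 0]) (auto simp: mass_nonneg convergent_def)
qed

section \<open>Return vectors and the limit of their phases\<close>

definition returns :: "real set" where
  "returns = {s' - s | s s'. \<exists>i l. (l, s) \<in> set (tiles len 0 ((subst_word \<sigma> ^^ 2) [i]))
     \<and> (l, s') \<in> set (tiles len 0 ((subst_word \<sigma> ^^ 2) [i]))}"

lemma returnsI: "(l, s) \<in> set (tiles len 0 ((subst_word \<sigma> ^^ 2) [i])) \<Longrightarrow>
    (l, s') \<in> set (tiles len 0 ((subst_word \<sigma> ^^ 2) [i])) \<Longrightarrow> s' - s \<in> returns"
  unfolding returns_def by blast

lemma finite_returns: "finite returns"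
proof -
  let ?P = "\<Union>i. snd ` set (tiles len 0 ((subst_word \<sigma> ^^ 2) [i]))"
  have "returns \<subseteq> (\<lambda>(s, s'). s' - s) ` (?P \<times> ?P)"
    unfolding returns_def by (force simp: image_iff)
  then show ?thesis by (rule finite_subset) auto
qed

text \<open>The two occurrences of l contribute terms of equal modulus whose relative phase is
  \<open>ek k (mu ^ m * (s' - s))\<close>. Adding these two before the triangle inequality is
  applied to the rest exposes their mutual cancellation as a lower bound for the loss.\<close>

lemma deficit_ge:
  assumes p: "(l, s) \<in> set (tiles len 0 ((subst_word \<sigma> ^^ 2) [i]))"
    and q: "(l, s') \<in> set (tiles len 0 ((subst_word \<sigma> ^^ 2) [i]))"
  shows "norm (expsum k j m l) * (2 - norm (1 + ek k (mu ^ m * (s' - s)))) \<le> deficit k j m i"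
proof (cases "s = s'")
  case True
  then show ?thesis using deficit_nonneg by simp
next
  case False
  define g where "g = (\<lambda>(l, s). ek k (mu ^ m * s) * expsum k j m l)"
  define S where "S = set (tiles len 0 ((subst_word \<sigma> ^^ 2) [i]))"
  define R where "R = S - {(l, s), (l, s')}"
  have S: "S = insert (l, s) (insert (l, s') R)" "(l, s) \<notin> insert (l, s') R" "(l, s') \<notin> R" "finite R"
    using p q False unfolding R_def S_def by auto
  have v: "expsum k j (m + 2) i = sum g S"
    unfolding S_def g_def expsum_add by (simp add: sum_list_distinct_conv_sum_set[OF distinct_tiles])
  have c: "(\<Sum>l\<in>UNIV. letter_count 2 l i * norm (expsum k j m l)) = (\<Sum>p\<in>S. norm (g p))"
    using sum_tiles_norm[where y = "\<lambda>s. mu ^ m * s" and x = 0 and n = 2 and i = i and g = "expsum k j m"]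
    by (simp only: S_def g_def case_prod_unfold)
  have "g (l, s) + g (l, s') = ek k (mu ^ m * s) * expsum k j m l * (1 + ek k (mu ^ m * (s' - s)))"
    by (simp add: g_def distrib_left ek_add[symmetric] right_diff_distrib)
  then have gg: "norm (g (l, s) + g (l, s')) = norm (expsum k j m l) * norm (1 + ek k (mu ^ m * (s' - s)))"
    by (simp add: norm_mult)
  have "norm (sum g S) \<le> norm (g (l, s) + g (l, s')) + norm (sum g R)"
    using S norm_triangle_ineq[of "g (l, s) + g (l, s')" "sum g R"] by (simp add: add.assoc)
  also have "norm (sum g R) \<le> (\<Sum>p\<in>R. norm (g p))" by (rule norm_sum)
  also have "(\<Sum>p\<in>R. norm (g p)) = (\<Sum>p\<in>S. norm (g p)) - 2 * norm (expsum k j m l)"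
    using S by (simp add: g_def norm_mult)
  finally show ?thesis unfolding deficit_def v c gg by (simp add: algebra_simps)
qed

text \<open>Convergence of the mass makes the deficits small against \<open>mu ^ m\<close>, whereas
  its positive limit keeps every \<open>expsum k j m i\<close> at least of order
  \<open>mu ^ m\<close>. Comparison through \<open>deficit_ge\<close> forces the relative phases to
  1.\<close>

lemma returns_phase_tendsto:
  assumes U: "mass k j \<longlonglongrightarrow> U" "U > 0" and "\<tau> \<in> returns"
  shows "(\<lambda>m. ek k (mu ^ m * \<tau>)) \<longlonglongrightarrow> 1"
proof -
  have defl: "(\<lambda>m. deficit k j m i / mu ^ m) \<longlonglongrightarrow> 0" for i
  proof (rule Lim_null_comparison[OF always_eventually])
    show "(\<lambda>m. mu ^ 2 / letter_freq i * (mass k j m - mass k j (m + 2))) \<longlonglongrightarrow> 0"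
      by (rule tendsto_mult_right_zero)
        (use tendsto_diff[OF U(1) LIMSEQ_ignore_initial_segment[OF U(1), of 2]] in simp)
    show "\<forall>m. norm (deficit k j m i / mu ^ m) \<le> mu ^ 2 / letter_freq i * (mass k j m - mass k j (m + 2))"
    proof
      fix m
      have "deficit k j m i \<le> mu ^ (m + 2) * (mass k j m - mass k j (m + 2)) / letter_freq i"
        using deficit_le[of i k j m] letter_freq(1)[of i] by (simp add: pos_le_divide_eq mult.commute)
      then have "deficit k j m i / mu ^ m \<le> mu ^ (m + 2) * (mass k j m - mass k j (m + 2)) / letter_freq i / mu ^ m"
        by (intro divide_right_mono) simp_all
      also have "\<dots> = mu ^ 2 / letter_freq i * (mass k j m - mass k j (m + 2))"
        by (simp add: power_add power2_eq_square)
      finally show "norm (deficit k j m i / mu ^ m) \<le> mu ^ 2 / letter_freq i * (mass k j m - mass k j (m + 2))"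
        using deficit_nonneg[of k j m i] by simp
    qed
  qed
  define F where "F = (\<Sum>l\<in>UNIV. letter_freq l)"
  have F: "F > 0" unfolding F_def using letter_freq(1) by (intro sum_pos) auto
  have letter_freq_le: "letter_freq l \<le> F" for l
    unfolding F_def by (rule member_le_sum) (auto simp: letter_freq_nonneg)
  have massF: "mass k j m \<le> F * (\<Sum>l\<in>UNIV. norm (expsum k j m l)) / mu ^ m" for m
    unfolding mass_def sum_distrib_left
    by (intro divide_right_mono sum_mono mult_right_mono letter_freq_le) auto
  \<comment> \<open>Of the sum of moduli, 3/4 of U / F comes from the mass, 1/4 is given away to the
    deficit, and \<open>mu ^ 2\<close> accounts for the two levels.\<close>
  define c where "c = U / (2 * F * mu ^ 2)"
  have c: "c > 0" unfolding c_def using U F by simp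
  have "\<forall>\<^sub>F m in sequentially. mass k j m > 3 / 4 * U"
    using U by (intro order_tendstoD(1)[OF U(1)]) simp
  moreover have "\<forall>\<^sub>F m in sequentially. \<forall>i. deficit k j m i / mu ^ m < U / (4 * F)"
    using U F by (intro eventually_all_finite order_tendstoD(2)[OF defl]) simp
  ultimately have "\<forall>\<^sub>F m in sequentially. \<forall>i. norm (expsum k j (m + 2) i) \<ge> c * mu ^ (m + 2)"
  proof eventually_elim
    case (elim m)
    show ?case
    proof
      fix i
      \<comment> \<open>Each letter occurs in each supertile of level two, so the weighted sum of
        moduli dominates the plain one.\<close>
      have cnt2: "letter_count 2 l i \<ge> 1" for l
      proof -
        have "l \<in> set ((subst_word \<sigma> ^^ 2) [i])"
          using full set_subst_word_pow[of 1 \<sigma> "\<sigma> i"] by (auto simp: numeral_2_eq_2)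
        then have "count_list ((subst_word \<sigma> ^^ 2) [i]) l \<noteq> 0" by (simp add: count_list_0_iff)
        then show ?thesis unfolding letter_count_def by linarith
      qed
      have "3 / 4 * U < F * (\<Sum>l\<in>UNIV. norm (expsum k j m l)) / mu ^ m"
        using massF[of m] elim by linarith
      then have "3 / 4 * U / F * mu ^ m \<le> (\<Sum>l\<in>UNIV. norm (expsum k j m l))"
        using F by (simp add: field_simps)
      also have "\<dots> \<le> (\<Sum>l\<in>UNIV. letter_count 2 l i * norm (expsum k j m l))"
        using cnt2 by (intro sum_mono) (simp add: mult_le_cancel_right1)
      also have "\<dots> = deficit k j m i + norm (expsum k j (m + 2) i)" by (simp add: deficit_def)
      also have "deficit k j m i \<le> U / (4 * F) * mu ^ m"
        using elim(2)[rule_format, of i] by (simp add: pos_divide_less_eq)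
      finally have "(3 / 4 * U / F - U / (4 * F)) * mu ^ m \<le> norm (expsum k j (m + 2) i)"
        by (simp add: left_diff_distrib)
      moreover have "(3 / 4 * U / F - U / (4 * F)) * mu ^ m = c * mu ^ (m + 2)"
        using F by (simp add: c_def power_add power2_eq_square field_simps)
      ultimately show "c * mu ^ (m + 2) \<le> norm (expsum k j (m + 2) i)" by simp
    qed
  qed
  then have low: "\<forall>\<^sub>F m in sequentially. \<forall>i. norm (expsum k j m i) \<ge> c * mu ^ m"
    by (rule eventually_sequentially_seg[THEN iffD1])
  obtain s s' l i where s: "\<tau> = s' - s" "(l, s) \<in> set (tiles len 0 ((subst_word \<sigma> ^^ 2) [i]))"
    "(l, s') \<in> set (tiles len 0 ((subst_word \<sigma> ^^ 2) [i]))"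
    using \<open>\<tau> \<in> returns\<close> unfolding returns_def by blast
  have "(\<lambda>m. norm (ek k (mu ^ m * \<tau>) - 1) ^ 2) \<longlonglongrightarrow> 0"
  proof (rule Lim_null_comparison)
    show "(\<lambda>m. 4 / c * (deficit k j m i / mu ^ m)) \<longlonglongrightarrow> 0"
      by (rule tendsto_mult_right_zero[OF defl])
    show "\<forall>\<^sub>F m in sequentially. norm (norm (ek k (mu ^ m * \<tau>) - 1) ^ 2) \<le> 4 / c * (deficit k j m i / mu ^ m)"
      using low
    proof eventually_elim
      case (elim m)
      let ?d = "2 - norm (1 + ek k (mu ^ m * \<tau>))"
      have "0 \<le> ?d" using norm_triangle_ineq[of 1 "ek k (mu ^ m * \<tau>)"] by simp
      then have "c * mu ^ m * ?d \<le> norm (expsum k j m l) * ?d"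
        using elim by (intro mult_right_mono) auto
      also have "\<dots> \<le> deficit k j m i" unfolding s(1) by (rule deficit_ge[OF s(2,3)])
      finally have "?d \<le> deficit k j m i / mu ^ m / c" using c by (simp add: field_simps)
      then have "4 * ?d \<le> 4 * (deficit k j m i / mu ^ m / c)" by (rule mult_left_mono) simp
      also have "\<dots> = 4 / c * (deficit k j m i / mu ^ m)" by simp
      finally have "norm (ek k (mu ^ m * \<tau>) - 1) ^ 2 \<le> 4 / c * (deficit k j m i / mu ^ m)"
        by (rule order_trans[OF norm_one_minus_le[OF norm_ek]])
      then show ?case by (simp only: real_norm_def abs_power2)
    qed
  qed
  from tendsto_real_sqrt[OF this] have "(\<lambda>m. norm (ek k (mu ^ m * \<tau>) - 1)) \<longlonglongrightarrow> 0" by simp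
  then show ?thesis by (simp add: tendsto_norm_zero_iff LIM_zero_iff)
qed

definition phase_error :: "real \<Rightarrow> nat \<Rightarrow> real" where
  "phase_error k n = (\<Sum>\<tau>\<in>returns. norm (ek k (mu ^ n * \<tau>) - 1))"

lemma phase_error_nonneg: "phase_error k n \<ge> 0"
  unfolding phase_error_def by (intro sum_nonneg) simp

lemma phase_error_summable:
  assumes "mass k j \<longlonglongrightarrow> U" "U > 0"
  shows "summable (phase_error k)"
  unfolding phase_error_def
proof (rule summable_sum)
  fix \<tau> assume "\<tau> \<in> returns"
  have ek: "ek k (mu ^ n * \<tau>) = exp (- 2 * of_real pi * \<i> * of_real (k * \<tau> * mu ^ n))" for n
    by (simp add: ek_def mult_ac)
  show "summable (\<lambda>n. norm (ek k (mu ^ n * \<tau>) - 1))"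
    unfolding ek
    by (rule algebraic_orbit_phase_summable[OF algebraic_mu])
      (use returns_phase_tendsto[OF assms \<open>\<tau> \<in> returns\<close>] in \<open>simp only: ek\<close>)
qed

lemma phase_error_ge: "\<tau> \<in> returns \<Longrightarrow> norm (ek k (mu ^ n * \<tau>) - 1) \<le> phase_error k n"
  unfolding phase_error_def
  by (intro member_le_sum[of \<tau> returns "\<lambda>\<tau>. norm (ek k (mu ^ n * \<tau>) - 1)"]) (auto simp: finite_returns)

section \<open>Positions in supertiles compared level by level\<close>

definition base :: "'a \<Rightarrow> 'a \<Rightarrow> real" where
  "base i l = (SOME s. (l, s) \<in> set (tiles len 0 (\<sigma> i)))"

lemma base: "(l, base i l) \<in> set (tiles len 0 (\<sigma> i))"
  unfolding base_def using full[of l i] fst_set_tiles[of len 0 "\<sigma> i"]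
  by (intro someI_ex[of "\<lambda>s. (l, s) \<in> set (tiles len 0 (\<sigma> i))"]) force

text \<open>A reference position of the letter \<open>l\<close> in the supertile of level \<open>q + 1\<close> over \<open>i\<close>. Routing all
  intermediate levels through one fixed letter makes any two such positions differ by a
  return vector on each level.\<close>

primrec refpos :: "nat \<Rightarrow> 'a \<Rightarrow> 'a \<Rightarrow> real" where
  "refpos 0 i l = base i l"
| "refpos (Suc q) i l = mu ^ Suc q * base i undefined + refpos q undefined l"

lemma two_level:
  assumes "(i', d) \<in> set (tiles len 0 (\<sigma> i))" "(l, y) \<in> set (tiles len 0 (\<sigma> i'))"
  shows "(l, mu * d + y) \<in> set (tiles len 0 ((subst_word \<sigma> ^^ 2) [i]))"
  using set_tiles_subst_pow_add[of 1 1 0 "[i]"] assms tiles_shift0[of len "mu * d" "\<sigma> i'"]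
  by (force simp: numeral_2_eq_2 add.commute)

text \<open>Beyond level zero both positions end in the same path through the letter
  \<open>undefined\<close>, which cancels. What remains is \<open>mu ^ q\<close> times the
  difference of two occurrences of one letter, \<open>undefined\<close> or for q = 0 the letter l,
  in the supertile of level two over i.\<close>

lemma refpos_return:
  assumes "(i', d) \<in> set (tiles len 0 (\<sigma> i))"
  shows "\<exists>\<tau>\<in>returns. mu ^ Suc q * d + refpos q i' l - refpos (Suc q) i l = mu ^ q * \<tau>"
proof (cases q)
  case 0
  have "(mu * d + base i' l) - (mu * base i undefined + base undefined l) \<in> returns"
    by (rule returnsI[OF two_level[OF base base] two_level[OF assms base]])
  then show ?thesis by (intro bexI) (auto simp: 0)
next
  case (Suc q')
  have "(mu * d + base i' undefined) - (mu * base i undefined + base undefined undefined) \<in> returns"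
    by (rule returnsI[OF two_level[OF base base] two_level[OF assms base]])
  then show ?thesis
    by (intro bexI[of _ "(mu * d + base i' undefined) - (mu * base i undefined + base undefined undefined)"])
      (auto simp: Suc algebra_simps)
qed

text \<open>Induction on the level: the top choice i', d is exchanged for the reference choice at
  the cost of one return vector on level n + q, and the rest of the path is handled inside the
  supertile over i'. The separate \<open>phase_error k n\<close> is the cost of the lowest
  level.\<close>

lemma position_phase:
  assumes "(l, x) \<in> set (tiles len 0 ((subst_word \<sigma> ^^ Suc q) [i]))"
  shows "norm (ek k (mu ^ n * x) - ek k (mu ^ n * refpos q i l)) \<le> phase_error k n + (\<Sum>s<q. phase_error k (n + s))"
  using assms
proof (induction q arbitrary: i x)
  case 0
  \<comment> \<open>Embedding \<sigma> i in some supertile of level two presents the difference of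
    the two positions as a return vector.\<close>
  obtain i' d where d: "(i, d) \<in> set (tiles len 0 (\<sigma> i'))" using base by blast
  have x: "(l, x) \<in> set (tiles len 0 (\<sigma> i))" using 0 by simp
  have "(mu * d + x) - (mu * d + base i l) \<in> returns"
    by (rule returnsI[OF two_level[OF d base] two_level[OF d x]])
  then have "x - base i l \<in> returns" by simp
  from phase_error_ge[OF this] show ?case
    by (simp add: norm_ek_diff right_diff_distrib)
next
  case (Suc q)
  have "(l, x) \<in> set (tiles len (mu ^ (Suc q + 1) * 0) ((subst_word \<sigma> ^^ (Suc q + 1)) [i]))"
    using Suc.prems by simp
  then obtain i' d where d: "(i', d) \<in> set (tiles len 0 (\<sigma> i))"
    and "(l, x) \<in> set (tiles len (mu ^ Suc q * d) ((subst_word \<sigma> ^^ Suc q) [i']))"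
    unfolding set_tiles_subst_pow_add[of "Suc q" 1 0 "[i]"] by auto
  then obtain y where y: "(l, y) \<in> set (tiles len 0 ((subst_word \<sigma> ^^ Suc q) [i']))" "x = y + mu ^ Suc q * d"
    unfolding tiles_shift0[of len "mu ^ Suc q * d"] by auto
  obtain \<tau> where \<tau>: "\<tau> \<in> returns" "mu ^ Suc q * d + refpos q i' l - refpos (Suc q) i l = mu ^ q * \<tau>"
    using refpos_return[OF d, of q l] by blast
  have "ek k (mu ^ n * x) - ek k (mu ^ n * (mu ^ Suc q * d + refpos q i' l))
      = ek k (mu ^ n * (mu ^ Suc q * d)) * (ek k (mu ^ n * y) - ek k (mu ^ n * refpos q i' l))"
    unfolding y(2) right_diff_distrib ek_add[symmetric] by (simp add: distrib_left add.commute)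
  then have 1: "norm (ek k (mu ^ n * x) - ek k (mu ^ n * (mu ^ Suc q * d + refpos q i' l)))
      \<le> phase_error k n + (\<Sum>s<q. phase_error k (n + s))"
    using Suc.IH[OF y(1)] by (simp only: norm_mult norm_ek mult_1_left)
  have "mu ^ n * (mu ^ Suc q * d + refpos q i' l) - mu ^ n * refpos (Suc q) i l = mu ^ (n + q) * \<tau>"
    unfolding right_diff_distrib[symmetric] \<tau>(2) by (simp add: power_add)
  then have 2: "norm (ek k (mu ^ n * (mu ^ Suc q * d + refpos q i' l)) - ek k (mu ^ n * refpos (Suc q) i l))
      \<le> phase_error k (n + q)"
    unfolding norm_ek_diff[of k "mu ^ n * (mu ^ Suc q * d + refpos q i' l)"]
    using phase_error_ge[OF \<tau>(1), of k "n + q"] by (simp only:)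
  have "norm (ek k (mu ^ n * x) - ek k (mu ^ n * refpos (Suc q) i l))
      \<le> (phase_error k n + (\<Sum>s<q. phase_error k (n + s))) + phase_error k (n + q)"
    using norm_triangle_mono[OF 1 2] by (simp only: diff_add_cancel add_diff_eq diff_add_eq)
  also have "\<dots> = phase_error k n + (\<Sum>s<Suc q. phase_error k (n + s))" by simp
  finally show ?case .
qed

end

text \<open>Both positions are compared with the same reference position; each comparison costs at
  most two copies of the series, one for the sum over the levels and one for its first term.\<close>

lemma (in inflation_tiling) same_letter_phase:
  assumes sm: "summable (phase_error k)"
    and x: "(l, x) \<in> set (tiles len 0 ((subst_word \<sigma> ^^ Suc q) [i]))"
    and x': "(l, x') \<in> set (tiles len 0 ((subst_word \<sigma> ^^ Suc q) [i]))"
  shows "norm (ek k (mu ^ n * x) - ek k (mu ^ n * x')) \<le> 4 * (\<Sum>s. phase_error k (n + s))"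
proof -
  have sm': "summable (\<lambda>s. phase_error k (n + s))"
    using summable_ignore_initial_segment[OF sm, of n] by (simp add: add.commute)
  have "(\<Sum>s<q. phase_error k (n + s)) \<le> (\<Sum>s. phase_error k (n + s))"
    by (rule sum_le_suminf[OF sm']) (auto simp: phase_error_nonneg)
  moreover have "phase_error k n \<le> (\<Sum>s. phase_error k (n + s))"
    using sum_le_suminf[OF sm', of "{0}"] by (simp add: phase_error_nonneg)
  ultimately have le: "phase_error k n + (\<Sum>s<q. phase_error k (n + s)) \<le> 2 * (\<Sum>s. phase_error k (n + s))"
    by linarith
  show ?thesis
    using position_phase[OF x, of k n] position_phase[OF x', of k n] le
      norm_triangle_sub norm_triangle_ineq4[of "ek k (mu ^ n * x) - ek k (mu ^ n * refpos q i l)"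
        "ek k (mu ^ n * x') - ek k (mu ^ n * refpos q i l)"]
    by simp
qed

locale legal_inflation_tiling = inflation_tiling +
  assumes legal_pair: "x \<in> T i \<Longrightarrow> x + len $ i \<in> T j \<Longrightarrow>
    \<exists>n a. sublist [i, j] ((subst_word \<sigma> ^^ n) [a])"
begin

text \<open>On a level where supertiles are longer than t' - t the two tiles lie in the same
  supertile or in adjacent ones. Adjacent supertiles come from adjacent tiles, whose types occur
  side by side in some iterated letter; inflating that occurrence reproduces the distance of the two
  tiles inside a single supertile.\<close>

lemma same_letter_in_supertile_le:
  assumes t: "t \<in> T l" "t' \<in> T l" "t \<le> t'"
  shows "\<exists>q i x x'. (l, x) \<in> set (tiles len 0 ((subst_word \<sigma> ^^ Suc q) [i]))
    \<and> (l, x') \<in> set (tiles len 0 ((subst_word \<sigma> ^^ Suc q) [i])) \<and> t' - t = x' - x"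
proof -
  obtain q0 where "(t' - t) / lmin < mu ^ q0" using real_arch_pow[OF mu_gt_1] by blast
  also have "mu ^ q0 \<le> mu ^ Suc q0" using mu_gt_1 by (intro power_increasing) auto
  finally have "(t' - t) / lmin < mu ^ Suc q0" .
  then obtain q where q: "q = Suc q0" "t' - t < mu ^ q * lmin"
    using lmin_pos by (metis pos_divide_less_eq)
  obtain a X where X: "X \<in> T a" "(l, t) \<in> set (supertile q a X)" using ancestor[OF t(1)] .
  obtain b X' where X': "X' \<in> T b" "(l, t') \<in> set (supertile q b X')" using ancestor[OF t(2)] .
  note bd = supertile_bounds[OF X(2)] and bd' = supertile_bounds[OF X'(2)]
  have in0: "(l, t - mu ^ q * X) \<in> set (tiles len 0 ((subst_word \<sigma> ^^ q) [a]))"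
    using X(2) unfolding tiles_shift0[of len "mu ^ q * X"] by auto
  have in0': "(l, t' - mu ^ q * X') \<in> set (tiles len 0 ((subst_word \<sigma> ^^ q) [b]))"
    using X'(2) unfolding tiles_shift0[of len "mu ^ q * X'"] by auto
  have "\<not> X' < X"
  proof
    assume "X' < X"
    then have "mu ^ q * (X' + len $ b) \<le> mu ^ q * X"
      using tile_spacing[OF X'(1) X(1)] by (intro mult_left_mono) auto
    then show False using bd bd' t(3) len_pos[of l] by linarith
  qed
  then consider "X' = X" | "X < X'" by linarith
  then show ?thesis
  proof cases
    case 1
    then have "a = b" using tile_type_unique X(1) X'(1) by simp
    then show ?thesis using in0 in0' 1 unfolding q(1)
      by (intro exI[of _ q0] exI[of _ a] exI[of _ "t - mu ^ Suc q0 * X"] exI[of _ "t' - mu ^ Suc q0 * X"]) simp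
  next
    case 2
    have le: "X + len $ a \<le> X'" using tile_spacing[OF X(1) X'(1) 2] .
    \<comment> \<open>A tile in between would contribute a gap of at least
      \<open>mu ^ q * lmin\<close>, more than the distance of the two tiles.\<close>
    have eq: "X + len $ a = X'"
    proof (rule ccontr)
      assume "X + len $ a \<noteq> X'"
      then have less: "X + len $ a < X'" using le by simp
      obtain c where c: "X + len $ a \<in> T c" using tile_right_neighbour[OF X(1)] .
      have "X + len $ a + lmin \<le> X'" using tile_spacing[OF c X'(1) less] lmin_le[of c] by linarith
      then have "mu ^ q * (X + len $ a + lmin) \<le> mu ^ q * X'" by (intro mult_left_mono) auto
      then have "mu ^ q * (X + len $ a) + mu ^ q * lmin \<le> mu ^ q * X'" by (simp only: distrib_left)
      then show False using bd bd' q(2) len_pos[of l] by linarith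
    qed
    obtain m c where "sublist [a, b] ((subst_word \<sigma> ^^ m) [c])"
      using legal_pair[OF X(1), of b] X'(1) eq by auto
    then obtain ps ss where w: "(subst_word \<sigma> ^^ m) [c] = ps @ [a, b] @ ss" unfolding sublist_def by auto
    define y where "y = wlen len ps"
    have ab: "(a, y) \<in> set (tiles len 0 ((subst_word \<sigma> ^^ m) [c]))"
      "(b, y + len $ a) \<in> set (tiles len 0 ((subst_word \<sigma> ^^ m) [c]))"
      unfolding w by (simp_all add: tiles_append y_def)
    have up: "(l, mu ^ q * s + z) \<in> set (tiles len 0 ((subst_word \<sigma> ^^ (q + m)) [c]))"
      if "(e, s) \<in> set (tiles len 0 ((subst_word \<sigma> ^^ m) [c]))"
        "(l, z) \<in> set (tiles len 0 ((subst_word \<sigma> ^^ q) [e]))" for e s z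
    proof -
      have "(l, mu ^ q * s + z) \<in> set (supertile q e s)"
        unfolding tiles_shift0[of len "mu ^ q * s"] using that(2) by (force simp: add.commute)
      then show ?thesis using set_tiles_subst_pow_add[of q m 0 "[c]"] that(1) by auto
    qed
    have "(l, mu ^ q * y + (t - mu ^ q * X)) \<in> set (tiles len 0 ((subst_word \<sigma> ^^ Suc (q0 + m)) [c]))"
      "(l, mu ^ q * (y + len $ a) + (t' - mu ^ q * X')) \<in> set (tiles len 0 ((subst_word \<sigma> ^^ Suc (q0 + m)) [c]))"
      using up[OF ab(1) in0] up[OF ab(2) in0'] q(1) by simp_all
    moreover have "t' - t = (mu ^ q * (y + len $ a) + (t' - mu ^ q * X')) - (mu ^ q * y + (t - mu ^ q * X))"
      unfolding eq[symmetric] by (simp add: distrib_left)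
    ultimately show ?thesis by blast
  qed
qed

lemma tile_phase:
  assumes sm: "summable (phase_error k)" and t: "t \<in> T l" "t' \<in> T l"
  shows "norm (ek k (mu ^ n * t) - ek k (mu ^ n * t')) \<le> 4 * (\<Sum>s. phase_error k (n + s))"
proof -
  have *: "norm (ek k (mu ^ n * t') - ek k (mu ^ n * t)) \<le> 4 * (\<Sum>s. phase_error k (n + s))"
    if le: "t \<in> T l" "t' \<in> T l" "t \<le> t'" for t t'
  proof -
    obtain q i x x' where x: "(l, x) \<in> set (tiles len 0 ((subst_word \<sigma> ^^ Suc q) [i]))"
      "(l, x') \<in> set (tiles len 0 ((subst_word \<sigma> ^^ Suc q) [i]))" "t' - t = x' - x"
      using same_letter_in_supertile_le[OF le] by blast
    have "norm (ek k (mu ^ n * t') - ek k (mu ^ n * t)) = norm (ek k (mu ^ n * x') - ek k (mu ^ n * x))"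
      unfolding norm_ek_diff[of _ "mu ^ n * t'"] norm_ek_diff[of _ "mu ^ n * x'"]
        right_diff_distrib[symmetric] x(3) ..
    also have "\<dots> \<le> 4 * (\<Sum>s. phase_error k (n + s))" by (rule same_letter_phase[OF sm x(2,1)])
    finally show ?thesis .
  qed
  show ?thesis
  proof (cases "t \<le> t'")
    case True
    from *[OF t True] show ?thesis by (simp add: norm_minus_commute)
  next
    case False
    then show ?thesis using *[OF t(2,1)] by simp
  qed
qed

text \<open>The limit U of the mass decides. If U = 0, supertile sums are small and compared with 0.
  If U > 0, they are compared with the sum over one reference supertile of each type, since the
  phases of all tiles of one type nearly agree on a high level.\<close>

lemma exponential_avg_converges:
  "\<exists>D. uniform_limit UNIV (avg (\<lambda>(a, x). if a = j then ek k x else 0)) (\<lambda>_. D) at_top"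
proof (rule avg_converges)
  let ?f = "\<lambda>(a, x). if a = j then ek k x else 0"
  show "norm (?f p) \<le> 1" for p by (cases p) simp
  fix \<eta> :: real assume \<eta>: "\<eta> > 0"
  have S: "sum_list (map ?f (supertile n l t)) = ek k (mu ^ n * t) * expsum k j n l" for n l t
    unfolding expsum_def by (rule supertile_exponential_sum)
  obtain U where U: "mass k j \<longlonglongrightarrow> U" using mass_convergent unfolding convergent_def by blast
  have "U \<ge> 0" using U by (rule LIMSEQ_le_const) (auto simp: mass_nonneg)
  then consider "U = 0" | "U > 0" by linarith
  then show "\<exists>n b. \<forall>l t. t \<in> T l \<longrightarrow> norm (sum_list (map ?f (supertile n l t)) - b l) \<le> \<eta> * mu ^ n"
  proof cases
    case 1
    have "\<forall>\<^sub>F n in sequentially. \<forall>l. mass k j n < \<eta> * letter_freq l"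
      using U \<eta> letter_freq(1) unfolding 1 by (intro eventually_all_finite order_tendstoD(2)[OF U[unfolded 1]]) simp
    then obtain n where n: "\<And>l. mass k j n < \<eta> * letter_freq l" using eventually_happens' sequentially_bot by blast
    have "norm (expsum k j n l) \<le> \<eta> * mu ^ n" for l
    proof -
      have "letter_freq l * norm (expsum k j n l) \<le> mass k j n * mu ^ n" by (rule expsum_le_mass)
      also have "\<dots> \<le> \<eta> * letter_freq l * mu ^ n" using n[of l] by (intro mult_right_mono) auto
      finally have "letter_freq l * norm (expsum k j n l) \<le> letter_freq l * (\<eta> * mu ^ n)" by (simp only: mult_ac)
      then show ?thesis using letter_freq(1)[of l] by simp
    qed
    then show ?thesis by (intro exI[of _ n] exI[of _ "\<lambda>_. 0"]) (simp add: S norm_mult)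
  next
    case 2
    have sm: "summable (phase_error k)" by (rule phase_error_summable[OF U 2])
    have "(\<lambda>n. \<Sum>s. phase_error k (s + n)) \<longlonglongrightarrow> 0" by (rule suminf_exist_split2[OF sm])
    then have "(\<lambda>n. 4 * (\<Sum>s. phase_error k (n + s)) * (lmax / lmin)) \<longlonglongrightarrow> 0"
      by (intro tendsto_mult_left_zero tendsto_mult_right_zero) (simp add: add.commute)
    then have "\<forall>\<^sub>F n in sequentially. 4 * (\<Sum>s. phase_error k (n + s)) * (lmax / lmin) < \<eta>"
      using \<eta> by (rule order_tendstoD)
    then obtain n where n: "4 * (\<Sum>s. phase_error k (n + s)) * (lmax / lmin) < \<eta>"
      using eventually_happens' sequentially_bot by blast
    define t0 where "t0 l = (SOME t. t \<in> T l)" for l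
    have "norm (sum_list (map ?f (supertile n l t)) - ek k (mu ^ n * t0 l) * expsum k j n l) \<le> \<eta> * mu ^ n"
      if t: "t \<in> T l" for l t
    proof -
      have t0: "t0 l \<in> T l" unfolding t0_def using t by (rule someI)
      have "norm (sum_list (map ?f (supertile n l t)) - ek k (mu ^ n * t0 l) * expsum k j n l)
          = norm (ek k (mu ^ n * t) - ek k (mu ^ n * t0 l)) * norm (expsum k j n l)"
        unfolding S left_diff_distrib[symmetric] norm_mult ..
      also have "\<dots> \<le> (4 * (\<Sum>s. phase_error k (n + s))) * (mu ^ n * lmax / lmin)"
        by (intro mult_mono tile_phase[OF sm t t0] norm_expsum_le norm_ge_zero
            order_trans[OF norm_ge_zero tile_phase[OF sm t t0]])
      also have "\<dots> = (4 * (\<Sum>s. phase_error k (n + s)) * (lmax / lmin)) * mu ^ n" by simp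
      also have "\<dots> \<le> \<eta> * mu ^ n" using n by (intro mult_right_mono) auto
      finally show ?thesis .
    qed
    then show ?thesis by (intro exI[of _ n] exI[of _ "\<lambda>l. ek k (mu ^ n * t0 l) * expsum k j n l"] allI impI)
  qed
qed

end

section \<open>The hull\<close>

lemma tiling_hull_patch:
  assumes "\<Lambda> \<in> tiling_hull T" "R > 0"
  shows "\<exists>s. \<forall>i. \<Lambda> i \<inter> {- R..R} = (\<lambda>x. x + s) ` T i \<inter> {- R..R}"
proof -
  obtain t where "locally_close (1 / R) \<Lambda> (translate t T)"
    using assms unfolding tiling_hull_def local_closure_def by fastforce
  then obtain s where "\<And>i. \<Lambda> i \<inter> {- R..R} = translate s (translate t T) i \<inter> {- R..R}"
    using assms(2) unfolding locally_close_def by auto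
  then show ?thesis
    unfolding translate_def by (intro exI[of _ "t + s"]) (simp add: image_image add.assoc)
qed

lemma tiling_hull_mem:
  assumes "\<Lambda> \<in> tiling_hull T" "R > 0"
  shows "\<exists>s. \<forall>i x. \<bar>x\<bar> \<le> R \<longrightarrow> (x \<in> \<Lambda> i \<longleftrightarrow> x - s \<in> T i)"
proof -
  obtain s where s: "\<And>i. \<Lambda> i \<inter> {- R..R} = (\<lambda>x. x + s) ` T i \<inter> {- R..R}"
    using tiling_hull_patch[OF assms] by blast
  have "x \<in> \<Lambda> i \<longleftrightarrow> x - s \<in> T i" if "\<bar>x\<bar> \<le> R" for i x
  proof -
    have "x \<in> {- R..R}" using that by auto
    then have "x \<in> \<Lambda> i \<longleftrightarrow> x \<in> (\<lambda>x. x + s) ` T i" using s[of i] by blast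
    also have "\<dots> \<longleftrightarrow> x - s \<in> T i" by (auto simp: image_iff) (metis diff_add_cancel)
    finally show ?thesis .
  qed
  then show ?thesis by blast
qed

text \<open>Every window of S' is a translate of a window of S, in general with a different centre;
  uniformity in the centre is therefore what carries the density over.\<close>

lemma uniform_density_transfer:
  assumes T: "uniform_limit UNIV (\<lambda>r c. real (card (S \<inter> {- r + c..r + c})) / (2 * r)) (\<lambda>_. d) at_top"
    and patch: "\<And>R. R > 0 \<Longrightarrow> \<exists>s. \<forall>x. \<bar>x\<bar> \<le> R \<longrightarrow> (x \<in> S' \<longleftrightarrow> x - s \<in> S)"
  shows "uniform_limit UNIV (\<lambda>r c. real (card (S' \<inter> {- r + c..r + c})) / (2 * r)) (\<lambda>_. d) at_top"
proof (rule uniform_limitI)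
  fix e :: real assume "e > 0"
  from uniform_limitD[OF T this] eventually_gt_at_top[of 0]
  show "\<forall>\<^sub>F r in at_top. \<forall>c\<in>UNIV. dist (real (card (S' \<inter> {- r + c..r + c})) / (2 * r)) d < e"
  proof eventually_elim
    case (elim r)
    show ?case
    proof
      fix c
      obtain s where s: "\<And>x. \<bar>x\<bar> \<le> \<bar>c\<bar> + r \<Longrightarrow> (x \<in> S' \<longleftrightarrow> x - s \<in> S)"
        using patch[of "\<bar>c\<bar> + r"] add_nonneg_pos[OF abs_ge_zero \<open>0 < r\<close>] by blast
      have "S' \<inter> {- r + c..r + c} = (\<lambda>x. x + s) ` (S \<inter> {- r + (c - s)..r + (c - s)})"
      proof (intro set_eqI iffI)
        fix x assume "x \<in> S' \<inter> {- r + c..r + c}"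
        then have "x - s \<in> S \<inter> {- r + (c - s)..r + (c - s)}" using s[of x] by auto
        then show "x \<in> (\<lambda>x. x + s) ` (S \<inter> {- r + (c - s)..r + (c - s)})" by (force simp: image_iff)
      next
        fix x assume "x \<in> (\<lambda>x. x + s) ` (S \<inter> {- r + (c - s)..r + (c - s)})"
        then show "x \<in> S' \<inter> {- r + c..r + c}" using s[of x] by auto
      qed
      then have "card (S' \<inter> {- r + c..r + c}) = card (S \<inter> {- r + (c - s)..r + (c - s)})"
        by (simp add: card_image)
      then show "dist (real (card (S' \<inter> {- r + c..r + c})) / (2 * r)) d < e" using elim by simp
    qed
  qed
qed

context legal_inflation_tiling begin

lemma sum_window: "sum f (window a b) = (\<Sum>i\<in>UNIV. \<Sum>x\<in>T i \<inter> {a..b}. f (i, x))"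
proof -
  have "window a b = (SIGMA i:UNIV. T i \<inter> {a..b})" by (auto simp: window_def)
  moreover have "finite (T i \<inter> {a..b})" for i
    using support_discrete(1)[of a b] by (rule finite_subset[rotated]) (auto simp: support_def)
  ultimately show ?thesis by (simp add: sum.Sigma)
qed

lemma finite_T_window: "finite (T i \<inter> {a..b})"
  using support_discrete(1)[of a b] by (rule finite_subset[rotated]) (auto simp: support_def)

lemma fb_average_eq_avg: "fb_average T j k = avg (\<lambda>(a, x). if a = j then ek k x else 0)"
proof (intro ext)
  fix r c
  have "(\<Sum>i\<in>UNIV. \<Sum>x\<in>T i \<inter> {- r + c..r + c}. if i = j then ek k x else 0)
      = (\<Sum>i\<in>UNIV. if i = j then \<Sum>x\<in>T i \<inter> {- r + c..r + c}. ek k x else 0)"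
    by (intro sum.cong) auto
  then show "fb_average T j k r c = avg (\<lambda>(a, x). if a = j then ek k x else 0) r c"
    unfolding fb_average_ek avg_def sum_window by simp
qed

lemma pair_density:
  "\<exists>d. uniform_limit UNIV
    (\<lambda>r c. real (card ((T i \<inter> (\<lambda>x. x - z) ` T j) \<inter> {- r + c..r + c})) / (2 * r)) (\<lambda>_. d) at_top"
proof -
  obtain D where D: "uniform_limit UNIV (avg (\<lambda>(l, x). if l = i \<and> x + z \<in> T j then 1 else 0)) (\<lambda>_. D) at_top"
    using pair_avg_converges by blast
  have "avg (\<lambda>(l, x). if l = i \<and> x + z \<in> T j then 1 else 0) r c
      = of_real (real (card ((T i \<inter> (\<lambda>x. x - z) ` T j) \<inter> {- r + c..r + c})) / (2 * r))" for r c
  proof -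
    let ?W = "T i \<inter> {- r + c..r + c}"
    have W: "(T i \<inter> (\<lambda>x. x - z) ` T j) \<inter> {- r + c..r + c} = {x \<in> ?W. x + z \<in> T j}"
      by (force simp: image_iff)
    have "(\<Sum>l\<in>UNIV. \<Sum>x\<in>T l \<inter> {- r + c..r + c}. if l = i \<and> x + z \<in> T j then 1 else 0 :: complex)
        = (\<Sum>l\<in>UNIV. if l = i then \<Sum>x\<in>T l \<inter> {- r + c..r + c}. if x + z \<in> T j then 1 else 0 else 0)"
      by (intro sum.cong) auto
    also have "\<dots> = (\<Sum>x\<in>?W. if x + z \<in> T j then 1 else 0)" by simp
    also have "\<dots> = (\<Sum>x\<in>{x \<in> ?W. x + z \<in> T j}. 1)"
      by (rule sum.inter_filter[symmetric]) (rule finite_T_window)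
    also have "\<dots> = of_nat (card {x \<in> ?W. x + z \<in> T j})" by simp
    finally show ?thesis unfolding avg_def sum_window W by simp
  qed
  then have "avg (\<lambda>(l, x). if l = i \<and> x + z \<in> T j then 1 else 0) = (\<lambda>r c.
      of_real (real (card ((T i \<inter> (\<lambda>x. x - z) ` T j) \<inter> {- r + c..r + c})) / (2 * r)))"
    by (intro ext)
  from uniform_limit_of_real_Re[OF D[unfolded this]] show ?thesis by blast
qed

lemma support_density:
  "\<exists>d>0. uniform_limit UNIV (\<lambda>r c. real (card (support T \<inter> {- r + c..r + c})) / (2 * r)) (\<lambda>_. d) at_top"
proof -
  have "\<exists>D. uniform_limit UNIV (avg (\<lambda>_. 1)) (\<lambda>_. D) at_top"
  proof (rule avg_converges)
    show "norm (1 :: complex) \<le> 1" by simp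
    fix \<eta> :: real assume "\<eta> > 0"
    \<comment> \<open>A supertile of level 0 is a single tile and its sum is exactly 1, so level 0
      serves as the witness.\<close>
    then show "\<exists>n b. \<forall>l t. t \<in> T l \<longrightarrow> norm ((\<Sum>_\<leftarrow>supertile n l t. 1) - b l) \<le> \<eta> * mu ^ n"
      by (intro exI[of _ 0] exI[of _ "\<lambda>_. 1"]) simp
  qed
  then obtain D where D: "uniform_limit UNIV (avg (\<lambda>_. 1)) (\<lambda>_. D) at_top" by blast
  have card: "card (support T \<inter> {a..b}) = card (window a b)" for a b
    using snd_window[of a b] card_image[OF inj_on_snd_window, of a b] by simp
  have "avg (\<lambda>_. 1) = (\<lambda>r c. of_real (real (card (support T \<inter> {- r + c..r + c})) / (2 * r)))"
    by (intro ext) (simp add: avg_def card)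
  from uniform_limit_of_real_Re[OF D[unfolded this]]
  have lim: "uniform_limit UNIV (\<lambda>r c. real (card (support T \<inter> {- r + c..r + c})) / (2 * r)) (\<lambda>_. Re D) at_top" .
  \<comment> \<open>Windows are filled by tiles of length at most \<open>lmax\<close>, which bounds
    the number of tiles from below.\<close>
  have "1 / (2 * lmax) \<le> Re D"
  proof (rule tendsto_lowerbound[OF tendsto_uniform_limitI[OF lim, of 0]])
    show "\<forall>\<^sub>F r in at_top. 1 / (2 * lmax) \<le> real (card (support T \<inter> {- r + 0..r + 0})) / (2 * r)"
      using eventually_ge_at_top[of lmax]
    proof eventually_elim
      case (elim r)
      have r: "r > 0" using elim lmax_pos by linarith
      have "2 * r - lmax \<le> (\<Sum>(i, x)\<in>window (- r) r. len $ i)"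
        using window_length[of "- r" r] r by linarith
      also have "\<dots> \<le> (\<Sum>p\<in>window (- r) r. lmax)"
        by (intro sum_mono) (auto simp: le_lmax)
      finally have "r \<le> real (card (window (- r) r)) * lmax" using elim by simp
      then show ?case using r lmax_pos by (simp add: card field_simps)
    qed
  qed simp_all
  moreover have "1 / (2 * lmax) > 0" using lmax_pos by simp
  ultimately have "Re D > 0" by linarith
  then show ?thesis using lim by blast
qed

text \<open>On the window of radius n + 1 the element is a translate of T by some
  \<open>s n\<close>, which multiplies averages by \<open>ek k (s n)\<close>. These factors need not
  converge but have a limit point u; as the shifts do not depend on the type, u serves all j at
  once.\<close>

lemma hull_fb_average_limit:
  assumes \<Lambda>: "\<Lambda> \<in> tiling_hull T"
    and A: "\<And>j. uniform_limit UNIV (fb_average T j k) (\<lambda>_. A j) at_top"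
  shows "\<exists>u. norm u = 1 \<and> (\<forall>j. uniform_limit UNIV (fb_average \<Lambda> j k) (\<lambda>_. u * A j) at_top)"
proof -
  have "\<exists>s. \<forall>i x. \<bar>x\<bar> \<le> real (Suc n) \<longrightarrow> (x \<in> \<Lambda> i \<longleftrightarrow> x - s \<in> T i)" for n
    using tiling_hull_mem[OF \<Lambda>, of "real (Suc n)"] by simp
  then obtain s where s: "\<And>n i x. \<bar>x\<bar> \<le> real (Suc n) \<Longrightarrow> x \<in> \<Lambda> i \<longleftrightarrow> x - s n \<in> T i" by metis
  have "bounded (range (\<lambda>n. ek k (s n)))" by (auto simp: bounded_iff intro!: exI[of _ 1])
  from bounded_imp_convergent_subsequence[OF this]
  obtain u \<phi> where \<phi>: "strict_mono \<phi>" "((\<lambda>n. ek k (s n)) \<circ> \<phi>) \<longlonglongrightarrow> u" by blast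
  have "norm u = 1"
    using LIMSEQ_unique[OF tendsto_norm[OF \<phi>(2)], of 1] by (simp add: o_def)
  moreover have "uniform_limit UNIV (fb_average \<Lambda> j k) (\<lambda>_. u * A j) at_top" for j
  proof (rule uniform_limitI)
    fix e :: real assume "e > 0"
    then have "e / 2 > 0" by simp
    from uniform_limitD[OF A[of j] this] eventually_gt_at_top[of 0]
    show "\<forall>\<^sub>F r in at_top. \<forall>c\<in>UNIV. dist (fb_average \<Lambda> j k r c) (u * A j) < e"
    proof eventually_elim
      case (elim r)
      show ?case
      proof
        fix c
        have shift: "fb_average \<Lambda> j k r c = ek k (s n) * fb_average T j k r (c - s n)"
          if n: "\<bar>c\<bar> + r \<le> real (Suc n)" for n
        proof -
          have "\<Lambda> j \<inter> {- r + c..r + c} = (\<lambda>x. x + s n) ` (T j \<inter> {- r + (c - s n)..r + (c - s n)})"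
          proof (intro set_eqI iffI)
            fix x assume "x \<in> \<Lambda> j \<inter> {- r + c..r + c}"
            then have "x - s n \<in> T j \<inter> {- r + (c - s n)..r + (c - s n)}" using s[of x n j] n by auto
            then show "x \<in> (\<lambda>x. x + s n) ` (T j \<inter> {- r + (c - s n)..r + (c - s n)})"
              by (force simp: image_iff)
          next
            fix x assume "x \<in> (\<lambda>x. x + s n) ` (T j \<inter> {- r + (c - s n)..r + (c - s n)})"
            then show "x \<in> \<Lambda> j \<inter> {- r + c..r + c}" using s[of x n j] n by auto
          qed
          then show ?thesis
            unfolding fb_average_ek by (simp add: sum.reindex ek_add sum_distrib_left mult_ac)
        qed
        obtain n0 where n0: "\<bar>c\<bar> + r \<le> real n0" using real_arch_simple by blast
        have "norm (fb_average \<Lambda> j k r c - u * A j) \<le> e / 2"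
        proof (rule Lim_bounded)
          show "(\<lambda>n. norm (fb_average \<Lambda> j k r c - ek k (s (\<phi> n)) * A j))
              \<longlonglongrightarrow> norm (fb_average \<Lambda> j k r c - u * A j)"
            using \<phi>(2) unfolding o_def by (intro tendsto_intros)
          show "\<forall>n\<ge>n0. norm (fb_average \<Lambda> j k r c - ek k (s (\<phi> n)) * A j) \<le> e / 2"
          proof (intro allI impI)
            fix n assume "n \<ge> n0"
            then have "n0 \<le> \<phi> n" using seq_suble[OF \<phi>(1), of n] by linarith
            then have "\<bar>c\<bar> + r \<le> real (Suc (\<phi> n))" using n0 by simp
            from shift[OF this] have "norm (fb_average \<Lambda> j k r c - ek k (s (\<phi> n)) * A j)
                = norm (fb_average T j k r (c - s (\<phi> n)) - A j)"
              by (simp add: right_diff_distrib[symmetric] norm_mult)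
            then show "norm (fb_average \<Lambda> j k r c - ek k (s (\<phi> n)) * A j) \<le> e / 2"
              using elim(1) by (simp add: dist_norm less_imp_le)
          qed
        qed
        then show "dist (fb_average \<Lambda> j k r c) (u * A j) < e" using \<open>e > 0\<close> by (simp add: dist_norm)
      qed
    qed
  qed
  ultimately show ?thesis by blast
qed

lemma fb_average_T_limits: "\<exists>A. \<forall>j. uniform_limit UNIV (fb_average T j k) (\<lambda>_. A j) at_top"
  unfolding fb_average_eq_avg by (rule choice) (intro allI exponential_avg_converges)

lemma hull_coloured_set:
  assumes \<Lambda>: "\<Lambda> \<in> tiling_hull T"
  shows "coloured_set \<Lambda> lmin"
proof
  have supp: "\<exists>s. \<forall>x. \<bar>x\<bar> \<le> R \<longrightarrow> (x \<in> support \<Lambda> \<longleftrightarrow> x - s \<in> support T)" if "R > 0" for R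
    using tiling_hull_mem[OF \<Lambda> that] unfolding support_def by (elim exE) (intro exI, auto)
  show "lmin > 0" by (rule lmin_pos)
  show "y - x \<ge> lmin" if "x \<in> support \<Lambda>" "y \<in> support \<Lambda>" "x < y" for x y
  proof -
    obtain s where "\<And>w. \<bar>w\<bar> \<le> \<bar>x\<bar> + \<bar>y\<bar> + 1 \<Longrightarrow> (w \<in> support \<Lambda> \<longleftrightarrow> w - s \<in> support T)"
      using supp[OF add_nonneg_pos[OF add_nonneg_nonneg[OF abs_ge_zero[of x] abs_ge_zero[of y]] zero_less_one]]
      by blast
    from this[of x] this[of y] that show ?thesis using support_sep[of "x - s" "y - s"] by simp
  qed
  show "finite ({y - x | x y. x \<in> support \<Lambda> \<and> y \<in> support \<Lambda>} \<inter> {- R..R})" for R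
  proof (rule finite_subset[OF _ finite_differences[of R]])
    show "{y - x | x y. x \<in> support \<Lambda> \<and> y \<in> support \<Lambda>} \<inter> {- R..R} \<subseteq> differences \<inter> {- R..R}"
    proof
      fix w assume "w \<in> {y - x | x y. x \<in> support \<Lambda> \<and> y \<in> support \<Lambda>} \<inter> {- R..R}"
      then obtain x y where w: "w = y - x" and xy: "x \<in> support \<Lambda>" "y \<in> support \<Lambda>" "y - x \<in> {- R..R}"
        by blast
      obtain s where "\<And>w. \<bar>w\<bar> \<le> \<bar>x\<bar> + \<bar>y\<bar> + 1 \<Longrightarrow> (w \<in> support \<Lambda> \<longleftrightarrow> w - s \<in> support T)"
        using supp[OF add_nonneg_pos[OF add_nonneg_nonneg[OF abs_ge_zero[of x] abs_ge_zero[of y]] zero_less_one]]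
      by blast
      from this[of x] this[of y] xy have "x - s \<in> support T" "y - s \<in> support T" by auto
      then have "(y - s) - (x - s) \<in> differences" unfolding differences_def by blast
      then show "w \<in> differences \<inter> {- R..R}" using xy by (simp add: w)
    qed
  qed
  show "\<exists>A. uniform_limit UNIV (fb_average \<Lambda> j k) (\<lambda>_. A) at_top" for j k
  proof -
    obtain A where "\<And>j. uniform_limit UNIV (fb_average T j k) (\<lambda>_. A j) at_top"
      using fb_average_T_limits by blast
    from hull_fb_average_limit[OF \<Lambda> this] show ?thesis by blast
  qed
  show "\<exists>d>0. uniform_limit UNIV
      (\<lambda>r c. real (card (support \<Lambda> \<inter> {- r + c..r + c})) / (2 * r)) (\<lambda>_. d) at_top"
  proof -
    note transfer = uniform_density_transfer[OF _ supp]
    obtain d where d: "d > 0" "uniform_limit UNIV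
        (\<lambda>r c. real (card (support T \<inter> {- r + c..r + c})) / (2 * r)) (\<lambda>_. d) at_top"
      using support_density by blast
    from transfer[OF d(2)] d(1) show ?thesis by (intro exI[of _ d] conjI)
  qed
  show "\<exists>d. uniform_limit UNIV
      (\<lambda>r c. real (card ((\<Lambda> i \<inter> (\<lambda>x. x - z) ` \<Lambda> j) \<inter> {- r + c..r + c})) / (2 * r)) (\<lambda>_. d) at_top" for i j z
  proof -
    have "\<exists>s. \<forall>x. \<bar>x\<bar> \<le> R \<longrightarrow> (x \<in> \<Lambda> i \<inter> (\<lambda>x. x - z) ` \<Lambda> j \<longleftrightarrow> x - s \<in> T i \<inter> (\<lambda>x. x - z) ` T j)"
      if "R > 0" for R
    proof -
      \<comment> \<open>Enlarging the radius by |z| keeps the partner x + z inside the region of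
        agreement.\<close>
      have "R + \<bar>z\<bar> > 0" using that by simp
      then obtain s where s: "\<And>i x. \<bar>x\<bar> \<le> R + \<bar>z\<bar> \<Longrightarrow> x \<in> \<Lambda> i \<longleftrightarrow> x - s \<in> T i"
        using tiling_hull_mem[OF \<Lambda>] by blast
      have mem: "x \<in> (\<lambda>x. x - z) ` S \<longleftrightarrow> x + z \<in> S" for x and S :: "real set"
        by (force simp: image_iff)
      have "x \<in> \<Lambda> i \<inter> (\<lambda>x. x - z) ` \<Lambda> j \<longleftrightarrow> x - s \<in> T i \<inter> (\<lambda>x. x - z) ` T j" if "\<bar>x\<bar> \<le> R" for x
        using s[of x i] s[of "x + z" j] that unfolding Int_iff mem by (simp add: algebra_simps)
      then show ?thesis by blast
    qed
    note transfer = uniform_density_transfer[OF _ this]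
    obtain d where d: "uniform_limit UNIV
        (\<lambda>r c. real (card ((T i \<inter> (\<lambda>x. x - z) ` T j) \<inter> {- r + c..r + c})) / (2 * r)) (\<lambda>_. d) at_top"
      using pair_density by blast
    from transfer[OF d] show ?thesis by (intro exI[of _ d])
  qed
qed

end

section \<open>Primitive substitutions\<close>

lemma matrix_pow_subst_matrix:
  fixes \<rho> :: "'a::finite \<Rightarrow> 'a list"
  shows "matrix_pow (subst_matrix \<rho>) n $ i $ j = real (count_list ((subst_word \<rho> ^^ n) [j]) i)"
proof (induction n arbitrary: i j)
  case 0
  show ?case by (simp add: matrix_pow_def mat_def)
next
  case (Suc n)
  have "matrix_pow (subst_matrix \<rho>) (Suc n) = subst_matrix \<rho> ** matrix_pow (subst_matrix \<rho>) n"
    by (simp add: matrix_pow_def)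
  then have "matrix_pow (subst_matrix \<rho>) (Suc n) $ i $ j
      = (\<Sum>l\<in>UNIV. subst_matrix \<rho> $ i $ l * matrix_pow (subst_matrix \<rho>) n $ l $ j)"
    by (simp add: matrix_matrix_mult_def)
  also have "\<dots> = (\<Sum>l\<in>UNIV. real (count_list ((subst_word \<rho> ^^ n) [j]) l * count_list ((subst_word \<rho> ^^ 1) [l]) i))"
    unfolding Suc by (simp add: subst_matrix_def mult.commute)
  also have "\<dots> = real (count_list ((subst_word \<rho> ^^ 1) ((subst_word \<rho> ^^ n) [j])) i)"
    unfolding count_subst_word_pow[where n = 1 and w = "(subst_word \<rho> ^^ n) [j]"] of_nat_sum ..
  finally show ?case by simp
qed

text \<open>The exponent is a multiple of a period N of T, so T becomes a fixed point, and at least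
  the primitivity exponent p, so every letter occurs in every image. Legality has to be reproved for
  the power.\<close>

lemma inflation_fixed_point_tiling:
  fixes \<rho> :: "'a::finite \<Rightarrow> 'a list"
  assumes prim: "primitive_substitution \<rho>" and lam: "lam > 1" and len: "\<forall>i. len $ i > 0"
    and eig: "len v* subst_matrix \<rho> = lam *s len" and fp: "inflation_fixed_point \<rho> lam len T"
  shows "\<exists>\<sigma> mu. legal_inflation_tiling \<sigma> mu len T"
proof -
  have wl: "wlen len (\<rho> i) = lam * len $ i" for i
  proof -
    have "(len v* subst_matrix \<rho>) $ i = lam * len $ i" unfolding eig by simp
    then show ?thesis
      unfolding wlen_conv_count by (simp add: vector_matrix_mult_def subst_matrix_def mult.commute)
  qed
  interpret base: natural_lengths \<rho> lam len
  proof
    show "0 < len $ i" for i using len by simp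
  qed (rule lam wl)+
  obtain p where p: "p \<ge> 1" "\<And>i j. 0 < matrix_pow (subst_matrix \<rho>) p $ i $ j"
    using prim unfolding primitive_substitution_def primitive_matrix_def by blast
  have occurs_p: "i \<in> set ((subst_word \<rho> ^^ p) [j])" for i j
    using p(2)[of i j] unfolding matrix_pow_subst_matrix by (auto intro: ccontr simp: count_list_0_iff)
  have nonempty: "(subst_word \<rho> ^^ n) [j] \<noteq> []" for n j
  proof (induction n)
    case (Suc n)
    have "\<rho> i \<noteq> []" for i using prim by (simp add: primitive_substitution_def)
    then show ?case using Suc by (cases "(subst_word \<rho> ^^ n) [j]") (auto simp: subst_word_def)
  qed simp
  have occurs: "i \<in> set ((subst_word \<rho> ^^ q) [j])" if "q \<ge> p" for q i j
  proof -
    obtain l where l: "l \<in> set ((subst_word \<rho> ^^ (q - p)) [j])" using nonempty[of "q - p" j] by fastforce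
    have "(subst_word \<rho> ^^ q) [j] = (subst_word \<rho> ^^ p) ((subst_word \<rho> ^^ (q - p)) [j])"
      using that funpow_add[of p "q - p" "subst_word \<rho>"] by simp
    then show ?thesis using l occurs_p set_subst_word_pow[of p \<rho> "(subst_word \<rho> ^^ (q - p)) [j]"] by auto
  qed
  obtain N where N: "N \<ge> 1" "(inflate \<rho> lam len ^^ N) T = T" and tiling: "is_tiling len T" and leg: "legal \<rho> len T"
    using fp unfolding inflation_fixed_point_def by blast
  define P where "P = N * p"
  have P: "P \<ge> p" "P \<ge> 1" using N p by (simp_all add: P_def)
  define \<sigma> where "\<sigma> a = (subst_word \<rho> ^^ P) [a]" for a
  have pow: "(subst_word \<sigma> ^^ n) w = (subst_word \<rho> ^^ (P * n)) w" for n w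
    unfolding \<sigma>_def by (rule subst_word_pow_pow)
  interpret natural_lengths \<sigma> "lam ^ P" len
  proof
    show "1 < lam ^ P" using lam P by (intro one_less_power) auto
    show "0 < len $ i" for i using len by simp
    show "wlen len (\<sigma> i) = lam ^ P * len $ i" for i unfolding \<sigma>_def by (simp add: base.wlen_subst_pow)
  qed
  have fixed: "inflate \<sigma> (lam ^ P) len T = T"
  proof -
    have "inflate \<sigma> (lam ^ P) len T j = (inflate \<rho> lam len ^^ P) T j" for j
      unfolding inflate_conv_tiles base.inflate_pow_conv_tiles \<sigma>_def ..
    moreover have "(inflate \<rho> lam len ^^ P) T = T"
    proof -
      have "((inflate \<rho> lam len ^^ N) ^^ p) T = T" by (induction p) (simp_all add: N(2))
      then show ?thesis by (simp add: P_def funpow_mult)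
    qed
    ultimately show ?thesis by auto
  qed
  have "legal_inflation_tiling \<sigma> (lam ^ P) len T"
  proof
    show "0 < len $ i" for i using len by simp
    show "is_tiling len T" by (rule tiling)
    show "inflate \<sigma> (lam ^ P) len T = T" by (rule fixed)
    show "i \<in> set (\<sigma> j)" for i j unfolding \<sigma>_def by (rule occurs[OF P(1)])
    fix x i j assume "x \<in> T i" "x + len $ i \<in> T j"
    then obtain n a where na: "sublist [i, j] ((subst_word \<rho> ^^ n) [a])" using leg unfolding legal_def by blast
    \<comment> \<open>The legal pair occurs in an n-th iterate, but n need not be a multiple of P.
      Adding q steps reaches the exponent P (n + 1), and the letter a occurs in its own q-th iterate
      because q is at least p.\<close>
    define q where "q = P * Suc n - n"
    have "P * Suc n \<ge> P + n"
    proof -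
      have "1 * n \<le> P * n" using P by (intro mult_le_mono1)
      then show ?thesis by simp
    qed
    then have q: "q \<ge> p" "P * Suc n = n + q" using P unfolding q_def by linarith+
    have "a \<in> set ((subst_word \<rho> ^^ q) [a])" by (rule occurs[OF q(1)])
    then obtain u v where uv: "(subst_word \<rho> ^^ q) [a] = u @ [a] @ v" by (metis split_list append_Cons append_Nil)
    have "(subst_word \<sigma> ^^ Suc n) [a] = (subst_word \<rho> ^^ n) ((subst_word \<rho> ^^ q) [a])"
      unfolding pow q(2) funpow_add by simp
    also have "\<dots> = (subst_word \<rho> ^^ n) u @ (subst_word \<rho> ^^ n) [a] @ (subst_word \<rho> ^^ n) v"
      unfolding uv subst_word_pow_append ..
    finally have "sublist ((subst_word \<rho> ^^ n) [a]) ((subst_word \<sigma> ^^ Suc n) [a])"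
      unfolding sublist_def by blast
    with na have "sublist [i, j] ((subst_word \<sigma> ^^ Suc n) [a])" by (rule sublist_order.order_trans)
    then show "\<exists>n a. sublist [i, j] ((subst_word \<sigma> ^^ n) [a])" by blast
  qed
  then show ?thesis by blast
qed

section \<open>Correlations of coloured point sets\<close>

text \<open>An exchange of limits: \<alpha> K is the error of the truncation at K, uniform in r, and
  \<beta> K / r the boundary error, which vanishes for fixed K as r grows.\<close>

lemma tendsto_by_truncation:
  fixes L :: "real \<Rightarrow> complex"
  assumes approx: "\<And>K r. r \<ge> 1 \<Longrightarrow> norm (L r - G K r) \<le> \<alpha> K + \<beta> K / r"
    and "\<alpha> \<longlonglongrightarrow> 0" and G: "\<And>K. (G K \<longlongrightarrow> S K) at_top" and S: "S \<longlonglongrightarrow> I"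
  shows "(L \<longlongrightarrow> I) at_top"
proof (rule tendstoI)
  fix e :: real assume e: "e > 0"
  have "\<forall>\<^sub>F K in sequentially. \<alpha> K < e / 4 \<and> dist (S K) I < e / 4"
    using e by (intro eventually_conj order_tendstoD(2)[OF \<open>\<alpha> \<longlonglongrightarrow> 0\<close>] tendstoD[OF S]) auto
  then obtain K where K: "\<alpha> K < e / 4" "dist (S K) I < e / 4"
    using eventually_happens' sequentially_bot by blast
  have "((\<lambda>r::real. \<beta> K / r) \<longlongrightarrow> 0) at_top"
    by (rule tendsto_divide_0[OF tendsto_const]) (rule filterlim_at_top_imp_at_infinity[OF filterlim_ident])
  then have "\<forall>\<^sub>F r in at_top. \<beta> K / r < e / 4" using e by (intro order_tendstoD) auto
  moreover have "\<forall>\<^sub>F r in at_top. dist (G K r) (S K) < e / 4" using e by (intro tendstoD[OF G]) auto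
  ultimately show "\<forall>\<^sub>F r in at_top. dist (L r) I < e"
    using eventually_ge_at_top[of 1]
  proof eventually_elim
    case (elim r)
    have "dist (L r) I \<le> dist (L r) (G K r) + dist (G K r) (S K) + dist (S K) I"
      by (meson add_mono dist_triangle_le dist_triangle order_refl order_trans)
    then show ?case using approx[of r K] elim K unfolding dist_norm by linarith
  qed
qed

text \<open>The largest value of 1 / (1 + u^2) for n <= |u| < n + 1.\<close>

definition shell :: "nat \<Rightarrow> real" where "shell n = 1 / (1 + (real n)\<^sup>2)"

lemma summable_shell: "summable shell"
proof (rule summable_comparison_test')
  show "summable (\<lambda>n. inverse ((real n)\<^sup>2))" by (rule inverse_power_summable) simp
  show "norm (shell n) \<le> inverse ((real n)\<^sup>2)" if "n \<ge> 1" for n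
  proof -
    have "(real n)\<^sup>2 > 0" using that by simp
    then show ?thesis unfolding shell_def by (simp add: inverse_eq_divide frac_le)
  qed
qed

lemma shell_nonneg: "shell n \<ge> 0" by (simp add: shell_def)

section \<open>Decaying kernels summed over a coloured set, and limits of correlations\<close>

context coloured_set begin

text \<open>The constant bounds the number of points whose distance from a given x lies between n
  and n + 1: two intervals of length 1 with at most 1 / \<delta> + 1 points each.\<close>

definition tail :: "nat \<Rightarrow> real" where
  "tail K = 2 * (1 / \<delta> + 1) * (\<Sum>n. shell (n + K))"

lemma tail_tendsto: "tail \<longlonglongrightarrow> 0"
  unfolding tail_def
  by (rule tendsto_mult_right_zero) (rule suminf_exist_split2[OF summable_shell])

lemma tail_nonneg: "tail K \<ge> 0"
  unfolding tail_def using \<delta>_pos shell_nonneg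
  by (intro mult_nonneg_nonneg suminf_nonneg summable_ignore_initial_segment summable_shell) auto

lemma discrete:
  "finite (support \<Lambda> \<inter> {a..b})"
  "a \<le> b \<Longrightarrow> real (card (support \<Lambda> \<inter> {a..b})) \<le> (b - a) / \<delta> + 1"
  using uniformly_discrete_card[OF \<delta>_pos, of "support \<Lambda>" a b] sep by blast+

lemma sub_support: "\<Lambda> i \<subseteq> support \<Lambda>" by (auto simp: support_def)

lemma finite_part [simp]: "finite (\<Lambda> i \<inter> {a..b})"
  by (rule finite_subset[OF _ discrete(1)[of a b]]) (use sub_support in auto)

lemma card_part: "a \<le> b \<Longrightarrow> real (card (\<Lambda> i \<inter> {a..b})) \<le> (b - a) / \<delta> + 1"
proof -
  assume "a \<le> b"
  have "card (\<Lambda> i \<inter> {a..b}) \<le> card (support \<Lambda> \<inter> {a..b})"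
    by (rule card_mono[OF discrete(1)]) (use sub_support in auto)
  then show ?thesis using discrete(2)[OF \<open>a \<le> b\<close>] by linarith
qed

lemma kernel_sum:
  assumes F: "finite F" "F \<subseteq> support \<Lambda>" "\<And>y. y \<in> F \<Longrightarrow> real K \<le> \<bar>y - x\<bar>"
  shows "(\<Sum>y\<in>F. 1 / (1 + (y - x)\<^sup>2)) \<le> tail K"
proof -
  let ?n = "\<lambda>y. nat \<lfloor>\<bar>y - x\<bar>\<rfloor>"
  have n_le: "real (?n y) \<le> \<bar>y - x\<bar>" for y by (simp add: of_nat_floor)
  have n_ge: "\<bar>y - x\<bar> \<le> real (?n y) + 1" for y by linarith
  have fib: "real (card {y \<in> F. ?n y = n}) \<le> 2 * (1 / \<delta> + 1)" for n
  proof -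
    let ?A = "support \<Lambda> \<inter> {x + real n..x + real n + 1}"
    let ?B = "support \<Lambda> \<inter> {x - real n - 1..x - real n}"
    have "{y \<in> F. ?n y = n} \<subseteq> ?A \<union> ?B"
    proof
      fix y assume "y \<in> {y \<in> F. ?n y = n}"
      then have "y \<in> support \<Lambda>" "real n \<le> \<bar>y - x\<bar>" "\<bar>y - x\<bar> \<le> real n + 1"
        using F(2) n_le[of y] n_ge[of y] by auto
      then show "y \<in> ?A \<union> ?B" by (cases "y \<ge> x") auto
    qed
    then have "card {y \<in> F. ?n y = n} \<le> card (?A \<union> ?B)"
      by (rule card_mono[rotated]) (intro finite_UnI discrete(1))
    also have "\<dots> \<le> card ?A + card ?B" by (rule card_Un_le)
    finally have "real (card {y \<in> F. ?n y = n}) \<le> real (card ?A) + real (card ?B)" by linarith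
    also have "\<dots> \<le> (1 / \<delta> + 1) + (1 / \<delta> + 1)"
      using discrete(2)[of "x + real n" "x + real n + 1"] discrete(2)[of "x - real n - 1" "x - real n"]
      by (intro add_mono) simp_all
    finally show ?thesis by simp
  qed
  have "(\<Sum>y\<in>F. 1 / (1 + (y - x)\<^sup>2)) \<le> (\<Sum>y\<in>F. shell (?n y))"
  proof (rule sum_mono)
    fix y assume "y \<in> F"
    have "(real (?n y))\<^sup>2 \<le> \<bar>y - x\<bar>\<^sup>2" using n_le[of y] by (intro power_mono) auto
    then show "1 / (1 + (y - x)\<^sup>2) \<le> shell (?n y)"
      unfolding shell_def by (intro divide_left_mono mult_pos_pos add_pos_nonneg) auto
  qed
  also have "\<dots> = (\<Sum>n\<in>?n ` F. \<Sum>y\<in>{y \<in> F. ?n y = n}. shell (?n y))"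
    by (rule sum.image_gen[OF F(1)])
  also have "\<dots> = (\<Sum>n\<in>?n ` F. real (card {y \<in> F. ?n y = n}) * shell n)"
    by (intro sum.cong refl) simp
  also have "\<dots> \<le> (\<Sum>n\<in>?n ` F. 2 * (1 / \<delta> + 1) * shell n)"
    by (intro sum_mono mult_right_mono fib shell_nonneg)
  also have "\<dots> = 2 * (1 / \<delta> + 1) * (\<Sum>n\<in>?n ` F. shell n)" by (simp add: sum_distrib_left)
  also have "(\<Sum>n\<in>?n ` F. shell n) = (\<Sum>n\<in>(\<lambda>n. n - K) ` ?n ` F. shell (n + K))"
  proof (rule sum.reindex_bij_witness[of _ "\<lambda>n. n + K" "\<lambda>n. n - K"])
    have ge: "K \<le> n" if "n \<in> ?n ` F" for n using that F(3) by (auto simp: le_nat_floor)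
    show "n - K + K = n" "shell (n - K + K) = shell n" if "n \<in> ?n ` F" for n
      using ge[OF that] by simp_all
    show "m + K \<in> ?n ` F" if m: "m \<in> (\<lambda>n. n - K) ` ?n ` F" for m
    proof -
      obtain n where "n \<in> ?n ` F" "m = n - K" using m by blast
      then show ?thesis using ge[of n] by simp
    qed
  qed (rule imageI, assumption | simp)+
  also have "(\<Sum>n\<in>(\<lambda>n. n - K) ` ?n ` F. shell (n + K)) \<le> (\<Sum>n. shell (n + K))"
    using F(1) by (intro sum_le_suminf summable_ignore_initial_segment summable_shell) (auto simp: shell_nonneg)
  finally show ?thesis unfolding tail_def using \<delta>_pos by (simp add: mult_left_mono)
qed

lemma norm_kernel_sum:
  fixes f :: "real \<Rightarrow> complex"
  assumes f: "\<And>u. norm (f u) \<le> B / (1 + u\<^sup>2)"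
    and F: "finite F" "F \<subseteq> support \<Lambda>" "\<And>y. y \<in> F \<Longrightarrow> real K \<le> \<bar>y - x\<bar>"
  shows "norm (\<Sum>y\<in>F. f (y - x)) \<le> B * tail K"
proof -
  have "B \<ge> 0" using order_trans[OF norm_ge_zero f[of 0]] by simp
  have "norm (\<Sum>y\<in>F. f (y - x)) \<le> (\<Sum>y\<in>F. B * (1 / (1 + (y - x)\<^sup>2)))"
    by (rule sum_norm_le) (use f in simp)
  also have "\<dots> = B * (\<Sum>y\<in>F. 1 / (1 + (y - x)\<^sup>2))" by (simp add: sum_distrib_left)
  also have "\<dots> \<le> B * tail K" by (intro mult_left_mono kernel_sum F \<open>B \<ge> 0\<close>)
  finally show ?thesis .
qed

definition \<Delta> :: "real set" where
  "\<Delta> = {y - x | x y. x \<in> support \<Lambda> \<and> y \<in> support \<Lambda>}"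

definition \<eta> :: "'a \<Rightarrow> 'a \<Rightarrow> real \<Rightarrow> real" where
  "\<eta> i j z = dens (\<Lambda> i \<inter> (\<lambda>x. x - z) ` \<Lambda> j)"

lemma finite_\<Delta>: "finite (\<Delta> \<inter> {- R..R})"
  unfolding \<Delta>_def by (rule flc)

lemma \<eta>_limit:
  "((\<lambda>r. real (card (\<Lambda> i \<inter> (\<lambda>x. x - z) ` \<Lambda> j \<inter> {- r..r})) / (2 * r)) \<longlongrightarrow> \<eta> i j z) at_top"
proof -
  obtain d where d: "uniform_limit UNIV
      (\<lambda>r c. real (card ((\<Lambda> i \<inter> (\<lambda>x. x - z) ` \<Lambda> j) \<inter> {- r + c..r + c})) / (2 * r)) (\<lambda>_. d) at_top"
    using pair_dens by blast
  then have "\<eta> i j z = d" unfolding \<eta>_def by (rule dens_eqI)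
  then show ?thesis using tendsto_uniform_limitI[OF d, of 0] by simp
qed

lemma \<eta>_nonneg: "\<eta> i j z \<ge> 0"
proof (rule tendsto_lowerbound[OF \<eta>_limit])
  show "\<forall>\<^sub>F r in at_top. 0 \<le> real (card (\<Lambda> i \<inter> (\<lambda>x. x - z) ` \<Lambda> j \<inter> {- r..r})) / (2 * r)"
    using eventually_gt_at_top[of 0] by eventually_elim simp
qed simp

text \<open>Only x is confined to [-r, r], while y is confined relative to x. For fixed K the
  differences then range over a finite set, and the limit can be taken term by term with the pair
  densities.\<close>

definition trunc_corr :: "'a \<Rightarrow> 'a \<Rightarrow> (real \<Rightarrow> complex) \<Rightarrow> nat \<Rightarrow> real \<Rightarrow> complex" where
  "trunc_corr i j f K r = (\<Sum>x\<in>\<Lambda> i \<inter> {- r..r}. \<Sum>y\<in>\<Lambda> j \<inter> {x - real K..x + real K}. f (y - x)) / of_real (2 * r)"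

lemma trunc_corr_limit:
  "(trunc_corr i j f K \<longlongrightarrow> (\<Sum>z\<in>\<Delta> \<inter> {- real K..real K}. of_real (\<eta> i j z) * f z)) at_top"
proof -
  have eq: "trunc_corr i j f K r = (\<Sum>z\<in>\<Delta> \<inter> {- real K..real K}.
      of_real (real (card (\<Lambda> i \<inter> (\<lambda>x. x - z) ` \<Lambda> j \<inter> {- r..r})) / (2 * r)) * f z)" for r
  proof -
    let ?W = "\<Lambda> i \<inter> {- r..r}" and ?Z = "\<Delta> \<inter> {- real K..real K}"
    have inner: "(\<Sum>y\<in>\<Lambda> j \<inter> {x - real K..x + real K}. f (y - x)) = (\<Sum>z\<in>?Z. if x + z \<in> \<Lambda> j then f z else 0)"
      if x: "x \<in> ?W" for x
    proof -
      have "(\<Sum>y\<in>\<Lambda> j \<inter> {x - real K..x + real K}. f (y - x)) = (\<Sum>z\<in>{z \<in> ?Z. x + z \<in> \<Lambda> j}. f z)"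
      proof (rule sum.reindex_bij_witness[of _ "\<lambda>z. x + z" "\<lambda>y. y - x"])
        fix y assume y: "y \<in> \<Lambda> j \<inter> {x - real K..x + real K}"
        have "x \<in> support \<Lambda>" "y \<in> support \<Lambda>" using x y sub_support by auto
        then have "y - x \<in> \<Delta>" unfolding \<Delta>_def by blast
        then show "y - x \<in> {z \<in> ?Z. x + z \<in> \<Lambda> j}" using y by auto
      qed auto
      also have "\<dots> = (\<Sum>z\<in>?Z. if x + z \<in> \<Lambda> j then f z else 0)"
        by (rule sum.inter_filter[OF finite_\<Delta>])
      finally show ?thesis .
    qed
    have card: "(\<Sum>x\<in>?W. if x + z \<in> \<Lambda> j then f z else 0)
        = of_nat (card (\<Lambda> i \<inter> (\<lambda>x. x - z) ` \<Lambda> j \<inter> {- r..r})) * f z" for z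
    proof -
      have "\<Lambda> i \<inter> (\<lambda>x. x - z) ` \<Lambda> j \<inter> {- r..r} = {x \<in> ?W. x + z \<in> \<Lambda> j}"
        by (force simp: image_iff)
      moreover have "(\<Sum>x\<in>?W. if x + z \<in> \<Lambda> j then f z else 0) = (\<Sum>x\<in>{x \<in> ?W. x + z \<in> \<Lambda> j}. f z)"
        by (rule sum.inter_filter[symmetric]) (rule finite_part)
      ultimately show ?thesis by simp
    qed
    have "(\<Sum>x\<in>?W. \<Sum>y\<in>\<Lambda> j \<inter> {x - real K..x + real K}. f (y - x)) = (\<Sum>x\<in>?W. \<Sum>z\<in>?Z. if x + z \<in> \<Lambda> j then f z else 0)"
      by (intro sum.cong refl inner)
    also have "\<dots> = (\<Sum>z\<in>?Z. of_nat (card (\<Lambda> i \<inter> (\<lambda>x. x - z) ` \<Lambda> j \<inter> {- r..r})) * f z)"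
      by (subst sum.swap) (simp only: card)
    finally show ?thesis unfolding trunc_corr_def by (simp add: sum_divide_distrib)
  qed
  show ?thesis unfolding eq by (intro tendsto_sum tendsto_mult tendsto_of_real \<eta>_limit tendsto_const)
qed

lemma card_ratio: "r \<ge> 1 \<Longrightarrow> real (card (\<Lambda> i \<inter> {- r..r})) / (2 * r) \<le> 1 / \<delta> + 1"
proof -
  assume "r \<ge> 1"
  have "real (card (\<Lambda> i \<inter> {- r..r})) \<le> 2 * r / \<delta> + 1" using card_part[of "- r" r i] \<open>r \<ge> 1\<close> by simp
  also have "\<dots> \<le> 2 * r / \<delta> + 2 * r" using \<open>r \<ge> 1\<close> by simp
  also have "\<dots> = (1 / \<delta> + 1) * (2 * r)" using \<delta>_pos by (simp add: field_simps)
  finally show ?thesis using \<open>r \<ge> 1\<close> by (simp add: pos_divide_le_eq)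
qed

lemma norm_trunc_corr_le:
  assumes "\<And>x. norm (\<Sum>y\<in>\<Lambda> j \<inter> {x - real K..x + real K}. f (y - x)) \<le> C" "r \<ge> 1"
  shows "norm (trunc_corr i j f K r) \<le> C * (1 / \<delta> + 1)"
proof -
  have C: "C \<ge> 0" using assms(1)[of 0] norm_ge_zero order_trans by blast
  have "norm (trunc_corr i j f K r) = norm (\<Sum>x\<in>\<Lambda> i \<inter> {- r..r}. \<Sum>y\<in>\<Lambda> j \<inter> {x - real K..x + real K}. f (y - x)) / (2 * r)"
    unfolding trunc_corr_def norm_divide norm_of_real using assms(2) by simp
  also have "\<dots> \<le> (of_nat (card (\<Lambda> i \<inter> {- r..r})) * C) / (2 * r)"
    using assms by (intro divide_right_mono sum_norm_bound) auto
  also have "\<dots> = C * (real (card (\<Lambda> i \<inter> {- r..r})) / (2 * r))" by simp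
  also have "\<dots> \<le> C * (1 / \<delta> + 1)" by (intro mult_left_mono card_ratio C assms)
  finally show ?thesis .
qed

text \<open>The bound holds for the finite averages, where each row is summed by
  \<open>norm_kernel_sum\<close>, and passes to the limit. It does not depend on K, which is what
  integrability over all differences requires.\<close>

lemma corr_bound:
  fixes f :: "real \<Rightarrow> complex"
  assumes f: "\<And>u. norm (f u) \<le> B / (1 + u\<^sup>2)"
  shows "(\<Sum>z\<in>\<Delta> \<inter> {- real K..real K}. \<eta> i j z * norm (f z)) \<le> B * tail 0 * (1 / \<delta> + 1)"
proof -
  let ?g = "\<lambda>u. complex_of_real (norm (f u))"
  have bound: "norm (\<Sum>y\<in>\<Lambda> j \<inter> {x - real K..x + real K}. ?g (y - x)) \<le> B * tail 0" for x
    by (rule norm_kernel_sum) (use f sub_support in auto)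
  have "norm (\<Sum>z\<in>\<Delta> \<inter> {- real K..real K}. of_real (\<eta> i j z) * ?g z) \<le> B * tail 0 * (1 / \<delta> + 1)"
  proof (rule tendsto_upperbound[OF tendsto_norm[OF trunc_corr_limit]])
    show "\<forall>\<^sub>F r in at_top. norm (trunc_corr i j ?g K r) \<le> B * tail 0 * (1 / \<delta> + 1)"
      using eventually_ge_at_top[of 1] by eventually_elim (rule norm_trunc_corr_le[OF bound])
  qed simp
  also have "(\<Sum>z\<in>\<Delta> \<inter> {- real K..real K}. of_real (\<eta> i j z) * ?g z)
      = of_real (\<Sum>z\<in>\<Delta> \<inter> {- real K..real K}. \<eta> i j z * norm (f z))" by simp
  finally show ?thesis unfolding norm_of_real by linarith
qed

lemma corr_integrable:
  fixes f :: "real \<Rightarrow> complex"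
  assumes f: "\<And>u. norm (f u) \<le> B / (1 + u\<^sup>2)"
  shows "integrable (count_space \<Delta>) (\<lambda>z. of_real (\<eta> i j z) * f z)"
    and "(\<lambda>K. \<Sum>z\<in>\<Delta> \<inter> {- real K..real K}. of_real (\<eta> i j z) * f z)
      \<longlonglongrightarrow> (LINT z|count_space \<Delta>. of_real (\<eta> i j z) * f z)"
proof -
  let ?h = "\<lambda>z. of_real (\<eta> i j z) * f z"
  let ?C = "B * tail 0 * (1 / \<delta> + 1)"
  let ?I = "\<lambda>K. indicator {- real K..real K} :: real \<Rightarrow> ennreal"
  have "(\<integral>\<^sup>+ z. norm (?h z) \<partial>count_space \<Delta>) = (\<integral>\<^sup>+ z. (SUP K. norm (?h z) * ?I K z) \<partial>count_space \<Delta>)"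
  proof (rule nn_integral_cong)
    fix z
    obtain K where K: "\<bar>z\<bar> \<le> real K" using real_arch_simple by blast
    show "ennreal (norm (?h z)) = (SUP K. norm (?h z) * ?I K z)"
    proof (rule antisym)
      have "ennreal (norm (?h z)) = norm (?h z) * ?I K z" using K by (auto simp: indicator_def)
      also have "\<dots> \<le> (SUP K. norm (?h z) * ?I K z)" by (rule SUP_upper) simp
      finally show "ennreal (norm (?h z)) \<le> (SUP K. norm (?h z) * ?I K z)" .
      show "(SUP K. norm (?h z) * ?I K z) \<le> ennreal (norm (?h z))"
        by (intro SUP_least) (auto simp: indicator_def)
    qed
  qed
  also have "\<dots> = (SUP K. \<integral>\<^sup>+ z. norm (?h z) * ?I K z \<partial>count_space \<Delta>)"
  proof (rule nn_integral_monotone_convergence_SUP)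
    show "incseq (\<lambda>K z. ennreal (norm (?h z)) * ?I K z)"
      by (rule incseq_SucI) (auto simp: le_fun_def indicator_def)
  qed simp
  also have "\<dots> \<le> ennreal ?C"
  proof (rule SUP_least)
    fix K
    have "(\<integral>\<^sup>+ z. norm (?h z) * ?I K z \<partial>count_space \<Delta>) = (\<Sum>z\<in>\<Delta> \<inter> {- real K..real K}. ennreal (norm (?h z)))"
    proof (subst nn_integral_count_space'[of "\<Delta> \<inter> {- real K..real K}"])
      show "(\<Sum>z\<in>\<Delta> \<inter> {- real K..real K}. norm (?h z) * ?I K z) = (\<Sum>z\<in>\<Delta> \<inter> {- real K..real K}. ennreal (norm (?h z)))"
        by (intro sum.cong) auto
    qed (auto simp: finite_\<Delta> indicator_def)
    also have "\<dots> = ennreal (\<Sum>z\<in>\<Delta> \<inter> {- real K..real K}. \<eta> i j z * norm (f z))"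
      by (subst sum_ennreal) (auto simp: norm_mult \<eta>_nonneg)
    also have "\<dots> \<le> ennreal ?C" by (intro ennreal_leI corr_bound f)
    finally show "(\<integral>\<^sup>+ z. norm (?h z) * ?I K z \<partial>count_space \<Delta>) \<le> ennreal ?C" .
  qed
  also have "\<dots> < \<infinity>" by simp
  finally show int: "integrable (count_space \<Delta>) ?h"
    unfolding integrable_iff_bounded by simp
  have "(\<lambda>K. LINT z|count_space \<Delta>. indicator {- real K..real K} z *\<^sub>R ?h z) \<longlonglongrightarrow> (LINT z|count_space \<Delta>. ?h z)"
  proof (rule integral_dominated_convergence[where w = "\<lambda>z. norm (?h z)"])
    show "AE z in count_space \<Delta>. (\<lambda>K. indicator {- real K..real K} z *\<^sub>R ?h z) \<longlonglongrightarrow> ?h z"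
    proof (rule AE_I2, rule tendsto_eventually)
      fix z
      obtain K where K: "\<bar>z\<bar> \<le> real K" using real_arch_simple by blast
      show "\<forall>\<^sub>F K in sequentially. indicator {- real K..real K} z *\<^sub>R ?h z = ?h z"
        using eventually_ge_at_top[of K] by eventually_elim (use K in \<open>auto simp: indicator_def\<close>)
    qed
  qed (use int in \<open>auto simp: indicator_def\<close>)
  moreover have "(LINT z|count_space \<Delta>. indicator {- real K..real K} z *\<^sub>R ?h z)
      = (\<Sum>z\<in>\<Delta> \<inter> {- real K..real K}. ?h z)" for K
  proof -
    have "finite {z \<in> \<Delta>. indicator {- real K..real K} z *\<^sub>R ?h z \<noteq> 0}"
      by (rule finite_subset[OF _ finite_\<Delta>[of K]]) (auto simp: indicator_def)
    then have "(LINT z|count_space \<Delta>. indicator {- real K..real K} z *\<^sub>R ?h z)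
        = (\<Sum>z | z \<in> \<Delta> \<and> indicator {- real K..real K} z *\<^sub>R ?h z \<noteq> 0. indicator {- real K..real K} z *\<^sub>R ?h z)"
      by (rule lebesgue_integral_count_space_finite_support)
    also have "\<dots> = (\<Sum>z\<in>\<Delta> \<inter> {- real K..real K}. ?h z)"
      by (rule sum.mono_neutral_cong_left) (auto simp: finite_\<Delta> indicator_def)
    finally show ?thesis .
  qed
  ultimately show "(\<lambda>K. \<Sum>z\<in>\<Delta> \<inter> {- real K..real K}. ?h z) \<longlonglongrightarrow> (LINT z|count_space \<Delta>. ?h z)" by simp
qed

text \<open>Compared with \<open>trunc_corr\<close>, the square window adds pairs farther apart than
  K, controlled by \<open>tail K\<close>, and omits y outside the window, which concerns only x
  within K of an end.\<close>

lemma corr_limit: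
  fixes f :: "real \<Rightarrow> complex"
  assumes f: "\<And>u. norm (f u) \<le> B / (1 + u\<^sup>2)"
  shows "((\<lambda>r. (\<Sum>x\<in>\<Lambda> i \<inter> {- r..r}. \<Sum>y\<in>\<Lambda> j \<inter> {- r..r}. f (y - x)) / of_real (2 * r))
    \<longlongrightarrow> (LINT z|count_space \<Delta>. of_real (\<eta> i j z) * f z)) at_top"
proof -
  have B: "B \<ge> 0" using order_trans[OF norm_ge_zero f[of 0]] by simp
  define \<alpha> where "\<alpha> K = B * tail K * (1 / \<delta> + 1)" for K
  define \<beta> where "\<beta> K = B * tail 0 * (2 * (real K / \<delta> + 1)) / 2" for K
  have \<alpha>: "\<alpha> \<longlonglongrightarrow> 0"
    unfolding \<alpha>_def by (intro tendsto_mult_left_zero tendsto_mult_right_zero tail_tendsto)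
  have approx: "norm ((\<Sum>x\<in>\<Lambda> i \<inter> {- r..r}. \<Sum>y\<in>\<Lambda> j \<inter> {- r..r}. f (y - x)) / of_real (2 * r)
      - trunc_corr i j f K r) \<le> \<alpha> K + \<beta> K / r" if r: "r \<ge> 1" for K :: nat and r :: real
  proof -
    let ?W = "\<lambda>i. \<Lambda> i \<inter> {- r..r}" and ?V = "\<lambda>x. \<Lambda> j \<inter> {x - real K..x + real K}"
    let ?E = "?W i \<inter> ({- r..- r + real K} \<union> {r - real K..r})"
    have split: "(\<Sum>y\<in>?W j. f (y - x)) - (\<Sum>y\<in>?V x. f (y - x))
        = (\<Sum>y\<in>?W j - ?V x. f (y - x)) - (\<Sum>y\<in>?V x - ?W j. f (y - x))" for x
      using sum.Int_Diff[of "?W j" "\<lambda>y. f (y - x)" "?V x"] sum.Int_Diff[of "?V x" "\<lambda>y. f (y - x)" "?W j"]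
      by (simp add: Int_commute Int_left_commute Int_assoc)
    have 1: "norm (\<Sum>y\<in>?W j - ?V x. f (y - x)) \<le> B * tail K" for x
      by (rule norm_kernel_sum[OF f]) (use sub_support in auto)
    have 2: "norm (\<Sum>y\<in>?V x - ?W j. f (y - x)) \<le> B * tail 0" for x
      by (rule norm_kernel_sum[OF f]) (use sub_support in auto)
    have 3: "(\<Sum>y\<in>?V x - ?W j. f (y - x)) = 0" if "x \<in> ?W i" "x \<notin> ?E" for x
    proof -
      have "?V x - ?W j = {}" using that by auto
      then show ?thesis by (simp only: sum.empty)
    qed
    have "card ?E \<le> card (\<Lambda> i \<inter> {- r..- r + real K}) + card (\<Lambda> i \<inter> {r - real K..r})"
      by (rule order_trans[OF card_mono card_Un_le]) auto
    also have "real \<dots> \<le> 2 * (real K / \<delta> + 1)"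
      using card_part[of "- r" "- r + K" i] card_part[of "r - K" r i] by simp
    finally have E: "real (card ?E) \<le> 2 * (real K / \<delta> + 1)" by simp
    let ?S = "\<Sum>x\<in>?W i. \<Sum>y\<in>?W j. f (y - x)" and ?S' = "\<Sum>x\<in>?W i. \<Sum>y\<in>?V x. f (y - x)"
    have "?S - ?S' = (\<Sum>x\<in>?W i. \<Sum>y\<in>?W j - ?V x. f (y - x)) - (\<Sum>x\<in>?W i. \<Sum>y\<in>?V x - ?W j. f (y - x))"
      unfolding sum_subtractf[symmetric] split ..
    also have "(\<Sum>x\<in>?W i. \<Sum>y\<in>?V x - ?W j. f (y - x)) = (\<Sum>x\<in>?E. \<Sum>y\<in>?V x - ?W j. f (y - x))"
      by (rule sum.mono_neutral_right) (use 3 in auto)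
    finally have "norm (?S - ?S') \<le> norm (\<Sum>x\<in>?W i. \<Sum>y\<in>?W j - ?V x. f (y - x))
        + norm (\<Sum>x\<in>?E. \<Sum>y\<in>?V x - ?W j. f (y - x))"
      by (simp add: norm_triangle_ineq4)
    also have "\<dots> \<le> of_nat (card (?W i)) * (B * tail K) + of_nat (card ?E) * (B * tail 0)"
      by (intro add_mono sum_norm_bound 1 2)
    also have "\<dots> \<le> real (card (?W i)) * (B * tail K) + 2 * (real K / \<delta> + 1) * (B * tail 0)"
      using E B tail_nonneg by (intro add_mono mult_right_mono) auto
    finally have N: "norm (?S - ?S') \<le> real (card (?W i)) * (B * tail K) + 2 * (real K / \<delta> + 1) * (B * tail 0)" .
    have "norm (?S / of_real (2 * r) - trunc_corr i j f K r) = norm (?S - ?S') / (2 * r)"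
      unfolding trunc_corr_def diff_divide_distrib[symmetric] norm_divide norm_of_real using r by simp
    also have "\<dots> \<le> (real (card (?W i)) * (B * tail K) + 2 * (real K / \<delta> + 1) * (B * tail 0)) / (2 * r)"
      using N r by (intro divide_right_mono) auto
    also have "\<dots> = B * tail K * (real (card (?W i)) / (2 * r)) + \<beta> K / r"
      using r by (simp add: \<beta>_def field_simps)
    also have "\<dots> \<le> \<alpha> K + \<beta> K / r"
      unfolding \<alpha>_def using r B tail_nonneg by (intro add_right_mono mult_left_mono card_ratio) auto
    finally show ?thesis .
  qed
  show ?thesis by (rule tendsto_by_truncation[OF approx \<alpha> trunc_corr_limit corr_integrable(2)[OF f]])
qed

end

section \<open>Gaussian averages\<close>

text \<open>The density of total mass 1 that is the transform of \<open>gauss_test\<close> up to a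
  character, see \<open>fourier_gauss_test\<close>. It spreads out as \<epsilon> tends to 0, so that
  sums against it become means.\<close>

definition gauss_kernel :: "real \<Rightarrow> real \<Rightarrow> real" where
  "gauss_kernel \<epsilon> u = \<epsilon> / sqrt pi * exp (- (\<epsilon> * u)\<^sup>2)"

lemma gauss_kernel_abs: "gauss_kernel \<epsilon> \<bar>u\<bar> = gauss_kernel \<epsilon> u" by (simp add: gauss_kernel_def power_mult_distrib)

lemma gauss_kernel_nonneg: "\<epsilon> > 0 \<Longrightarrow> gauss_kernel \<epsilon> u \<ge> 0" by (simp add: gauss_kernel_def)

lemma exp_minus_square_le: "exp (- t\<^sup>2) \<le> 1 / (1 + t\<^sup>2 :: real)"
  using exp_ge_add_one_self[of "t\<^sup>2"] by (simp add: exp_minus inverse_eq_divide frac_le add_pos_nonneg)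

lemma gauss_kernel_le: assumes "\<epsilon> > 0" shows "gauss_kernel \<epsilon> u \<le> \<epsilon> / (1 + (\<epsilon> * u)\<^sup>2)"
proof -
  have "1 \<le> sqrt pi" using pi_ge_two by (intro real_le_rsqrt) simp
  then have "\<epsilon> / sqrt pi \<le> \<epsilon> / 1" using assms by (intro divide_left_mono) auto
  then have "gauss_kernel \<epsilon> u \<le> \<epsilon> * (1 / (1 + (\<epsilon> * u)\<^sup>2))"
    unfolding gauss_kernel_def using assms by (intro mult_mono exp_minus_square_le) auto
  then show ?thesis by simp
qed

lemma gauss_kernel_decay: assumes "\<epsilon> > 0" shows "gauss_kernel \<epsilon> u \<le> (\<epsilon> + 1 / \<epsilon>) / (1 + u\<^sup>2)"
proof -
  have "\<epsilon> * (1 + u\<^sup>2) \<le> (\<epsilon> + 1 / \<epsilon>) * (1 + (\<epsilon> * u)\<^sup>2)"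
  proof -
    have "(\<epsilon> + 1 / \<epsilon>) * (1 + (\<epsilon> * u)\<^sup>2) = \<epsilon> * (1 + u\<^sup>2) + (1 / \<epsilon> + \<epsilon> * (\<epsilon> * u)\<^sup>2)"
      using assms by (simp add: field_simps power2_eq_square)
    then show ?thesis using assms by simp
  qed
  then have "\<epsilon> / (1 + (\<epsilon> * u)\<^sup>2) \<le> (\<epsilon> + 1 / \<epsilon>) / (1 + u\<^sup>2)"
    using assms by (intro iffD2[OF frac_le_eq]) (auto simp: add_pos_nonneg divide_le_0_iff mult_ac add_nonneg_eq_0_iff)
  then show ?thesis using gauss_kernel_le[OF assms, of u] by linarith
qed

text \<open>Minus the derivative of \<open>gauss_kernel \<epsilon>\<close>. Integrated over s it
  writes the Gaussian as a superposition of indicators of [-s, s], which reduces Gaussian averages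
  to sums over centred intervals.\<close>

definition gauss_layer :: "real \<Rightarrow> real \<Rightarrow> real" where
  "gauss_layer \<epsilon> s = 2 * \<epsilon>\<^sup>2 * s * gauss_kernel \<epsilon> s"

lemma gauss_kernel_deriv: "((\<lambda>s. - gauss_kernel \<epsilon> s) has_real_derivative gauss_layer \<epsilon> s) (at s within S)"
proof -
  have "((\<lambda>s. - (c * exp (- (\<epsilon> * s)\<^sup>2))) has_real_derivative 2 * \<epsilon>\<^sup>2 * s * (c * exp (- (\<epsilon> * s)\<^sup>2))) (at s within S)" for c
    by (auto intro!: derivative_eq_intros simp: power2_eq_square)
  then show ?thesis unfolding gauss_kernel_def gauss_layer_def .
qed

lemma gauss_layer_has_integral: "0 \<le> a \<Longrightarrow> a \<le> b \<Longrightarrow> (gauss_layer \<epsilon> has_integral (gauss_kernel \<epsilon> a - gauss_kernel \<epsilon> b)) {a..b}"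
  using fundamental_theorem_of_calculus[of a b "\<lambda>s. - gauss_kernel \<epsilon> s" "gauss_layer \<epsilon>"] gauss_kernel_deriv
  by (simp add: has_real_derivative_iff_has_vector_derivative)

lemma gauss_layer_has_integral_layer:
  assumes "\<bar>u\<bar> \<le> K"
  shows "((\<lambda>s. if \<bar>u\<bar> \<le> s then gauss_layer \<epsilon> s else 0) has_integral (gauss_kernel \<epsilon> u - gauss_kernel \<epsilon> K)) {0..K}"
proof -
  have "((\<lambda>s. if s \<in> {\<bar>u\<bar>..K} then gauss_layer \<epsilon> s else 0) has_integral (gauss_kernel \<epsilon> u - gauss_kernel \<epsilon> K)) {0..K}"
    using gauss_layer_has_integral[of "\<bar>u\<bar>" K \<epsilon>] assms by (subst has_integral_restrict) (auto simp: gauss_kernel_abs)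
  then show ?thesis by (rule has_integral_eq[rotated]) auto
qed

text \<open>An indicator of [-s, s] has mass 2 s, so this limit is the total mass of the Gaussian;
  it is computed from a second moment.\<close>

lemma gauss_layer_first_moment:
  assumes "\<epsilon> > 0"
  shows "((\<lambda>K. integral {0..K} (\<lambda>s. gauss_layer \<epsilon> s * (2 * s))) \<longlongrightarrow> 1) at_top"
proof -
  define F where "F s = indicator {0..} s *\<^sub>R (gauss_layer \<epsilon> s * (2 * s))" for s
  \<comment> \<open>Normalizes the integral of x^2 exp(- x^2) over the positive half-line, which is
    sqrt pi / 4.\<close>
  define c where "c = 4 / sqrt pi"
  have "has_bochner_integral lborel (\<lambda>x. c * (indicator {0..} x *\<^sub>R (exp (- x\<^sup>2) * x ^ (2 * 1)))) (c * (sqrt pi / 2 * (fact (2 * 1) / (2 ^ (2 * 1) * fact 1))))"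
    by (rule has_bochner_integral_mult_right[OF gaussian_moment_even_pos])
  then have "has_bochner_integral lborel (\<lambda>x. c * (indicator {0..} x *\<^sub>R (exp (- x\<^sup>2) * x ^ 2))) 1"
    by (simp add: c_def)
  then have "has_bochner_integral lborel (\<lambda>x. c * (indicator {0..} (0 + \<epsilon> * x) *\<^sub>R (exp (- (0 + \<epsilon> * x)\<^sup>2) * (0 + \<epsilon> * x)\<^sup>2))) (1 /\<^sub>R \<bar>\<epsilon>\<bar>)"
    using lborel_has_bochner_integral_real_affine_iff[of \<epsilon> "\<lambda>x. c * (indicator {0..} x *\<^sub>R (exp (- x\<^sup>2) * x ^ 2))" 1 0] assms
    by simp
  then have "has_bochner_integral lborel (\<lambda>x. \<epsilon> * (c * (indicator {0..} (0 + \<epsilon> * x) *\<^sub>R (exp (- (0 + \<epsilon> * x)\<^sup>2) * (0 + \<epsilon> * x)\<^sup>2)))) (\<epsilon> * (1 /\<^sub>R \<bar>\<epsilon>\<bar>))"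
    by (rule has_bochner_integral_mult_right)
  moreover have "\<epsilon> * (c * (indicator {0..} (0 + \<epsilon> * x) *\<^sub>R (exp (- (0 + \<epsilon> * x)\<^sup>2) * (0 + \<epsilon> * x)\<^sup>2))) = F x" for x
    using assms by (auto simp: F_def gauss_layer_def gauss_kernel_def c_def indicator_def power2_eq_square zero_le_mult_iff)
  ultimately have F: "has_bochner_integral lborel F 1" using assms by simp
  have lim: "((\<lambda>K. \<integral>x. indicator {..K} x *\<^sub>R F x \<partial>lborel) \<longlongrightarrow> 1) at_top"
    using tendsto_integral_at_top[of lborel F] F by (simp add: has_bochner_integral_iff)
  have eq: "(\<integral>x. indicator {..K} x *\<^sub>R F x \<partial>lborel) = integral {0..K} (\<lambda>s. gauss_layer \<epsilon> s * (2 * s))" for K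
  proof -
    have "set_integrable lborel {0..K} (\<lambda>s. gauss_layer \<epsilon> s * (2 * s))"
      unfolding set_integrable_def gauss_layer_def gauss_kernel_def
      by (intro borel_integrable_compact continuous_intros) auto
    from set_borel_integral_eq_integral(2)[OF this]
    have "integral {0..K} (\<lambda>s. gauss_layer \<epsilon> s * (2 * s)) = (\<integral>x. indicator {0..K} x *\<^sub>R (gauss_layer \<epsilon> x * (2 * x)) \<partial>lborel)"
      unfolding set_lebesgue_integral_def by simp
    also have "\<dots> = (\<integral>x. indicator {..K} x *\<^sub>R F x \<partial>lborel)"
      by (intro Bochner_Integration.integral_cong refl) (auto simp: F_def indicator_def)
    finally show ?thesis by simp
  qed
  show ?thesis using lim unfolding eq .
qed

section \<open>Gaussian averages as superpositions of centred sums\<close>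

context coloured_set begin

definition supp_dens where "supp_dens = dens (support \<Lambda>)"

lemma supp_dens_pos: "supp_dens > 0"
  using support_dens dens_eqI unfolding supp_dens_def by blast

definition fb_mean :: "'a \<Rightarrow> real \<Rightarrow> complex" where
  "fb_mean j k = Lim at_top (\<lambda>r. fb_average \<Lambda> j k r 0)"

lemma fb_limit: "uniform_limit UNIV (fb_average \<Lambda> j k) (\<lambda>_. fb_mean j k) at_top"
proof -
  obtain A where A: "uniform_limit UNIV (fb_average \<Lambda> j k) (\<lambda>_. A) at_top" using fb_converges by blast
  then have "fb_mean j k = A"
    unfolding fb_mean_def by (intro tendsto_Lim tendsto_uniform_limitI[OF A]) simp_all
  then show ?thesis using A by simp
qed

lemma fb_coeff_eq: "fb_coeff \<Lambda> j k = fb_mean j k / of_real supp_dens"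
  unfolding fb_coeff_def fb_mean_def supp_dens_def by (simp add: field_simps)

definition centred_sum :: "'a \<Rightarrow> real \<Rightarrow> real \<Rightarrow> real \<Rightarrow> complex" where
  "centred_sum j k s x = (\<Sum>y\<in>\<Lambda> j \<inter> {x - s..x + s}. ek k y)"

lemma norm_centred_sum_le: "s \<ge> 0 \<Longrightarrow> norm (centred_sum j k s x) \<le> 2 * s / \<delta> + 1"
proof -
  assume "s \<ge> 0"
  have "norm (centred_sum j k s x) \<le> of_nat (card (\<Lambda> j \<inter> {x - s..x + s})) * 1"
    unfolding centred_sum_def by (rule sum_norm_bound) simp
  then show ?thesis using card_part[of "x - s" "x + s" j] \<open>s \<ge> 0\<close> by simp
qed

text \<open>Uniform convergence gives the linear error for s beyond some s0, for all centres; C pays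
  for the shorter intervals.\<close>

lemma centred_sum_approx:
  assumes "\<tau> > 0"
  obtains C where "C \<ge> 0" "\<And>s x. s \<ge> 0 \<Longrightarrow> norm (centred_sum j k s x - (2 * s) *\<^sub>R fb_mean j k) \<le> C + 2 * s * \<tau>"
proof -
  from uniform_limitD[OF fb_limit assms] obtain s1 where
    s1: "\<And>s x. s \<ge> s1 \<Longrightarrow> norm (fb_average \<Lambda> j k s x - fb_mean j k) < \<tau>"
    unfolding eventually_at_top_linorder dist_norm by blast
  define s0 where "s0 = max 1 s1"
  define C where "C = 2 * s0 / \<delta> + 1 + 2 * s0 * norm (fb_mean j k)"
  have C: "C \<ge> 0" unfolding C_def s0_def using \<delta>_pos by (intro add_nonneg_nonneg) auto
  have "norm (centred_sum j k s x - (2 * s) *\<^sub>R fb_mean j k) \<le> C + 2 * s * \<tau>" if s: "s \<ge> 0" for s x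
  proof (cases "s \<ge> s0")
    case True
    then have s': "s > 0" "s \<ge> s1" by (auto simp: s0_def)
    have "centred_sum j k s x - (2 * s) *\<^sub>R fb_mean j k = (2 * s) *\<^sub>R (fb_average \<Lambda> j k s x - fb_mean j k)"
      using s' unfolding fb_average_ek centred_sum_def
      by (simp add: scaleR_conv_of_real right_diff_distrib add.commute)
    then have "norm (centred_sum j k s x - (2 * s) *\<^sub>R fb_mean j k) = 2 * s * norm (fb_average \<Lambda> j k s x - fb_mean j k)"
      using s' by simp
    also have "\<dots> \<le> 2 * s * \<tau>" using s1[OF s'(2), of x] s' by (intro mult_left_mono) auto
    finally show ?thesis using C by simp
  next
    case False
    have "norm (centred_sum j k s x - (2 * s) *\<^sub>R fb_mean j k) \<le> norm (centred_sum j k s x) + 2 * s * norm (fb_mean j k)"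
      using norm_triangle_ineq4[of "centred_sum j k s x" "(2 * s) *\<^sub>R fb_mean j k"] s by simp
    also have "\<dots> \<le> (2 * s0 / \<delta> + 1) + 2 * s0 * norm (fb_mean j k)"
    proof (intro add_mono mult_right_mono)
      have "2 * s / \<delta> \<le> 2 * s0 / \<delta>" using False \<delta>_pos by (intro divide_right_mono) auto
      then show "norm (centred_sum j k s x) \<le> 2 * s0 / \<delta> + 1" using norm_centred_sum_le[OF s, of j k x] by linarith
    qed (use False in auto)
    also have "\<dots> \<le> C + 2 * s * \<tau>" using s assms by (simp add: C_def)
    finally show ?thesis .
  qed
  then show thesis using that C by blast
qed

text \<open>Each y is represented by its layers with |y - x| <= s <= K; the layers beyond K are
  missing, which produces the subtracted term.\<close>

lemma gaussian_sum_layers: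
  assumes "K \<ge> 0"
  shows "((\<lambda>s. gauss_layer \<epsilon> s *\<^sub>R centred_sum j k s x) has_integral
    ((\<Sum>y\<in>\<Lambda> j \<inter> {x - K..x + K}. gauss_kernel \<epsilon> (y - x) *\<^sub>R ek k y) - gauss_kernel \<epsilon> K *\<^sub>R centred_sum j k K x)) {0..K}"
proof -
  let ?Y = "\<Lambda> j \<inter> {x - K..x + K}"
  have "((\<lambda>s. \<Sum>y\<in>?Y. (if \<bar>y - x\<bar> \<le> s then gauss_layer \<epsilon> s else 0) *\<^sub>R ek k y) has_integral
      (\<Sum>y\<in>?Y. (gauss_kernel \<epsilon> (y - x) - gauss_kernel \<epsilon> K) *\<^sub>R ek k y)) {0..K}"
    by (intro has_integral_sum has_integral_scaleR_left gauss_layer_has_integral_layer) auto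
  moreover have "(\<Sum>y\<in>?Y. (gauss_kernel \<epsilon> (y - x) - gauss_kernel \<epsilon> K) *\<^sub>R ek k y)
      = (\<Sum>y\<in>?Y. gauss_kernel \<epsilon> (y - x) *\<^sub>R ek k y) - gauss_kernel \<epsilon> K *\<^sub>R centred_sum j k K x"
    by (simp add: centred_sum_def scaleR_diff_left sum_subtractf scaleR_sum_right)
  ultimately have "((\<lambda>s. \<Sum>y\<in>?Y. (if \<bar>y - x\<bar> \<le> s then gauss_layer \<epsilon> s else 0) *\<^sub>R ek k y) has_integral
      ((\<Sum>y\<in>?Y. gauss_kernel \<epsilon> (y - x) *\<^sub>R ek k y) - gauss_kernel \<epsilon> K *\<^sub>R centred_sum j k K x)) {0..K}" by simp
  then show ?thesis
  proof (rule has_integral_eq[rotated])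
    fix s assume s: "s \<in> {0..K}"
    have "(\<Sum>y\<in>?Y. (if \<bar>y - x\<bar> \<le> s then gauss_layer \<epsilon> s else 0) *\<^sub>R ek k y)
        = (\<Sum>y\<in>?Y. if \<bar>y - x\<bar> \<le> s then gauss_layer \<epsilon> s *\<^sub>R ek k y else 0)"
      by (intro sum.cong) auto
    also have "\<dots> = (\<Sum>y\<in>{y \<in> ?Y. \<bar>y - x\<bar> \<le> s}. gauss_layer \<epsilon> s *\<^sub>R ek k y)"
      by (rule sum.inter_filter[symmetric]) simp
    also have "{y \<in> ?Y. \<bar>y - x\<bar> \<le> s} = \<Lambda> j \<inter> {x - s..x + s}" using s by auto
    finally show "(\<Sum>y\<in>?Y. (if \<bar>y - x\<bar> \<le> s then gauss_layer \<epsilon> s else 0) *\<^sub>R ek k y) = gauss_layer \<epsilon> s *\<^sub>R centred_sum j k s x"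
      by (simp add: centred_sum_def scaleR_sum_right)
  qed
qed

text \<open>The four terms are the constant and the linear error of
  \<open>centred_sum_approx\<close>, the cut of the layers at K, and the deviation of the first
  moment up to K from 1.\<close>

lemma gaussian_average_bound:
  assumes "\<epsilon> > 0" "\<tau> > 0" "K \<ge> 0"
    and C: "C \<ge> 0" "\<And>s x. s \<ge> 0 \<Longrightarrow> norm (centred_sum j k s x - (2 * s) *\<^sub>R fb_mean j k) \<le> C + 2 * s * \<tau>"
  shows "norm ((\<Sum>y\<in>\<Lambda> j \<inter> {x - K..x + K}. gauss_kernel \<epsilon> (y - x) *\<^sub>R ek k y) - fb_mean j k)
    \<le> C * \<epsilon> + \<tau> * integral {0..K} (\<lambda>s. gauss_layer \<epsilon> s * (2 * s))
      + gauss_kernel \<epsilon> K * (2 * K / \<delta> + 1) + \<bar>integral {0..K} (\<lambda>s. gauss_layer \<epsilon> s * (2 * s)) - 1\<bar> * norm (fb_mean j k)"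
proof -
  let ?I = "integral {0..K} (\<lambda>s. gauss_layer \<epsilon> s * (2 * s))"
  let ?S = "\<Sum>y\<in>\<Lambda> j \<inter> {x - K..x + K}. gauss_kernel \<epsilon> (y - x) *\<^sub>R ek k y"
  have I: "((\<lambda>s. gauss_layer \<epsilon> s * (2 * s)) has_integral ?I) {0..K}"
    by (rule integrable_integral) (auto intro!: integrable_continuous_real continuous_intros simp: gauss_layer_def gauss_kernel_def)
  have 1: "((\<lambda>s. gauss_layer \<epsilon> s *\<^sub>R centred_sum j k s x - (gauss_layer \<epsilon> s * (2 * s)) *\<^sub>R fb_mean j k) has_integral
      ((?S - gauss_kernel \<epsilon> K *\<^sub>R centred_sum j k K x) - ?I *\<^sub>R fb_mean j k)) {0..K}"
    by (intro has_integral_diff gaussian_sum_layers assms has_integral_scaleR_left I)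
  have 2: "((\<lambda>s. C * gauss_layer \<epsilon> s + \<tau> * (gauss_layer \<epsilon> s * (2 * s))) has_integral (C * (gauss_kernel \<epsilon> 0 - gauss_kernel \<epsilon> K) + \<tau> * ?I)) {0..K}"
    by (intro has_integral_add has_integral_mult_right gauss_layer_has_integral I assms order_refl)
  have "norm ((?S - gauss_kernel \<epsilon> K *\<^sub>R centred_sum j k K x) - ?I *\<^sub>R fb_mean j k) \<le> C * (gauss_kernel \<epsilon> 0 - gauss_kernel \<epsilon> K) + \<tau> * ?I"
  proof -
    have "norm (gauss_layer \<epsilon> s *\<^sub>R centred_sum j k s x - (gauss_layer \<epsilon> s * (2 * s)) *\<^sub>R fb_mean j k) \<le> C * gauss_layer \<epsilon> s + \<tau> * (gauss_layer \<epsilon> s * (2 * s))"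
      if "s \<in> {0..K}" for s
    proof -
      have g: "gauss_layer \<epsilon> s \<ge> 0" using that gauss_kernel_nonneg[OF assms(1), of s] by (simp add: gauss_layer_def)
      have "norm (gauss_layer \<epsilon> s *\<^sub>R centred_sum j k s x - (gauss_layer \<epsilon> s * (2 * s)) *\<^sub>R fb_mean j k)
          = gauss_layer \<epsilon> s * norm (centred_sum j k s x - (2 * s) *\<^sub>R fb_mean j k)"
        using g by (simp only: scaleR_scaleR[symmetric] scaleR_diff_right[symmetric] norm_scaleR abs_of_nonneg)
      also have "\<dots> \<le> gauss_layer \<epsilon> s * (C + 2 * s * \<tau>)" using that g by (intro mult_left_mono C) auto
      finally show ?thesis by (simp add: algebra_simps)
    qed
    then show ?thesis
      using integral_norm_bound_integral[OF has_integral_integrable[OF 1] has_integral_integrable[OF 2]]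
      by (simp only: integral_unique[OF 1] integral_unique[OF 2])
  qed
  also have "\<dots> \<le> C * \<epsilon> + \<tau> * ?I"
  proof -
    have "gauss_kernel \<epsilon> 0 - gauss_kernel \<epsilon> K \<le> \<epsilon>" using gauss_kernel_le[OF assms(1), of 0] gauss_kernel_nonneg[OF assms(1), of K] by simp
    then show ?thesis using C(1) by (intro add_right_mono mult_left_mono) auto
  qed
  finally have 3: "norm ((?S - gauss_kernel \<epsilon> K *\<^sub>R centred_sum j k K x) - ?I *\<^sub>R fb_mean j k) \<le> C * \<epsilon> + \<tau> * ?I" .
  have 4: "norm (gauss_kernel \<epsilon> K *\<^sub>R centred_sum j k K x) \<le> gauss_kernel \<epsilon> K * (2 * K / \<delta> + 1)"
    using gauss_kernel_nonneg[OF assms(1), of K] norm_centred_sum_le[OF assms(3), of j k x] by (simp add: mult_left_mono)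
  have 5: "norm ((?I - 1) *\<^sub>R fb_mean j k) = \<bar>?I - 1\<bar> * norm (fb_mean j k)" by simp
  have "?S - fb_mean j k = ((?S - gauss_kernel \<epsilon> K *\<^sub>R centred_sum j k K x) - ?I *\<^sub>R fb_mean j k) + gauss_kernel \<epsilon> K *\<^sub>R centred_sum j k K x
      + (?I - 1) *\<^sub>R fb_mean j k" by (simp add: scaleR_diff_left)
  then show ?thesis
    using norm_triangle_le[OF add_mono[OF norm_triangle_le[OF add_mono[OF 3 4]] eq_refl[OF 5]]]
    by (simp only:)
qed

text \<open>The order of choices matters: the tolerance e / 8 determines C, then \<epsilon> is made
  small against e / (C + 1), and K is taken large for that \<epsilon>. Each of the four errors of
  \<open>gaussian_average_bound\<close> is at most e / 4, as the first moment stays below 2.\<close>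

lemma gaussian_average:
  assumes "e > 0"
  shows "\<exists>\<epsilon>0>0. \<forall>\<epsilon>. 0 < \<epsilon> \<and> \<epsilon> < \<epsilon>0 \<longrightarrow> (\<forall>\<^sub>F K in sequentially. \<forall>x.
    norm ((\<Sum>y\<in>\<Lambda> j \<inter> {x - real K..x + real K}. gauss_kernel \<epsilon> (y - x) *\<^sub>R ek k y) - fb_mean j k) \<le> e)"
proof -
  have "e / 8 > 0" using assms by simp
  from centred_sum_approx[OF this, of j k] obtain C where
    C: "C \<ge> 0" "\<And>s x. s \<ge> 0 \<Longrightarrow> norm (centred_sum j k s x - (2 * s) *\<^sub>R fb_mean j k) \<le> C + 2 * s * (e / 8)" by blast
  define \<epsilon>0 where "\<epsilon>0 = e / 4 / (C + 1)"
  have "\<epsilon>0 > 0" using assms C by (simp add: \<epsilon>0_def)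
  moreover have "\<forall>\<^sub>F K in sequentially. \<forall>x.
    norm ((\<Sum>y\<in>\<Lambda> j \<inter> {x - real K..x + real K}. gauss_kernel \<epsilon> (y - x) *\<^sub>R ek k y) - fb_mean j k) \<le> e"
    if \<epsilon>: "0 < \<epsilon>" "\<epsilon> < \<epsilon>0" for \<epsilon>
  proof -
    let ?I = "\<lambda>K. integral {0..real K} (\<lambda>s. gauss_layer \<epsilon> s * (2 * s))"
    have I: "?I \<longlonglongrightarrow> 1"
      using filterlim_compose[OF gauss_layer_first_moment[OF \<epsilon>(1)] filterlim_real_sequentially] .
    have C\<epsilon>: "C * \<epsilon> \<le> e / 4"
    proof -
      have "C * \<epsilon> \<le> (C + 1) * \<epsilon>0" using C \<epsilon> by (intro mult_mono) auto
      also have "(C + 1) * \<epsilon>0 = e / 4" 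
      proof -
        have "c * (x / c) = x" if "c > 0" for x c :: real using that by simp
        from this[of "C + 1"] C(1) show ?thesis unfolding \<epsilon>0_def by (simp only: add_nonneg_pos zero_less_one)
      qed
      finally show ?thesis .
    qed
    have g0: "(\<lambda>K. gauss_kernel \<epsilon> (real K) * (2 * real K / \<delta> + 1)) \<longlonglongrightarrow> 0"
    proof (rule Lim_null_comparison)
      show "(\<lambda>K. ((2 / \<delta> + 1) / \<epsilon>) / real K) \<longlonglongrightarrow> 0" by (rule lim_const_over_n)
      show "\<forall>\<^sub>F K in sequentially. norm (gauss_kernel \<epsilon> (real K) * (2 * real K / \<delta> + 1)) \<le> ((2 / \<delta> + 1) / \<epsilon>) / real K"
        using eventually_gt_at_top[of 0]
      proof eventually_elim
        case (elim K)
        then have K: "real K \<ge> 1" by simp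
        have "gauss_kernel \<epsilon> (real K) \<le> \<epsilon> / (1 + (\<epsilon> * real K)\<^sup>2)" by (rule gauss_kernel_le[OF \<epsilon>(1)])
        also have "\<dots> \<le> \<epsilon> / (\<epsilon> * real K)\<^sup>2"
          using \<epsilon> K by (intro divide_left_mono) (auto intro!: mult_pos_pos add_pos_nonneg)
        finally have "gauss_kernel \<epsilon> (real K) \<le> \<epsilon> / (\<epsilon> * real K)\<^sup>2" .
        moreover have "2 * real K / \<delta> + 1 \<le> (2 / \<delta> + 1) * real K"
          using K \<delta>_pos by (simp add: distrib_right)
        ultimately have "gauss_kernel \<epsilon> (real K) * (2 * real K / \<delta> + 1) \<le> \<epsilon> / (\<epsilon> * real K)\<^sup>2 * ((2 / \<delta> + 1) * real K)"
          using \<epsilon> K \<delta>_pos by (intro mult_mono) auto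
        also have "\<dots> = ((2 / \<delta> + 1) / \<epsilon>) / real K"
          using \<epsilon> K by (simp add: power2_eq_square)
        finally show ?case using gauss_kernel_nonneg[OF \<epsilon>(1), of "real K"] \<delta>_pos by simp
      qed
    qed
    have "\<forall>\<^sub>F K in sequentially. ?I K < 2" by (rule order_tendstoD(2)[OF I]) simp
    moreover have "\<forall>\<^sub>F K in sequentially. gauss_kernel \<epsilon> (real K) * (2 * real K / \<delta> + 1) < e / 4"
      by (rule order_tendstoD(2)[OF g0]) (use assms in simp)
    moreover have "\<forall>\<^sub>F K in sequentially. \<bar>?I K - 1\<bar> * norm (fb_mean j k) < e / 4"
    proof (rule order_tendstoD(2))
      show "(\<lambda>K. \<bar>?I K - 1\<bar> * norm (fb_mean j k)) \<longlonglongrightarrow> 0"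
        by (intro tendsto_mult_left_zero tendsto_rabs_zero) (simp add: LIM_zero_iff I)
    qed (use assms in simp)
    ultimately show ?thesis
    proof eventually_elim
      case (elim K)
      show ?case
      proof
        fix x
        have "e / 8 * ?I K \<le> e / 8 * 2" using elim assms by (intro mult_left_mono) auto
        then show "norm ((\<Sum>y\<in>\<Lambda> j \<inter> {x - real K..x + real K}. gauss_kernel \<epsilon> (y - x) *\<^sub>R ek k y) - fb_mean j k) \<le> e"
          using gaussian_average_bound[OF \<epsilon>(1) \<open>e / 8 > 0\<close> of_nat_0_le_iff C, of x K] elim C\<epsilon> by linarith
      qed
    qed
  qed
  ultimately show ?thesis by blast
qed

text \<open>For fixed x the Gaussian sum over y is nearly \<open>fb_mean j k\<close> times the
  conjugate of \<open>ek k x\<close>, with an error bound independent of x. Averaging over x then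
  yields the conjugate of \<open>fb_mean i k\<close> as the other factor.\<close>

lemma corr_gaussian_limit:
  "(\<lambda>n. LINT z|count_space \<Delta>. of_real (\<eta> i j z) * (of_real (gauss_kernel (inverse (real (Suc n))) z) * ek k z))
    \<longlonglongrightarrow> cnj (fb_mean i k) * fb_mean j k"
proof (rule LIMSEQ_I)
  fix e0 :: real assume "e0 > 0"
  \<comment> \<open>Averaging over x multiplies the error by at most 1 / \<delta> + 1, the bound of
    \<open>card_ratio\<close>.\<close>
  define e where "e = e0 / 2 / (1 / \<delta> + 1)"
  have c: "1 / \<delta> + 1 > 0" using \<delta>_pos by (simp add: add_pos_pos)
  have "x / c * c = x" if "c > 0" for x c :: real using that by simp
  from this[OF c, of "e0 / 2"] have "e * (1 / \<delta> + 1) = e0 / 2" unfolding e_def .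
  moreover have "e > 0" unfolding e_def using \<open>e0 > 0\<close> c by (intro divide_pos_pos) auto
  ultimately have e: "e > 0" "e * (1 / \<delta> + 1) < e0" using \<open>e0 > 0\<close> by linarith+
  obtain \<epsilon>0 where \<epsilon>0: "\<epsilon>0 > 0" and avg: "\<And>\<epsilon>. 0 < \<epsilon> \<Longrightarrow> \<epsilon> < \<epsilon>0 \<Longrightarrow> \<forall>\<^sub>F K in sequentially. \<forall>x.
    norm ((\<Sum>y\<in>\<Lambda> j \<inter> {x - real K..x + real K}. gauss_kernel \<epsilon> (y - x) *\<^sub>R ek k y) - fb_mean j k) \<le> e"
    using gaussian_average[OF e(1), where j = j and k = k] by blast
  have main: "norm ((LINT z|count_space \<Delta>. of_real (\<eta> i j z) * (of_real (gauss_kernel \<epsilon> z) * ek k z)) - cnj (fb_mean i k) * fb_mean j k) < e0"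
    if \<epsilon>: "0 < \<epsilon>" "\<epsilon> < \<epsilon>0" for \<epsilon>
  proof -
    let ?f = "\<lambda>z. of_real (gauss_kernel \<epsilon> z) * ek k z"
    have f: "norm (?f u) \<le> (\<epsilon> + 1 / \<epsilon>) / (1 + u\<^sup>2)" for u
      using gauss_kernel_decay[OF \<epsilon>(1), of u] gauss_kernel_nonneg[OF \<epsilon>(1), of u] by (simp add: norm_mult)
    have "\<forall>\<^sub>F K in sequentially. norm ((\<Sum>z\<in>\<Delta> \<inter> {- real K..real K}. of_real (\<eta> i j z) * ?f z)
        - cnj (fb_mean i k) * fb_mean j k) \<le> e * (1 / \<delta> + 1)"
      using avg[OF \<epsilon>]
    proof eventually_elim
      case (elim K)
      have tr: "norm (trunc_corr i j ?f K r - cnj (fb_average \<Lambda> i k r 0) * fb_mean j k) \<le> e * (1 / \<delta> + 1)"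
        if r: "r \<ge> 1" for r
      proof -
        let ?B = "\<lambda>x. \<Sum>y\<in>\<Lambda> j \<inter> {x - real K..x + real K}. gauss_kernel \<epsilon> (y - x) *\<^sub>R ek k y"
        have in_eq: "(\<Sum>y\<in>\<Lambda> j \<inter> {x - real K..x + real K}. ?f (y - x)) = cnj (ek k x) * ?B x" for x
          by (simp add: sum_distrib_left scaleR_conv_of_real ek_diff mult_ac)
        have eq: "trunc_corr i j ?f K r - cnj (fb_average \<Lambda> i k r 0) * fb_mean j k
            = (\<Sum>x\<in>\<Lambda> i \<inter> {- r..r}. cnj (ek k x) * (?B x - fb_mean j k)) / of_real (2 * r)"
          unfolding trunc_corr_def in_eq fb_average_ek
          by (simp add: right_diff_distrib sum_subtractf diff_divide_distrib sum_distrib_right[symmetric])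
        have "norm (cnj (ek k x) * (?B x - fb_mean j k)) \<le> e" for x
          using elim by (simp only: norm_mult complex_mod_cnj norm_ek mult_1_left)
        then have "norm (\<Sum>x\<in>\<Lambda> i \<inter> {- r..r}. cnj (ek k x) * (?B x - fb_mean j k))
            \<le> of_nat (card (\<Lambda> i \<inter> {- r..r})) * e"
          by (intro sum_norm_bound)
        then have "norm (trunc_corr i j ?f K r - cnj (fb_average \<Lambda> i k r 0) * fb_mean j k)
            \<le> (of_nat (card (\<Lambda> i \<inter> {- r..r})) * e) / \<bar>2 * r\<bar>"
          unfolding eq norm_divide norm_of_real by (rule divide_right_mono) simp
        also have "\<bar>2 * r\<bar> = 2 * r" using r by simp
        also have "of_nat (card (\<Lambda> i \<inter> {- r..r})) * e / (2 * r) = e * (real (card (\<Lambda> i \<inter> {- r..r})) / (2 * r))" by simp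
        also have "\<dots> \<le> e * (1 / \<delta> + 1)" using e(1) by (intro mult_left_mono card_ratio r) auto
        finally show ?thesis .
      qed
      show ?case
      proof (rule tendsto_upperbound)
        show "((\<lambda>r. norm (trunc_corr i j ?f K r - cnj (fb_average \<Lambda> i k r 0) * fb_mean j k)) \<longlongrightarrow>
          norm ((\<Sum>z\<in>\<Delta> \<inter> {- real K..real K}. of_real (\<eta> i j z) * ?f z) - cnj (fb_mean i k) * fb_mean j k)) at_top"
          by (intro tendsto_norm tendsto_diff trunc_corr_limit tendsto_mult tendsto_cnj tendsto_const
              tendsto_uniform_limitI[OF fb_limit]) simp
        show "\<forall>\<^sub>F r in at_top. norm (trunc_corr i j ?f K r - cnj (fb_average \<Lambda> i k r 0) * fb_mean j k) \<le> e * (1 / \<delta> + 1)"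
          using eventually_ge_at_top[of 1] by eventually_elim (rule tr)
      qed simp
    qed
    then have "norm ((LINT z|count_space \<Delta>. of_real (\<eta> i j z) * ?f z) - cnj (fb_mean i k) * fb_mean j k) \<le> e * (1 / \<delta> + 1)"
      by (intro tendsto_upperbound[OF tendsto_norm[OF tendsto_diff[OF corr_integrable(2)[OF f] tendsto_const]]]) simp_all
    then show ?thesis using e(2) by linarith
  qed
  obtain n0 where n0: "inverse (real (Suc n0)) < \<epsilon>0" using reals_Archimedean[OF \<epsilon>0] by blast
  show "\<exists>no. \<forall>n\<ge>no. norm ((LINT z|count_space \<Delta>. of_real (\<eta> i j z) * (of_real (gauss_kernel (inverse (real (Suc n))) z) * ek k z))
      - cnj (fb_mean i k) * fb_mean j k) < e0"
  proof (intro exI[of _ n0] allI impI main)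
    fix n assume "n0 \<le> n"
    then have "inverse (real (Suc n)) \<le> inverse (real (Suc n0))" by (intro le_imp_inverse_le) auto
    then show "inverse (real (Suc n)) < \<epsilon>0" using n0 by linarith
  qed simp
qed

end

section \<open>Fourier transforms of test functions\<close>

lemma integrable_lorentz: "integrable lborel (\<lambda>x::real. 1 / (1 + x\<^sup>2))"
  using Sinc_Integral.integrable_inverse_1_plus_square
  by (simp add: set_integrable_def inverse_eq_divide)

lemma ek_measurable [measurable]: "ek k \<in> borel_measurable borel"
  unfolding ek_def[abs_def] by measurable

lemma ek_commute: "ek k x = ek x k"
  by (simp add: ek_def mult_ac)

lemma fourier_ek: "fourier \<phi> u = (LINT x|lborel. ek u x * \<phi> x)"
  unfolding fourier_def ek_def ..

lemma schwartzE:
  assumes "schwartz \<phi>"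
  obtains D where "D 0 = \<phi>" "\<And>n x. (D n has_vector_derivative D (Suc n) x) (at x)"
    "\<And>m n. \<exists>B. \<forall>x. norm (x ^ m *\<^sub>R D n x) \<le> B"
  using assms unfolding schwartz_def bounded_iff by (metis rangeI)

lemma schwartz_deriv_decay:
  fixes D :: "nat \<Rightarrow> real \<Rightarrow> complex"
  assumes "\<And>m n. \<exists>B. \<forall>x. norm (x ^ m *\<^sub>R D n x) \<le> B"
  shows "\<exists>B. \<forall>x. norm (D n x) \<le> B / (1 + x\<^sup>2)"
proof -
  obtain B0 where B0: "\<And>x. norm (x ^ 0 *\<^sub>R D n x) \<le> B0" using assms by blast
  obtain B2 where B2: "\<And>x. norm (x ^ 2 *\<^sub>R D n x) \<le> B2" using assms by blast
  have "norm (D n x) \<le> (B0 + B2) / (1 + x\<^sup>2)" for x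
  proof -
    have "norm (D n x) * (1 + x\<^sup>2) \<le> B0 + B2" using B0[of x] B2[of x] by (simp add: algebra_simps)
    then show ?thesis by (simp add: pos_le_divide_eq add_pos_nonneg)
  qed
  then show ?thesis by blast
qed

lemma schwartz_weighted_bound:
  assumes "schwartz \<phi>"
  shows "\<exists>B. \<forall>x. norm (\<phi> x) * (1 + x\<^sup>2)\<^sup>2 \<le> B"
proof -
  obtain D where D: "D 0 = \<phi>" "\<And>n x. (D n has_vector_derivative D (Suc n) x) (at x)"
    "\<And>m n. \<exists>B. \<forall>x. norm (x ^ m *\<^sub>R D n x) \<le> B"
    by (rule schwartzE[OF assms]) blast
  obtain B0 where B0: "\<And>x. norm (x ^ 0 *\<^sub>R D 0 x) \<le> B0" using D(3) by blast
  obtain B2 where B2: "\<And>x. norm (x ^ 2 *\<^sub>R D 0 x) \<le> B2" using D(3) by blast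
  obtain B4 where B4: "\<And>x. norm (x ^ 4 *\<^sub>R D 0 x) \<le> B4" using D(3) by blast
  have "norm (\<phi> x) * (1 + x\<^sup>2)\<^sup>2 \<le> B0 + 2 * B2 + B4" for x
  proof -
    have "(1 + x\<^sup>2)\<^sup>2 = 1 + 2 * x\<^sup>2 + x ^ 4" by (simp add: power2_eq_square power4_eq_xxxx algebra_simps)
    then show ?thesis using B0[of x] B2[of x] B4[of x] D(1) by (simp add: algebra_simps)
  qed
  then show ?thesis by blast
qed

lemma schwartz_continuous: "schwartz \<phi> \<Longrightarrow> isCont \<phi> x"
  by (erule schwartzE) (metis has_vector_derivative_continuous)

lemma schwartz_borel: "schwartz \<phi> \<Longrightarrow> \<phi> \<in> borel_measurable borel"
  by (intro borel_measurable_continuous_onI continuous_at_imp_continuous_on ballI schwartz_continuous)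

lemma integrable_of_lorentz_bound:
  fixes f :: "real \<Rightarrow> complex"
  assumes [measurable]: "f \<in> borel_measurable borel" and "\<And>x. norm (f x) \<le> B / (1 + x\<^sup>2)"
  shows "integrable lborel f"
proof (rule Bochner_Integration.integrable_bound)
  show "integrable lborel (\<lambda>x. B * (1 / (1 + x\<^sup>2)))" by (rule integrable_mult_right) (rule integrable_lorentz)
  show "AE x in lborel. norm (f x) \<le> norm (B * (1 / (1 + x\<^sup>2)))"
  proof (rule AE_I2)
    fix x show "norm (f x) \<le> norm (B * (1 / (1 + x\<^sup>2)))"
    proof -
      have "B / (1 + x\<^sup>2) \<le> \<bar>B\<bar> / (1 + x\<^sup>2)" by (intro divide_right_mono) auto
      then show ?thesis using assms(2)[of x] by (simp add: abs_mult)
    qed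
  qed
qed simp

lemma lorentz_bound_tendsto_0:
  fixes f :: "real \<Rightarrow> complex"
  assumes "\<And>x. norm (f x) \<le> B / (1 + x\<^sup>2)"
  shows "(f \<longlongrightarrow> 0) at_top" "(f \<longlongrightarrow> 0) at_bot"
proof -
  have 1: "LIM x (at_top :: real filter). 1 + x\<^sup>2 :> at_top"
    by (intro filterlim_tendsto_add_at_top[OF tendsto_const] filterlim_pow_at_top filterlim_ident) simp
  have 2: "LIM x (at_bot :: real filter). 1 + x\<^sup>2 :> at_top"
    using 1 unfolding filterlim_at_bot_mirror by simp
  have *: "((\<lambda>x. B / (1 + x\<^sup>2)) \<longlongrightarrow> 0) at_top" "((\<lambda>x. B / (1 + x\<^sup>2)) \<longlongrightarrow> 0) at_bot"
    using 1 2 by (auto intro!: tendsto_divide_0[OF tendsto_const] filterlim_at_top_imp_at_infinity)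
  show "(f \<longlongrightarrow> 0) at_top" by (rule Lim_null_comparison[OF always_eventually *(1)]) (simp add: assms)
  show "(f \<longlongrightarrow> 0) at_bot" by (rule Lim_null_comparison[OF always_eventually *(2)]) (simp add: assms)
qed

lemma ek_has_vector_derivative:
  "(ek u has_vector_derivative (- 2 * of_real pi * \<i> * of_real u) * ek u x) (at x within S)"
proof -
  have "((\<lambda>z. exp (- 2 * of_real pi * \<i> * of_real u * z)) has_field_derivative
      exp (- 2 * of_real pi * \<i> * of_real u * of_real x) * (- 2 * of_real pi * \<i> * of_real u)) (at (of_real x))"
    by (auto intro!: derivative_eq_intros)
  from has_vector_derivative_real_field[OF this]
  show ?thesis unfolding ek_def[abs_def] by (simp add: mult_ac has_vector_derivative_at_within)
qed

text \<open>Integration by parts, phrased as the vanishing of the integral of the derivative of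
  \<open>ek u x * f x\<close>, which tends to 0 at both ends.\<close>

lemma fourier_derivative:
  fixes f f' :: "real \<Rightarrow> complex"
  assumes d: "\<And>x. (f has_vector_derivative f' x) (at x)"
    and f: "\<And>x. norm (f x) \<le> B / (1 + x\<^sup>2)" and f': "\<And>x. norm (f' x) \<le> B' / (1 + x\<^sup>2)"
    and c: "\<And>x. isCont f' x"
  shows "fourier f' u = 2 * of_real pi * \<i> * of_real u * fourier f u"
proof -
  let ?c = "- 2 * of_real pi * \<i> * of_real u"
  have cf: "isCont f x" for x using d has_vector_derivative_continuous by blast
  have ck: "isCont (ek u) x" for x using ek_has_vector_derivative has_vector_derivative_continuous by blast
  have [measurable]: "f \<in> borel_measurable borel" "f' \<in> borel_measurable borel"
    by (intro borel_measurable_continuous_onI continuous_at_imp_continuous_on ballI cf c)+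
  have i1: "integrable lborel (\<lambda>x. ek u x * f x)"
    by (rule integrable_of_lorentz_bound[of _ B]) (use f in \<open>auto simp: norm_mult\<close>)
  have i2: "integrable lborel (\<lambda>x. ek u x * f' x)"
    by (rule integrable_of_lorentz_bound[of _ B']) (use f' in \<open>auto simp: norm_mult\<close>)
  have int: "integrable lborel (\<lambda>x. ek u x * f' x + ?c * (ek u x * f x))"
    by (intro Bochner_Integration.integrable_add integrable_mult_right i1 i2)
  have lims: "((\<lambda>x. ek u x * f x) \<longlongrightarrow> 0) at_top" "((\<lambda>x. ek u x * f x) \<longlongrightarrow> 0) at_bot"
    by (rule lorentz_bound_tendsto_0[of _ B]; use f in \<open>simp add: norm_mult\<close>)+
  have "(LBINT x=-\<infinity>..\<infinity>. ek u x * f' x + ?c * (ek u x * f x)) = 0 - 0"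
  proof (rule interval_integral_FTC_integrable[where F = "\<lambda>x. ek u x * f x"])
    show "((\<lambda>x. ek u x * f x) has_vector_derivative ek u x * f' x + ?c * (ek u x * f x)) (at x)" for x
      using has_vector_derivative_mult[OF ek_has_vector_derivative[of u x UNIV] d[of x]]
      by (simp only: mult.assoc)
    show "isCont (\<lambda>x. ek u x * f' x + ?c * (ek u x * f x)) x" for x
      by (intro continuous_intros ck cf c)
    show "set_integrable lborel (einterval (-\<infinity>) \<infinity>) (\<lambda>x. ek u x * f' x + ?c * (ek u x * f x))"
      using int by (simp add: set_integrable_def)
    show "(((\<lambda>x. ek u x * f x) \<circ> real_of_ereal) \<longlongrightarrow> 0) (at_right (-\<infinity>))"
      "(((\<lambda>x. ek u x * f x) \<circ> real_of_ereal) \<longlongrightarrow> 0) (at_left \<infinity>)"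
      using lims by (simp_all add: ereal_tendsto_simps)
  qed simp
  then have "(LINT x|lborel. ek u x * f' x + ?c * (ek u x * f x)) = 0"
    by (simp add: interval_lebesgue_integral_def set_lebesgue_integral_def)
  then have "fourier f' u + ?c * fourier f u = 0"
    unfolding fourier_ek using i1 i2 by (simp add: Bochner_Integration.integral_add)
  then show ?thesis by (simp add: add_eq_0_iff)
qed

text \<open>Two derivatives are traded for a factor of modulus (2 pi u)^2, which dominates u^2; the
  transforms of \<phi> and of its second derivative are bounded by integrals of the moduli.\<close>

lemma fourier_schwartz_decay:
  assumes "schwartz \<phi>"
  shows "\<exists>B. \<forall>u. norm (fourier \<phi> u) \<le> B / (1 + u\<^sup>2)"
proof -
  obtain D where D: "D 0 = \<phi>" "\<And>n x. (D n has_vector_derivative D (Suc n) x) (at x)"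
    "\<And>m n. \<exists>B. \<forall>x. norm (x ^ m *\<^sub>R D n x) \<le> B"
    by (rule schwartzE[OF assms]) blast
  have "\<forall>n. \<exists>B. \<forall>x. norm (D n x) \<le> B / (1 + x\<^sup>2)"
    by (intro allI schwartz_deriv_decay D(3))
  then obtain B where B: "\<And>n x. norm (D n x) \<le> B n / (1 + x\<^sup>2)" by metis
  have cont: "isCont (D n) x" for n x using D(2) has_vector_derivative_continuous by blast
  have [measurable]: "D n \<in> borel_measurable borel" for n
    by (intro borel_measurable_continuous_onI continuous_at_imp_continuous_on ballI cont)
  have int: "integrable lborel (D n)" for n by (rule integrable_of_lorentz_bound[OF _ B]) simp
  define b where "b n = (LINT x|lborel. norm (D n x))" for n
  have le: "norm (fourier (D n) u) \<le> b n" for n u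
  proof -
    have "norm (fourier (D n) u) \<le> (LINT x|lborel. norm (ek u x * D n x))"
      unfolding fourier_ek by (rule integral_norm_bound)
    then show ?thesis by (simp add: norm_mult b_def)
  qed
  have "norm (fourier \<phi> u) \<le> (b 0 + b 2) / (1 + u\<^sup>2)" for u
  proof -
    have "fourier (D 2) u = (2 * of_real pi * \<i> * of_real u) * ((2 * of_real pi * \<i> * of_real u) * fourier (D 0) u)"
      using fourier_derivative[OF D(2) B B cont, of 0 u] fourier_derivative[OF D(2) B B cont, of 1 u]
      by (simp add: numeral_2_eq_2)
    then have "norm (fourier (D 2) u) = (2 * pi * \<bar>u\<bar>)\<^sup>2 * norm (fourier (D 0) u)"
      by (simp add: norm_mult power2_eq_square mult_ac)
    moreover have "u\<^sup>2 * norm (fourier (D 0) u) \<le> (2 * pi * \<bar>u\<bar>)\<^sup>2 * norm (fourier (D 0) u)"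
    proof (intro mult_right_mono)
      have "1 * \<bar>u\<bar> \<le> 2 * pi * \<bar>u\<bar>" using pi_ge_two by (intro mult_right_mono) auto
      then have "\<bar>u\<bar>\<^sup>2 \<le> (2 * pi * \<bar>u\<bar>)\<^sup>2" by (intro power_mono) auto
      then show "u\<^sup>2 \<le> (2 * pi * \<bar>u\<bar>)\<^sup>2" by simp
    qed simp
    ultimately have "u\<^sup>2 * norm (fourier (D 0) u) \<le> b 2" using le[of 2 u] by linarith
    then have "norm (fourier \<phi> u) * (1 + u\<^sup>2) \<le> b 0 + b 2"
      using le[of 0 u] D(1) by (simp add: algebra_simps)
    then show ?thesis by (simp add: pos_le_divide_eq add_pos_nonneg)
  qed
  then show ?thesis by blast
qed

lemma fourier_measurable [measurable]:
  assumes [measurable]: "\<phi> \<in> borel_measurable borel"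
  shows "fourier \<phi> \<in> borel_measurable borel"
proof -
  have "(\<lambda>u. LINT x|lborel. exp (- 2 * of_real pi * \<i> * of_real u * of_real x) * \<phi> x) \<in> borel_measurable borel"
    by measurable
  then show ?thesis unfolding fourier_def[abs_def] .
qed

section \<open>Gaussian test functions\<close>

definition gauss_test :: "real \<Rightarrow> real \<Rightarrow> real \<Rightarrow> complex" where
  "gauss_test \<epsilon> k x = of_real (exp (- (pi * (x - k) / \<epsilon>)\<^sup>2))"

lemma fourier_gauss_test:
  assumes "\<epsilon> > 0"
  shows "fourier (gauss_test \<epsilon> k) u = of_real (gauss_kernel \<epsilon> u) * ek k u"
proof -
  \<comment> \<open>The standard deviation of the test function; rescaling by it leads to the
    characteristic function of the standard normal distribution.\<close>
  define c where "c = \<epsilon> / (pi * sqrt 2)"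
  have c: "c \<noteq> 0" using assms by (simp add: c_def)
  have "fourier (gauss_test \<epsilon> k) u = \<bar>c\<bar> *\<^sub>R (LINT x|lborel. ek u (k + c * x) * gauss_test \<epsilon> k (k + c * x))"
    unfolding fourier_ek by (rule lborel_integral_real_affine[OF c])
  also have "(\<lambda>x. ek u (k + c * x) * gauss_test \<epsilon> k (k + c * x))
      = (\<lambda>x. (ek u k * of_real (sqrt (2 * pi))) * (std_normal_density x *\<^sub>R iexp ((- 2 * pi * u * c) * x)))"
  proof
    fix x
    have "(pi * (k + c * x - k) / \<epsilon>)\<^sup>2 = x\<^sup>2 / 2"
      using assms by (simp add: c_def power_mult_distrib power_divide)
    moreover have "ek u (c * x) = iexp ((- 2 * pi * u * c) * x)" by (simp add: ek_def mult_ac)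
    ultimately show "ek u (k + c * x) * gauss_test \<epsilon> k (k + c * x)
        = (ek u k * of_real (sqrt (2 * pi))) * (std_normal_density x *\<^sub>R iexp ((- 2 * pi * u * c) * x))"
      by (simp add: gauss_test_def ek_add normal_density_def scaleR_conv_of_real)
  qed
  also have "(LINT x|lborel. (ek u k * of_real (sqrt (2 * pi))) * (std_normal_density x *\<^sub>R iexp ((- 2 * pi * u * c) * x)))
      = (ek u k * of_real (sqrt (2 * pi))) * char std_normal_distribution (- 2 * pi * u * c)"
  proof -
    have "char std_normal_distribution (- 2 * pi * u * c)
        = (LINT x|lborel. std_normal_density x *\<^sub>R iexp ((- 2 * pi * u * c) * x))"
      unfolding char_def by (subst integral_density) (auto simp: normal_density_nonneg)
    then show ?thesis by (simp only: integral_mult_right_zero)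
  qed
  also have "char std_normal_distribution (- 2 * pi * u * c) = of_real (exp (- (\<epsilon> * u)\<^sup>2))"
  proof -
    have "(- 2 * pi * u * c)\<^sup>2 / 2 = (\<epsilon> * u)\<^sup>2"
      by (simp add: c_def power_mult_distrib power_divide)
    then show ?thesis unfolding char_std_normal_distribution by simp
  qed
  also have "\<bar>c\<bar> *\<^sub>R ((ek u k * of_real (sqrt (2 * pi))) * of_real (exp (- (\<epsilon> * u)\<^sup>2)))
      = of_real (gauss_kernel \<epsilon> u) * ek k u"
  proof -
    have "\<bar>c\<bar> * sqrt (2 * pi) = \<epsilon> / sqrt pi"
      using assms by (simp add: c_def real_sqrt_mult field_simps)
    moreover have "\<bar>c\<bar> *\<^sub>R ((ek u k * of_real (sqrt (2 * pi))) * of_real (exp (- (\<epsilon> * u)\<^sup>2)))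
        = of_real ((\<bar>c\<bar> * sqrt (2 * pi)) * exp (- (\<epsilon> * u)\<^sup>2)) * ek u k"
      by (simp add: scaleR_conv_of_real mult_ac)
    ultimately show ?thesis unfolding gauss_kernel_def ek_commute[of k u] by (simp only:)
  qed
  finally show ?thesis .
qed

text \<open>The power is absorbed by m! exp |x|, and the exponent |x| - (c (x - k))^2 is bounded by
  completing a square.\<close>

lemma power_gaussian_bounded: "\<exists>B. \<forall>x. norm (x ^ m * exp (- (c * (x - k))\<^sup>2)) \<le> B" if "c > 0" for c :: real
proof -
  have "norm (x ^ m * exp (- (c * (x - k))\<^sup>2)) \<le> fact m * exp (\<bar>k\<bar> + 1 / c\<^sup>2)" for x
  proof -
    have "\<bar>x\<bar> ^ m / fact m \<le> exp \<bar>x\<bar>"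
    proof -
      have "(\<Sum>n\<in>{m}. \<bar>x\<bar> ^ n /\<^sub>R fact n) \<le> exp \<bar>x\<bar>"
        unfolding exp_def by (intro sum_le_suminf summable_exp_generic) auto
      then show ?thesis by (simp add: divide_inverse mult.commute)
    qed
    then have "\<bar>x\<bar> ^ m \<le> fact m * exp \<bar>x\<bar>" by (simp add: field_simps)
    then have "\<bar>x\<bar> ^ m * exp (- (c * (x - k))\<^sup>2) \<le> fact m * exp \<bar>x\<bar> * exp (- (c * (x - k))\<^sup>2)"
      by (rule mult_right_mono) simp
    also have "\<dots> = fact m * exp (\<bar>x\<bar> - (c * (x - k))\<^sup>2)" by (simp add: exp_diff exp_minus field_simps)
    also have "\<dots> \<le> fact m * exp (\<bar>k\<bar> + 1 / c\<^sup>2)"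
    proof -
      have "0 \<le> (c * \<bar>x - k\<bar> - 1 / c)\<^sup>2" by simp
      then have "2 * \<bar>x - k\<bar> \<le> (c * (x - k))\<^sup>2 + 1 / c\<^sup>2"
        using that by (simp add: power2_diff power_mult_distrib power_divide)
      moreover have "\<bar>x\<bar> \<le> \<bar>k\<bar> + \<bar>x - k\<bar>" "0 \<le> \<bar>x - k\<bar>" by linarith+
      moreover have "a - A \<le> b + B" if "2 * d \<le> A + B" "a \<le> b + d" "0 \<le> d" for a b d A B :: real
        using that by linarith
      ultimately have "\<bar>x\<bar> - (c * (x - k))\<^sup>2 \<le> \<bar>k\<bar> + 1 / c\<^sup>2" by blast
      then show ?thesis by simp
    qed
    finally show ?thesis by (simp add: abs_mult power_abs)
  qed
  then show ?thesis by blast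
qed

lemma poly_gaussian_bounded:
  fixes p :: "real poly"
  assumes "c > 0"
  shows "\<exists>B. \<forall>x. norm (x ^ m * (poly p x * exp (- (c * (x - k))\<^sup>2))) \<le> B"
proof (induction p arbitrary: m)
  case 0
  then show ?case by auto
next
  case (pCons a p)
  obtain B1 where B1: "\<And>x. norm (x ^ m * exp (- (c * (x - k))\<^sup>2)) \<le> B1"
    using power_gaussian_bounded[OF assms] by blast
  obtain B2 where B2: "\<And>x. norm (x ^ Suc m * (poly p x * exp (- (c * (x - k))\<^sup>2))) \<le> B2"
    using pCons.IH by blast
  have "norm (x ^ m * (poly (pCons a p) x * exp (- (c * (x - k))\<^sup>2))) \<le> \<bar>a\<bar> * B1 + B2" for x
  proof -
    have "x ^ m * (poly (pCons a p) x * exp (- (c * (x - k))\<^sup>2))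
      = a * (x ^ m * exp (- (c * (x - k))\<^sup>2)) + x ^ Suc m * (poly p x * exp (- (c * (x - k))\<^sup>2))"
      by (simp add: algebra_simps)
    moreover have "norm (a * (x ^ m * exp (- (c * (x - k))\<^sup>2))) \<le> \<bar>a\<bar> * B1"
      unfolding norm_mult[of a] real_norm_def[of a] by (intro mult_left_mono B1) simp
    ultimately show ?thesis using norm_triangle_le[OF add_mono[OF _ B2[of x]]] by metis
  qed
  then show ?case by blast
qed

lemma schwartz_gauss_test:
  assumes "\<epsilon> > 0"
  shows "schwartz (gauss_test \<epsilon> k)"
proof -
  define c where "c = pi / \<epsilon>"
  have c: "c > 0" using assms by (simp add: c_def)
  \<comment> \<open>The logarithmic derivative - 2 c^2 (x - k) of the Gaussian: differentiating p
    times the Gaussian replaces p by p' + q p.\<close>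
  define q where "q = [:2 * c\<^sup>2 * k, - 2 * c\<^sup>2:]"
  define P where "P n = ((\<lambda>p. pderiv p + q * p) ^^ n) 1" for n
  define D where "D n x = complex_of_real (poly (P n) x * exp (- (c * (x - k))\<^sup>2))" for n x
  have "D 0 = gauss_test \<epsilon> k" by (auto simp: D_def P_def gauss_test_def c_def)
  moreover have "(D n has_vector_derivative D (Suc n) x) (at x)" for n x
  proof -
    have "((\<lambda>x. poly (P n) x * exp (- (c * (x - k))\<^sup>2)) has_real_derivative
        poly (P (Suc n)) x * exp (- (c * (x - k))\<^sup>2)) (at x)"
      by (auto intro!: derivative_eq_intros simp: P_def q_def power2_eq_square algebra_simps)
    then have "((\<lambda>x. poly (P n) x * exp (- (c * (x - k))\<^sup>2)) has_vector_derivative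
        poly (P (Suc n)) x * exp (- (c * (x - k))\<^sup>2)) (at x)"
      by (simp add: has_real_derivative_iff_has_vector_derivative)
    then show ?thesis unfolding D_def by (rule bounded_linear.has_vector_derivative[OF bounded_linear_of_real])
  qed
  moreover have "bounded (range (\<lambda>x. x ^ m *\<^sub>R D n x))" for m n
  proof -
    obtain B where "\<And>x. norm (x ^ m * (poly (P n) x * exp (- (c * (x - k))\<^sup>2))) \<le> B"
      using poly_gaussian_bounded[OF c] by blast
    then have "norm (x ^ m *\<^sub>R D n x) \<le> B" for x
      unfolding D_def scaleR_conv_of_real of_real_mult[symmetric] norm_of_real by (simp only: real_norm_def)
    then show ?thesis unfolding bounded_iff by blast
  qed
  ultimately show ?thesis unfolding schwartz_def by blast
qed

section \<open>Existence of the Fourier transform\<close>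

lemma weak_conv_m_subseq:
  assumes "weak_conv_m \<mu> M" "strict_mono r"
  shows "weak_conv_m (\<mu> \<circ> r) M"
  using assms LIMSEQ_subseq_LIMSEQ[of _ _ r] unfolding weak_conv_m_def weak_conv_def o_def by blast

text \<open>Successive extraction, one index at a time; convergence already achieved survives
  further extraction. The four polarized measures and their masses have to converge along one common
  subsequence.\<close>

lemma finite_tight_family_subsequence:
  fixes \<mu> :: "'i \<Rightarrow> nat \<Rightarrow> real measure" and c :: "'i \<Rightarrow> nat \<Rightarrow> real"
  assumes "finite I" and "\<And>i. i \<in> I \<Longrightarrow> tight (\<mu> i)" and "\<And>i. i \<in> I \<Longrightarrow> bounded (range (c i))"
  shows "\<exists>s M C. strict_mono s \<and> (\<forall>i\<in>I. real_distribution (M i) \<and> weak_conv_m (\<mu> i \<circ> s) (M i)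
    \<and> (c i \<circ> s) \<longlonglongrightarrow> C i)"
  using assms
proof (induction I)
  case empty
  show ?case by (intro exI[of _ id]) (auto simp: strict_mono_def)
next
  case (insert i I)
  then obtain s M C where s: "strict_mono s" and
    MC: "\<And>i. i \<in> I \<Longrightarrow> real_distribution (M i) \<and> weak_conv_m (\<mu> i \<circ> s) (M i) \<and> (c i \<circ> s) \<longlonglongrightarrow> C i"
    by (metis insertCI)
  have "tight (\<mu> i)" using insert by simp
  from tight_imp_convergent_subsubsequence[OF this s] obtain r N where
    r: "strict_mono r" "real_distribution N" "weak_conv_m (\<mu> i \<circ> s \<circ> r) N" by blast
  have "bounded (range (c i \<circ> s \<circ> r))"
    by (rule bounded_subset[OF insert.prems(2)[of i]]) auto
  from bounded_imp_convergent_subsequence[OF this] obtain L t where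
    t: "strict_mono t" "(c i \<circ> s \<circ> r \<circ> t) \<longlonglongrightarrow> L" by blast
  have rt: "strict_mono (r \<circ> t)" by (rule strict_mono_o[OF r(1) t(1)])
  have "strict_mono (s \<circ> (r \<circ> t))" by (rule strict_mono_o[OF s rt])
  moreover have "real_distribution ((M(i := N)) j) \<and> weak_conv_m (\<mu> j \<circ> (s \<circ> (r \<circ> t))) ((M(i := N)) j)
      \<and> (c j \<circ> (s \<circ> (r \<circ> t))) \<longlonglongrightarrow> (C(i := L)) j" if "j \<in> insert i I" for j
  proof (cases "j = i")
    case True
    have "weak_conv_m (\<mu> i \<circ> s \<circ> r \<circ> t) N" by (rule weak_conv_m_subseq[OF r(3) t(1)])
    then show ?thesis using True r(2) t(2) by (simp add: o_assoc)
  next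
    case False
    then have "j \<in> I" using that by simp
    from MC[OF this] have "weak_conv_m ((\<mu> j \<circ> s) \<circ> (r \<circ> t)) (M j)" "((c j \<circ> s) \<circ> (r \<circ> t)) \<longlonglongrightarrow> C j"
      using weak_conv_m_subseq[OF _ rt] LIMSEQ_subseq_LIMSEQ[OF _ rt] by blast+
    then show ?thesis using False MC[OF \<open>j \<in> I\<close>] by (simp add: o_assoc)
  qed
  ultimately show ?case by blast
qed

text \<open>Summation over the fourth roots of unity singles out the mixed term; the added constant
  1 disappears because the roots sum to 0.\<close>

lemma polarization:
  fixes a b :: complex
  assumes "r > 0"
  shows "(\<Sum>m<4. cnj (\<i> ^ m) * of_real ((norm (a + \<i> ^ m * b))\<^sup>2 / (2 * r) + 1)) / 4 = cnj a * b / of_real (2 * r)"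
proof -
  have sq: "complex_of_real ((norm z)\<^sup>2) = z * cnj z" for z using complex_norm_square[of z] by simp
  have "(\<Sum>m<4. cnj (\<i> ^ m) * of_real ((norm (a + \<i> ^ m * b))\<^sup>2 / (2 * r) + 1))
      = (\<Sum>m<4. cnj (\<i> ^ m) * ((a + \<i> ^ m * b) * cnj (a + \<i> ^ m * b))) / of_real (2 * r) + (\<Sum>m<4. cnj (\<i> ^ m))"
    unfolding sum_divide_distrib sum.distrib[symmetric]
    by (intro sum.cong refl) (simp only: of_real_add of_real_divide sq of_real_1, simp add: distrib_left)
  also have "(\<Sum>m<4. cnj (\<i> ^ m)) = 0" by (simp add: eval_nat_numeral)
  also have "(\<Sum>m<4. cnj (\<i> ^ m) * ((a + \<i> ^ m * b) * cnj (a + \<i> ^ m * b))) = 4 * (cnj a * b)"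
    by (simp add: eval_nat_numeral algebra_simps)
  finally show ?thesis by simp
qed

text \<open>With n the integer part of |x|, the point x is at distance at most 1 from n or from -n,
  and the Gaussian centred there is still at least exp(- pi^2) at x. This reduces bounds with the
  weight 1 / (1 + x^2) to bounds for translated Gaussians.\<close>

lemma lorentz_le_gaussians:
  "1 / (1 + x\<^sup>2) \<le> exp (pi\<^sup>2) * (shell (nat \<lfloor>\<bar>x\<bar>\<rfloor>)
     * (exp (- (pi * (x - real (nat \<lfloor>\<bar>x\<bar>\<rfloor>)))\<^sup>2) + exp (- (pi * (x - (- real (nat \<lfloor>\<bar>x\<bar>\<rfloor>))))\<^sup>2)))"
proof -
  define n where "n = real (nat \<lfloor>\<bar>x\<bar>\<rfloor>)"
  have n: "0 \<le> n" "n \<le> \<bar>x\<bar>" "\<bar>x\<bar> - n \<le> 1" unfolding n_def by (simp_all add: of_nat_floor) linarith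
  have "n\<^sup>2 \<le> \<bar>x\<bar>\<^sup>2" using n by (intro power_mono) auto
  then have "1 / (1 + x\<^sup>2) \<le> 1 / (1 + n\<^sup>2)" by (intro divide_left_mono mult_pos_pos add_pos_nonneg) auto
  then have 1: "1 / (1 + x\<^sup>2) \<le> shell (nat \<lfloor>\<bar>x\<bar>\<rfloor>)" by (simp add: shell_def n_def)
  have "1 \<le> exp (pi\<^sup>2) * exp (- (pi * (\<bar>x\<bar> - n))\<^sup>2)"
  proof -
    have "(\<bar>x\<bar> - n)\<^sup>2 \<le> 1\<^sup>2" using n by (intro power_mono) auto
    then have "(pi * (\<bar>x\<bar> - n))\<^sup>2 \<le> pi\<^sup>2 * 1" unfolding power_mult_distrib by (intro mult_left_mono) auto
    then show ?thesis unfolding exp_add[symmetric] by simp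
  qed
  also have "\<dots> \<le> exp (pi\<^sup>2) * (exp (- (pi * (x - n))\<^sup>2) + exp (- (pi * (x - (- n)))\<^sup>2))"
  proof (intro mult_left_mono)
    show "exp (- (pi * (\<bar>x\<bar> - n))\<^sup>2) \<le> exp (- (pi * (x - n))\<^sup>2) + exp (- (pi * (x - (- n)))\<^sup>2)"
    proof (cases "x \<ge> 0")
      case False
      have "(pi * (- x - n))\<^sup>2 = (pi * (x - (- n)))\<^sup>2" by (simp add: power_mult_distrib power2_eq_square algebra_simps)
      then show ?thesis using False by simp
    qed simp
  qed simp
  finally have 2: "1 \<le> exp (pi\<^sup>2) * (exp (- (pi * (x - n))\<^sup>2) + exp (- (pi * (x - (- n)))\<^sup>2))" .
  have "1 / (1 + x\<^sup>2) * 1 \<le> shell (nat \<lfloor>\<bar>x\<bar>\<rfloor>) * (exp (pi\<^sup>2) * (exp (- (pi * (x - n))\<^sup>2) + exp (- (pi * (x - (- n)))\<^sup>2)))"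
    by (intro mult_mono 1 2 shell_nonneg) auto
  then show ?thesis unfolding n_def by (simp add: mult_ac)
qed

context coloured_set begin

definition exp_sum :: "'a \<Rightarrow> real \<Rightarrow> real \<Rightarrow> complex" where
  "exp_sum j r \<kappa> = (\<Sum>x\<in>\<Lambda> j \<inter> {- r..r}. ek \<kappa> x)"

lemma exp_sum_measurable [measurable]: "exp_sum j r \<in> borel_measurable borel"
proof -
  have "exp_sum j r = (\<lambda>\<kappa>. \<Sum>x\<in>\<Lambda> j \<inter> {- r..r}. ek x \<kappa>)"
    unfolding exp_sum_def by (intro ext sum.cong refl ek_commute)
  then show ?thesis by simp
qed

lemma schwartz_integrable:
  assumes "schwartz \<phi>"
  shows "integrable lborel \<phi>"
proof -
  obtain D where D: "D 0 = \<phi>" "\<And>n x. (D n has_vector_derivative D (Suc n) x) (at x)"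
    "\<And>m n. \<exists>B. \<forall>x. norm (x ^ m *\<^sub>R D n x) \<le> B"
    by (rule schwartzE[OF assms]) blast
  obtain B where "\<And>x. norm (D 0 x) \<le> B / (1 + x\<^sup>2)" using schwartz_deriv_decay[of D 0] D(3) by blast
  then have "\<And>x. norm (\<phi> x) \<le> B / (1 + x\<^sup>2)" using D(1) by simp
  then show ?thesis by (rule integrable_of_lorentz_bound[OF schwartz_borel[OF assms]])
qed

lemma structure_factor_integral:
  assumes \<phi>: "schwartz \<phi>"
  shows "integrable lborel (\<lambda>\<kappa>. \<phi> \<kappa> * (cnj (exp_sum i r \<kappa>) * exp_sum j r \<kappa>))"
    and "(LINT \<kappa>|lborel. \<phi> \<kappa> * (cnj (exp_sum i r \<kappa>) * exp_sum j r \<kappa>))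
      = (\<Sum>x\<in>\<Lambda> i \<inter> {- r..r}. \<Sum>y\<in>\<Lambda> j \<inter> {- r..r}. fourier \<phi> (y - x))"
proof -
  note [measurable] = schwartz_borel[OF \<phi>]
  have eq: "\<phi> \<kappa> * (cnj (exp_sum i r \<kappa>) * exp_sum j r \<kappa>)
      = (\<Sum>x\<in>\<Lambda> i \<inter> {- r..r}. \<Sum>y\<in>\<Lambda> j \<inter> {- r..r}. ek (y - x) \<kappa> * \<phi> \<kappa>)" for \<kappa>
  proof -
    have "\<phi> \<kappa> * (cnj (exp_sum i r \<kappa>) * exp_sum j r \<kappa>)
        = \<phi> \<kappa> * (\<Sum>x\<in>\<Lambda> i \<inter> {- r..r}. \<Sum>y\<in>\<Lambda> j \<inter> {- r..r}. cnj (ek \<kappa> x) * ek \<kappa> y)"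
      unfolding exp_sum_def cnj_sum sum_product ..
    also have "\<dots> = (\<Sum>x\<in>\<Lambda> i \<inter> {- r..r}. \<Sum>y\<in>\<Lambda> j \<inter> {- r..r}. \<phi> \<kappa> * (cnj (ek \<kappa> x) * ek \<kappa> y))"
      unfolding sum_distrib_left ..
    also have "\<dots> = (\<Sum>x\<in>\<Lambda> i \<inter> {- r..r}. \<Sum>y\<in>\<Lambda> j \<inter> {- r..r}. ek (y - x) \<kappa> * \<phi> \<kappa>)"
      by (intro sum.cong refl) (subst ek_commute[of _ \<kappa>], simp add: ek_diff mult_ac)
    finally show ?thesis .
  qed
  have int: "integrable lborel (\<lambda>\<kappa>. ek u \<kappa> * \<phi> \<kappa>)" for u
    by (rule Bochner_Integration.integrable_bound[OF schwartz_integrable[OF \<phi>]]) (auto simp: norm_mult)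
  show "integrable lborel (\<lambda>\<kappa>. \<phi> \<kappa> * (cnj (exp_sum i r \<kappa>) * exp_sum j r \<kappa>))"
    unfolding eq by (intro Bochner_Integration.integrable_sum int)
  show "(LINT \<kappa>|lborel. \<phi> \<kappa> * (cnj (exp_sum i r \<kappa>) * exp_sum j r \<kappa>))
      = (\<Sum>x\<in>\<Lambda> i \<inter> {- r..r}. \<Sum>y\<in>\<Lambda> j \<inter> {- r..r}. fourier \<phi> (y - x))"
    unfolding eq fourier_ek
    by (subst Bochner_Integration.integral_sum, intro Bochner_Integration.integrable_sum int)
      (intro sum.cong refl Bochner_Integration.integral_sum int)
qed

text \<open>The integral is a double sum of the transformed Gaussian over the patch, and the centre
  a only contributes a character. Summing the decay row by row gives a bound independent of r and
  a.\<close>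

lemma diffraction_gaussian_bound:
  assumes "r \<ge> 1"
  shows "(\<integral>\<^sup>+ \<kappa>. ennreal ((norm (exp_sum j r \<kappa>))\<^sup>2 / (2 * r) * exp (- (pi * (\<kappa> - a))\<^sup>2)) \<partial>lborel)
    \<le> ennreal (2 * tail 0 * (1 / \<delta> + 1))"
proof -
  let ?g = "gauss_test 1 a"
  have sch: "schwartz ?g" by (rule schwartz_gauss_test) simp
  have eq: "?g \<kappa> * (cnj (exp_sum j r \<kappa>) * exp_sum j r \<kappa>) / of_real (2 * r)
      = of_real ((norm (exp_sum j r \<kappa>))\<^sup>2 / (2 * r) * exp (- (pi * (\<kappa> - a))\<^sup>2))" for \<kappa>
    using complex_norm_square[of "exp_sum j r \<kappa>"] by (simp add: gauss_test_def mult_ac)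
  have int: "integrable lborel (\<lambda>\<kappa>. complex_of_real ((norm (exp_sum j r \<kappa>))\<^sup>2 / (2 * r) * exp (- (pi * (\<kappa> - a))\<^sup>2)))"
    unfolding eq[symmetric] by (intro integrable_divide structure_factor_integral(1) sch)
  have kernel: "norm (of_real (gauss_kernel 1 u) * ek a u) \<le> 2 / (1 + u\<^sup>2)" for u
    using gauss_kernel_decay[of 1 u] gauss_kernel_nonneg[of 1 u] by (simp add: norm_mult)
  have "(LINT \<kappa>|lborel. complex_of_real ((norm (exp_sum j r \<kappa>))\<^sup>2 / (2 * r) * exp (- (pi * (\<kappa> - a))\<^sup>2)))
      = (\<Sum>x\<in>\<Lambda> j \<inter> {- r..r}. \<Sum>y\<in>\<Lambda> j \<inter> {- r..r}. of_real (gauss_kernel 1 (y - x)) * ek a (y - x)) / of_real (2 * r)"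
    unfolding eq[symmetric] integral_divide_zero structure_factor_integral(2)[OF sch] fourier_gauss_test[OF zero_less_one] ..
  also have "norm \<dots> \<le> (of_nat (card (\<Lambda> j \<inter> {- r..r})) * (2 * tail 0)) / \<bar>2 * r\<bar>"
    unfolding norm_divide norm_of_real
  proof (intro divide_right_mono sum_norm_bound)
    fix x assume "x \<in> \<Lambda> j \<inter> {- r..r}"
    show "norm (\<Sum>y\<in>\<Lambda> j \<inter> {- r..r}. of_real (gauss_kernel 1 (y - x)) * ek a (y - x)) \<le> 2 * tail 0"
      by (rule norm_kernel_sum[OF kernel]) (use sub_support in auto)
  qed simp
  also have "\<dots> = 2 * tail 0 * (real (card (\<Lambda> j \<inter> {- r..r})) / (2 * r))" using assms by simp
  also have "\<dots> \<le> 2 * tail 0 * (1 / \<delta> + 1)"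
    using tail_nonneg[of 0] by (intro mult_left_mono card_ratio assms) auto
  finally have "norm (LINT \<kappa>|lborel. complex_of_real ((norm (exp_sum j r \<kappa>))\<^sup>2 / (2 * r) * exp (- (pi * (\<kappa> - a))\<^sup>2)))
      \<le> 2 * tail 0 * (1 / \<delta> + 1)" .
  then have "(LINT \<kappa>|lborel. (norm (exp_sum j r \<kappa>))\<^sup>2 / (2 * r) * exp (- (pi * (\<kappa> - a))\<^sup>2)) \<le> 2 * tail 0 * (1 / \<delta> + 1)"
    unfolding integral_complex_of_real norm_of_real by linarith
  moreover have "(\<integral>\<^sup>+ \<kappa>. ennreal ((norm (exp_sum j r \<kappa>))\<^sup>2 / (2 * r) * exp (- (pi * (\<kappa> - a))\<^sup>2)) \<partial>lborel)
      = ennreal (LINT \<kappa>|lborel. (norm (exp_sum j r \<kappa>))\<^sup>2 / (2 * r) * exp (- (pi * (\<kappa> - a))\<^sup>2))"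
    using int assms unfolding complex_of_real_integrable_eq by (intro nn_integral_eq_integral) auto
  ultimately show ?thesis by (simp add: ennreal_leI)
qed

text \<open>Superposes \<open>diffraction_gaussian_bound\<close> over all integer centres with the
  summable weights \<open>shell n\<close>.\<close>

lemma diffraction_lorentz_bound:
  "\<exists>C\<ge>0. \<forall>r\<ge>1. (\<integral>\<^sup>+ \<kappa>. ennreal ((norm (exp_sum j r \<kappa>))\<^sup>2 / (2 * r) * (1 / (1 + \<kappa>\<^sup>2))) \<partial>lborel) \<le> ennreal C"
proof -
  define c where "c = 2 * tail 0 * (1 / \<delta> + 1)"
  have c: "c \<ge> 0" unfolding c_def using tail_nonneg \<delta>_pos by (intro mult_nonneg_nonneg) auto
  define C where "C = (\<Sum>n. exp (pi\<^sup>2) * shell n * (2 * c))"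
  have sm: "summable (\<lambda>n. exp (pi\<^sup>2) * shell n * (2 * c))"
    by (intro summable_mult summable_mult2 summable_shell)
  have C: "C \<ge> 0" unfolding C_def using c shell_nonneg by (intro suminf_nonneg sm mult_nonneg_nonneg) auto
  have "(\<integral>\<^sup>+ \<kappa>. ennreal ((norm (exp_sum j r \<kappa>))\<^sup>2 / (2 * r) * (1 / (1 + \<kappa>\<^sup>2))) \<partial>lborel) \<le> ennreal C"
    if r: "r \<ge> 1" for r
  proof -
    let ?p = "\<lambda>\<kappa>. (norm (exp_sum j r \<kappa>))\<^sup>2 / (2 * r)"
    let ?g = "\<lambda>a \<kappa>. exp (- (pi * (\<kappa> - a))\<^sup>2)"
    let ?G = "\<lambda>n \<kappa>. ennreal (exp (pi\<^sup>2) * shell n) * (ennreal (?p \<kappa> * ?g (real n) \<kappa>) + ennreal (?p \<kappa> * ?g (- real n) \<kappa>))"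
    have "(\<integral>\<^sup>+ \<kappa>. ennreal (?p \<kappa> * (1 / (1 + \<kappa>\<^sup>2))) \<partial>lborel) \<le> (\<integral>\<^sup>+ \<kappa>. (\<Sum>n. ?G n \<kappa>) \<partial>lborel)"
    proof (rule nn_integral_mono)
      fix \<kappa> :: real
      let ?n = "nat \<lfloor>\<bar>\<kappa>\<bar>\<rfloor>"
      have "?p \<kappa> * (1 / (1 + \<kappa>\<^sup>2)) \<le> ?p \<kappa> * (exp (pi\<^sup>2) * (shell ?n * (?g (real ?n) \<kappa> + ?g (- real ?n) \<kappa>)))"
        using r by (intro mult_left_mono lorentz_le_gaussians) auto
      also have "\<dots> = (exp (pi\<^sup>2) * shell ?n) * (?p \<kappa> * ?g (real ?n) \<kappa> + ?p \<kappa> * ?g (- real ?n) \<kappa>)"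
        by (simp add: distrib_left mult_ac)
      finally have "ennreal (?p \<kappa> * (1 / (1 + \<kappa>\<^sup>2))) \<le> ?G ?n \<kappa>"
        using r shell_nonneg by (simp add: ennreal_mult[symmetric] ennreal_plus[symmetric] ennreal_leI del: ennreal_plus)
      also have "\<dots> = (\<Sum>n\<in>{?n}. ?G n \<kappa>)" by simp
      also have "\<dots> \<le> (\<Sum>n. ?G n \<kappa>)" by (rule sum_le_suminf) auto
      finally show "ennreal (?p \<kappa> * (1 / (1 + \<kappa>\<^sup>2))) \<le> (\<Sum>n. ?G n \<kappa>)" .
    qed
    also have "\<dots> = (\<Sum>n. \<integral>\<^sup>+ \<kappa>. ?G n \<kappa> \<partial>lborel)" by (rule nn_integral_suminf) measurable
    also have "\<dots> \<le> (\<Sum>n. ennreal (exp (pi\<^sup>2) * shell n * (2 * c)))"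
    proof (rule suminf_le)
      fix n
      have "(\<integral>\<^sup>+ \<kappa>. ?G n \<kappa> \<partial>lborel) = ennreal (exp (pi\<^sup>2) * shell n)
          * ((\<integral>\<^sup>+ \<kappa>. ennreal (?p \<kappa> * ?g (real n) \<kappa>) \<partial>lborel) + (\<integral>\<^sup>+ \<kappa>. ennreal (?p \<kappa> * ?g (- real n) \<kappa>) \<partial>lborel))"
        by (subst nn_integral_cmult, measurable, subst nn_integral_add, measurable)
      also have "\<dots> \<le> ennreal (exp (pi\<^sup>2) * shell n) * (ennreal c + ennreal c)"
        unfolding c_def by (intro mult_left_mono add_mono diffraction_gaussian_bound r) simp
      also have "\<dots> = ennreal (exp (pi\<^sup>2) * shell n * (2 * c))"
        using c shell_nonneg[of n] by (simp add: ennreal_mult[symmetric] ennreal_plus[symmetric] del: ennreal_plus)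
      finally show "(\<integral>\<^sup>+ \<kappa>. ?G n \<kappa> \<partial>lborel) \<le> ennreal (exp (pi\<^sup>2) * shell n * (2 * c))" .
    qed auto
    also have "\<dots> = ennreal C"
      unfolding C_def using c shell_nonneg by (intro suminf_ennreal2 sm mult_nonneg_nonneg) auto
    finally show ?thesis .
  qed
  then show ?thesis using C by blast
qed

end

text \<open>The mixture of the measures with equal weights dominates each of them; Radon-Nikodym
  derivatives with respect to it let complex combinations be formed pointwise.\<close>

lemma common_dominating_measure:
  fixes M :: "nat \<Rightarrow> real measure"
  assumes M: "\<And>m. m < N \<Longrightarrow> real_distribution (M m)" and "N > 0"
  shows "\<exists>M0 R. real_distribution M0 \<and> (\<forall>m<N. R m \<in> borel_measurable borel \<and> (\<forall>x. 0 \<le> R m x)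
    \<and> M m = density M0 (\<lambda>x. ennreal (R m x)))"
proof -
  define p where "p = pmf_of_set {..<N}"
  define M' where "M' m = (if m < N then M m else M 0)" for m
  have M': "real_distribution (M' m)" for m using M \<open>N > 0\<close> by (simp add: M'_def)
  define M0 where "M0 = measure_pmf p \<bind> M'"
  have setsM': "sets (M' m) = sets borel" for m
    using M'[of m] by (simp add: real_distribution.events_eq_borel)
  have meas: "M' \<in> measurable (measure_pmf p) (subprob_algebra borel)"
  proof -
    have "subprob_space (M' m)" for m
      using M'[of m] unfolding real_distribution_def by (intro prob_space_imp_subprob_space) simp
    then show ?thesis using setsM' by (auto simp: space_subprob_algebra)
  qed
  have sets0: "sets M0 = sets borel" unfolding M0_def by (rule sets_bind) (simp_all add: setsM')
  have em: "emeasure M0 X = (\<integral>\<^sup>+ m. emeasure (M' m) X \<partial>measure_pmf p)" if "X \<in> sets borel" for X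
    unfolding M0_def by (rule emeasure_bind[OF _ meas that]) simp
  have "prob_space M0"
  proof (rule prob_spaceI)
    have "space M0 = UNIV" using sets_eq_imp_space_eq[OF sets0] by simp
    moreover have "emeasure (M' m) UNIV = 1" for m
    proof -
      interpret real_distribution "M' m" by (rule M')
      show ?thesis using emeasure_space_1 by simp
    qed
    ultimately show "emeasure M0 (space M0) = 1" using em[of UNIV] by simp
  qed
  then have rd0: "real_distribution M0"
    unfolding real_distribution_def real_distribution_axioms_def using sets0 by simp
  interpret M0: real_distribution M0 by (rule rd0)
  have "\<exists>R. R \<in> borel_measurable borel \<and> (\<forall>x. 0 \<le> R x) \<and> M m = density M0 (\<lambda>x. ennreal (R x))" if m: "m < N" for m
  proof -
    interpret Mm: real_distribution "M m" by (rule M[OF m])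
    have ac: "absolutely_continuous M0 (M m)"
      unfolding absolutely_continuous_def
    proof
      fix X assume "X \<in> null_sets M0"
      then have X: "X \<in> sets borel" "emeasure M0 X = 0" by (auto simp: sets0)
      then have "(\<integral>\<^sup>+ m. emeasure (M' m) X \<partial>measure_pmf p) = 0" using em by simp
      then have "AE m in measure_pmf p. emeasure (M' m) X = 0" by (subst (asm) nn_integral_0_iff_AE) auto
      moreover have "m \<in> set_pmf p" unfolding p_def using m \<open>N > 0\<close> by (subst set_pmf_of_set) auto
      ultimately have "emeasure (M' m) X = 0" by (simp add: AE_measure_pmf_iff)
      then show "X \<in> null_sets (M m)" using X m by (simp add: M'_def null_sets_def)
    qed
    have sm: "sets (M m) = sets M0" by (simp add: sets0)
    obtain R where R: "R \<in> borel_measurable M0" "AE x in M0. RN_deriv M0 (M m) x = ennreal (R x)" "\<And>x. 0 \<le> R x"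
      using M0.real_RN_deriv[OF Mm.finite_measure_axioms ac sm] by metis
    have "M m = density M0 (RN_deriv M0 (M m))" by (rule M0.density_RN_deriv[OF ac sm, symmetric])
    also have "\<dots> = density M0 (\<lambda>x. ennreal (R x))"
      using R by (intro density_cong) auto
    finally show ?thesis using R by (auto intro!: exI[of _ R])
  qed
  then obtain R where "\<And>m. m < N \<Longrightarrow> R m \<in> borel_measurable borel \<and> (\<forall>x. 0 \<le> R m x) \<and> M m = density M0 (\<lambda>x. ennreal (R m x))"
    by metis
  then show ?thesis using rd0 by blast
qed

section \<open>Polarized and damped diffraction measures of finite patches\<close>

context coloured_set begin

text \<open>The summand \<open>1\<close> cancels under polarization; it keeps the total mass away from \<open>0\<close>, so that the
  measures can be normalized to probability distributions.\<close>

definition polarized :: "'a \<Rightarrow> 'a \<Rightarrow> nat \<Rightarrow> real \<Rightarrow> real \<Rightarrow> real" where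
  "polarized i j m r \<kappa> = (norm (exp_sum i r \<kappa> + \<i> ^ m * exp_sum j r \<kappa>))\<^sup>2 / (2 * r) + 1"

lemma polarized_measurable [measurable]: "polarized i j m r \<in> borel_measurable borel"
  unfolding polarized_def[abs_def] by measurable

lemma polarized_ge_1: "r \<ge> 1 \<Longrightarrow> polarized i j m r \<kappa> \<ge> 1" by (simp add: polarized_def)

lemma polarized_lorentz_bound:
  "\<exists>C\<ge>0. \<forall>r\<ge>1. (\<integral>\<^sup>+ \<kappa>. ennreal (polarized i j m r \<kappa> * (1 / (1 + \<kappa>\<^sup>2))) \<partial>lborel) \<le> ennreal C"
proof -
  let ?p = "\<lambda>j r \<kappa>. (norm (exp_sum j r \<kappa>))\<^sup>2 / (2 * r) * (1 / (1 + \<kappa>\<^sup>2))"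
  obtain C1 where C1: "C1 \<ge> 0" "\<And>r. r \<ge> 1 \<Longrightarrow> (\<integral>\<^sup>+ \<kappa>. ennreal (?p i r \<kappa>) \<partial>lborel) \<le> ennreal C1"
    using diffraction_lorentz_bound[of i] by blast
  obtain C2 where C2: "C2 \<ge> 0" "\<And>r. r \<ge> 1 \<Longrightarrow> (\<integral>\<^sup>+ \<kappa>. ennreal (?p j r \<kappa>) \<partial>lborel) \<le> ennreal C2"
    using diffraction_lorentz_bound[of j] by blast
  define C3 where "C3 = (LINT \<kappa>|lborel. 1 / (1 + \<kappa>\<^sup>2 :: real))"
  have C3: "C3 \<ge> 0" "(\<integral>\<^sup>+ \<kappa>. ennreal (1 / (1 + \<kappa>\<^sup>2 :: real)) \<partial>lborel) = ennreal C3"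
    unfolding C3_def by (auto intro!: integral_nonneg_AE nn_integral_eq_integral integrable_lorentz)
  have "(\<integral>\<^sup>+ \<kappa>. ennreal (polarized i j m r \<kappa> * (1 / (1 + \<kappa>\<^sup>2))) \<partial>lborel) \<le> ennreal (2 * C1 + 2 * C2 + C3)" if r: "r \<ge> 1" for r
  proof -
    have "(\<integral>\<^sup>+ \<kappa>. ennreal (polarized i j m r \<kappa> * (1 / (1 + \<kappa>\<^sup>2))) \<partial>lborel)
        \<le> (\<integral>\<^sup>+ \<kappa>. (2 * ennreal (?p i r \<kappa>) + 2 * ennreal (?p j r \<kappa>)) + ennreal (1 / (1 + \<kappa>\<^sup>2)) \<partial>lborel)"
    proof (rule nn_integral_mono)
      fix \<kappa> :: real
      have "norm (exp_sum i r \<kappa> + \<i> ^ m * exp_sum j r \<kappa>) \<le> norm (exp_sum i r \<kappa>) + norm (exp_sum j r \<kappa>)"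
        using norm_triangle_ineq[of "exp_sum i r \<kappa>" "\<i> ^ m * exp_sum j r \<kappa>"] by (simp add: norm_mult norm_power)
      then have "(norm (exp_sum i r \<kappa> + \<i> ^ m * exp_sum j r \<kappa>))\<^sup>2 \<le> (norm (exp_sum i r \<kappa>) + norm (exp_sum j r \<kappa>))\<^sup>2"
        by (intro power_mono) auto
      also have "\<dots> \<le> 2 * (norm (exp_sum i r \<kappa>))\<^sup>2 + 2 * (norm (exp_sum j r \<kappa>))\<^sup>2"
        using zero_le_power2[of "norm (exp_sum i r \<kappa>) - norm (exp_sum j r \<kappa>)"] by (simp add: power2_sum power2_diff)
      finally have "(norm (exp_sum i r \<kappa> + \<i> ^ m * exp_sum j r \<kappa>))\<^sup>2 / (2 * r)
          \<le> (2 * (norm (exp_sum i r \<kappa>))\<^sup>2 + 2 * (norm (exp_sum j r \<kappa>))\<^sup>2) / (2 * r)"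
        using r by (intro divide_right_mono) auto
      then have "polarized i j m r \<kappa> \<le> 2 * ((norm (exp_sum i r \<kappa>))\<^sup>2 / (2 * r)) + 2 * ((norm (exp_sum j r \<kappa>))\<^sup>2 / (2 * r)) + 1"
        unfolding polarized_def by (simp add: add_divide_distrib)
      then have "polarized i j m r \<kappa> * (1 / (1 + \<kappa>\<^sup>2))
          \<le> (2 * ((norm (exp_sum i r \<kappa>))\<^sup>2 / (2 * r)) + 2 * ((norm (exp_sum j r \<kappa>))\<^sup>2 / (2 * r)) + 1) * (1 / (1 + \<kappa>\<^sup>2))"
        by (intro mult_right_mono) auto
      also have "\<dots> = (2 * ?p i r \<kappa> + 2 * ?p j r \<kappa>) + 1 / (1 + \<kappa>\<^sup>2)" by (simp only: distrib_right mult.assoc mult_1_left)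
      finally have "ennreal (polarized i j m r \<kappa> * (1 / (1 + \<kappa>\<^sup>2))) \<le> ennreal ((2 * ?p i r \<kappa> + 2 * ?p j r \<kappa>) + 1 / (1 + \<kappa>\<^sup>2))"
        by (rule ennreal_leI)
      also have "\<dots> = (2 * ennreal (?p i r \<kappa>) + 2 * ennreal (?p j r \<kappa>)) + ennreal (1 / (1 + \<kappa>\<^sup>2))"
      proof -
        have nn: "?p i r \<kappa> \<ge> 0" "?p j r \<kappa> \<ge> 0" "1 / (1 + \<kappa>\<^sup>2) \<ge> 0" using r by auto
        have "ennreal (2 * a + 2 * b + c) = 2 * ennreal a + 2 * ennreal b + ennreal c"
          if "a \<ge> 0" "b \<ge> 0" "c \<ge> 0" for a b c :: real
          using that by (simp add: ennreal_plus ennreal_mult)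
        from this[OF nn] show ?thesis .
      qed
      finally show "ennreal (polarized i j m r \<kappa> * (1 / (1 + \<kappa>\<^sup>2)))
        \<le> (2 * ennreal (?p i r \<kappa>) + 2 * ennreal (?p j r \<kappa>)) + ennreal (1 / (1 + \<kappa>\<^sup>2))" .
    qed
    also have "\<dots> = 2 * (\<integral>\<^sup>+ \<kappa>. ennreal (?p i r \<kappa>) \<partial>lborel) + 2 * (\<integral>\<^sup>+ \<kappa>. ennreal (?p j r \<kappa>) \<partial>lborel)
        + (\<integral>\<^sup>+ \<kappa>. ennreal (1 / (1 + \<kappa>\<^sup>2 :: real)) \<partial>lborel)"
      by (simp add: nn_integral_add nn_integral_cmult)
    also have "\<dots> \<le> 2 * ennreal C1 + 2 * ennreal C2 + ennreal C3"
      unfolding C3(2) by (intro add_mono mult_left_mono C1(2) C2(2) r order_refl) auto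
    also have "\<dots> = ennreal (2 * C1 + 2 * C2 + C3)"
      using C1(1) C2(1) C3(1) by (simp add: ennreal_plus ennreal_mult)
    finally show ?thesis .
  qed
  then show ?thesis using C1(1) C2(1) C3(1) by (intro exI[of _ "2 * C1 + 2 * C2 + C3"]) auto
qed

text \<open>One factor \<open>1 / (1 + \<kappa>\<^sup>2)\<close> makes the mass finite, uniformly in \<open>r\<close>; the second one gives
  tightness.\<close>

definition damped :: "'a \<Rightarrow> 'a \<Rightarrow> nat \<Rightarrow> real \<Rightarrow> real \<Rightarrow> real" where
  "damped i j m r \<kappa> = polarized i j m r \<kappa> * (1 / (1 + \<kappa>\<^sup>2))\<^sup>2"

lemma damped_measurable [measurable]: "damped i j m r \<in> borel_measurable borel"
  unfolding damped_def[abs_def] by measurable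

lemma damped_nonneg: "r \<ge> 1 \<Longrightarrow> damped i j m r \<kappa> \<ge> 0"
  using polarized_ge_1[of r i j m \<kappa>] by (simp add: damped_def)

lemma damped_le: "r \<ge> 1 \<Longrightarrow> damped i j m r \<kappa> \<le> polarized i j m r \<kappa> * (1 / (1 + \<kappa>\<^sup>2)) * (1 / (1 + K\<^sup>2))" if "\<bar>K\<bar> \<le> \<bar>\<kappa>\<bar>"
proof -
  assume r: "r \<ge> 1"
  have "K\<^sup>2 \<le> \<kappa>\<^sup>2" using that by (simp add: abs_le_square_iff)
  then have "1 / (1 + \<kappa>\<^sup>2) \<le> 1 / (1 + K\<^sup>2)" by (intro divide_left_mono mult_pos_pos add_pos_nonneg) auto
  then have "polarized i j m r \<kappa> * (1 / (1 + \<kappa>\<^sup>2)) * (1 / (1 + \<kappa>\<^sup>2)) \<le> polarized i j m r \<kappa> * (1 / (1 + \<kappa>\<^sup>2)) * (1 / (1 + K\<^sup>2))"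
    using polarized_ge_1[OF r, of i j m \<kappa>] by (intro mult_left_mono) auto
  then show ?thesis by (simp add: damped_def power2_eq_square)
qed

definition mass :: "'a \<Rightarrow> 'a \<Rightarrow> nat \<Rightarrow> real \<Rightarrow> real" where
  "mass i j m r = (LINT \<kappa>|lborel. damped i j m r \<kappa>)"

lemma damped_integrable_mass:
  "\<exists>C\<ge>0. \<forall>r\<ge>1. integrable lborel (damped i j m r) \<and> 1 / 2 \<le> mass i j m r \<and> mass i j m r \<le> C
    \<and> (\<integral>\<^sup>+ \<kappa>. ennreal (polarized i j m r \<kappa> * (1 / (1 + \<kappa>\<^sup>2))) \<partial>lborel) \<le> ennreal C"
proof -
  obtain C where C: "C \<ge> 0" "\<And>r. r \<ge> 1 \<Longrightarrow>
      (\<integral>\<^sup>+ \<kappa>. ennreal (polarized i j m r \<kappa> * (1 / (1 + \<kappa>\<^sup>2))) \<partial>lborel) \<le> ennreal C"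
    using polarized_lorentz_bound by blast
  have "integrable lborel (damped i j m r) \<and> 1 / 2 \<le> mass i j m r \<and> mass i j m r \<le> C" if r: "r \<ge> 1" for r
  proof -
    have "(\<integral>\<^sup>+ \<kappa>. ennreal (damped i j m r \<kappa>) \<partial>lborel) \<le> (\<integral>\<^sup>+ \<kappa>. ennreal (polarized i j m r \<kappa> * (1 / (1 + \<kappa>\<^sup>2))) \<partial>lborel)"
      by (intro nn_integral_mono ennreal_leI) (use damped_le[of 0, OF _ r] in simp)
    also have "\<dots> \<le> ennreal C" by (rule C(2)[OF r])
    finally have le: "(\<integral>\<^sup>+ \<kappa>. ennreal (damped i j m r \<kappa>) \<partial>lborel) \<le> ennreal C" .
    have int: "integrable lborel (damped i j m r)"
    proof (rule integrableI_bounded)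
      have "(\<integral>\<^sup>+ \<kappa>. ennreal (norm (damped i j m r \<kappa>)) \<partial>lborel) = (\<integral>\<^sup>+ \<kappa>. ennreal (damped i j m r \<kappa>) \<partial>lborel)"
        using damped_nonneg[OF r] by simp
      also have "\<dots> < \<infinity>" using le by (rule order.strict_trans1) simp
      finally show "(\<integral>\<^sup>+ \<kappa>. ennreal (norm (damped i j m r \<kappa>)) \<partial>lborel) < \<infinity>" .
    qed simp
    have "ennreal (mass i j m r) = (\<integral>\<^sup>+ \<kappa>. ennreal (damped i j m r \<kappa>) \<partial>lborel)"
      unfolding mass_def using damped_nonneg[OF r] by (intro nn_integral_eq_integral[symmetric] int) auto
    then have "ennreal (mass i j m r) \<le> ennreal C" using le by (simp only:)
    then have up: "mass i j m r \<le> C" using C(1) by (simp only: ennreal_le_iff)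
    \<comment> \<open>On [-1, 1] the damped density is at least the square of 1 / 2, and the
      interval has length 2.\<close>
    have "(LINT \<kappa>|lborel. 1 / 4 * indicator {- 1..1::real} \<kappa>) \<le> mass i j m r"
      unfolding mass_def
    proof (rule integral_mono[OF _ int])
      show "integrable lborel (\<lambda>\<kappa>. 1 / 4 * indicator {- 1..1::real} \<kappa> :: real)" by simp
      fix \<kappa> :: real
      show "1 / 4 * indicator {- 1..1} \<kappa> \<le> damped i j m r \<kappa>"
      proof (cases "\<kappa> \<in> {- 1..1}")
        case True
        then have "\<kappa>\<^sup>2 \<le> 1" using abs_square_le_1[of \<kappa>] by auto
        then have "1 / 2 \<le> 1 / (1 + \<kappa>\<^sup>2)" by (intro divide_left_mono mult_pos_pos add_pos_nonneg) auto
        then have "(1 / 2)\<^sup>2 \<le> (1 / (1 + \<kappa>\<^sup>2))\<^sup>2" by (intro power_mono) auto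
        then have "1 * (1 / 4) \<le> polarized i j m r \<kappa> * (1 / (1 + \<kappa>\<^sup>2))\<^sup>2"
          using polarized_ge_1[OF r, of i j m \<kappa>] by (intro mult_mono) (auto simp: power2_eq_square)
        then show ?thesis using True by (simp add: damped_def)
      qed (simp add: damped_nonneg[OF r])
    qed
    then have "1 / 2 \<le> mass i j m r" by simp
    then show ?thesis using int up by blast
  qed
  then show ?thesis using C by blast
qed

definition damped_dist :: "'a \<Rightarrow> 'a \<Rightarrow> nat \<Rightarrow> real \<Rightarrow> real measure" where
  "damped_dist i j m r = density lborel (\<lambda>\<kappa>. ennreal (damped i j m r \<kappa> / mass i j m r))"

lemma real_distribution_damped_dist: "r \<ge> 1 \<Longrightarrow> real_distribution (damped_dist i j m r)"
proof -
  assume r: "r \<ge> 1"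
  have int: "integrable lborel (damped i j m r)" and m: "1 / 2 \<le> mass i j m r" using damped_integrable_mass r by blast+
  have "prob_space (damped_dist i j m r)"
  proof (rule prob_spaceI)
    have "emeasure (damped_dist i j m r) (space (damped_dist i j m r)) = (\<integral>\<^sup>+ \<kappa>. ennreal (damped i j m r \<kappa> / mass i j m r) \<partial>lborel)"
      unfolding damped_dist_def by (simp add: emeasure_density)
    also have "\<dots> = ennreal (LINT \<kappa>|lborel. damped i j m r \<kappa> / mass i j m r)"
      using m damped_nonneg[OF r] by (intro nn_integral_eq_integral integrable_divide int) auto
    also have "\<dots> = 1" using m unfolding integral_divide_zero mass_def[symmetric] by simp
    finally show "emeasure (damped_dist i j m r) (space (damped_dist i j m r)) = 1" .
  qed
  then show ?thesis unfolding real_distribution_def real_distribution_axioms_def by (simp add: damped_dist_def)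
qed

lemma tight_damped_dist: "tight (\<lambda>n. damped_dist i j m (real (Suc n)))"
  unfolding tight_def
proof (intro conjI allI impI)
  show "real_distribution (damped_dist i j m (real (Suc n)))" for n by (rule real_distribution_damped_dist) simp
  fix \<epsilon> :: real assume \<epsilon>: "\<epsilon> > 0"
  obtain C where C: "C \<ge> 0" "\<And>r. r \<ge> 1 \<Longrightarrow> 1 / 2 \<le> mass i j m r \<and>
      (\<integral>\<^sup>+ \<kappa>. ennreal (polarized i j m r \<kappa> * (1 / (1 + \<kappa>\<^sup>2))) \<partial>lborel) \<le> ennreal C"
    using damped_integrable_mass[of i j m] by blast
  \<comment> \<open>Chosen such that 2 C / (1 + K^2) < \<epsilon>, using K \<le> K^2; the factor 2
    is the inverse of the lower bound for the mass.\<close>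
  define K where "K = 1 + 2 * C / \<epsilon>"
  have K: "K \<ge> 1" using C \<epsilon> by (simp add: K_def)
  have "2 * C / \<epsilon> < 1 + K\<^sup>2"
  proof -
    have "K * 1 \<le> K * K" using K by (intro mult_left_mono) auto
    then show ?thesis by (simp add: K_def power2_eq_square)
  qed
  then have KC: "2 * C / (1 + K\<^sup>2) < \<epsilon>" using \<epsilon> by (simp add: field_simps add_pos_nonneg)
  show "\<exists>a b. a < b \<and> (\<forall>n. 1 - \<epsilon> < measure (damped_dist i j m (real (Suc n))) {a<..b})"
  proof (rule exI[of _ "- K"], rule exI[of _ K], intro conjI allI)
    show "- K < K" using K by simp
    fix n
    define r where "r = real (Suc n)"
    have r: "r \<ge> 1" by (simp add: r_def)
    note mC = C(2)[OF r]
    interpret real_distribution "damped_dist i j m r" by (rule real_distribution_damped_dist[OF r])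
    have "emeasure (damped_dist i j m r) (- {- K<..K})
        = (\<integral>\<^sup>+ \<kappa>. ennreal (damped i j m r \<kappa> / mass i j m r) * indicator (- {- K<..K}) \<kappa> \<partial>lborel)"
      unfolding damped_dist_def by (subst emeasure_density) auto
    also have "\<dots> \<le> (\<integral>\<^sup>+ \<kappa>. ennreal (2 / (1 + K\<^sup>2)) * ennreal (polarized i j m r \<kappa> * (1 / (1 + \<kappa>\<^sup>2))) \<partial>lborel)"
    proof (rule nn_integral_mono)
      fix \<kappa> :: real
      show "ennreal (damped i j m r \<kappa> / mass i j m r) * indicator (- {- K<..K}) \<kappa>
          \<le> ennreal (2 / (1 + K\<^sup>2)) * ennreal (polarized i j m r \<kappa> * (1 / (1 + \<kappa>\<^sup>2)))"
      proof (cases "\<kappa> \<in> - {- K<..K}")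
        case True
        then have "\<bar>K\<bar> \<le> \<bar>\<kappa>\<bar>" using K by auto
        have "damped i j m r \<kappa> / mass i j m r \<le> damped i j m r \<kappa> / (1 / 2)"
          using mC damped_nonneg[OF r, of i j m \<kappa>] by (intro divide_left_mono) auto
        also have "\<dots> \<le> 2 * (polarized i j m r \<kappa> * (1 / (1 + \<kappa>\<^sup>2)) * (1 / (1 + K\<^sup>2)))"
          using damped_le[OF \<open>\<bar>K\<bar> \<le> \<bar>\<kappa>\<bar>\<close> r, of i j m] by simp
        also have "\<dots> = 2 / (1 + K\<^sup>2) * (polarized i j m r \<kappa> * (1 / (1 + \<kappa>\<^sup>2)))" by simp
        finally show ?thesis
          using True polarized_ge_1[OF r, of i j m \<kappa>] by (simp add: ennreal_mult[symmetric] ennreal_leI)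
      qed simp
    qed
    also have "\<dots> = ennreal (2 / (1 + K\<^sup>2)) * (\<integral>\<^sup>+ \<kappa>. ennreal (polarized i j m r \<kappa> * (1 / (1 + \<kappa>\<^sup>2))) \<partial>lborel)"
      by (rule nn_integral_cmult) measurable
    also have "\<dots> \<le> ennreal (2 / (1 + K\<^sup>2)) * ennreal C" using mC by (intro mult_left_mono) auto
    also have "\<dots> = ennreal (2 * C / (1 + K\<^sup>2))" using C(1) by (simp add: ennreal_mult[symmetric])
    finally have "prob (- {- K<..K}) \<le> 2 * C / (1 + K\<^sup>2)"
      using C(1) by (simp add: emeasure_eq_measure ennreal_le_iff)
    moreover have "prob (- {- K<..K}) = 1 - prob {- K<..K}"
      using prob_compl[of "{- K<..K}"] by (simp add: Compl_eq_Diff_UNIV)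
    ultimately show "1 - \<epsilon> < measure (damped_dist i j m (real (Suc n))) {- K<..K}"
      using KC unfolding r_def by linarith
  qed
qed

text \<open>The weight (1 + \<kappa>^2)^2 undoes the damping. A Schwartz function times this weight
  is still bounded, so that weak convergence can be applied to it.\<close>

lemma damped_dist_integral:
  assumes r: "r \<ge> 1" and \<phi>: "schwartz \<phi>"
  shows "integrable lborel (\<lambda>\<kappa>. of_real (polarized i j m r \<kappa>) * \<phi> \<kappa>)"
    and "of_real (mass i j m r) * (LINT \<kappa>|damped_dist i j m r. of_real ((1 + \<kappa>\<^sup>2)\<^sup>2) * \<phi> \<kappa>)
      = (LINT \<kappa>|lborel. of_real (polarized i j m r \<kappa>) * \<phi> \<kappa>)"
proof -
  note [measurable] = schwartz_borel[OF \<phi>]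
  have int: "integrable lborel (damped i j m r)" and m: "1 / 2 \<le> mass i j m r" using damped_integrable_mass r by blast+
  have P_eq: "polarized i j m r \<kappa> = damped i j m r \<kappa> * (1 + \<kappa>\<^sup>2)\<^sup>2" for \<kappa>
  proof -
    have "(1 + \<kappa>\<^sup>2)\<^sup>2 \<noteq> 0" by (simp add: add_nonneg_eq_0_iff)
    then show ?thesis by (simp add: damped_def power_divide)
  qed
  obtain B where B: "\<And>x. norm (\<phi> x) * (1 + x\<^sup>2)\<^sup>2 \<le> B" using schwartz_weighted_bound[OF \<phi>] by blast
  have "norm (of_real (polarized i j m r \<kappa>) * \<phi> \<kappa>) \<le> norm (B * damped i j m r \<kappa>)" for \<kappa>
  proof -
    have "norm (of_real (polarized i j m r \<kappa>) * \<phi> \<kappa>) = damped i j m r \<kappa> * (norm (\<phi> \<kappa>) * (1 + \<kappa>\<^sup>2)\<^sup>2)"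
    proof -
      have "norm (of_real (polarized i j m r \<kappa>) * \<phi> \<kappa>) = \<bar>damped i j m r \<kappa>\<bar> * \<bar>(1 + \<kappa>\<^sup>2)\<^sup>2\<bar> * norm (\<phi> \<kappa>)"
        unfolding P_eq by (simp only: norm_mult norm_of_real abs_mult)
      then show ?thesis using damped_nonneg[OF r, of i j m \<kappa>] by (simp only: abs_power2 abs_of_nonneg mult_ac)
    qed
    also have "\<dots> \<le> damped i j m r \<kappa> * B" by (intro mult_left_mono B damped_nonneg r)
    also have "\<dots> \<le> norm (B * damped i j m r \<kappa>)" by (simp add: mult.commute)
    finally show ?thesis .
  qed
  then show "integrable lborel (\<lambda>\<kappa>. of_real (polarized i j m r \<kappa>) * \<phi> \<kappa>)"
    by (intro Bochner_Integration.integrable_bound[OF integrable_mult_right[OF int, of B]]) auto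
  have "(LINT \<kappa>|damped_dist i j m r. of_real ((1 + \<kappa>\<^sup>2)\<^sup>2) * \<phi> \<kappa>)
      = (LINT \<kappa>|lborel. (damped i j m r \<kappa> / mass i j m r) *\<^sub>R (of_real ((1 + \<kappa>\<^sup>2)\<^sup>2) * \<phi> \<kappa>))"
    unfolding damped_dist_def using m damped_nonneg[OF r] by (intro integral_density) auto
  also have "\<dots> = (LINT \<kappa>|lborel. of_real (polarized i j m r \<kappa>) * \<phi> \<kappa> / of_real (mass i j m r))"
    unfolding P_eq by (simp add: scaleR_conv_of_real mult.assoc)
  also have "\<dots> = (LINT \<kappa>|lborel. of_real (polarized i j m r \<kappa>) * \<phi> \<kappa>) / of_real (mass i j m r)"
    by (rule integral_divide_zero)
  finally show "of_real (mass i j m r) * (LINT \<kappa>|damped_dist i j m r. of_real ((1 + \<kappa>\<^sup>2)\<^sup>2) * \<phi> \<kappa>)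
      = (LINT \<kappa>|lborel. of_real (polarized i j m r \<kappa>) * \<phi> \<kappa>)" using m by auto
qed

text \<open>Along a common subsequence the four normalized measures converge weakly and their masses
  converge. Polarization identifies the combination for finite r with the correlation sum of the
  patch, whose limit is known from \<open>corr_limit\<close>.\<close>

lemma spectral_measures:
  "\<exists>M C. (\<forall>m<4. real_distribution (M m) \<and> 0 \<le> C m) \<and> (\<forall>\<phi>. schwartz \<phi> \<longrightarrow>
    (\<Sum>m<4. cnj (\<i> ^ m) / 4 * (of_real (C m) * (LINT \<kappa>|M m. of_real ((1 + \<kappa>\<^sup>2)\<^sup>2) * \<phi> \<kappa>)))
      = (LINT z|count_space \<Delta>. of_real (\<eta> i j z) * fourier \<phi> z))"
proof -
  have bd: "bounded (range (\<lambda>n. mass i j m (real (Suc n))))" for m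
  proof -
    obtain C where "\<And>r. r \<ge> 1 \<Longrightarrow> 1 / 2 \<le> mass i j m r \<and> mass i j m r \<le> C" using damped_integrable_mass[of i j m] by blast
    then have b: "1 / 2 \<le> mass i j m (real (Suc n)) \<and> mass i j m (real (Suc n)) \<le> C" for n by simp
    have "norm (mass i j m (real (Suc n))) \<le> C" for n using b[of n] by auto
    then show ?thesis unfolding bounded_iff by blast
  qed
  obtain s M C where s: "strict_mono (s :: nat \<Rightarrow> nat)" and
    MC: "\<And>m. m < 4 \<Longrightarrow> real_distribution (M m) \<and> weak_conv_m ((\<lambda>n. damped_dist i j m (real (Suc n))) \<circ> s) (M m)
      \<and> ((\<lambda>n. mass i j m (real (Suc n))) \<circ> s) \<longlonglongrightarrow> C m"
    using finite_tight_family_subsequence[of "{..<4::nat}" "\<lambda>m n. damped_dist i j m (real (Suc n))" "\<lambda>m n. mass i j m (real (Suc n))",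
        OF finite_lessThan tight_damped_dist bd] by auto
  have C0: "0 \<le> C m" if "m < 4" for m
  proof (rule LIMSEQ_le_const)
    show "((\<lambda>n. mass i j m (real (Suc n))) \<circ> s) \<longlonglongrightarrow> C m" using MC[OF that] by blast
    have "1 / 2 \<le> mass i j m (real (Suc n))" for n using damped_integrable_mass[of i j m] by auto
    then have "0 \<le> mass i j m (real (Suc n))" for n by (rule order_trans[rotated]) simp
    then show "\<exists>N. \<forall>n\<ge>N. 0 \<le> ((\<lambda>n. mass i j m (real (Suc n))) \<circ> s) n" by (simp add: o_def)
  qed
  have "(\<Sum>m<4. cnj (\<i> ^ m) / 4 * (of_real (C m) * (LINT \<kappa>|M m. of_real ((1 + \<kappa>\<^sup>2)\<^sup>2) * \<phi> \<kappa>)))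
      = (LINT z|count_space \<Delta>. of_real (\<eta> i j z) * fourier \<phi> z)" if \<phi>: "schwartz \<phi>" for \<phi>
  proof -
    let ?\<psi> = "\<lambda>\<kappa>. of_real ((1 + \<kappa>\<^sup>2)\<^sup>2) * \<phi> \<kappa>"
    let ?r = "\<lambda>n. real (Suc (s n))"
    let ?J = "\<lambda>m r. LINT \<kappa>|lborel. of_real (polarized i j m r \<kappa>) * \<phi> \<kappa>"
    obtain B where B: "\<And>x. norm (\<phi> x) * (1 + x\<^sup>2)\<^sup>2 \<le> B" using schwartz_weighted_bound[OF \<phi>] by blast
    have lim: "(\<lambda>n. ?J m (?r n)) \<longlonglongrightarrow> of_real (C m) * (LINT \<kappa>|M m. ?\<psi> \<kappa>)" if m: "m < 4" for m
    proof -
      have "(\<lambda>n. LINT \<kappa>|((\<lambda>n. damped_dist i j m (real (Suc n))) \<circ> s) n. ?\<psi> \<kappa>) \<longlonglongrightarrow> (LINT \<kappa>|M m. ?\<psi> \<kappa>)"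
      proof (rule weak_conv_imp_integral_bdd_continuous_conv)
        show "isCont ?\<psi> x" for x by (intro continuous_intros schwartz_continuous \<phi>)
        show "norm (?\<psi> x) \<le> B" for x
          using B[of x] by (simp only: norm_mult norm_of_real abs_power2 mult.commute)
        show "real_distribution (((\<lambda>n. damped_dist i j m (real (Suc n))) \<circ> s) n)" for n
          unfolding o_apply by (rule real_distribution_damped_dist) simp
        show "real_distribution (M m)" using MC[OF m] by blast
        have "weak_conv_m ((\<lambda>n. damped_dist i j m (real (Suc n))) \<circ> s) (M m)" using MC[OF m] by blast
        then show "weak_conv_m (\<lambda>n. ((\<lambda>n. damped_dist i j m (real (Suc n))) \<circ> s) n) (M m)" .
      qed
      moreover have "(\<lambda>n. mass i j m (?r n)) \<longlonglongrightarrow> C m" using MC[OF m] by (simp add: o_def)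
      ultimately have "(\<lambda>n. of_real (mass i j m (?r n)) * (LINT \<kappa>|damped_dist i j m (?r n). ?\<psi> \<kappa>))
          \<longlonglongrightarrow> of_real (C m) * (LINT \<kappa>|M m. ?\<psi> \<kappa>)"
        unfolding o_def by (intro tendsto_mult tendsto_of_real)
      moreover have "of_real (mass i j m (?r n)) * (LINT \<kappa>|damped_dist i j m (?r n). ?\<psi> \<kappa>) = ?J m (?r n)" for n
        by (rule damped_dist_integral(2)[OF _ \<phi>]) simp
      ultimately show ?thesis by (simp only:)
    qed
    have "(\<lambda>n. \<Sum>m<4. cnj (\<i> ^ m) / 4 * ?J m (?r n))
        \<longlonglongrightarrow> (\<Sum>m<4. cnj (\<i> ^ m) / 4 * (of_real (C m) * (LINT \<kappa>|M m. ?\<psi> \<kappa>)))"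
      by (intro tendsto_sum tendsto_mult tendsto_const lim) simp
    moreover have "(\<Sum>m<4. cnj (\<i> ^ m) / 4 * ?J m r)
        = (\<Sum>x\<in>\<Lambda> i \<inter> {- r..r}. \<Sum>y\<in>\<Lambda> j \<inter> {- r..r}. fourier \<phi> (y - x)) / of_real (2 * r)" if r: "r \<ge> 1" for r
    proof -
      have "(\<Sum>m<4. cnj (\<i> ^ m) / 4 * ?J m r)
          = (\<Sum>m<4. LINT \<kappa>|lborel. cnj (\<i> ^ m) / 4 * (of_real (polarized i j m r \<kappa>) * \<phi> \<kappa>))"
        by (intro sum.cong refl integral_mult_right_zero[symmetric])
      also have "\<dots> = (LINT \<kappa>|lborel. (\<Sum>m<4. cnj (\<i> ^ m) / 4 * (of_real (polarized i j m r \<kappa>) * \<phi> \<kappa>)))"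
        by (intro Bochner_Integration.integral_sum[symmetric] integrable_mult_right damped_dist_integral(1) r \<phi>)
      also have "\<dots> = (LINT \<kappa>|lborel. \<phi> \<kappa> * (cnj (exp_sum i r \<kappa>) * exp_sum j r \<kappa>) / of_real (2 * r))"
      proof (intro Bochner_Integration.integral_cong refl)
        fix \<kappa> :: real
        have "(\<Sum>m<4. cnj (\<i> ^ m) / 4 * (of_real (polarized i j m r \<kappa>) * \<phi> \<kappa>))
            = ((\<Sum>m<4. cnj (\<i> ^ m) * of_real (polarized i j m r \<kappa>)) / 4) * \<phi> \<kappa>"
          unfolding sum_divide_distrib sum_distrib_right by (intro sum.cong refl) simp
        also have "(\<Sum>m<4. cnj (\<i> ^ m) * of_real (polarized i j m r \<kappa>)) / 4 = cnj (exp_sum i r \<kappa>) * exp_sum j r \<kappa> / of_real (2 * r)"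
          unfolding polarized_def by (rule polarization) (use r in simp)
        finally show "(\<Sum>m<4. cnj (\<i> ^ m) / 4 * (of_real (polarized i j m r \<kappa>) * \<phi> \<kappa>))
            = \<phi> \<kappa> * (cnj (exp_sum i r \<kappa>) * exp_sum j r \<kappa>) / of_real (2 * r)" by simp
      qed
      also have "\<dots> = (\<Sum>x\<in>\<Lambda> i \<inter> {- r..r}. \<Sum>y\<in>\<Lambda> j \<inter> {- r..r}. fourier \<phi> (y - x)) / of_real (2 * r)"
        unfolding integral_divide_zero structure_factor_integral(2)[OF \<phi>] ..
      finally show ?thesis .
    qed
    then have "(\<Sum>m<4. cnj (\<i> ^ m) / 4 * ?J m (?r n))
        = (\<Sum>x\<in>\<Lambda> i \<inter> {- ?r n..?r n}. \<Sum>y\<in>\<Lambda> j \<inter> {- ?r n..?r n}. fourier \<phi> (y - x)) / of_real (2 * ?r n)" for n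
      by simp
    moreover have "(\<lambda>n. (\<Sum>x\<in>\<Lambda> i \<inter> {- ?r n..?r n}. \<Sum>y\<in>\<Lambda> j \<inter> {- ?r n..?r n}. fourier \<phi> (y - x)) / of_real (2 * ?r n))
        \<longlonglongrightarrow> (LINT z|count_space \<Delta>. of_real (\<eta> i j z) * fourier \<phi> z)"
    proof -
      obtain B' where B': "\<And>u. norm (fourier \<phi> u) \<le> B' / (1 + u\<^sup>2)" using fourier_schwartz_decay[OF \<phi>] by blast
      have "filterlim (\<lambda>n. Suc (s n)) sequentially sequentially"
        using filterlim_subseq[OF s] filterlim_compose[OF filterlim_Suc] by blast
      then have "filterlim ?r at_top sequentially"
        by (rule filterlim_compose[OF filterlim_real_sequentially])
      from filterlim_compose[OF corr_limit[OF B'] this] show ?thesis .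
    qed
    ultimately show ?thesis using LIMSEQ_unique by (simp only:) blast
  qed
  then show ?thesis using MC C0 by blast
qed

section \<open>The transform of a pair correlation measure and its atoms\<close>

lemma pair_corr_measure_integral:
  fixes f :: "real \<Rightarrow> complex"
  assumes [measurable]: "f \<in> borel_measurable borel"
  shows "integrable (pair_corr_measure \<Lambda> i j) f \<longleftrightarrow> integrable (count_space \<Delta>) (\<lambda>z. of_real (\<eta> i j z) * f z)"
    and "(LINT z|pair_corr_measure \<Lambda> i j. f z) = (LINT z|count_space \<Delta>. of_real (\<eta> i j z) * f z) / of_real supp_dens"
proof -
  have pc: "pair_corr \<Lambda> i j z = \<eta> i j z / supp_dens" for z
    by (simp add: pair_corr_def \<eta>_def supp_dens_def)
  have nn: "\<eta> i j z / supp_dens \<ge> 0" for z using \<eta>_nonneg supp_dens_pos by simp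
  have M: "pair_corr_measure \<Lambda> i j = distr (density (count_space \<Delta>) (\<lambda>z. ennreal (\<eta> i j z / supp_dens))) borel (\<lambda>z. z)"
    unfolding pair_corr_measure_def point_measure_def \<Delta>_def pc ..
  have id: "(\<lambda>z. z) \<in> measurable (density (count_space \<Delta>) (\<lambda>z. ennreal (\<eta> i j z / supp_dens))) borel" by simp
  have sc: "(\<eta> i j z / supp_dens) *\<^sub>R f z = (of_real (\<eta> i j z) * f z) / of_real supp_dens" for z
    by (simp add: scaleR_conv_of_real)
  have "integrable (pair_corr_measure \<Lambda> i j) f
      \<longleftrightarrow> integrable (count_space \<Delta>) (\<lambda>z. (of_real (\<eta> i j z) * f z) / of_real supp_dens)"
    unfolding M integrable_distr_eq[OF id assms] sc[symmetric]
    by (rule integrable_density) (auto simp: nn)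
  then show "integrable (pair_corr_measure \<Lambda> i j) f \<longleftrightarrow> integrable (count_space \<Delta>) (\<lambda>z. of_real (\<eta> i j z) * f z)"
  proof -
    have "integrable \<nu> (\<lambda>z. g z / c) \<longleftrightarrow> integrable \<nu> g" if "c \<noteq> 0" for \<nu> :: "real measure" and g and c :: complex
    proof
      assume "integrable \<nu> (\<lambda>z. g z / c)"
      then have "integrable \<nu> (\<lambda>z. (g z / c) * c)" by (rule integrable_mult_left)
      then show "integrable \<nu> g" using that by simp
    qed (rule integrable_divide)
    from this[of "of_real supp_dens"] supp_dens_pos
      \<open>integrable (pair_corr_measure \<Lambda> i j) f
        \<longleftrightarrow> integrable (count_space \<Delta>) (\<lambda>z. (of_real (\<eta> i j z) * f z) / of_real supp_dens)\<close>
    show ?thesis by simp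
  qed
  have "(LINT z|pair_corr_measure \<Lambda> i j. f z) = (LINT z|count_space \<Delta>. (of_real (\<eta> i j z) * f z) / of_real supp_dens)"
    unfolding M integral_distr[OF id assms] sc[symmetric]
    by (rule integral_density) (auto simp: nn)
  then show "(LINT z|pair_corr_measure \<Lambda> i j. f z) = (LINT z|count_space \<Delta>. of_real (\<eta> i j z) * f z) / of_real supp_dens"
    by simp
qed

text \<open>The combination of the four spectral measures, with the damping undone, has the complex
  density H with respect to a common probability measure M0; |H| M0 and H / |H| form its polar
  decomposition. The weight (1 + \<kappa>^2)^2 in H may make the total mass infinite but keeps it
  finite on bounded sets.\<close>

lemma fourier_transform_exists: "\<exists>\<mu>. is_fourier_transform (pair_corr_measure \<Lambda> i j) \<mu>"
proof -
  obtain M C where MC: "\<And>m. m < 4 \<Longrightarrow> real_distribution (M m) \<and> 0 \<le> C m" and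
    eq: "\<And>\<phi>. schwartz \<phi> \<Longrightarrow>
      (\<Sum>m<4. cnj (\<i> ^ m) / 4 * (of_real (C m) * (LINT \<kappa>|M m. of_real ((1 + \<kappa>\<^sup>2)\<^sup>2) * \<phi> \<kappa>)))
      = (LINT z|count_space \<Delta>. of_real (\<eta> i j z) * fourier \<phi> z)"
    using spectral_measures[of i j] by blast
  have "\<exists>M0 R. real_distribution M0 \<and> (\<forall>m<4. R m \<in> borel_measurable borel \<and> (\<forall>x. 0 \<le> R m x)
    \<and> M m = density M0 (\<lambda>x. ennreal (R m x)))"
    by (rule common_dominating_measure) (use MC in auto)
  then obtain M0 R where M0: "real_distribution M0" and
    R: "\<And>m. m < 4 \<Longrightarrow> R m \<in> borel_measurable borel" "\<And>m x. m < 4 \<Longrightarrow> 0 \<le> R m x"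
      "\<And>m. m < 4 \<Longrightarrow> M m = density M0 (\<lambda>x. ennreal (R m x))" by blast
  interpret M0: real_distribution M0 by (rule M0)
  define R' where "R' m = (if m < 4 then R m else (\<lambda>_. 0))" for m
  have R'_meas [measurable]: "R' m \<in> borel_measurable borel" for m using R(1) by (simp add: R'_def)
  have R'_nn: "R' m x \<ge> 0" for m x using R(2) by (simp add: R'_def)
  have R'_M: "M m = density M0 (\<lambda>x. ennreal (R' m x))" if "m < 4" for m using R(3) that by (simp add: R'_def)
  have R'_int: "integrable M0 (R' m)" for m
  proof (cases "m < 4")
    case True
    interpret Mm: real_distribution "M m" using MC[OF True] by blast
    have "(\<integral>\<^sup>+ x. ennreal (R' m x) \<partial>M0) = emeasure (M m) (space (M m))"
      unfolding R'_M[OF True] by (subst emeasure_density) auto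
    then have "(\<integral>\<^sup>+ x. ennreal (R' m x) \<partial>M0) = 1" using Mm.emeasure_space_1 by simp
    then show ?thesis using R'_nn by (intro integrableI_nonneg) auto
  next
    case False
    then show ?thesis by (simp add: R'_def)
  qed
  define a where "a m = cnj (\<i> ^ m) / 4 * of_real (C m) / of_real supp_dens" for m
  define H where "H \<kappa> = (\<Sum>m<4. a m * of_real (R' m \<kappa>)) * of_real ((1 + \<kappa>\<^sup>2)\<^sup>2)" for \<kappa>
  \<comment> \<open>An integrable majorant of H without its polynomial weight.\<close>
  define G where "G \<kappa> = (\<Sum>m<4. norm (a m) * R' m \<kappa>)" for \<kappa>
  \<comment> \<open>The value 1 where H vanishes keeps the modulus equal to 1; these points form a
    null set of N.\<close>
  define h where "h \<kappa> = (if H \<kappa> = 0 then 1 else H \<kappa> / of_real (norm (H \<kappa>)))" for \<kappa>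
  define N where "N = density M0 (\<lambda>\<kappa>. ennreal (norm (H \<kappa>)))"
  have H_meas [measurable]: "H \<in> borel_measurable borel" unfolding H_def[abs_def] by measurable
  have h_meas [measurable]: "h \<in> borel_measurable borel" unfolding h_def[abs_def] by measurable
  have h1: "norm (h \<kappa>) = 1" for \<kappa> by (simp add: h_def norm_divide)
  have Hh: "norm (H \<kappa>) *\<^sub>R (z * h \<kappa>) = z * H \<kappa>" for \<kappa> z by (simp add: h_def scaleR_conv_of_real)
  have G_int: "integrable M0 G" unfolding G_def[abs_def] by (intro Bochner_Integration.integrable_sum integrable_mult_right R'_int)
  have G_meas [measurable]: "G \<in> borel_measurable borel" unfolding G_def[abs_def] by measurable
  have G_nn: "G \<kappa> \<ge> 0" for \<kappa> unfolding G_def by (intro sum_nonneg mult_nonneg_nonneg R'_nn) auto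
  have HG: "norm (H \<kappa>) \<le> G \<kappa> * (1 + \<kappa>\<^sup>2)\<^sup>2" for \<kappa>
  proof -
    have "norm (\<Sum>m<4. a m * of_real (R' m \<kappa>)) \<le> G \<kappa>"
      unfolding G_def by (rule sum_norm_le) (simp add: norm_mult R'_nn)
    then show ?thesis unfolding H_def norm_mult norm_of_real abs_power2 by (rule mult_right_mono) simp
  qed
  have setsN: "sets N = sets borel" by (simp add: N_def)
  have radon: "complex_radon (N, h)"
    unfolding complex_radon_def
  proof (simp only: prod.case, intro conjI ballI impI allI)
    fix B :: "real set" assume B: "B \<in> sets borel" "bounded B"
    obtain b where b: "\<And>x. x \<in> B \<Longrightarrow> \<bar>x\<bar> \<le> b" using B(2) unfolding bounded_iff by auto
    have "emeasure N B = (\<integral>\<^sup>+ x. ennreal (norm (H x)) * indicator B x \<partial>M0)"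
      unfolding N_def using B(1) by (subst emeasure_density) auto
    also have "\<dots> \<le> (\<integral>\<^sup>+ x. ennreal ((1 + b\<^sup>2)\<^sup>2 * G x) \<partial>M0)"
    proof (rule nn_integral_mono)
      fix x
      show "ennreal (norm (H x)) * indicator B x \<le> ennreal ((1 + b\<^sup>2)\<^sup>2 * G x)"
      proof (cases "x \<in> B")
        case True
        then have "x\<^sup>2 \<le> b\<^sup>2" using b[of x] by (simp add: abs_le_square_iff[symmetric])
        then have "(1 + x\<^sup>2)\<^sup>2 \<le> (1 + b\<^sup>2)\<^sup>2" by (intro power_mono) auto
        then have "G x * (1 + x\<^sup>2)\<^sup>2 \<le> G x * (1 + b\<^sup>2)\<^sup>2" using G_nn by (rule mult_left_mono)
        then have "norm (H x) \<le> G x * (1 + b\<^sup>2)\<^sup>2" using HG[of x] by linarith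
        then have "norm (H x) \<le> (1 + b\<^sup>2)\<^sup>2 * G x" by (simp only: mult.commute)
        then show ?thesis using True by (simp add: ennreal_leI)
      qed simp
    qed
    also have "\<dots> = ennreal (LINT x|M0. (1 + b\<^sup>2)\<^sup>2 * G x)"
      by (intro nn_integral_eq_integral integrable_mult_right G_int) (auto simp: G_nn)
    also have "\<dots> < \<infinity>" by simp
    finally show "emeasure N B < \<infinity>" .
  qed (simp_all add: setsN h1)
  have "integrable (pair_corr_measure \<Lambda> i j) (fourier \<phi>) \<and> integrable N \<phi> \<and>
      (LINT k|N. \<phi> k * h k) = (LINT x|pair_corr_measure \<Lambda> i j. fourier \<phi> x)" if \<phi>: "schwartz \<phi>" for \<phi>
  proof (intro conjI)
    note [measurable] = schwartz_borel[OF \<phi>]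
    obtain B' where B': "\<And>u. norm (fourier \<phi> u) \<le> B' / (1 + u\<^sup>2)" using fourier_schwartz_decay[OF \<phi>] by blast
    obtain B where B: "\<And>x. norm (\<phi> x) * (1 + x\<^sup>2)\<^sup>2 \<le> B" using schwartz_weighted_bound[OF \<phi>] by blast
    show "integrable (pair_corr_measure \<Lambda> i j) (fourier \<phi>)"
      by (subst pair_corr_measure_integral(1)) (auto intro: corr_integrable(1)[OF B'])
    have "norm (norm (H x) *\<^sub>R \<phi> x) \<le> norm (B * G x)" for x
    proof -
      have "norm (norm (H x) *\<^sub>R \<phi> x) \<le> G x * (1 + x\<^sup>2)\<^sup>2 * norm (\<phi> x)"
        using HG[of x] by (simp add: mult_right_mono)
      also have "\<dots> = G x * (norm (\<phi> x) * (1 + x\<^sup>2)\<^sup>2)" by simp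
      also have "\<dots> \<le> G x * B" by (intro mult_left_mono B G_nn)
      also have "\<dots> \<le> norm (B * G x)" by (simp add: mult.commute)
      finally show ?thesis .
    qed
    then have "integrable M0 (\<lambda>x. norm (H x) *\<^sub>R \<phi> x)"
      by (intro Bochner_Integration.integrable_bound[OF integrable_mult_right[OF G_int, of B]]) auto
    then show "integrable N \<phi>"
      unfolding N_def by (subst integrable_density) auto
    have intR: "integrable M0 (\<lambda>x. R' m x *\<^sub>R (of_real ((1 + x\<^sup>2)\<^sup>2) * \<phi> x))" for m
    proof (rule Bochner_Integration.integrable_bound[OF integrable_mult_right[OF R'_int, of B]])
      show "AE x in M0. norm (R' m x *\<^sub>R (of_real ((1 + x\<^sup>2)\<^sup>2) * \<phi> x)) \<le> norm (B * R' m x)"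
      proof (rule AE_I2)
        fix x
        have "norm (R' m x *\<^sub>R (of_real ((1 + x\<^sup>2)\<^sup>2) * \<phi> x)) = R' m x * (norm (\<phi> x) * (1 + x\<^sup>2)\<^sup>2)"
          using R'_nn[of m x] by (simp only: norm_scaleR norm_mult norm_of_real abs_power2 abs_of_nonneg mult_ac)
        also have "\<dots> \<le> R' m x * B" by (intro mult_left_mono B R'_nn)
        also have "\<dots> \<le> norm (B * R' m x)" by (simp add: mult.commute)
        finally show "norm (R' m x *\<^sub>R (of_real ((1 + x\<^sup>2)\<^sup>2) * \<phi> x)) \<le> norm (B * R' m x)" .
      qed
    qed simp
    have "(LINT k|N. \<phi> k * h k) = (LINT k|M0. norm (H k) *\<^sub>R (\<phi> k * h k))"
      unfolding N_def by (rule integral_density) auto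
    also have "\<dots> = (LINT k|M0. (\<Sum>m<4. a m * (R' m k *\<^sub>R (of_real ((1 + k\<^sup>2)\<^sup>2) * \<phi> k))))"
      unfolding Hh by (intro Bochner_Integration.integral_cong refl)
        (simp add: H_def sum_distrib_left sum_distrib_right scaleR_conv_of_real mult_ac)
    also have "\<dots> = (\<Sum>m<4. a m * (LINT k|M0. R' m k *\<^sub>R (of_real ((1 + k\<^sup>2)\<^sup>2) * \<phi> k)))"
    proof -
      have "(LINT k|M0. (\<Sum>m<4. a m * (R' m k *\<^sub>R (of_real ((1 + k\<^sup>2)\<^sup>2) * \<phi> k))))
          = (\<Sum>m<4. LINT k|M0. a m * (R' m k *\<^sub>R (of_real ((1 + k\<^sup>2)\<^sup>2) * \<phi> k)))"
        by (intro Bochner_Integration.integral_sum integrable_mult_right intR)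
      then show ?thesis by (simp only: integral_mult_right_zero)
    qed
    also have "\<dots> = (\<Sum>m<4. a m * (LINT k|M m. of_real ((1 + k\<^sup>2)\<^sup>2) * \<phi> k))"
    proof (intro sum.cong refl arg_cong2[where f = "(*)"])
      fix m :: nat assume "m \<in> {..<4}"
      then have "m < 4" by simp
      show "(LINT k|M0. R' m k *\<^sub>R (of_real ((1 + k\<^sup>2)\<^sup>2) * \<phi> k)) = (LINT k|M m. of_real ((1 + k\<^sup>2)\<^sup>2) * \<phi> k)"
        unfolding R'_M[OF \<open>m < 4\<close>] by (rule integral_density[symmetric]) (auto simp: R'_nn)
    qed
    also have "\<dots> = (\<Sum>m<4. cnj (\<i> ^ m) / 4 * (of_real (C m) * (LINT \<kappa>|M m. of_real ((1 + \<kappa>\<^sup>2)\<^sup>2) * \<phi> \<kappa>))) / of_real supp_dens"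
      by (simp add: a_def sum_divide_distrib mult.assoc)
    also have "\<dots> = (LINT x|pair_corr_measure \<Lambda> i j. fourier \<phi> x)"
      unfolding eq[OF \<phi>] by (rule pair_corr_measure_integral(2)[symmetric]) simp
    finally show "(LINT k|N. \<phi> k * h k) = (LINT x|pair_corr_measure \<Lambda> i j. fourier \<phi> x)" .
  qed
  then have "is_fourier_transform (pair_corr_measure \<Lambda> i j) (N, h)"
    unfolding is_fourier_transform_def using radon by simp
  then show ?thesis by blast
qed

text \<open>Gaussian tests of width tending to 0: on the spectral side dominated convergence
  isolates the point k, on the other side the transformed Gaussians spread out and
  \<open>corr_gaussian_limit\<close> applies. The argument works for every transform, in particular
  for the one selected in \<open>measure_fourier\<close>.\<close>

lemma fourier_transform_atom:
  assumes "is_fourier_transform (pair_corr_measure \<Lambda> i j) \<mu>"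
  shows "cm_value \<mu> {k} = of_real supp_dens * (cnj (fb_coeff \<Lambda> i k) * fb_coeff \<Lambda> j k)"
proof -
  obtain N h where \<mu>: "\<mu> = (N, h)" by fastforce
  have radon: "complex_radon (N, h)" and ft: "\<And>\<phi>. schwartz \<phi> \<Longrightarrow> integrable N \<phi> \<and>
      (LINT k|N. \<phi> k * h k) = (LINT x|pair_corr_measure \<Lambda> i j. fourier \<phi> x)"
    using assms unfolding \<mu> is_fourier_transform_def by auto
  have setsN [measurable_cong]: "sets N = sets borel" and h_meas [measurable]: "h \<in> borel_measurable borel"
    and h1: "\<And>x. norm (h x) = 1"
    using radon unfolding complex_radon_def by auto
  let ?e = "\<lambda>n. inverse (real (Suc n))"
  have gt: "schwartz (gauss_test (?e n) k)" for n by (rule schwartz_gauss_test) simp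
  have gm [measurable]: "gauss_test \<epsilon> k \<in> borel_measurable borel" for \<epsilon> unfolding gauss_test_def[abs_def] by measurable
  have "(\<lambda>n. LINT x|N. gauss_test (?e n) k x * h x) \<longlonglongrightarrow> (LINT x|N. indicator {k} x *\<^sub>R h x)"
  proof (rule integral_dominated_convergence[where w = "\<lambda>x. norm (gauss_test 1 k x)"])
    show "integrable N (\<lambda>x. norm (gauss_test 1 k x))"
      using ft[OF schwartz_gauss_test[of 1 k]] by (intro integrable_norm) simp
    show "AE x in N. (\<lambda>n. gauss_test (?e n) k x * h x) \<longlonglongrightarrow> indicator {k} x *\<^sub>R h x"
    proof (rule AE_I2)
      fix x
      show "(\<lambda>n. gauss_test (?e n) k x * h x) \<longlonglongrightarrow> indicator {k} x *\<^sub>R h x"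
      proof (cases "x = k")
        case True
        then show ?thesis by (simp add: gauss_test_def)
      next
        case False
        define t where "t = (pi * (x - k))\<^sup>2"
        have t: "t > 0" using False by (simp add: t_def)
        have "(\<lambda>n. exp (- ((pi * (x - k) / ?e n)\<^sup>2))) \<longlonglongrightarrow> 0"
        proof (rule Lim_null_comparison[OF always_eventually])
          show "(\<lambda>n. (1 / t) * inverse (real (Suc n))) \<longlonglongrightarrow> 0"
            by (intro tendsto_mult_right_zero LIMSEQ_inverse_real_of_nat)
          show "\<forall>n. norm (exp (- ((pi * (x - k) / ?e n)\<^sup>2))) \<le> (1 / t) * inverse (real (Suc n))"
          proof
            fix n
            have "(pi * (x - k) / ?e n)\<^sup>2 = t * (real (Suc n))\<^sup>2"
              by (simp add: t_def power_divide power_mult_distrib divide_inverse)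
            moreover have "exp (- ((pi * (x - k) / ?e n)\<^sup>2)) \<le> 1 / (1 + (pi * (x - k) / ?e n)\<^sup>2)"
              by (rule exp_minus_square_le)
            moreover have "1 / (1 + t * (real (Suc n))\<^sup>2) \<le> 1 / (t * real (Suc n))"
            proof (rule divide_left_mono)
              have "t * (real (Suc n) * 1) \<le> t * (real (Suc n) * real (Suc n))"
                using t by (intro mult_left_mono) auto
              then show "t * real (Suc n) \<le> 1 + t * (real (Suc n))\<^sup>2" by (simp add: power2_eq_square)
              show "0 < (1 + t * (real (Suc n))\<^sup>2) * (t * real (Suc n))"
                using t by (intro mult_pos_pos add_pos_nonneg) auto
            qed simp
            ultimately show "norm (exp (- ((pi * (x - k) / ?e n)\<^sup>2))) \<le> (1 / t) * inverse (real (Suc n))"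
              by (simp add: divide_inverse mult.commute)
          qed
        qed
        then have "(\<lambda>n. complex_of_real (exp (- ((pi * (x - k) / ?e n)\<^sup>2)))) \<longlonglongrightarrow> of_real 0"
          by (rule tendsto_of_real)
        then show ?thesis unfolding gauss_test_def using False by (intro tendsto_mult_left_zero[THEN tendsto_eq_rhs]) auto
      qed
    qed
    show "AE x in N. norm (gauss_test (?e n) k x * h x) \<le> norm (gauss_test 1 k x)" for n
    proof (rule AE_I2)
      fix x
      have "\<bar>pi * (x - k)\<bar> * 1 \<le> \<bar>pi * (x - k)\<bar> * real (Suc n)" by (intro mult_left_mono) auto
      then have "\<bar>pi * (x - k) / 1\<bar> \<le> \<bar>pi * (x - k) / ?e n\<bar>" by (simp add: abs_mult divide_inverse)
      then have "(pi * (x - k) / 1)\<^sup>2 \<le> (pi * (x - k) / ?e n)\<^sup>2" unfolding abs_le_square_iff .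
      then have "exp (- (pi * (x - k) / ?e n)\<^sup>2) \<le> exp (- (pi * (x - k) / 1)\<^sup>2)" by (simp only: exp_le_cancel_iff neg_le_iff_le)
      then show "norm (gauss_test (?e n) k x * h x) \<le> norm (gauss_test 1 k x)"
        unfolding gauss_test_def norm_mult h1 norm_of_real by (simp only: abs_exp_cancel mult_1_right)
    qed
  qed simp_all
  then have lim: "(\<lambda>n. LINT x|pair_corr_measure \<Lambda> i j. fourier (gauss_test (?e n) k) x) \<longlonglongrightarrow> cm_value \<mu> {k}"
    using ft[OF gt] by (simp add: \<mu> cm_value_def set_lebesgue_integral_def)
  have "(LINT x|pair_corr_measure \<Lambda> i j. fourier (gauss_test (?e n) k) x)
      = (LINT z|count_space \<Delta>. of_real (\<eta> i j z) * (of_real (gauss_kernel (?e n) z) * ek k z)) / of_real supp_dens" for n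
    by (subst pair_corr_measure_integral(2)) (simp_all add: fourier_gauss_test)
  then have "(\<lambda>n. LINT x|pair_corr_measure \<Lambda> i j. fourier (gauss_test (?e n) k) x)
      \<longlonglongrightarrow> cnj (fb_mean i k) * fb_mean j k / of_real supp_dens"
    using tendsto_divide[OF corr_gaussian_limit[of i j k] tendsto_const, of "of_real supp_dens"] supp_dens_pos by simp
  then have "cm_value \<mu> {k} = cnj (fb_mean i k) * fb_mean j k / of_real supp_dens"
    using lim LIMSEQ_unique by blast
  then show ?thesis unfolding fb_coeff_eq using supp_dens_pos by (simp add: field_simps)
qed

end

section \<open>Intensities\<close>

lemma cm_value_singleton:
  assumes "complex_radon (N, h)"
  shows "cm_value (N, h) {k} = measure N {k} *\<^sub>R h k"
proof -
  have setsN: "sets N = sets borel" and h: "h \<in> borel_measurable borel"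
    and fin: "emeasure N {k} < \<infinity>"
    using assms unfolding complex_radon_def by auto
  have "(\<lambda>x. indicator {k} x *\<^sub>R h x) = (\<lambda>x. indicator {k} x *\<^sub>R h k)"
    by (auto simp: indicator_def)
  then have "cm_value (N, h) {k} = (LINT x|N. indicator {k} x *\<^sub>R h k)"
    by (simp add: cm_value_def set_lebesgue_integral_def)
  also have "\<dots> = measure N {k} *\<^sub>R h k"
    using fin setsN sets_eq_imp_space_eq[OF setsN] by (subst integral_scaleR_left) auto
  finally show ?thesis .
qed

text \<open>On each bounded interval N is a finite measure, which has only countably many
  atoms.\<close>

lemma countable_atoms:
  assumes radon: "complex_radon (N, h)"
  shows "countable {k. cm_value (N, h) {k} \<noteq> 0}"
proof -
  have setsN: "sets N = sets borel"
    and fin: "\<And>B. B \<in> sets borel \<Longrightarrow> bounded B \<Longrightarrow> emeasure N B < \<infinity>"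
    using radon unfolding complex_radon_def by auto
  have "countable {k \<in> {- real n..real n}. measure N {k} \<noteq> 0}" for n
  proof -
    let ?\<nu> = "density N (indicator {- real n..real n})"
    have em: "emeasure ?\<nu> A = emeasure N (A \<inter> {- real n..real n})" if "A \<in> sets borel" for A
    proof -
      have "emeasure ?\<nu> A = (\<integral>\<^sup>+ x. indicator {- real n..real n} x * indicator A x \<partial>N)"
        using that setsN by (subst emeasure_density) auto
      also have "\<dots> = (\<integral>\<^sup>+ x. indicator (A \<inter> {- real n..real n}) x \<partial>N)"
        by (intro nn_integral_cong) (simp split: split_indicator)
      also have "\<dots> = emeasure N (A \<inter> {- real n..real n})"
        using that setsN by (intro nn_integral_indicator) auto
      finally show ?thesis .
    qed
    interpret finite_measure ?\<nu>
    proof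
      have "emeasure ?\<nu> UNIV = emeasure N {- real n..real n}" using em[of UNIV] by simp
      then show "emeasure ?\<nu> (space ?\<nu>) \<noteq> \<infinity>"
        using fin[of "{- real n..real n}"] sets_eq_imp_space_eq[OF setsN] by simp
    qed
    have "measure ?\<nu> {k} = measure N {k}" if "k \<in> {- real n..real n}" for k
      using em[of "{k}"] that by (simp add: measure_def)
    then have "{k \<in> {- real n..real n}. measure N {k} \<noteq> 0} \<subseteq> {k. measure ?\<nu> {k} \<noteq> 0}" by auto
    then show ?thesis using countable_support by (rule countable_subset)
  qed
  then have "countable (\<Union>n. {k \<in> {- real n..real n}. measure N {k} \<noteq> 0})" by simp
  moreover have "{k. cm_value (N, h) {k} \<noteq> 0} \<subseteq> (\<Union>n. {k \<in> {- real n..real n}. measure N {k} \<noteq> 0})"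
  proof
    fix k assume "k \<in> {k. cm_value (N, h) {k} \<noteq> 0}"
    then have "measure N {k} \<noteq> 0" using cm_value_singleton[OF radon] by auto
    moreover obtain n where "\<bar>k\<bar> \<le> real n" using real_arch_simple by blast
    ultimately show "k \<in> (\<Union>n. {k \<in> {- real n..real n}. measure N {k} \<noteq> 0})" by (auto intro!: exI[of _ n])
  qed
  ultimately show ?thesis by (rule countable_subset[rotated])
qed

text \<open>Countable additivity along the enumeration \<open>to_nat_on S\<close>. As h has modulus
  1, the norms of the terms are dominated by masses whose sum is at most the mass of S, which makes
  the sum unconditional.\<close>

lemma cm_value_countable_has_sum:
  assumes radon: "complex_radon (N, h)" and S: "countable S" "bounded S"
  shows "((\<lambda>k. cm_value (N, h) {k}) has_sum cm_value (N, h) S) S"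
proof -
  have setsN [measurable_cong]: "sets N = sets borel" and h [measurable]: "h \<in> borel_measurable borel"
    and h1: "\<And>x. norm (h x) = 1"
    and fin: "\<And>B. B \<in> sets borel \<Longrightarrow> bounded B \<Longrightarrow> emeasure N B < \<infinity>"
    using radon unfolding complex_radon_def prod.case by blast+
  have borelc: "A \<in> sets borel" if "A \<subseteq> S" for A :: "real set"
    by (rule sets.countable[OF _ countable_subset[OF that S(1)]]) simp
  define A where "A i = {x \<in> S. to_nat_on S x = i}" for i
  have A_sub: "A i \<subseteq> S" for i by (auto simp: A_def)
  have A_sets: "A i \<in> sets N" for i using borelc[OF A_sub] by (simp add: setsN)
  have A_disj: "A i \<inter> A j = {}" if "i \<noteq> j" for i j using that by (auto simp: A_def)
  have A_un: "(\<Union>i. A i) = S" by (auto simp: A_def)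
  have finS: "emeasure N S < \<infinity>" using fin[OF borelc[OF subset_refl] S(2)] .
  have int: "set_integrable N S h"
    unfolding set_integrable_def
  proof (rule integrableI_bounded)
    show "(\<lambda>x. indicator S x *\<^sub>R h x) \<in> borel_measurable N"
      using borelc[OF subset_refl] by measurable
    have "(\<integral>\<^sup>+ x. ennreal (norm (indicator S x *\<^sub>R h x)) \<partial>N) = (\<integral>\<^sup>+ x. indicator S x \<partial>N)"
      by (intro nn_integral_cong) (simp add: h1 indicator_def)
    then show "(\<integral>\<^sup>+ x. ennreal (norm (indicator S x *\<^sub>R h x)) \<partial>N) < \<infinity>"
      using finS borelc[OF subset_refl] setsN by (simp add: nn_integral_indicator)
  qed
  define g where "g i = (LINT x:A i|N. h x)" for i
  have g_norm: "norm (g i) \<le> measure N (A i)" for i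
  proof -
    have "norm (g i) \<le> (LINT x|N. norm (indicator (A i) x *\<^sub>R h x))"
      unfolding g_def set_lebesgue_integral_def by (rule integral_norm_bound)
    also have "\<dots> = (LINT x|N. indicator (A i) x)"
      by (intro Bochner_Integration.integral_cong refl) (simp add: h1 indicator_def)
    also have "\<dots> = measure N (A i)" using sets.sets_into_space[OF A_sets] by (simp add: Int_absorb2)
    finally show ?thesis .
  qed
  have "summable (\<lambda>i. measure N (A i))"
  proof (rule bounded_imp_summable)
    fix n
    have finA: "emeasure N (A i) \<noteq> \<infinity>" for i
      using emeasure_mono[OF A_sub, of N i] finS borelc[OF subset_refl] setsN by (auto simp: top_unique)
    have "(\<Sum>i\<le>n. measure N (A i)) = measure N (\<Union>i\<in>{..n}. A i)"
      by (rule measure_finite_Union[symmetric]) (use A_sets A_disj finA in \<open>auto simp: disjoint_family_on_def\<close>)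
    also have "\<dots> \<le> measure N S"
      using finS A_sub A_sets borelc[OF subset_refl] setsN
      by (intro measure_mono_fmeasurable fmeasurableI) auto
    finally show "(\<Sum>i\<le>n. measure N (A i)) \<le> measure N S" .
  qed simp
  then have sm: "summable (\<lambda>i. norm (g i))"
    by (rule summable_comparison_test'[of _ 0]) (simp add: g_norm)
  have "cm_value (N, h) S = (\<Sum>i. g i)"
    unfolding cm_value_def g_def prod.case A_un[symmetric]
    by (rule lebesgue_integral_countable_add) (use A_sets A_disj int A_un in auto)
  then have "g sums cm_value (N, h) S" using summable_norm_cancel[OF sm] by (simp add: summable_sums)
  with sm have "(g has_sum cm_value (N, h) S) UNIV" by (rule norm_summable_imp_has_sum)
  then have "(g has_sum cm_value (N, h) S) (to_nat_on S ` S)"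
  proof (rule has_sum_cong_neutral[THEN iffD1, rotated -1])
    fix i assume "i \<in> UNIV - to_nat_on S ` S"
    then have "A i = {}" by (auto simp: A_def)
    then show "g i = 0" by (simp add: g_def set_lebesgue_integral_def)
  qed auto
  then have "((g \<circ> to_nat_on S) has_sum cm_value (N, h) S) S"
    by (subst (asm) has_sum_reindex) (use inj_on_to_nat_on[OF S(1)] in auto)
  then show ?thesis
  proof (rule has_sum_cong[THEN iffD1, rotated])
    fix k assume k: "k \<in> S"
    have "A (to_nat_on S k) = {k}" using inj_on_to_nat_on[OF S(1)] k by (auto simp: A_def inj_on_def)
    then show "(g \<circ> to_nat_on S) k = cm_value (N, h) {k}" by (simp add: g_def cm_value_def)
  qed
qed

context coloured_set begin

text \<open>The description in \<open>intensity\<close> has to be shown to denote: the scaled atoms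
  satisfy it by countable additivity, and testing with B = {x} determines the value at x.\<close>

lemma intensity_eq:
  "intensity \<Lambda> i j k = cnj (fb_coeff \<Lambda> i k) * fb_coeff \<Lambda> j k"
  and countable_intensity: "countable {k. intensity \<Lambda> i j k \<noteq> 0}"
proof -
  define \<mu> where "\<mu> = measure_fourier (pair_corr_measure \<Lambda> i j)"
  have ft: "is_fourier_transform (pair_corr_measure \<Lambda> i j) \<mu>"
    unfolding \<mu>_def measure_fourier_def by (rule someI_ex[OF fourier_transform_exists])
  obtain N h where Nh: "\<mu> = (N, h)" by fastforce
  have radon: "complex_radon (N, h)" using ft unfolding Nh is_fourier_transform_def by simp
  define f where "f k = cm_value \<mu> {k}" for k
  define I where "I k = f k / of_real supp_dens" for k
  have DI: "complex_of_real supp_dens * I k = f k" for k using supp_dens_pos by (simp add: I_def)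
  have letter_count: "countable {k. f k \<noteq> 0}" unfolding f_def Nh by (rule countable_atoms[OF radon])
  have sums: "(f has_sum pp_part \<mu> B) B" if "bounded B" for B
  proof -
    let ?S = "B \<inter> {k. f k \<noteq> 0}"
    have "countable ?S" "bounded ?S" using letter_count that by (auto intro: countable_subset bounded_subset)
    from cm_value_countable_has_sum[OF radon this]
    have "(f has_sum pp_part \<mu> B) ?S" unfolding pp_part_def f_def Nh .
    then show ?thesis by (rule has_sum_cong_neutral[THEN iffD1, rotated -1]) auto
  qed
  have single: "pp_part \<mu> {x} = f x" for x
  proof -
    have "(f has_sum (\<Sum>k\<in>{x}. f k)) {x}" by (rule has_sum_finite) simp
    moreover have "(f has_sum pp_part \<mu> {x}) {x}" by (rule sums) simp
    ultimately have "pp_part \<mu> {x} = (\<Sum>k\<in>{x}. f k)" using has_sum_unique by blast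
    then show ?thesis by simp
  qed
  have "intensity \<Lambda> i j = I"
    unfolding intensity_def \<mu>_def[symmetric] supp_dens_def[symmetric]
  proof (rule the_equality)
    show "countable {k. I k \<noteq> 0} \<and> (\<forall>B\<in>sets borel. bounded B \<longrightarrow>
        ((\<lambda>k. complex_of_real supp_dens * I k) has_sum pp_part \<mu> B) B)"
      using letter_count sums supp_dens_pos by (simp add: DI) (simp add: I_def)
  next
    fix I' assume I': "countable {k. I' k \<noteq> 0} \<and> (\<forall>B\<in>sets borel. bounded B \<longrightarrow>
        ((\<lambda>k. complex_of_real supp_dens * I' k) has_sum pp_part \<mu> B) B)"
    show "I' = I"
    proof
      fix x
      have "((\<lambda>k. complex_of_real supp_dens * I' k) has_sum pp_part \<mu> {x}) {x}"
        using I'[THEN conjunct2, rule_format, of "{x}"] by simp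
      then have "((\<lambda>k. complex_of_real supp_dens * I' k) has_sum f x) {x}" unfolding single .
      moreover have "((\<lambda>k. complex_of_real supp_dens * I' k) has_sum (\<Sum>k\<in>{x}. complex_of_real supp_dens * I' k)) {x}"
        by (rule has_sum_finite) simp
      ultimately have "f x = complex_of_real supp_dens * I' x" using has_sum_unique by fastforce
      then show "I' x = I x" using supp_dens_pos by (simp add: I_def)
    qed
  qed
  then have eq: "intensity \<Lambda> i j k = f k / of_real supp_dens" for k by (simp add: I_def)
  show "intensity \<Lambda> i j k = cnj (fb_coeff \<Lambda> i k) * fb_coeff \<Lambda> j k"
    unfolding eq f_def fourier_transform_atom[OF ft] using supp_dens_pos by simp
  show "countable {k. intensity \<Lambda> i j k \<noteq> 0}" unfolding eq using letter_count supp_dens_pos by simp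
qed

lemma fb_coeff_uniform_limit:
  "uniform_limit UNIV (\<lambda>r c. inverse (complex_of_real (dens (support \<Lambda>))) * fb_average \<Lambda> j k r c)
    (\<lambda>c. fb_coeff \<Lambda> j k) at_top"
proof -
  have "uniform_limit UNIV (\<lambda>r c. inverse (complex_of_real supp_dens) * fb_average \<Lambda> j k r c)
      (\<lambda>c. inverse (complex_of_real supp_dens) * fb_mean j k) at_top"
    by (rule bounded_linear_uniform_limit_intros(13)[OF fb_limit])
  then show ?thesis unfolding fb_coeff_eq supp_dens_def by (simp add: divide_inverse mult.commute)
qed

text \<open>A coefficient vanishes exactly when its diagonal intensity, the square of its modulus,
  does, and intensities have countable support.\<close>

lemma countable_fb_coeff: "countable {k. \<exists>j. fb_coeff \<Lambda> j k \<noteq> 0}"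
proof -
  have "{k. \<exists>j. fb_coeff \<Lambda> j k \<noteq> 0} = (\<Union>j. {k. intensity \<Lambda> j j k \<noteq> 0})"
    by (auto simp: intensity_eq)
  then show ?thesis using countable_intensity by simp
qed

end

text \<open>Every row is a multiple of the one vector a.\<close>

lemma rank_outer_product_le_1:
  fixes a :: "complex^'n"
  shows "rank (\<chi> i j. b i * a $ j :: complex^'n^'m) \<le> 1"
proof -
  let ?A = "\<chi> i j. b i * a $ j :: complex^'n^'m"
  have "rows ?A \<subseteq> vec.span {a}"
  proof
    fix v assume "v \<in> rows ?A"
    then obtain i where "v = row i ?A" unfolding rows_def by blast
    then have "v = b i *s a" by (simp add: row_def vec_eq_iff)
    then show "v \<in> vec.span {a}" by (simp add: vec.span_scale vec.span_base)
  qed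
  then have "vec.dim (rows ?A) \<le> card {a}" by (rule vec.dim_le_card) simp
  then show ?thesis by (simp add: row_rank_def_gen)
qed

theorem theorem3p23:
  fixes \<rho> :: "'a::finite \<Rightarrow> 'a list"
    and lam :: real
    and len :: "real^'a"
    and T :: "'a cps"
  assumes "primitive_substitution \<rho>"
    and "pf_eigenvalue (subst_matrix \<rho>) lam"
    and "lam > 1"
    and "\<forall>i. len $ i > 0"
    and "len v* subst_matrix \<rho> = lam *s len"
    and "inflation_fixed_point \<rho> lam len T"
  shows "(\<forall>\<Lambda>\<in>tiling_hull T. \<forall>k j.
            uniform_limit UNIV
              (\<lambda>r c. inverse (complex_of_real (dens (support \<Lambda>))) * fb_average \<Lambda> j k r c)
              (\<lambda>c. fb_coeff \<Lambda> j k) at_top)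
       \<and> (\<forall>\<Lambda>\<in>tiling_hull T. \<forall>\<Lambda>'\<in>tiling_hull T. \<forall>k i j.
            intensity \<Lambda>' i j k = cnj (fb_coeff \<Lambda> i k) * fb_coeff \<Lambda> j k)
       \<and> (\<forall>\<Lambda>\<in>tiling_hull T. \<forall>\<Lambda>'\<in>tiling_hull T. \<forall>k. \<exists>u. norm u = 1 \<and>
            (\<forall>j. fb_coeff \<Lambda>' j k = u * fb_coeff \<Lambda> j k))
       \<and> (\<forall>\<Lambda>\<in>tiling_hull T. \<forall>k.
            hermitian (intensity_matrix \<Lambda> k)
          \<and> pos_semidef (intensity_matrix \<Lambda> k)
          \<and> rank (intensity_matrix \<Lambda> k) \<le> 1)
       \<and> (\<forall>\<Lambda>\<in>tiling_hull T. countable {k. \<exists>j. fb_coeff \<Lambda> j k \<noteq> 0})"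
proof -
  obtain \<sigma> mu where "legal_inflation_tiling \<sigma> mu len T"
    using inflation_fixed_point_tiling assms by blast
  then interpret legal_inflation_tiling \<sigma> mu len T .
  have cs: "coloured_set \<Lambda> lmin" if "\<Lambda> \<in> tiling_hull T" for \<Lambda>
    using that by (rule hull_coloured_set)
  have dens: "dens (support \<Lambda>) = dens (support T)" if \<Lambda>: "\<Lambda> \<in> tiling_hull T" for \<Lambda>
  proof -
    obtain d where d: "uniform_limit UNIV
        (\<lambda>r c. real (card (support T \<inter> {- r + c..r + c})) / (2 * r)) (\<lambda>_. d) at_top"
      using support_density by blast
    have "\<exists>s. \<forall>x. \<bar>x\<bar> \<le> R \<longrightarrow> (x \<in> support \<Lambda> \<longleftrightarrow> x - s \<in> support T)" if "R > 0" for R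
      using tiling_hull_mem[OF \<Lambda> that] unfolding support_def by (elim exE) (intro exI, auto)
    from dens_eqI[OF uniform_density_transfer[OF d this]] dens_eqI[OF d] show ?thesis by simp
  qed
  have phase: "\<exists>u. norm u = 1 \<and> (\<forall>j. fb_coeff \<Lambda> j k = u * fb_coeff T j k)" if \<Lambda>: "\<Lambda> \<in> tiling_hull T" for \<Lambda> k
  proof -
    obtain A where A: "\<And>j. uniform_limit UNIV (fb_average T j k) (\<lambda>_. A j) at_top"
      using fb_average_T_limits by blast
    obtain u where u: "norm u = 1" "\<And>j. uniform_limit UNIV (fb_average \<Lambda> j k) (\<lambda>_. u * A j) at_top"
      using hull_fb_average_limit[OF \<Lambda> A] by blast
    have L: "Lim at_top (\<lambda>r. fb_average \<Lambda>' j k r 0) = B"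
      if "uniform_limit UNIV (fb_average \<Lambda>' j k) (\<lambda>_. B) at_top" for \<Lambda>' :: "'a cps" and j B
      by (intro tendsto_Lim tendsto_uniform_limitI[OF that]) simp_all
    have "fb_coeff \<Lambda> j k = u * fb_coeff T j k" for j
      unfolding fb_coeff_def L[OF A] L[OF u(2)] dens[OF \<Lambda>] by simp
    then show ?thesis using u(1) by blast
  qed
  have int: "intensity \<Lambda>' i j k = cnj (fb_coeff \<Lambda> i k) * fb_coeff \<Lambda> j k"
    if \<Lambda>: "\<Lambda> \<in> tiling_hull T" "\<Lambda>' \<in> tiling_hull T" for \<Lambda> \<Lambda>' i j k
  proof -
    obtain u where u: "norm u = 1" "\<And>j. fb_coeff \<Lambda> j k = u * fb_coeff T j k" using phase[OF \<Lambda>(1), of k] by blast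
    obtain u' where u': "norm u' = 1" "\<And>j. fb_coeff \<Lambda>' j k = u' * fb_coeff T j k" using phase[OF \<Lambda>(2), of k] by blast
    \<comment> \<open>A common unimodular factor cancels in the product with a conjugate, which
      makes the intensities independent of the member of the hull.\<close>
    have unit: "cnj (v * x) * (v * y) = cnj x * y" if "norm v = 1" for v x y :: complex
    proof -
      have "cnj (v * x) * (v * y) = (v * cnj v) * (cnj x * y)" by simp
      moreover have "v * cnj v = 1" using complex_norm_square[of v] that by simp
      ultimately show ?thesis by (simp only: mult_1_left)
    qed
    show ?thesis
      unfolding coloured_set.intensity_eq[OF cs[OF \<Lambda>(2)]] u(2) u'(2) unit[OF u(1)] unit[OF u'(1)] ..
  qed
  have relphase: "\<exists>u. norm u = 1 \<and> (\<forall>j. fb_coeff \<Lambda>' j k = u * fb_coeff \<Lambda> j k)"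
    if \<Lambda>: "\<Lambda> \<in> tiling_hull T" "\<Lambda>' \<in> tiling_hull T" for \<Lambda> \<Lambda>' k
  proof -
    obtain u where u: "norm u = 1" "\<And>j. fb_coeff \<Lambda> j k = u * fb_coeff T j k" using phase[OF \<Lambda>(1), of k] by blast
    obtain u' where u': "norm u' = 1" "\<And>j. fb_coeff \<Lambda>' j k = u' * fb_coeff T j k" using phase[OF \<Lambda>(2), of k] by blast
    have "u \<noteq> 0" using u(1) by auto
    then have "fb_coeff \<Lambda>' j k = (u' / u) * fb_coeff \<Lambda> j k" for j by (simp add: u(2) u'(2))
    moreover have "norm (u' / u) = 1" using u(1) u'(1) by (simp add: norm_divide)
    ultimately show ?thesis by blast
  qed
  have matrix: "hermitian (intensity_matrix \<Lambda> k) \<and> pos_semidef (intensity_matrix \<Lambda> k)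
      \<and> rank (intensity_matrix \<Lambda> k) \<le> 1" if \<Lambda>: "\<Lambda> \<in> tiling_hull T" for \<Lambda> k
  proof -
    define a where "a = (\<chi> j. fb_coeff \<Lambda> j k)"
    have I: "intensity_matrix \<Lambda> k = (\<chi> i j. cnj (a $ i) * a $ j)"
      by (simp add: intensity_matrix_def int[OF \<Lambda> \<Lambda>] a_def)
    have "hermitian (intensity_matrix \<Lambda> k)" by (simp add: I hermitian_def mult.commute)
    moreover have "pos_semidef (intensity_matrix \<Lambda> k)"
      unfolding pos_semidef_def
    proof
      fix v :: "complex^'a"
      have "(\<Sum>i\<in>UNIV. \<Sum>j\<in>UNIV. cnj (v $ i) * intensity_matrix \<Lambda> k $ i $ j * v $ j)
          = (\<Sum>i\<in>UNIV. cnj (v $ i * a $ i)) * (\<Sum>j\<in>UNIV. v $ j * a $ j)"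
        unfolding sum_product by (intro sum.cong refl) (simp add: I mult_ac)
      also have "\<dots> = of_real ((norm (\<Sum>j\<in>UNIV. v $ j * a $ j))\<^sup>2)"
        unfolding cnj_sum[symmetric] using complex_norm_square[of "\<Sum>j\<in>UNIV. v $ j * a $ j"]
        by (simp only: mult.commute of_real_power)
      finally have eq: "(\<Sum>i\<in>UNIV. \<Sum>j\<in>UNIV. cnj (v $ i) * intensity_matrix \<Lambda> k $ i $ j * v $ j)
          = of_real ((norm (\<Sum>j\<in>UNIV. v $ j * a $ j))\<^sup>2)" .
      show "(\<Sum>i\<in>UNIV. \<Sum>j\<in>UNIV. cnj (v $ i) * intensity_matrix \<Lambda> k $ i $ j * v $ j) \<in> \<real> \<and>
        0 \<le> Re (\<Sum>i\<in>UNIV. \<Sum>j\<in>UNIV. cnj (v $ i) * intensity_matrix \<Lambda> k $ i $ j * v $ j)"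
        unfolding eq Re_complex_of_real by simp
    qed
    moreover have "rank (intensity_matrix \<Lambda> k) \<le> 1" unfolding I by (rule rank_outer_product_le_1)
    ultimately show ?thesis by blast
  qed
  show ?thesis
    using coloured_set.fb_coeff_uniform_limit[OF cs] int relphase matrix coloured_set.countable_fb_coeff[OF cs]
    by (intro conjI ballI allI) auto
qed

end
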